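(* Let $m,n\ge1$ be integers, let $\mathcal E_1$ and $\mathcal E_2$ be two Hilbert spaces, and let $\mathcal Q_i$ be a co-invariant subspace of $\mathbb H_m(\mathbb B^n,\mathcal E_i)$ for $i=1,2$. If $X\in\mathcal B(\mathcal Q_1,\mathcal Q_2)$ is a contraction such that $$X(P_{\mathcal Q_1}M_{z_i}|_{\mathcal Q_1})=(P_{\mathcal Q_2}M_{z_i}|_{\mathcal Q_2})X\qquad(1\le i\le n),$$ then there exists a Schur-Agler function $\Phi:\mathbb B^n\to\mathcal B(\mathcal E_1,\mathcal E_2)$ such that $X^*=M_\Phi^*|_{\mathcal Q_2}$ if and only if $$(1-\sigma_S)^{m-1}(I-XX^* )\ge0,$$ where $S_i=P_{\mathcal Q_2}M_{z_i}|_{\mathcal Q_2}$ for all $i=1,\dots,n$ and $S=(S_1,\dots,S_n)$. In such a case, the multiplier $\Phi$ can be made explicit by taking the transfer function of the corresponding unitary $U^*$, where $U$ is the unitary associated with $X$, $S$ and $T=(P_{\mathcal Q_1}M_{z_1}|_{\mathcal Q_1},\dots,P_{\mathcal Q_1}M_{z_n}|_{\mathcal Q_1})$ described in the context.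
   Context: All Hilbert spaces are complex; $\mathbb B^n$ is the open unit ball of $\mathbb C^n$. For a Hilbert space $\mathcal E$, $\mathbb H_m(\mathbb B^n,\mathcal E)$ is the $\mathcal E$-valued reproducing kernel Hilbert space of holomorphic functions on $\mathbb B^n$ with kernel $(1-\langle\boldsymbol z,\boldsymbol w\rangle)^{-m}I_{\mathcal E}$ (a weighted Bergman space), and $H^2_n(\mathcal E):=\mathbb H_1(\mathbb B^n,\mathcal E)$ is the Drury-Arveson space. $M_{z_i}$ is multiplication by the coordinate $z_i$. A closed subspace $\mathcal Q$ is co-invariant if $M_{z_i}^*\mathcal Q\subseteq\mathcal Q$ for all $i=1,\dots,n$; $P_{\mathcal Q}$ is the orthogonal projection onto $\mathcal Q$. A Schur-Agler function $\Phi:\mathbb B^n\to\mathcal B(\mathcal E_1,\mathcal E_2)$ is a holomorphic function for which multiplication by $\Phi$ is a contraction from $H^2_n(\mathcal E_1)$ to $H^2_n(\mathcal E_2)$. For such $\Phi$, $M_\Phi:\mathbb H_m(\mathbb B^n,\mathcal E_1)\to\mathbb H_m(\mathbb B^n,\mathcal E_2)$, $f\mapsto\Phi f$, is also a contraction. For an $n$-tuple $T$ of operators on a Hilbert space $\mathcal H$, $\sigma_T(Y)=\sum_{i=1}^nT_iYT_i^*$ for $Y\in\mathcal B(\mathcal H)$, and $(1-\sigma_T)^j$ is the $j$-th power (composition) of $\mathrm{id}-\sigma_T$. The compressions $T$ and $S$ in the statement are pure $m$-hypercontractions; in particular $(1-\sigma_T)^m(I)\ge0$ and $(1-\sigma_S)^m(I)\ge0$.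 The defect operator is $D_{m,T^*}=[(1-\sigma_T)^m(I)]^{1/2}$ and the defect space is $\mathcal D_{m,T^*}=\overline{\mathrm{ran}}\,D_{m,T^*}$; similarly for $S$. The unitary $U$: when $(1-\sigma_S)^{m-1}(I-XX^* )\ge0$, put $\Delta=[(1-\sigma_S)^{m-1}(I-XX^* )]^{1/2}$. Adding an infinite dimensional Hilbert space $\mathcal L$ if necessary and setting $\mathcal R=\overline{\mathrm{ran}}\,\Delta\oplus\mathcal L$, one constructs a unitary $U=\begin{bmatrix}A&B\\C&D\end{bmatrix}:\mathcal D_{m,S^*}\oplus\mathcal R^n\to\mathcal D_{m,T^*}\oplus\mathcal R$ such that for all $k\in\mathcal Q_2$ $$U\big(D_{m,S^*}k,(\Delta S_1^*k,0_{\mathcal L}),\dots,(\Delta S_n^*k,0_{\mathcal L})\big)=\big(D_{m,T^*}X^*k,(\Delta k,0_{\mathcal L})\big).$$ The transfer function of $U^*$ is $\boldsymbol z\mapsto A^*+C^*(I-ZD^* )^{-1}ZB^*$ $(\boldsymbol z\in\mathbb B^n)$, where $Z=(z_1I_{\mathcal R},\dots,z_nI_{\mathcal R}):\mathcal R^n\to\mathcal R$ is the row operator $Z(h_1,\dots,h_n)=\sum_iz_ih_i$. *)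

theory Defs
  imports "HOL-Analysis.Analysis" "HOL-Library.Function_Algebras"
begin

section \<open>Complex Hilbert spaces\<close>

text \<open>
  The spaces involved (function spaces depending on the number \<open>m\<close>, closed subspaces, closures of
  ranges, direct sums) are not types, so a Hilbert space is a carrier inside a complex vector space
  type together with an inner product.  Only values on the carrier matter: operators are functions
  on the ambient type and are compared on carriers.
\<close>

class complex_vector = ab_group_add +
  fixes scaleC :: "complex \<Rightarrow> 'a \<Rightarrow> 'a" (infixr \<open>*\<^sub>C\<close> 75)
  assumes scaleC_add_right: "a *\<^sub>C (x + y) = a *\<^sub>C x + a *\<^sub>C y"
    and scaleC_add_left: "(a + b) *\<^sub>C x = a *\<^sub>C x + b *\<^sub>C x"
    and scaleC_scaleC: "a *\<^sub>C b *\<^sub>C x = (a * b) *\<^sub>C x"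
    and scaleC_one: "1 *\<^sub>C x = x"

instantiation complex :: complex_vector
begin
definition scaleC_complex :: "complex \<Rightarrow> complex \<Rightarrow> complex" where
  "scaleC_complex a x = a * x"
instance
  by standard (simp_all add: scaleC_complex_def algebra_simps)
end

instantiation "fun" :: (type, complex_vector) complex_vector
begin
definition scaleC_fun :: "complex \<Rightarrow> ('a \<Rightarrow> 'b) \<Rightarrow> 'a \<Rightarrow> 'b" where
  "scaleC_fun a f = (\<lambda>x. a *\<^sub>C f x)"
instance
  by standard (simp_all add: scaleC_fun_def fun_eq_iff plus_fun_def
      scaleC_add_right scaleC_add_left scaleC_scaleC scaleC_one)
end

instantiation prod :: (complex_vector, complex_vector) complex_vector
begin
definition scaleC_prod :: "complex \<Rightarrow> 'a \<times> 'b \<Rightarrow> 'a \<times> 'b" where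
  "scaleC_prod a p = (a *\<^sub>C fst p, a *\<^sub>C snd p)"
instance
  by standard (simp_all add: scaleC_prod_def prod_eq_iff
      scaleC_add_right scaleC_add_left scaleC_scaleC scaleC_one)
end

record 'a hspace =
  hs_carrier :: "'a set"
  hs_inner :: "'a \<Rightarrow> 'a \<Rightarrow> complex"

definition hs_norm :: "'a hspace \<Rightarrow> 'a \<Rightarrow> real" where
  "hs_norm H x = sqrt (Re (hs_inner H x x))"

definition hs_lim :: "'a::complex_vector hspace \<Rightarrow> (nat \<Rightarrow> 'a) \<Rightarrow> 'a \<Rightarrow> bool" where
  "hs_lim H s x \<longleftrightarrow> (\<lambda>n. hs_norm H (s n - x)) \<longlonglongrightarrow> 0"

definition linear_subset :: "'a::complex_vector set \<Rightarrow> bool" where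
  "linear_subset V \<longleftrightarrow> 0 \<in> V \<and> (\<forall>x\<in>V. \<forall>y\<in>V. x + y \<in> V) \<and> (\<forall>c. \<forall>x\<in>V. c *\<^sub>C x \<in> V)"

text \<open>The inner product is linear in the first argument.\<close>

definition hilbert_space :: "'a::complex_vector hspace \<Rightarrow> bool" where
  "hilbert_space H \<longleftrightarrow>
     linear_subset (hs_carrier H) \<and>
     (\<forall>x\<in>hs_carrier H. \<forall>y\<in>hs_carrier H. \<forall>z\<in>hs_carrier H.
        hs_inner H (x + y) z = hs_inner H x z + hs_inner H y z) \<and>
     (\<forall>c. \<forall>x\<in>hs_carrier H. \<forall>y\<in>hs_carrier H. hs_inner H (c *\<^sub>C x) y = c * hs_inner H x y) \<and>
     (\<forall>x\<in>hs_carrier H. \<forall>y\<in>hs_carrier H. hs_inner H y x = cnj (hs_inner H x y)) \<and>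
     (\<forall>x\<in>hs_carrier H. x \<noteq> 0 \<longrightarrow> 0 < Re (hs_inner H x x)) \<and>
     (\<forall>s. (\<forall>n. s n \<in> hs_carrier H) \<and>
          (\<forall>\<epsilon>>0. \<exists>N. \<forall>i\<ge>N. \<forall>j\<ge>N. hs_norm H (s i - s j) < \<epsilon>) \<longrightarrow>
          (\<exists>x\<in>hs_carrier H. hs_lim H s x))"

definition infinite_dimensional :: "'a::complex_vector hspace \<Rightarrow> bool" where
  "infinite_dimensional H \<longleftrightarrow>
     \<not> (\<exists>B. finite B \<and> B \<subseteq> hs_carrier H \<and>
          (\<forall>x\<in>hs_carrier H. \<exists>c. x = (\<Sum>b\<in>B. c b *\<^sub>C b)))"

definition hs_sub :: "'a hspace \<Rightarrow> 'a set \<Rightarrow> 'a hspace" where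
  "hs_sub H V = \<lparr>hs_carrier = V, hs_inner = hs_inner H\<rparr>"

definition hs_closure :: "'a::complex_vector hspace \<Rightarrow> 'a set \<Rightarrow> 'a set" where
  "hs_closure H V = {x \<in> hs_carrier H. \<exists>s. (\<forall>n. s n \<in> V) \<and> hs_lim H s x}"

definition closed_subspace :: "'a::complex_vector hspace \<Rightarrow> 'a set \<Rightarrow> bool" where
  "closed_subspace H V \<longleftrightarrow> V \<subseteq> hs_carrier H \<and> linear_subset V \<and> hs_closure H V \<subseteq> V"

definition hs_sum :: "'a hspace \<Rightarrow> 'b hspace \<Rightarrow> ('a \<times> 'b) hspace" where
  "hs_sum H K = \<lparr>hs_carrier = hs_carrier H \<times> hs_carrier K,
     hs_inner = (\<lambda>p q. hs_inner H (fst p) (fst q) + hs_inner K (snd p) (snd q))\<rparr>"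

definition hs_pow :: "'a hspace \<Rightarrow> ('n::finite \<Rightarrow> 'a) hspace" where
  "hs_pow H = \<lparr>hs_carrier = {v. \<forall>i. v i \<in> hs_carrier H},
     hs_inner = (\<lambda>v w. \<Sum>i\<in>UNIV. hs_inner H (v i) (w i))\<rparr>"


section \<open>Bounded operators\<close>

definition bounded_ops ::
    "'a::complex_vector hspace \<Rightarrow> 'b::complex_vector hspace \<Rightarrow> ('a \<Rightarrow> 'b) set" where
  "bounded_ops H K = {A.
     (\<forall>x\<in>hs_carrier H. A x \<in> hs_carrier K) \<and>
     (\<forall>x\<in>hs_carrier H. \<forall>y\<in>hs_carrier H. A (x + y) = A x + A y) \<and>
     (\<forall>c. \<forall>x\<in>hs_carrier H. A (c *\<^sub>C x) = c *\<^sub>C A x) \<and>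
     (\<exists>C. \<forall>x\<in>hs_carrier H. hs_norm K (A x) \<le> C * hs_norm H x)}"

definition contraction_op ::
    "'a::complex_vector hspace \<Rightarrow> 'b::complex_vector hspace \<Rightarrow> ('a \<Rightarrow> 'b) \<Rightarrow> bool" where
  "contraction_op H K A \<longleftrightarrow>
     A \<in> bounded_ops H K \<and> (\<forall>x\<in>hs_carrier H. hs_norm K (A x) \<le> hs_norm H x)"

text \<open>For \<open>A \<in> bounded_ops H K\<close> the described vector exists uniquely by the Riesz theorem.\<close>

definition hs_adj :: "'a hspace \<Rightarrow> 'b hspace \<Rightarrow> ('a \<Rightarrow> 'b) \<Rightarrow> 'b \<Rightarrow> 'a" where
  "hs_adj H K A y = (THE x. x \<in> hs_carrier H \<and>
     (\<forall>h\<in>hs_carrier H. hs_inner K (A h) y = hs_inner H h x))"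

definition hs_proj :: "'a::complex_vector hspace \<Rightarrow> 'a set \<Rightarrow> 'a \<Rightarrow> 'a" where
  "hs_proj H V f = (THE g. g \<in> V \<and> (\<forall>v\<in>V. hs_inner H (f - g) v = 0))"

definition positive_op :: "'a::complex_vector hspace \<Rightarrow> ('a \<Rightarrow> 'a) \<Rightarrow> bool" where
  "positive_op H A \<longleftrightarrow> A \<in> bounded_ops H H \<and>
     (\<forall>x\<in>hs_carrier H. hs_inner H (A x) x \<in> \<real> \<and> 0 \<le> Re (hs_inner H (A x) x))"

text \<open>The value \<open>0\<close> off the carrier only serves to make the described function unique.\<close>

definition op_sqrt :: "'a::complex_vector hspace \<Rightarrow> ('a \<Rightarrow> 'a) \<Rightarrow> 'a \<Rightarrow> 'a" where
  "op_sqrt H A = (THE R. positive_op H R \<and> (\<forall>x\<in>hs_carrier H. R (R x) = A x) \<and>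
     (\<forall>x. x \<notin> hs_carrier H \<longrightarrow> R x = 0))"

definition unitary_op ::
    "'a::complex_vector hspace \<Rightarrow> 'b::complex_vector hspace \<Rightarrow> ('a \<Rightarrow> 'b) \<Rightarrow> bool" where
  "unitary_op H K U \<longleftrightarrow> U \<in> bounded_ops H K \<and> U ` hs_carrier H = hs_carrier K \<and>
     (\<forall>x\<in>hs_carrier H. \<forall>y\<in>hs_carrier H. hs_inner K (U x) (U y) = hs_inner H x y)"

definition closed_range :: "'a::complex_vector hspace \<Rightarrow> ('a \<Rightarrow> 'a) \<Rightarrow> 'a hspace" where
  "closed_range H A = hs_sub H (hs_closure H (A ` hs_carrier H))"


section \<open>Operator tuples and defect spaces\<close>

definition op_sigma ::
    "'a::complex_vector hspace \<Rightarrow> ('n::finite \<Rightarrow> 'a \<Rightarrow> 'a) \<Rightarrow> ('a \<Rightarrow> 'a) \<Rightarrow> 'a \<Rightarrow> 'a" where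
  "op_sigma H T Y = (\<lambda>h. \<Sum>i\<in>UNIV. T i (Y (hs_adj H H (T i) h)))"

definition one_minus_sigma_pow ::
    "'a::complex_vector hspace \<Rightarrow> ('n::finite \<Rightarrow> 'a \<Rightarrow> 'a) \<Rightarrow> nat \<Rightarrow> ('a \<Rightarrow> 'a) \<Rightarrow> 'a \<Rightarrow> 'a" where
  "one_minus_sigma_pow H T j = (\<lambda>Y h. Y h - op_sigma H T Y h) ^^ j"

definition defect_op ::
    "'a::complex_vector hspace \<Rightarrow> ('n::finite \<Rightarrow> 'a \<Rightarrow> 'a) \<Rightarrow> nat \<Rightarrow> 'a \<Rightarrow> 'a" where
  "defect_op H T m = op_sqrt H (one_minus_sigma_pow H T m (\<lambda>h. h))"

definition defect_space ::
    "'a::complex_vector hspace \<Rightarrow> ('n::finite \<Rightarrow> 'a \<Rightarrow> 'a) \<Rightarrow> nat \<Rightarrow> 'a hspace" where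
  "defect_space H T m = closed_range H (defect_op H T m)"


section \<open>Function spaces on the unit ball\<close>

abbreviation unit_ball :: "(complex ^ 'n) set" where
  "unit_ball \<equiv> ball 0 1"

definition cdot :: "complex ^ 'n \<Rightarrow> complex ^ 'n \<Rightarrow> complex" where
  "cdot z w = (\<Sum>i\<in>UNIV. z $ i * cnj (w $ i))"

definition holomorphic_vec ::
    "'e::complex_vector hspace \<Rightarrow> (complex ^ 'n \<Rightarrow> 'e) \<Rightarrow> bool" where
  "holomorphic_vec E f \<longleftrightarrow> (\<forall>z\<in>unit_ball. f z \<in> hs_carrier E) \<and>
     (\<forall>z\<in>unit_ball. \<exists>d. (\<forall>i. d i \<in> hs_carrier E) \<and>
        (\<forall>\<epsilon>>0. \<forall>\<^sub>F h in at 0.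
           hs_norm E (f (z + h) - f z - (\<Sum>i\<in>UNIV. h $ i *\<^sub>C d i)) \<le> \<epsilon> * norm h))"

text \<open>Holomorphy with respect to the operator norm.\<close>

definition holomorphic_op ::
    "'a::complex_vector hspace \<Rightarrow> 'b::complex_vector hspace \<Rightarrow> (complex ^ 'n \<Rightarrow> 'a \<Rightarrow> 'b) \<Rightarrow> bool" where
  "holomorphic_op E F \<Phi> \<longleftrightarrow> (\<forall>z\<in>unit_ball. \<Phi> z \<in> bounded_ops E F) \<and>
     (\<forall>z\<in>unit_ball. \<exists>d. (\<forall>i. d i \<in> bounded_ops E F) \<and>
        (\<forall>\<epsilon>>0. \<forall>\<^sub>F h in at 0. \<forall>x\<in>hs_carrier E.
           hs_norm F (\<Phi> (z + h) x - \<Phi> z x - (\<Sum>i\<in>UNIV. h $ i *\<^sub>C d i x))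
             \<le> \<epsilon> * norm h * hs_norm E x))"

definition kernel_fun :: "nat \<Rightarrow> complex ^ 'n \<Rightarrow> 'e::complex_vector \<Rightarrow> complex ^ 'n \<Rightarrow> 'e" where
  "kernel_fun m w \<eta> = (\<lambda>z. if z \<in> unit_ball then (1 / (1 - cdot z w) ^ m) *\<^sub>C \<eta> else 0)"

text \<open>
  \<open>H\<close> is the space \<open>\<H>\<^sub>m(\<bool>\<^sup>n, E)\<close>: the Hilbert space of holomorphic \<open>E\<close>-valued functions on the
  ball, with pointwise operations, reproducing kernel \<open>(1 - \<langle>z, w\<rangle>)\<^sup>-\<^sup>m I\<close>.  Functions on the ball are
  represented as functions vanishing outside it.  By the Moore-Aronszajn theorem the carrier and
  the inner product on it are determined by \<open>m\<close> and \<open>E\<close>.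
\<close>

definition weighted_bergman ::
    "nat \<Rightarrow> 'e::complex_vector hspace \<Rightarrow> (complex ^ 'n \<Rightarrow> 'e) hspace \<Rightarrow> bool" where
  "weighted_bergman m E H \<longleftrightarrow> hilbert_space H \<and>
     (\<forall>f\<in>hs_carrier H. holomorphic_vec E f \<and> (\<forall>z. z \<notin> unit_ball \<longrightarrow> f z = 0)) \<and>
     (\<forall>w\<in>unit_ball. \<forall>\<eta>\<in>hs_carrier E. kernel_fun m w \<eta> \<in> hs_carrier H \<and>
        (\<forall>f\<in>hs_carrier H. hs_inner H f (kernel_fun m w \<eta>) = hs_inner E (f w) \<eta>))"

definition drury_arveson ::
    "'e::complex_vector hspace \<Rightarrow> (complex ^ 'n \<Rightarrow> 'e) hspace \<Rightarrow> bool" where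
  "drury_arveson E H \<longleftrightarrow> weighted_bergman 1 E H"

definition coord_mult :: "'n \<Rightarrow> (complex ^ 'n \<Rightarrow> 'e::complex_vector) \<Rightarrow> complex ^ 'n \<Rightarrow> 'e" where
  "coord_mult i f = (\<lambda>z. (z $ i) *\<^sub>C f z)"

definition mult_op ::
    "(complex ^ 'n \<Rightarrow> 'a::complex_vector \<Rightarrow> 'b::complex_vector) \<Rightarrow>
     (complex ^ 'n \<Rightarrow> 'a) \<Rightarrow> complex ^ 'n \<Rightarrow> 'b" where
  "mult_op \<Phi> f = (\<lambda>z. if z \<in> unit_ball then \<Phi> z (f z) else 0)"

definition coinvariant_subspace ::
    "(complex ^ 'n \<Rightarrow> 'e::complex_vector) hspace \<Rightarrow> (complex ^ 'n \<Rightarrow> 'e) set \<Rightarrow> bool" where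
  "coinvariant_subspace H Q \<longleftrightarrow> closed_subspace H Q \<and>
     (\<forall>i. \<forall>f\<in>Q. hs_adj H H (coord_mult i) f \<in> Q)"

definition compression ::
    "(complex ^ 'n \<Rightarrow> 'e::complex_vector) hspace \<Rightarrow> (complex ^ 'n \<Rightarrow> 'e) set \<Rightarrow>
     'n \<Rightarrow> (complex ^ 'n \<Rightarrow> 'e) \<Rightarrow> complex ^ 'n \<Rightarrow> 'e" where
  "compression H Q i = (\<lambda>f. hs_proj H Q (coord_mult i f))"

text \<open>\<open>A1\<close> and \<open>A2\<close> are the Drury-Arveson spaces with values in \<open>E1\<close> and \<open>E2\<close>.\<close>

definition schur_agler ::
    "'a::complex_vector hspace \<Rightarrow> 'b::complex_vector hspace \<Rightarrow>
     (complex ^ 'n \<Rightarrow> 'a) hspace \<Rightarrow> (complex ^ 'n \<Rightarrow> 'b) hspace \<Rightarrow>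
     (complex ^ 'n \<Rightarrow> 'a \<Rightarrow> 'b) \<Rightarrow> bool" where
  "schur_agler E1 E2 A1 A2 \<Phi> \<longleftrightarrow> holomorphic_op E1 E2 \<Phi> \<and> contraction_op A1 A2 (mult_op \<Phi>)"


section \<open>The associated unitary and its transfer function\<close>

text \<open>In this section \<open>K1\<close> and \<open>K2\<close> are the spaces on which the tuples \<open>T\<close> and \<open>S\<close> act, and
  \<open>X\<close> is an operator from \<open>K1\<close> to \<open>K2\<close>.\<close>

definition lifting_defect ::
    "nat \<Rightarrow> 'a::complex_vector hspace \<Rightarrow> 'b::complex_vector hspace \<Rightarrow>
     ('n::finite \<Rightarrow> 'b \<Rightarrow> 'b) \<Rightarrow> ('a \<Rightarrow> 'b) \<Rightarrow> 'b \<Rightarrow> 'b" where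
  "lifting_defect m K1 K2 S X =
     one_minus_sigma_pow K2 S (m - 1) (\<lambda>k. k - X (hs_adj K1 K2 X k))"

definition lifting_Delta ::
    "nat \<Rightarrow> 'a::complex_vector hspace \<Rightarrow> 'b::complex_vector hspace \<Rightarrow>
     ('n::finite \<Rightarrow> 'b \<Rightarrow> 'b) \<Rightarrow> ('a \<Rightarrow> 'b) \<Rightarrow> 'b \<Rightarrow> 'b" where
  "lifting_Delta m K1 K2 S X = op_sqrt K2 (lifting_defect m K1 K2 S X)"

definition state_space ::
    "nat \<Rightarrow> 'a::complex_vector hspace \<Rightarrow> 'b::complex_vector hspace \<Rightarrow>
     ('n::finite \<Rightarrow> 'b \<Rightarrow> 'b) \<Rightarrow> ('a \<Rightarrow> 'b) \<Rightarrow> 'l hspace \<Rightarrow> ('b \<times> 'l) hspace" where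
  "state_space m K1 K2 S X L = hs_sum (closed_range K2 (lifting_Delta m K1 K2 S X)) L"

definition associated_unitary ::
    "nat \<Rightarrow> 'a::complex_vector hspace \<Rightarrow> 'b::complex_vector hspace \<Rightarrow>
     ('n::finite \<Rightarrow> 'a \<Rightarrow> 'a) \<Rightarrow> ('n \<Rightarrow> 'b \<Rightarrow> 'b) \<Rightarrow> ('a \<Rightarrow> 'b) \<Rightarrow>
     'l::complex_vector hspace \<Rightarrow> ('b \<times> ('n \<Rightarrow> 'b \<times> 'l) \<Rightarrow> 'a \<times> ('b \<times> 'l)) \<Rightarrow> bool" where
  "associated_unitary m K1 K2 T S X L U \<longleftrightarrow>
     (let R = state_space m K1 K2 S X L; \<Delta> = lifting_Delta m K1 K2 S X in
      unitary_op (hs_sum (defect_space K2 S m) (hs_pow R)) (hs_sum (defect_space K1 T m) R) U \<and>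
      (\<forall>k\<in>hs_carrier K2.
         U (defect_op K2 S m k, \<lambda>i. (\<Delta> (hs_adj K2 K2 (S i) k), 0)) =
           (defect_op K1 T m (hs_adj K1 K2 X k), (\<Delta> k, 0))))"

definition row_Z :: "complex ^ 'n \<Rightarrow> ('n \<Rightarrow> 'r::complex_vector) \<Rightarrow> 'r" where
  "row_Z z v = (\<Sum>i\<in>UNIV. z $ i *\<^sub>C v i)"

text \<open>
  For \<open>U\<close> from \<open>F \<oplus> R\<^sup>n\<close> to \<open>E \<oplus> R\<close> with block entries \<open>A, B, C, D\<close>, the transfer function
  of \<open>U\<^sup>*\<close>, whose values are operators from \<open>E\<close> to \<open>F\<close>.
\<close>

definition adj_transfer_function ::
    "'f::complex_vector hspace \<Rightarrow> 'e::complex_vector hspace \<Rightarrow> 'r::complex_vector hspace \<Rightarrow>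
     ('f \<times> ('n::finite \<Rightarrow> 'r) \<Rightarrow> 'e \<times> 'r) \<Rightarrow> complex ^ 'n \<Rightarrow> 'e \<Rightarrow> 'f" where
  "adj_transfer_function F E R U z =
     (let A = (\<lambda>x. fst (U (x, 0))); B = (\<lambda>v. fst (U (0, v)));
          C = (\<lambda>x. snd (U (x, 0))); D = (\<lambda>v. snd (U (0, v)));
          inverse_op = inv_into (hs_carrier R) (\<lambda>r. r - row_Z z (hs_adj (hs_pow R) R D r))
      in (\<lambda>e. hs_adj F E A e +
            hs_adj F R C (inverse_op (row_Z z (hs_adj (hs_pow R) E B e)))))"

text \<open>
  The transfer function takes values in the operators between defect spaces, whereas a multiplier
  takes values in the operators between the coefficient spaces.  For a co-invariant subspace \<open>Q\<close>
  of \<open>\<H>\<^sub>m(\<bool>\<^sup>n, E)\<close> with compression \<open>T\<close> one has \<open>\<parallel>D f\<parallel> = \<parallel>f(0)\<parallel>\<close> for \<open>f \<in> Q\<close>, where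
  \<open>D\<close> is the defect operator, since \<open>(1 - \<sigma>)\<^sup>m(I)\<close> for the coordinate multiplications is the
  projection onto the constants.  Hence \<open>D f \<mapsto> f(0)\<close> extends to a canonical isometry from the
  defect space into \<open>E\<close>, along which the defect space is regarded as a subspace of \<open>E\<close>.
  The value \<open>0\<close> off the defect space makes the described function unique.
\<close>

definition defect_embedding ::
    "nat \<Rightarrow> 'e::complex_vector hspace \<Rightarrow> (complex ^ 'n \<Rightarrow> 'e) hspace \<Rightarrow>
     ('n \<Rightarrow> (complex ^ 'n \<Rightarrow> 'e) \<Rightarrow> complex ^ 'n \<Rightarrow> 'e) \<Rightarrow> (complex ^ 'n \<Rightarrow> 'e) \<Rightarrow> 'e" where
  "defect_embedding m E K T =
     (THE J. J \<in> bounded_ops (defect_space K T m) E \<and>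
        (\<forall>f\<in>hs_carrier K. J (defect_op K T m f) = f 0) \<and>
        (\<forall>x. x \<notin> hs_carrier (defect_space K T m) \<longrightarrow> J x = 0))"

definition transfer_multiplier ::
    "nat \<Rightarrow> 'a::complex_vector hspace \<Rightarrow> 'b::complex_vector hspace \<Rightarrow>
     (complex ^ 'n \<Rightarrow> 'a) hspace \<Rightarrow> (complex ^ 'n \<Rightarrow> 'b) hspace \<Rightarrow>
     ('n \<Rightarrow> (complex ^ 'n \<Rightarrow> 'a) \<Rightarrow> complex ^ 'n \<Rightarrow> 'a) \<Rightarrow>
     ('n \<Rightarrow> (complex ^ 'n \<Rightarrow> 'b) \<Rightarrow> complex ^ 'n \<Rightarrow> 'b) \<Rightarrow>
     ((complex ^ 'n \<Rightarrow> 'a) \<Rightarrow> complex ^ 'n \<Rightarrow> 'b) \<Rightarrow> 'l::complex_vector hspace \<Rightarrow>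
     ((complex ^ 'n \<Rightarrow> 'b) \<times> ('n \<Rightarrow> (complex ^ 'n \<Rightarrow> 'b) \<times> 'l) \<Rightarrow>
      (complex ^ 'n \<Rightarrow> 'a) \<times> ((complex ^ 'n \<Rightarrow> 'b) \<times> 'l)) \<Rightarrow>
     complex ^ 'n \<Rightarrow> 'a \<Rightarrow> 'b" where
  "transfer_multiplier m E1 E2 K1 K2 T S X L U z =
     (\<lambda>e. defect_embedding m E2 K2 S
        (adj_transfer_function (defect_space K2 S m) (defect_space K1 T m)
           (state_space m K1 K2 S X L) U z
           (hs_adj (defect_space K1 T m) E1 (defect_embedding m E1 K1 T) e)))"

end

theory Submission
  imports Defs
begin

text \<open>
  Everything is tested on the kernel functions \<open>k\<^sub>w \<eta>\<close>, where \<open>M\<^sub>i\<^sup>* k\<^sub>w \<eta> = cnj w\<^sub>i k\<^sub>w \<eta>\<close>: the operator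
  \<open>(1 - \<sigma>\<^sub>M)\<^sup>j(Y)\<close> has the kernel of \<open>Y\<close> multiplied by \<open>(1 - \<langle>z, w\<rangle>)\<^sup>j\<close>, and positive kernels remain
  positive when divided by \<open>1 - \<langle>z, w\<rangle>\<close>.  With \<open>Y = I - M\<^sub>\<Phi> M\<^sub>\<Phi>\<^sup>*\<close> this gives necessity.

  For sufficiency, \<open>\<parallel>D\<^sub>S k\<parallel>\<^sup>2 + \<Sum> \<parallel>\<Delta> S\<^sub>i\<^sup>* k\<parallel>\<^sup>2 = \<parallel>D\<^sub>T X\<^sup>* k\<parallel>\<^sup>2 + \<parallel>\<Delta> k\<parallel>\<^sup>2\<close>, and this isometry extends to
  a unitary \<open>U\<close> because the auxiliary space absorbs both defects, by a Cantor-Bernstein argument.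
  If \<open>\<tau>\<close> is the transfer function of \<open>U\<^sup>*\<close>, then
  \<open>U(x, (cnj w\<^sub>i g\<^sub>w x)\<^sub>i) = (\<tau>(w)\<^sup>* x, g\<^sub>w x)\<close> for suitable operators \<open>g\<^sub>w\<close>; comparing inner products gives
  \<open>\<langle>x, y\<rangle> - \<langle>\<tau>(w)\<^sup>* x, \<tau>(z)\<^sup>* y\<rangle> = (1 - \<langle>z, w\<rangle>) \<langle>g\<^sub>w x, g\<^sub>z y\<rangle>\<close>, so the multiplier \<open>\<Phi>\<close> is Schur-Agler.  The
  operator \<open>\<Gamma>\<close> with \<open>\<Gamma> (k\<^sub>w \<eta>) = g\<^sub>w \<eta>\<close> obeys the same equation as \<open>k \<mapsto> (\<Delta> k, 0)\<close>, so their difference \<open>\<delta>\<close>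
  satisfies \<open>\<parallel>\<delta> k\<parallel>\<^sup>2 \<le> \<Sum> \<parallel>\<delta> (S\<^sub>i\<^sup>* k)\<parallel>\<^sup>2\<close> and vanishes, since the shift is pure.  Hence \<open>X\<^sup>* k\<close> and
  \<open>M\<^sub>\<Phi>\<^sup>* k\<close> agree at \<open>0\<close>; as both maps intertwine the adjoint shifts, purity again shows that they agree.
\<close>

text \<open>The claim about the explicit multiplier concerns every unitary that satisfies the
  defining equation, over any auxiliary space. So the lifting argument may use nothing of
  \<open>U\<close> but unitarity and that equation; how \<open>U\<close> is built matters for
  existence only. The operator \<Gamma> has to be bounded on the space with exponent m, although the
  transfer function only knows the exponent 1. Here m \<ge> 1 decides: the kernel <g_w x, g_z y>
  lies below the Drury-Arveson kernel, and that one below the kernel with exponent m, so comparing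
  kernels yields \<Gamma> at once and no Taylor coefficients appear. The power m - 1 in the
  condition is the number of factors that lead from the exponent m down to the Schur-Agler exponent
  1. One more power turns the form of the identity into <f(0), g(0)>, which identifies defect
  vectors with values at the origin and places the defect spaces inside the coefficient spaces.
  Adjoints of the compressions are plain restrictions, so forms written with adjoints alone pass
  between Q and the full space without projections.\<close>

interpretation cvec: vector_space "scaleC :: complex \<Rightarrow> 'a \<Rightarrow> 'a::complex_vector"
  by standard (simp_all add: scaleC_add_right scaleC_add_left scaleC_scaleC scaleC_one)

section \<open>Linear subsets\<close>

lemma linear_subset_zero: "linear_subset V \<Longrightarrow> 0 \<in> V"
  and linear_subset_add: "linear_subset V \<Longrightarrow> x \<in> V \<Longrightarrow> y \<in> V \<Longrightarrow> x + y \<in> V"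
  and linear_subset_scale: "linear_subset V \<Longrightarrow> x \<in> V \<Longrightarrow> c *\<^sub>C x \<in> V"
  by (auto simp: linear_subset_def)

lemma linear_subset_uminus: "linear_subset V \<Longrightarrow> x \<in> V \<Longrightarrow> - x \<in> V"
  using linear_subset_scale[of V x "-1"] by simp

lemma linear_subset_diff: "linear_subset V \<Longrightarrow> x \<in> V \<Longrightarrow> y \<in> V \<Longrightarrow> x - y \<in> V"
  using linear_subset_add[of V x "- y"] linear_subset_uminus[of V y] by simp

lemma linear_subset_sum: "linear_subset V \<Longrightarrow> (\<And>i. i \<in> I \<Longrightarrow> f i \<in> V) \<Longrightarrow> sum f I \<in> V"
  by (induction I rule: infinite_finite_induct) (auto intro: linear_subset_zero linear_subset_add)

lemmas linear_subset_intros = linear_subset_zero linear_subset_add linear_subset_scale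
  linear_subset_uminus linear_subset_diff linear_subset_sum


section \<open>Inner products\<close>

lemma hs_carrier_linear: "hilbert_space H \<Longrightarrow> linear_subset (hs_carrier H)"
  by (simp add: hilbert_space_def)

lemma hs_carrier_simps [simp]:
  assumes "hilbert_space H"
  shows "0 \<in> hs_carrier H"
    and "x \<in> hs_carrier H \<Longrightarrow> y \<in> hs_carrier H \<Longrightarrow> x + y \<in> hs_carrier H"
    and "x \<in> hs_carrier H \<Longrightarrow> c *\<^sub>C x \<in> hs_carrier H"
    and "x \<in> hs_carrier H \<Longrightarrow> - x \<in> hs_carrier H"
    and "x \<in> hs_carrier H \<Longrightarrow> y \<in> hs_carrier H \<Longrightarrow> x - y \<in> hs_carrier H"
    and "(\<And>i. i \<in> I \<Longrightarrow> f i \<in> hs_carrier H) \<Longrightarrow> sum f I \<in> hs_carrier H"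
  using hs_carrier_linear[OF assms] by (auto intro: linear_subset_intros)

lemma hilbert_spaceD:
  assumes "hilbert_space H"
  shows "\<forall>x\<in>hs_carrier H. \<forall>y\<in>hs_carrier H. \<forall>z\<in>hs_carrier H.
      hs_inner H (x + y) z = hs_inner H x z + hs_inner H y z"
    and "\<forall>c. \<forall>x\<in>hs_carrier H. \<forall>y\<in>hs_carrier H. hs_inner H (c *\<^sub>C x) y = c * hs_inner H x y"
    and "\<forall>x\<in>hs_carrier H. \<forall>y\<in>hs_carrier H. hs_inner H y x = cnj (hs_inner H x y)"
    and "\<forall>x\<in>hs_carrier H. x \<noteq> 0 \<longrightarrow> 0 < Re (hs_inner H x x)"
    and "\<forall>s. (\<forall>n. s n \<in> hs_carrier H) \<and>
      (\<forall>\<epsilon>>0. \<exists>N. \<forall>i\<ge>N. \<forall>j\<ge>N. hs_norm H (s i - s j) < \<epsilon>) \<longrightarrow>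
      (\<exists>x\<in>hs_carrier H. hs_lim H s x)"
  by (insert assms, unfold hilbert_space_def, (elim conjE, assumption)+)

lemma hs_inner_add_left [simp]:
  "\<lbrakk>hilbert_space H; x \<in> hs_carrier H; y \<in> hs_carrier H; z \<in> hs_carrier H\<rbrakk>
    \<Longrightarrow> hs_inner H (x + y) z = hs_inner H x z + hs_inner H y z"
  using hilbert_spaceD(1) by metis

lemma hs_inner_scale_left [simp]:
  "\<lbrakk>hilbert_space H; x \<in> hs_carrier H; y \<in> hs_carrier H\<rbrakk>
    \<Longrightarrow> hs_inner H (c *\<^sub>C x) y = c * hs_inner H x y"
  using hilbert_spaceD(2) by metis

lemma hs_inner_cnj:
  "\<lbrakk>hilbert_space H; x \<in> hs_carrier H; y \<in> hs_carrier H\<rbrakk>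
    \<Longrightarrow> cnj (hs_inner H x y) = hs_inner H y x"
  by (rule sym, rule hilbert_spaceD(3)[THEN bspec, THEN bspec])

lemma hs_inner_add_right [simp]:
  "\<lbrakk>hilbert_space H; x \<in> hs_carrier H; y \<in> hs_carrier H; z \<in> hs_carrier H\<rbrakk>
    \<Longrightarrow> hs_inner H z (x + y) = hs_inner H z x + hs_inner H z y"
  using hs_inner_add_left[of H x y z] by (simp flip: hs_inner_cnj[of H _ z])

lemma hs_inner_scale_right [simp]:
  "\<lbrakk>hilbert_space H; x \<in> hs_carrier H; y \<in> hs_carrier H\<rbrakk>
    \<Longrightarrow> hs_inner H y (c *\<^sub>C x) = cnj c * hs_inner H y x"
  using hs_inner_scale_left[of H x y c] by (simp flip: hs_inner_cnj[of H _ y])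

lemma hs_inner_minus_left [simp]:
  "\<lbrakk>hilbert_space H; x \<in> hs_carrier H; y \<in> hs_carrier H\<rbrakk> \<Longrightarrow> hs_inner H (- x) y = - hs_inner H x y"
  using hs_inner_scale_left[of H x y "-1"] by simp

lemma hs_inner_minus_right [simp]:
  "\<lbrakk>hilbert_space H; x \<in> hs_carrier H; y \<in> hs_carrier H\<rbrakk> \<Longrightarrow> hs_inner H y (- x) = - hs_inner H y x"
  using hs_inner_scale_right[of H x y "-1"] by simp

lemma hs_inner_zero [simp]:
  assumes "hilbert_space H" "x \<in> hs_carrier H"
  shows "hs_inner H 0 x = 0" "hs_inner H x 0 = 0"
  using hs_inner_scale_left[of H x x 0] hs_inner_scale_right[of H x x 0] assms by auto

lemma hs_inner_diff_left [simp]: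
  "\<lbrakk>hilbert_space H; x \<in> hs_carrier H; y \<in> hs_carrier H; z \<in> hs_carrier H\<rbrakk>
    \<Longrightarrow> hs_inner H (x - y) z = hs_inner H x z - hs_inner H y z"
  using hs_inner_add_left[of H x "-y" z] by simp

lemma hs_inner_diff_right [simp]:
  "\<lbrakk>hilbert_space H; x \<in> hs_carrier H; y \<in> hs_carrier H; z \<in> hs_carrier H\<rbrakk>
    \<Longrightarrow> hs_inner H z (x - y) = hs_inner H z x - hs_inner H z y"
  using hs_inner_add_right[of H x "-y" z] by simp

lemma hs_inner_sum_left:
  assumes "hilbert_space H" "\<And>i. i \<in> I \<Longrightarrow> f i \<in> hs_carrier H" "z \<in> hs_carrier H"
  shows "hs_inner H (sum f I) z = (\<Sum>i\<in>I. hs_inner H (f i) z)"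
  using assms(2)
  by (induction I rule: infinite_finite_induct) (use assms in \<open>auto\<close>)

lemma hs_inner_sum_right:
  assumes "hilbert_space H" "\<And>i. i \<in> I \<Longrightarrow> f i \<in> hs_carrier H" "z \<in> hs_carrier H"
  shows "hs_inner H z (sum f I) = (\<Sum>i\<in>I. hs_inner H z (f i))"
  using assms(2)
  by (induction I rule: infinite_finite_induct) (use assms in \<open>auto\<close>)

lemma hs_inner_self_Im:
  "\<lbrakk>hilbert_space H; x \<in> hs_carrier H\<rbrakk> \<Longrightarrow> Im (hs_inner H x x) = 0"
  using hs_inner_cnj[of H x x] by (simp add: complex_eq_iff)

lemma hs_inner_self_pos:
  "\<lbrakk>hilbert_space H; x \<in> hs_carrier H; x \<noteq> 0\<rbrakk> \<Longrightarrow> 0 < Re (hs_inner H x x)"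
  using hilbert_spaceD(4) by metis

lemma hs_inner_self_nonneg:
  "\<lbrakk>hilbert_space H; x \<in> hs_carrier H\<rbrakk> \<Longrightarrow> 0 \<le> Re (hs_inner H x x)"
  using hs_inner_self_pos[of H x] by (cases "x = 0") (auto simp: less_imp_le)

lemma hs_norm_sq:
  "\<lbrakk>hilbert_space H; x \<in> hs_carrier H\<rbrakk> \<Longrightarrow> (hs_norm H x)\<^sup>2 = Re (hs_inner H x x)"
  by (simp add: hs_norm_def hs_inner_self_nonneg)

lemma hs_inner_self:
  "\<lbrakk>hilbert_space H; x \<in> hs_carrier H\<rbrakk> \<Longrightarrow> hs_inner H x x = of_real ((hs_norm H x)\<^sup>2)"
  by (simp add: hs_norm_sq complex_eq_iff hs_inner_self_Im del: of_real_power)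

lemma hs_norm_nonneg [simp]:
  "\<lbrakk>hilbert_space H; x \<in> hs_carrier H\<rbrakk> \<Longrightarrow> 0 \<le> hs_norm H x"
  by (simp add: hs_norm_def hs_inner_self_nonneg)

lemma hs_norm_zero [simp]: "hilbert_space H \<Longrightarrow> hs_norm H 0 = 0"
  by (simp add: hs_norm_def)

lemma hs_norm_eq_0 [simp]:
  "\<lbrakk>hilbert_space H; x \<in> hs_carrier H\<rbrakk> \<Longrightarrow> hs_norm H x = 0 \<longleftrightarrow> x = 0"
  using hs_inner_self_pos[of H x] by (cases "x = 0") (auto simp: hs_norm_def)

lemma hs_norm_scale [simp]:
  assumes "hilbert_space H" "x \<in> hs_carrier H"
  shows "hs_norm H (c *\<^sub>C x) = cmod c * hs_norm H x"
proof -
  have "hs_inner H (c *\<^sub>C x) (c *\<^sub>C x) = of_real ((cmod c * hs_norm H x)\<^sup>2)"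
    using assms complex_norm_square[of c] hs_inner_self[OF assms]
    by (simp add: power_mult_distrib)
  then have "(hs_norm H (c *\<^sub>C x))\<^sup>2 = (cmod c * hs_norm H x)\<^sup>2"
    using assms by (simp add: hs_norm_sq del: of_real_power of_real_mult)
  then show ?thesis
    by (rule power2_eq_imp_eq) (use assms in auto)
qed

lemma hs_norm_minus [simp]:
  "\<lbrakk>hilbert_space H; x \<in> hs_carrier H\<rbrakk> \<Longrightarrow> hs_norm H (- x) = hs_norm H x"
  using hs_norm_scale[of H x "-1"] by simp

lemma hs_norm_minus_commute:
  "\<lbrakk>hilbert_space H; x \<in> hs_carrier H; y \<in> hs_carrier H\<rbrakk> \<Longrightarrow> hs_norm H (x - y) = hs_norm H (y - x)"
  using hs_norm_minus[of H "x - y"] by simp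

lemma hs_norm_add_sq:
  assumes "hilbert_space H" "x \<in> hs_carrier H" "y \<in> hs_carrier H"
  shows "(hs_norm H (x + y))\<^sup>2 = (hs_norm H x)\<^sup>2 + 2 * Re (hs_inner H x y) + (hs_norm H y)\<^sup>2"
proof -
  have "Re (hs_inner H y x) = Re (hs_inner H x y)"
    using assms by (simp flip: hs_inner_cnj[of H x y])
  then show ?thesis using assms by (simp add: hs_norm_sq)
qed

lemma hs_norm_diff_sq:
  assumes "hilbert_space H" "x \<in> hs_carrier H" "y \<in> hs_carrier H"
  shows "(hs_norm H (x - y))\<^sup>2 = (hs_norm H x)\<^sup>2 - 2 * Re (hs_inner H x y) + (hs_norm H y)\<^sup>2"
  using hs_norm_add_sq[of H x "-y"] assms by simp

text \<open>The discriminant criterion, the scalar core of the Cauchy-Schwarz inequality and of the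
  first-order condition in the Riesz theorem. If c = 0 the expression is affine in t and is bounded
  below only if b = 0; otherwise its vertex t = -b/c decides.\<close>

lemma quadratic_nonneg_imp:
  fixes a b c :: real
  assumes "\<And>t. 0 \<le> a + 2 * t * b + t\<^sup>2 * c" "0 \<le> c"
  shows "b\<^sup>2 \<le> a * c"
proof (cases "c = 0")
  case True
  have "b = 0"
  proof (rule ccontr)
    assume "b \<noteq> 0"
    \<comment> \<open>At this t the affine expression equals -1.\<close>
    then show False
      using assms(1)[of "- (a + 1) / (2 * b)"] True by (simp add: field_simps)
  qed
  then show ?thesis using True by simp
next
  case False
  have "0 \<le> a + 2 * (- b / c) * b + (- b / c)\<^sup>2 * c" by (rule assms)
  also have "\<dots> = (a * c - b\<^sup>2) / c"
    using False by (simp add: field_simps power2_eq_square)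
  finally show ?thesis using False assms(2) by (simp add: zero_le_divide_iff)
qed

text \<open>The Cauchy-Schwarz inequality is also needed for the semi-inner products \<open>\<langle>Ax, y\<rangle>\<close> with \<open>A\<close>
  positive.\<close>

lemma semi_inner_Cauchy_Schwarz:
  fixes g :: "'a::complex_vector \<Rightarrow> 'a \<Rightarrow> complex"
  assumes V: "linear_subset V" "x \<in> V" "y \<in> V"
    and add: "\<And>x y z. \<lbrakk>x \<in> V; y \<in> V; z \<in> V\<rbrakk> \<Longrightarrow> g (x + y) z = g x z + g y z"
    and scale: "\<And>c x y. \<lbrakk>x \<in> V; y \<in> V\<rbrakk> \<Longrightarrow> g (c *\<^sub>C x) y = c * g x y"
    and herm: "\<And>x y. \<lbrakk>x \<in> V; y \<in> V\<rbrakk> \<Longrightarrow> g y x = cnj (g x y)"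
    and pos: "\<And>x. x \<in> V \<Longrightarrow> 0 \<le> Re (g x x)"
  shows "(cmod (g x y))\<^sup>2 \<le> Re (g x x) * Re (g y y)"
proof -
  have addr: "g z (x + y) = g z x + g z y" if "x \<in> V" "y \<in> V" "z \<in> V" for x y z
    using that V(1) add herm by (metis complex_cnj_add linear_subset_add)
  have scaler: "g y (c *\<^sub>C x) = cnj c * g y x" if "x \<in> V" "y \<in> V" for c x y
    using that V(1) scale herm by (metis complex_cnj_mult linear_subset_scale)
  \<comment> \<open>The unimodular \<open>u\<close> rotates \<open>g x y\<close> onto the
    nonnegative reals, so real multiples of u y detect the modulus and not only the real
    part.\<close>
  define u where "u = (if g x y = 0 then 1 else g x y / cmod (g x y))"
  have uu: "cnj u * u = 1" "cnj u * g x y = of_real (cmod (g x y))"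
    using complex_norm_square[of "g x y"]
    by (auto simp: u_def divide_simps power2_eq_square mult_ac)
  have "0 \<le> Re (g x x) + 2 * t * cmod (g x y) + t\<^sup>2 * Re (g y y)" for t :: real
  proof -
    have uy: "u *\<^sub>C y \<in> V" "(of_real t * u) *\<^sub>C y \<in> V" using V by (auto intro: linear_subset_scale)
    have h: "g x ((of_real t * u) *\<^sub>C y) = of_real t * of_real (cmod (g x y))"
      using V uu(2) by (simp add: scaler mult.assoc)
    have h': "g ((of_real t * u) *\<^sub>C y) x = of_real t * of_real (cmod (g x y))"
      using herm[of x "(of_real t * u) *\<^sub>C y"] V uy h by simp
    have "g ((of_real t * u) *\<^sub>C y) ((of_real t * u) *\<^sub>C y) = (of_real t * u) * (cnj (of_real t * u) * g y y)"
      using V uy by (simp add: scaler scale)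
    also have "\<dots> = of_real (t\<^sup>2) * g y y" using uu(1) by (simp add: power2_eq_square mult_ac)
    finally have h'': "g ((of_real t * u) *\<^sub>C y) ((of_real t * u) *\<^sub>C y) = of_real (t\<^sup>2) * g y y" .
    have "0 \<le> Re (g (x + (of_real t * u) *\<^sub>C y) (x + (of_real t * u) *\<^sub>C y))"
      using V uy by (intro pos linear_subset_add)
    also have "\<dots> = Re (g x x) + 2 * t * cmod (g x y) + t\<^sup>2 * Re (g y y)"
      using V uy by (simp add: linear_subset_add add addr h h' h'' del: of_real_power)
    finally show ?thesis .
  qed
  then show ?thesis using pos[OF V(3)] by (rule quadratic_nonneg_imp)
qed

lemma hs_Cauchy_Schwarz:
  assumes "hilbert_space H" "x \<in> hs_carrier H" "y \<in> hs_carrier H"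
  shows "cmod (hs_inner H x y) \<le> hs_norm H x * hs_norm H y"
proof -
  have "(cmod (hs_inner H x y))\<^sup>2 \<le> Re (hs_inner H x x) * Re (hs_inner H y y)"
    by (rule semi_inner_Cauchy_Schwarz[where V = "hs_carrier H"])
      (use assms in \<open>auto simp: hs_carrier_linear hs_inner_cnj hs_inner_self_nonneg\<close>)
  then have "(cmod (hs_inner H x y))\<^sup>2 \<le> (hs_norm H x * hs_norm H y)\<^sup>2"
    using assms by (simp add: power_mult_distrib hs_norm_sq)
  then show ?thesis by (rule power2_le_imp_le) (use assms in auto)
qed

lemma hs_norm_triangle:
  assumes "hilbert_space H" "x \<in> hs_carrier H" "y \<in> hs_carrier H"
  shows "hs_norm H (x + y) \<le> hs_norm H x + hs_norm H y"
proof (rule power2_le_imp_le)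
  show "(hs_norm H (x + y))\<^sup>2 \<le> (hs_norm H x + hs_norm H y)\<^sup>2"
    using hs_Cauchy_Schwarz[OF assms] complex_Re_le_cmod[of "hs_inner H x y"] assms
    by (simp add: hs_norm_add_sq power2_sum)
qed (use assms in auto)

lemma hs_norm_triangle_diff:
  assumes "hilbert_space H" "x \<in> hs_carrier H" "y \<in> hs_carrier H"
  shows "hs_norm H (x - y) \<le> hs_norm H x + hs_norm H y"
  using hs_norm_triangle[of H x "-y"] assms by simp

lemma hs_norm_triangle_sub:
  assumes "hilbert_space H" "x \<in> hs_carrier H" "y \<in> hs_carrier H"
  shows "\<bar>hs_norm H x - hs_norm H y\<bar> \<le> hs_norm H (x - y)"
  using hs_norm_triangle[of H "x - y" y] hs_norm_triangle[of H "y - x" x]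
    hs_norm_minus_commute[of H x y] assms by simp

lemma hs_norm_sum_le:
  assumes "hilbert_space H" "\<And>i. i \<in> I \<Longrightarrow> f i \<in> hs_carrier H"
  shows "hs_norm H (sum f I) \<le> (\<Sum>i\<in>I. hs_norm H (f i))"
  using assms(2)
proof (induction I rule: infinite_finite_induct)
  case (insert i I)
  have "hs_norm H (f i + sum f I) \<le> hs_norm H (f i) + hs_norm H (sum f I)"
    using insert.prems assms(1) by (intro hs_norm_triangle) auto
  with insert show ?case by fastforce
qed (use assms(1) in auto)

lemma hs_parallelogram_le:
  assumes "hilbert_space H" "x \<in> hs_carrier H" "y \<in> hs_carrier H"
  shows "(hs_norm H (x + y))\<^sup>2 \<le> 2 * (hs_norm H x)\<^sup>2 + 2 * (hs_norm H y)\<^sup>2"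
  using hs_norm_add_sq[OF assms] hs_norm_diff_sq[OF assms] zero_le_power2[of "hs_norm H (x - y)"]
  by linarith

lemma hs_eq_if_inner_eq:
  assumes "hilbert_space H" "x \<in> hs_carrier H" "y \<in> hs_carrier H"
    and "\<And>h. h \<in> hs_carrier H \<Longrightarrow> hs_inner H h x = hs_inner H h y"
  shows "x = y"
  using assms(4)[of "x - y"] assms(1-3) hs_inner_self_pos[of H "x - y"] by fastforce


section \<open>Limits\<close>

lemma hs_lim_unique:
  assumes "hilbert_space H" "\<And>n. s n \<in> hs_carrier H" "x \<in> hs_carrier H" "y \<in> hs_carrier H"
    and "hs_lim H s x" "hs_lim H s y"
  shows "x = y"
proof -
  have "(\<lambda>n. hs_norm H (s n - x) + hs_norm H (s n - y)) \<longlonglongrightarrow> 0"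
    using tendsto_add[OF assms(5,6)[unfolded hs_lim_def]] by simp
  moreover have "hs_norm H (x - y) \<le> hs_norm H (s n - x) + hs_norm H (s n - y)" for n
    using hs_norm_triangle_diff[of H "s n - y" "s n - x"] assms by simp
  ultimately have "hs_norm H (x - y) \<le> 0"
    by (intro tendsto_lowerbound[where F = sequentially]) auto
  then have "hs_norm H (x - y) = 0"
    using assms by (intro antisym) auto
  then show ?thesis using assms(1,3,4) by simp
qed

lemma hs_lim_const: "hilbert_space H \<Longrightarrow> hs_lim H (\<lambda>_. x) x"
  by (simp add: hs_lim_def)

lemma hs_lim_add:
  assumes "hilbert_space H" "\<And>n. s n \<in> hs_carrier H" "\<And>n. t n \<in> hs_carrier H"
    "x \<in> hs_carrier H" "y \<in> hs_carrier H" and "hs_lim H s x" "hs_lim H t y"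
  shows "hs_lim H (\<lambda>n. s n + t n) (x + y)"
  unfolding hs_lim_def
proof (rule tendsto_sandwich[OF _ _ tendsto_const])
  show "(\<lambda>n. hs_norm H (s n - x) + hs_norm H (t n - y)) \<longlonglongrightarrow> 0"
    using tendsto_add[OF assms(6,7)[unfolded hs_lim_def]] by simp
  have "hs_norm H (s n + t n - (x + y)) \<le> hs_norm H (s n - x) + hs_norm H (t n - y)" for n
    using hs_norm_triangle[of H "s n - x" "t n - y"] assms by (simp add: algebra_simps)
  then show "\<forall>\<^sub>F n in sequentially.
      hs_norm H (s n + t n - (x + y)) \<le> hs_norm H (s n - x) + hs_norm H (t n - y)" by simp
qed (use assms in auto)

lemma hs_lim_scale:
  assumes "hilbert_space H" "\<And>n. s n \<in> hs_carrier H" "x \<in> hs_carrier H" "hs_lim H s x"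
  shows "hs_lim H (\<lambda>n. c *\<^sub>C s n) (c *\<^sub>C x)"
proof -
  have "hs_norm H (c *\<^sub>C s n - c *\<^sub>C x) = cmod c * hs_norm H (s n - x)" for n
    using hs_norm_scale[of H "s n - x" c] assms by (simp add: cvec.scale_right_diff_distrib)
  then show ?thesis
    using tendsto_mult_left[OF assms(4)[unfolded hs_lim_def], of "cmod c"] by (simp add: hs_lim_def)
qed

lemma hs_lim_inner:
  assumes "hilbert_space H" "\<And>n. s n \<in> hs_carrier H" "x \<in> hs_carrier H" "y \<in> hs_carrier H"
    and "hs_lim H s x"
  shows "(\<lambda>n. hs_inner H (s n) y) \<longlonglongrightarrow> hs_inner H x y"
proof (rule LIM_zero_cancel, rule tendsto_norm_zero_cancel, rule tendsto_sandwich[OF _ _ tendsto_const])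
  show "(\<lambda>n. hs_norm H (s n - x) * hs_norm H y) \<longlonglongrightarrow> 0"
    using tendsto_mult_right[OF assms(5)[unfolded hs_lim_def], of "hs_norm H y"] by simp
  have "norm (hs_inner H (s n) y - hs_inner H x y) \<le> hs_norm H (s n - x) * hs_norm H y" for n
    using hs_Cauchy_Schwarz[of H "s n - x" y] assms by simp
  then show "\<forall>\<^sub>F n in sequentially.
      norm (hs_inner H (s n) y - hs_inner H x y) \<le> hs_norm H (s n - x) * hs_norm H y" by simp
qed auto

lemma hs_lim_norm:
  assumes "hilbert_space H" "\<And>n. s n \<in> hs_carrier H" "x \<in> hs_carrier H" "hs_lim H s x"
  shows "(\<lambda>n. hs_norm H (s n)) \<longlonglongrightarrow> hs_norm H x"
proof (rule LIM_zero_cancel, rule tendsto_rabs_zero_cancel, rule tendsto_sandwich[OF _ _ tendsto_const])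
  show "(\<lambda>n. hs_norm H (s n - x)) \<longlonglongrightarrow> 0" using assms(4) by (simp add: hs_lim_def)
  show "\<forall>\<^sub>F n in sequentially. \<bar>hs_norm H (s n) - hs_norm H x\<bar> \<le> hs_norm H (s n - x)"
    using assms by (simp add: hs_norm_triangle_sub)
qed auto

lemma hs_complete:
  assumes "hilbert_space H" "\<And>n. s n \<in> hs_carrier H"
    "\<And>\<epsilon>. \<epsilon> > 0 \<Longrightarrow> \<exists>N. \<forall>i\<ge>N. \<forall>j\<ge>N. hs_norm H (s i - s j) < \<epsilon>"
  obtains x where "x \<in> hs_carrier H" "hs_lim H s x"
  using hilbert_spaceD(5)[OF assms(1), THEN spec, of s] assms(2,3) by blast

lemma hs_lim_Cauchy:
  assumes "hilbert_space H" "\<And>n. s n \<in> hs_carrier H" "x \<in> hs_carrier H" "hs_lim H s x" "\<epsilon> > 0"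
  shows "\<exists>N. \<forall>i\<ge>N. \<forall>j\<ge>N. hs_norm H (s i - s j) < \<epsilon>"
proof -
  from assms(4,5) have "\<forall>\<^sub>F n in sequentially. hs_norm H (s n - x) < \<epsilon> / 2"
    unfolding hs_lim_def by (intro order_tendstoD) auto
  then obtain N where N: "\<And>n. n \<ge> N \<Longrightarrow> hs_norm H (s n - x) < \<epsilon> / 2"
    by (auto simp: eventually_sequentially)
  have "hs_norm H (s i - s j) < \<epsilon>" if "i \<ge> N" "j \<ge> N" for i j
    using hs_norm_triangle_diff[of H "s i - x" "s j - x"] N[OF that(1)] N[OF that(2)] assms by simp
  then show ?thesis by blast
qed

section \<open>Closures and closed subspaces\<close>

lemma hs_closure_subset: "hs_closure H V \<subseteq> hs_carrier H"
  by (auto simp: hs_closure_def)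

lemma hs_closure_incl: "hilbert_space H \<Longrightarrow> V \<subseteq> hs_carrier H \<Longrightarrow> V \<subseteq> hs_closure H V"
  by (force simp: hs_closure_def intro: hs_lim_const)

lemma hs_closure_linear:
  assumes H: "hilbert_space H" and V: "V \<subseteq> hs_carrier H" "linear_subset V"
  shows "linear_subset (hs_closure H V)"
  unfolding linear_subset_def
proof (intro conjI ballI allI)
  show "0 \<in> hs_closure H V"
    using hs_closure_incl[OF H V(1)] linear_subset_zero[OF V(2)] by auto
next
  fix x y assume "x \<in> hs_closure H V" "y \<in> hs_closure H V"
  then obtain s t where st: "x \<in> hs_carrier H" "y \<in> hs_carrier H"
    "\<And>n. s n \<in> V" "\<And>n. t n \<in> V" "hs_lim H s x" "hs_lim H t y"
    by (auto simp: hs_closure_def)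
  then have "hs_lim H (\<lambda>n. s n + t n) (x + y)" using V by (intro hs_lim_add[OF H]) auto
  with st V show "x + y \<in> hs_closure H V"
    using H by (auto simp: hs_closure_def intro!: exI[of _ "\<lambda>n. s n + t n"] linear_subset_add)
next
  fix c x assume "x \<in> hs_closure H V"
  then obtain s where st: "x \<in> hs_carrier H" "\<And>n. s n \<in> V" "hs_lim H s x"
    by (auto simp: hs_closure_def)
  then have "hs_lim H (\<lambda>n. c *\<^sub>C s n) (c *\<^sub>C x)" using V by (intro hs_lim_scale[OF H]) auto
  with st V show "c *\<^sub>C x \<in> hs_closure H V"
    using H by (auto simp: hs_closure_def intro!: exI[of _ "\<lambda>n. c *\<^sub>C s n"] linear_subset_scale)
qed

lemma hs_closure_closed:
  assumes H: "hilbert_space H" and V: "V \<subseteq> hs_carrier H"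
  shows "hs_closure H (hs_closure H V) \<subseteq> hs_closure H V"
proof
  fix x assume "x \<in> hs_closure H (hs_closure H V)"
  then obtain s where x: "x \<in> hs_carrier H" and s: "\<And>n. s n \<in> hs_closure H V" and lim: "hs_lim H s x"
    by (auto simp: hs_closure_def)
  \<comment> \<open>A diagonal choice: \<open>v n\<close> from V within 1/(n + 1) of
    \<open>s n\<close>, so that both sequences have the same limit.\<close>
  have "\<exists>v\<in>V. hs_norm H (v - s n) < 1 / (real n + 1)" for n
  proof -
    from s[of n] obtain t where t: "\<And>k. t k \<in> V" "hs_lim H t (s n)" by (auto simp: hs_closure_def)
    then have "\<forall>\<^sub>F k in sequentially. hs_norm H (t k - s n) < 1 / (real n + 1)"
      unfolding hs_lim_def by (intro order_tendstoD) auto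
    then obtain k where "hs_norm H (t k - s n) < 1 / (real n + 1)"
      by (meson eventually_sequentially order_refl)
    then show ?thesis using t by blast
  qed
  then obtain v where v: "\<And>n. v n \<in> V" "\<And>n. hs_norm H (v n - s n) < 1 / (real n + 1)" by metis
  have sc: "s n \<in> hs_carrier H" "v n \<in> hs_carrier H" for n
    using s hs_closure_subset v(1) V by (blast, blast)
  have "hs_lim H v x"
    unfolding hs_lim_def
  proof (rule tendsto_sandwich[OF _ _ tendsto_const])
    have "(\<lambda>n. 1 / (real n + 1)) \<longlonglongrightarrow> 0"
      using LIMSEQ_inverse_real_of_nat by (simp add: inverse_eq_divide add.commute)
    then show "(\<lambda>n. 1 / (real n + 1) + hs_norm H (s n - x)) \<longlonglongrightarrow> 0"
      using tendsto_add[OF _ lim[unfolded hs_lim_def]] by fastforce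
    have "hs_norm H (v n - x) \<le> 1 / (real n + 1) + hs_norm H (s n - x)" for n
      using hs_norm_triangle[of H "v n - s n" "s n - x"] v(2)[of n] H sc x by simp
    then show "\<forall>\<^sub>F n in sequentially. hs_norm H (v n - x) \<le> 1 / (real n + 1) + hs_norm H (s n - x)"
      by simp
  qed (use H sc x in auto)
  then show "x \<in> hs_closure H V" using v(1) x by (auto simp: hs_closure_def)
qed

lemma closed_subspace_closure:
  "\<lbrakk>hilbert_space H; V \<subseteq> hs_carrier H; linear_subset V\<rbrakk> \<Longrightarrow> closed_subspace H (hs_closure H V)"
  by (simp add: closed_subspace_def hs_closure_subset hs_closure_linear hs_closure_closed)

lemma closed_subspaceD:
  assumes "closed_subspace H V"
  shows "V \<subseteq> hs_carrier H" "linear_subset V"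
    and "\<And>s x. \<lbrakk>x \<in> hs_carrier H; \<And>n. s n \<in> V; hs_lim H s x\<rbrakk> \<Longrightarrow> x \<in> V"
  using assms by (auto simp: closed_subspace_def hs_closure_def)

lemma hs_sub_simps [simp]:
  "hs_carrier (hs_sub H V) = V" "hs_inner (hs_sub H V) = hs_inner H" "hs_norm (hs_sub H V) = hs_norm H"
  "hs_lim (hs_sub H V) = hs_lim H"
  by (simp_all add: hs_sub_def hs_norm_def hs_lim_def fun_eq_iff)

lemma hilbert_space_sub:
  fixes H :: "'a::complex_vector hspace"
  assumes H: "hilbert_space H" and V: "closed_subspace H V"
  shows "hilbert_space (hs_sub H V)"
  unfolding hilbert_space_def hs_sub_simps
proof (intro conjI ballI allI impI)
  have [simp]: "x \<in> hs_carrier H" if "x \<in> V" for x using that closed_subspaceD(1)[OF V] by auto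
  show "linear_subset V" using closed_subspaceD[OF V] by auto
  show "hs_inner H (x + y) z = hs_inner H x z + hs_inner H y z" if "x \<in> V" "y \<in> V" "z \<in> V" for x y z
    using that H by simp
  show "hs_inner H (c *\<^sub>C x) y = c * hs_inner H x y" if "x \<in> V" "y \<in> V" for c x y
    using that H by simp
  show "hs_inner H y x = cnj (hs_inner H x y)" if "x \<in> V" "y \<in> V" for x y
    using that H by (simp add: hs_inner_cnj)
  show "0 < Re (hs_inner H x x)" if "x \<in> V" "x \<noteq> 0" for x
    using that H by (simp add: hs_inner_self_pos)
next
  fix s :: "nat \<Rightarrow> 'a" assume s: "(\<forall>n. s n \<in> V) \<and> (\<forall>\<epsilon>>0. \<exists>N. \<forall>i\<ge>N. \<forall>j\<ge>N. hs_norm H (s i - s j) < \<epsilon>)"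
  then obtain x where "x \<in> hs_carrier H" "hs_lim H s x"
    using hs_complete[OF H, of s] closed_subspaceD(1)[OF V] by blast
  then show "\<exists>x\<in>V. hs_lim H s x" using closed_subspaceD(3)[OF V] s by blast
qed


section \<open>Riesz representation and orthogonal projections\<close>

text \<open>Minimizing \<open>\<parallel>v\<parallel>\<^sup>2 - 2 Re f(v)\<close> over \<open>V\<close> yields the projection theorem, the Riesz theorem and the
  extension of functionals from dense subspaces at once.\<close>

lemma riesz_on_linear_subset:
  fixes H :: "'a::complex_vector hspace"
  assumes H: "hilbert_space H" and V: "V \<subseteq> hs_carrier H" "linear_subset V"
    and add: "\<And>x y. \<lbrakk>x \<in> V; y \<in> V\<rbrakk> \<Longrightarrow> f (x + y) = f x + f y"
    and scale: "\<And>c x. x \<in> V \<Longrightarrow> f (c *\<^sub>C x) = c * f x"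
    and bound: "\<And>x. x \<in> V \<Longrightarrow> cmod (f x) \<le> C * hs_norm H x"
  obtains y where "y \<in> hs_closure H V" "\<And>x. x \<in> V \<Longrightarrow> f x = hs_inner H x y"
proof -
  have Vc: "x \<in> hs_carrier H" if "x \<in> V" for x using that V by auto
  define J where "J v = (hs_norm H v)\<^sup>2 - 2 * Re (f v)" for v
  \<comment> \<open>Completing the square in the norm of v bounds J below by -C^2, so the infimum is
    finite.\<close>
  have bdd: "- (C\<^sup>2) \<le> J v" if "v \<in> V" for v
  proof -
    have "Re (f v) \<le> C * hs_norm H v"
      using bound[OF that] complex_Re_le_cmod[of "f v"] by linarith
    moreover have "0 \<le> (hs_norm H v - C)\<^sup>2" by simp
    ultimately show ?thesis unfolding J_def power2_diff by (simp add: mult.commute)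
  qed
  define d where "d = Inf (J ` V)"
  have d_le: "d \<le> J v" if "v \<in> V" for v
    unfolding d_def using that bdd by (intro cInf_lower) (auto simp: bdd_below_def)
  have "\<exists>v\<in>V. J v < d + 1 / (real n + 1)" for n
    using cInf_lessD[of "J ` V" "d + 1 / (real n + 1)"] linear_subset_zero[OF V(2)]
    by (auto simp: d_def)
  then obtain v where v: "\<And>n. v n \<in> V" "\<And>n. J (v n) < d + 1 / (real n + 1)" by metis
  have inv0: "(\<lambda>n. 1 / (real n + 1)) \<longlonglongrightarrow> 0"
    using LIMSEQ_inverse_real_of_nat by (simp add: inverse_eq_divide add.commute)
  \<comment> \<open>The parallelogram law, with J taken at the midpoint w: the linear terms cancel,
    so two near-minimizers are close to each other.\<close>
  have par: "(hs_norm H (x - y))\<^sup>2 \<le> 2 * (J x - d) + 2 * (J y - d)" if "x \<in> V" "y \<in> V" for x y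
  proof -
    define w where "w = (1/2) *\<^sub>C (x + y)"
    have w: "w \<in> V" using that V(2) by (simp add: w_def linear_subset_add linear_subset_scale)
    have fw: "f w = (f x + f y) / 2" using that V(2) by (simp add: w_def linear_subset_add add scale)
    have "(hs_norm H w)\<^sup>2 = (hs_norm H (x + y))\<^sup>2 / 4"
      using that Vc H by (simp add: w_def power_divide norm_divide)
    then have "4 * J w = (hs_norm H (x + y))\<^sup>2 - 4 * Re (f x) - 4 * Re (f y)"
      by (simp add: J_def fw field_simps)
    then have "(hs_norm H (x - y))\<^sup>2 = 2 * J x + 2 * J y - 4 * J w"
      using hs_norm_add_sq[OF H Vc Vc, OF that] hs_norm_diff_sq[OF H Vc Vc, OF that]
      by (simp add: J_def)
    then show ?thesis using d_le[OF w] by simp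
  qed
  have "\<exists>N. \<forall>i\<ge>N. \<forall>j\<ge>N. hs_norm H (v i - v j) < \<epsilon>" if "\<epsilon> > 0" for \<epsilon>
  proof -
    have "\<epsilon>\<^sup>2 / 4 > 0" using that by simp
    with inv0 have "\<forall>\<^sub>F n in sequentially. 1 / (real n + 1) < \<epsilon>\<^sup>2 / 4"
      by (rule order_tendstoD)
    then obtain N where N: "\<And>n. n \<ge> N \<Longrightarrow> 1 / (real n + 1) < \<epsilon>\<^sup>2 / 4"
      by (auto simp: eventually_sequentially)
    have J_less: "J (v i) < d + \<epsilon>\<^sup>2 / 4" if "i \<ge> N" for i
      using v(2)[of i] N[OF that] by (meson add_strict_left_mono order.strict_trans)
    have "hs_norm H (v i - v j) < \<epsilon>" if "i \<ge> N" "j \<ge> N" for i j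
    proof (rule power2_less_imp_less)
      show "(hs_norm H (v i - v j))\<^sup>2 < \<epsilon>\<^sup>2"
        using par[OF v(1) v(1), of i j] J_less[OF that(1)] J_less[OF that(2)] by (simp add: field_simps)
    qed (use \<open>\<epsilon> > 0\<close> in auto)
    then show ?thesis by blast
  qed
  then obtain y where y: "y \<in> hs_carrier H" and lim: "hs_lim H v y"
    using hs_complete[OF H, of v] v(1) Vc by metis
  have Re_eq: "Re (hs_inner H y x) = Re (f x)" if x: "x \<in> V" for x
  proof -
    \<comment> \<open>Moving \<open>v n\<close> by t x cannot bring J below d, and J exceeds d at
      \<open>v n\<close> by less than 1/(n + 1). In the limit a quadratic in t without constant term
      is nonnegative, so its linear coefficient is 0.\<close>
    have ineq: "0 \<le> 0 + 2 * t * (Re (hs_inner H y x) - Re (f x)) + t\<^sup>2 * (hs_norm H x)\<^sup>2" for t :: real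
    proof (rule LIMSEQ_le)
      show "(\<lambda>n. 0::real) \<longlonglongrightarrow> 0" by simp
      have "(\<lambda>n. Re (hs_inner H (v n) x)) \<longlonglongrightarrow> Re (hs_inner H y x)"
        using v Vc x y lim H by (intro tendsto_Re hs_lim_inner) auto
      then show "(\<lambda>n. 1 / (real n + 1) + 2 * t * (Re (hs_inner H (v n) x) - Re (f x)) + t\<^sup>2 * (hs_norm H x)\<^sup>2)
         \<longlonglongrightarrow> 0 + 2 * t * (Re (hs_inner H y x) - Re (f x)) + t\<^sup>2 * (hs_norm H x)\<^sup>2"
        using inv0 by (intro tendsto_add tendsto_mult tendsto_diff tendsto_const)
      have "0 \<le> 1 / (real n + 1) + 2 * t * (Re (hs_inner H (v n) x) - Re (f x)) + t\<^sup>2 * (hs_norm H x)\<^sup>2" for n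
      proof -
        have tx: "of_real t *\<^sub>C x \<in> V" using x V(2) by (simp add: linear_subset_scale)
        have "d \<le> J (v n + of_real t *\<^sub>C x)" using v(1) tx V(2) by (intro d_le linear_subset_add)
        also have "\<dots> = J (v n) + 2 * t * (Re (hs_inner H (v n) x) - Re (f x)) + t\<^sup>2 * (hs_norm H x)\<^sup>2"
          using v(1) tx x Vc H
          by (simp add: J_def hs_norm_add_sq add scale power_mult_distrib algebra_simps)
        finally show ?thesis using v(2)[of n] by simp
      qed
      then show "\<exists>N. \<forall>n\<ge>N. 0 \<le> 1 / (real n + 1) + 2 * t * (Re (hs_inner H (v n) x) - Re (f x)) + t\<^sup>2 * (hs_norm H x)\<^sup>2"
        by blast
    qed
    have "(Re (hs_inner H y x) - Re (f x))\<^sup>2 \<le> 0 * (hs_norm H x)\<^sup>2"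
      by (rule quadratic_nonneg_imp[OF ineq]) simp
    then show ?thesis by simp
  qed
  have "f x = hs_inner H x y" if x: "x \<in> V" for x
  proof -
    \<comment> \<open>The real parts determine the imaginary parts through the vector i x.\<close>
    have "Im (f x) = - Re (f (\<i> *\<^sub>C x))" using scale[OF x, of \<i>] by simp
    also have "\<dots> = - Re (hs_inner H y (\<i> *\<^sub>C x))"
      using Re_eq[of "\<i> *\<^sub>C x"] x V(2) by (simp add: linear_subset_scale)
    also have "\<dots> = - Im (hs_inner H y x)" using H y Vc x by simp
    finally show ?thesis
      using Re_eq[OF x] hs_inner_cnj[OF H y Vc[OF x], symmetric] by (simp add: complex_eq_iff)
  qed
  moreover have "y \<in> hs_closure H V" using y lim v(1) by (auto simp: hs_closure_def)
  ultimately show thesis using that by blast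
qed

definition hs_perp :: "'a::complex_vector hspace \<Rightarrow> 'a set \<Rightarrow> 'a set" where
  "hs_perp H V = {x \<in> hs_carrier H. \<forall>v\<in>V. hs_inner H x v = 0}"

lemma closed_subspace_perp:
  assumes H: "hilbert_space H" and V: "V \<subseteq> hs_carrier H"
  shows "closed_subspace H (hs_perp H V)"
  unfolding closed_subspace_def
proof (intro conjI subsetI)
  show "linear_subset (hs_perp H V)"
    using H V by (auto simp: linear_subset_def hs_perp_def subset_eq)
  fix x assume "x \<in> hs_closure H (hs_perp H V)"
  then obtain s where s: "x \<in> hs_carrier H" "\<And>n. s n \<in> hs_carrier H" "hs_lim H s x"
      and 0: "\<And>n v. v \<in> V \<Longrightarrow> hs_inner H (s n) v = 0"
    by (auto simp: hs_closure_def hs_perp_def)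
  have "hs_inner H x v = 0" if "v \<in> V" for v
  proof -
    have "(\<lambda>n. hs_inner H (s n) v) \<longlonglongrightarrow> hs_inner H x v"
      using s V that by (intro hs_lim_inner[OF H]) auto
    then show ?thesis using 0[OF that] LIMSEQ_unique[OF _ tendsto_const] by force
  qed
  then show "x \<in> hs_perp H V" using s by (simp add: hs_perp_def)
qed (auto simp: hs_perp_def)

text \<open>The difference of two candidates lies in V and is orthogonal to V, hence to
  itself.\<close>

lemma hs_proj_unique:
  assumes H: "hilbert_space H" and V: "V \<subseteq> hs_carrier H" "linear_subset V" and x: "x \<in> hs_carrier H"
    and y: "y \<in> V" "\<And>v. v \<in> V \<Longrightarrow> hs_inner H (x - y) v = 0"
  shows "hs_proj H V x = y"
  unfolding hs_proj_def
proof (rule the_equality)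
  fix g assume g: "g \<in> V \<and> (\<forall>v\<in>V. hs_inner H (x - g) v = 0)"
  have gy: "g - y \<in> V" using g y V by (auto intro: linear_subset_diff)
  have "hs_inner H (g - y) (g - y) = hs_inner H (x - y) (g - y) - hs_inner H (x - g) (g - y)"
  proof -
    have "g \<in> hs_carrier H" "y \<in> hs_carrier H" using g y V by auto
    then show ?thesis using H x by simp
  qed
  also have "\<dots> = 0" using g y gy by simp
  finally show "g = y" using hs_inner_self_pos[OF H, of "g - y"] gy V by fastforce
qed (use y in auto)

text \<open>The projection of x is the Riesz vector of the functional v \<mapsto> <v, x> on V. The
  Riesz theorem puts it in the closure of V, which is V.\<close>

lemma hs_proj:
  assumes H: "hilbert_space H" and V: "closed_subspace H V" and x: "x \<in> hs_carrier H"
  shows "hs_proj H V x \<in> V" "x - hs_proj H V x \<in> hs_perp H V"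
    and "v \<in> V \<Longrightarrow> hs_inner H (x - hs_proj H V x) v = 0"
    and "v \<in> V \<Longrightarrow> hs_inner H v (x - hs_proj H V x) = 0"
proof -
  note V' = closed_subspaceD[OF V]
  have Vc: "v \<in> hs_carrier H" if "v \<in> V" for v using that V' by auto
  obtain y where y: "y \<in> hs_closure H V" "\<And>v. v \<in> V \<Longrightarrow> hs_inner H v x = hs_inner H v y"
  proof (rule riesz_on_linear_subset[OF H V'(1,2), where f = "\<lambda>v. hs_inner H v x" and C = "hs_norm H x"])
    show "cmod (hs_inner H v x) \<le> hs_norm H x * hs_norm H v" if "v \<in> V" for v
      using hs_Cauchy_Schwarz[OF H Vc[OF that] x] by (simp add: mult.commute)
  qed (use H x Vc in auto)
  have yV: "y \<in> V" using y V by (auto simp: closed_subspace_def)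
  have orth: "hs_inner H (x - y) v = 0" if "v \<in> V" for v
    using hs_inner_cnj[OF H Vc[OF that] x] hs_inner_cnj[OF H Vc[OF that] Vc[OF yV]] y(2)[OF that]
      H x Vc[OF yV] Vc[OF that] by simp
  have eq: "hs_proj H V x = y" by (rule hs_proj_unique[OF H V'(1,2) x yV orth])
  show "hs_proj H V x \<in> V" "x - hs_proj H V x \<in> hs_perp H V"
    using yV orth x Vc H by (auto simp: eq hs_perp_def)
  show "hs_inner H (x - hs_proj H V x) v = 0" if "v \<in> V" using orth[OF that] eq by simp
  then show "hs_inner H v (x - hs_proj H V x) = 0" if "v \<in> V"
    using that hs_inner_cnj[OF H, of "x - hs_proj H V x" v] H x Vc yV eq by simp
qed

text \<open>Subtracting from x its projection onto the closure leaves a vector orthogonal to V,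
  which totality forces to be 0.\<close>

lemma hs_closure_eq_carrier:
  assumes H: "hilbert_space H" and V: "V \<subseteq> hs_carrier H" "linear_subset V"
    and total: "\<And>x. \<lbrakk>x \<in> hs_carrier H; \<And>v. v \<in> V \<Longrightarrow> hs_inner H x v = 0\<rbrakk> \<Longrightarrow> x = 0"
  shows "hs_closure H V = hs_carrier H"
proof
  show "hs_carrier H \<subseteq> hs_closure H V"
  proof
    fix x assume x: "x \<in> hs_carrier H"
    note cl = closed_subspace_closure[OF H V]
    note p = hs_proj[OF H cl x]
    have "x - hs_proj H (hs_closure H V) x = 0"
      using p(3) hs_closure_incl[OF H V(1)] p(2) by (intro total) (auto simp: hs_perp_def)
    then show "x \<in> hs_closure H V" using p(1) by simp
  qed
qed (rule hs_closure_subset)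

lemma hs_perp_perp:
  assumes H: "hilbert_space H" and V: "closed_subspace H V"
    and x: "x \<in> hs_carrier H" "\<And>v. v \<in> hs_perp H V \<Longrightarrow> hs_inner H x v = 0"
  shows "x \<in> V"
proof -
  note p = hs_proj[OF H V x(1)]
  have c: "hs_proj H V x \<in> hs_carrier H" using p(1) closed_subspaceD(1)[OF V] by auto
  have "hs_inner H (x - hs_proj H V x) (x - hs_proj H V x) = 0"
    using p(4)[OF p(1)] x(2)[OF p(2)] x(1) c H by simp
  then have "x - hs_proj H V x = 0"
    using hs_inner_self_pos[OF H, of "x - hs_proj H V x"] x(1) c H by fastforce
  then show ?thesis using p(1) by simp
qed


section \<open>Bounded operators\<close>

lemma bounded_ops_mem: "A \<in> bounded_ops H K \<Longrightarrow> x \<in> hs_carrier H \<Longrightarrow> A x \<in> hs_carrier K"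
  and bounded_ops_add: "A \<in> bounded_ops H K \<Longrightarrow> x \<in> hs_carrier H \<Longrightarrow> y \<in> hs_carrier H \<Longrightarrow> A (x + y) = A x + A y"
  and bounded_ops_scale: "A \<in> bounded_ops H K \<Longrightarrow> x \<in> hs_carrier H \<Longrightarrow> A (c *\<^sub>C x) = c *\<^sub>C A x"
  by (auto simp: bounded_ops_def)

lemma bounded_opsI:
  assumes "\<And>x. x \<in> hs_carrier H \<Longrightarrow> A x \<in> hs_carrier K"
    and "\<And>x y. x \<in> hs_carrier H \<Longrightarrow> y \<in> hs_carrier H \<Longrightarrow> A (x + y) = A x + A y"
    and "\<And>c x. x \<in> hs_carrier H \<Longrightarrow> A (c *\<^sub>C x) = c *\<^sub>C A x"
    and "\<And>x. x \<in> hs_carrier H \<Longrightarrow> hs_norm K (A x) \<le> C * hs_norm H x"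
  shows "A \<in> bounded_ops H K"
  unfolding bounded_ops_def using assms by blast

lemma bounded_ops_bound:
  assumes "A \<in> bounded_ops H K" "hilbert_space H"
  obtains C where "C \<ge> 0" "\<And>x. x \<in> hs_carrier H \<Longrightarrow> hs_norm K (A x) \<le> C * hs_norm H x"
proof -
  obtain C where C: "\<And>x. x \<in> hs_carrier H \<Longrightarrow> hs_norm K (A x) \<le> C * hs_norm H x"
    using assms(1) unfolding bounded_ops_def by blast
  show thesis
  proof (rule that[of "max C 0"])
    fix x assume x: "x \<in> hs_carrier H"
    have "C * hs_norm H x \<le> max C 0 * hs_norm H x"
      using assms x by (intro mult_right_mono) auto
    with C[OF x] show "hs_norm K (A x) \<le> max C 0 * hs_norm H x" by linarith
  qed auto
qed

lemma bounded_ops_zero: "A \<in> bounded_ops H K \<Longrightarrow> hilbert_space H \<Longrightarrow> A 0 = 0"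
  using bounded_ops_scale[of A H K 0 0] by simp

lemma bounded_ops_minus: "A \<in> bounded_ops H K \<Longrightarrow> x \<in> hs_carrier H \<Longrightarrow> A (- x) = - A x"
  using bounded_ops_scale[of A H K x "-1"] by simp

lemma bounded_ops_diff:
  "A \<in> bounded_ops H K \<Longrightarrow> hilbert_space H \<Longrightarrow> x \<in> hs_carrier H \<Longrightarrow> y \<in> hs_carrier H \<Longrightarrow> A (x - y) = A x - A y"
  using bounded_ops_add[of A H K x "- y"] by (simp add: bounded_ops_minus)

lemma bounded_ops_sum:
  assumes "A \<in> bounded_ops H K" "hilbert_space H" "\<And>i. i \<in> I \<Longrightarrow> f i \<in> hs_carrier H"
  shows "A (sum f I) = (\<Sum>i\<in>I. A (f i))"
  using assms(3)
  by (induction I rule: infinite_finite_induct)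
    (use assms(1,2) in \<open>auto simp: bounded_ops_zero bounded_ops_add\<close>)

lemma bounded_ops_compose:
  assumes "B \<in> bounded_ops K L" "A \<in> bounded_ops H K" "hilbert_space H" "hilbert_space K"
  shows "(\<lambda>x. B (A x)) \<in> bounded_ops H L"
proof -
  obtain C where C: "C \<ge> 0" "\<And>x. x \<in> hs_carrier H \<Longrightarrow> hs_norm K (A x) \<le> C * hs_norm H x"
    using bounded_ops_bound[OF assms(2,3)] by blast
  obtain D where D: "D \<ge> 0" "\<And>x. x \<in> hs_carrier K \<Longrightarrow> hs_norm L (B x) \<le> D * hs_norm K x"
    using bounded_ops_bound[OF assms(1,4)] by blast
  show ?thesis
  proof (rule bounded_opsI[where C = "D * C"])
    fix x assume x: "x \<in> hs_carrier H"
    have "hs_norm L (B (A x)) \<le> D * hs_norm K (A x)" using D assms x by (simp add: bounded_ops_mem)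
    also have "\<dots> \<le> D * (C * hs_norm H x)" using C x D by (intro mult_left_mono) auto
    finally show "hs_norm L (B (A x)) \<le> D * C * hs_norm H x" by (simp add: mult.assoc)
  qed (use assms in \<open>simp_all add: bounded_ops_mem bounded_ops_add bounded_ops_scale\<close>)
qed

lemma bounded_ops_ident: "(\<lambda>x. x) \<in> bounded_ops H H"
  by (rule bounded_opsI[where C = 1]) auto

lemma bounded_ops_const_zero: "hilbert_space K \<Longrightarrow> (\<lambda>x. 0) \<in> bounded_ops H K"
  by (rule bounded_opsI[where C = 0]) auto

lemma bounded_ops_plus:
  assumes "A \<in> bounded_ops H K" "B \<in> bounded_ops H K" "hilbert_space H" "hilbert_space K"
  shows "(\<lambda>x. A x + B x) \<in> bounded_ops H K"
proof -
  obtain C where C: "C \<ge> 0" "\<And>x. x \<in> hs_carrier H \<Longrightarrow> hs_norm K (A x) \<le> C * hs_norm H x"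
    using bounded_ops_bound[OF assms(1,3)] by blast
  obtain D where D: "D \<ge> 0" "\<And>x. x \<in> hs_carrier H \<Longrightarrow> hs_norm K (B x) \<le> D * hs_norm H x"
    using bounded_ops_bound[OF assms(2,3)] by blast
  show ?thesis
  proof (rule bounded_opsI[where C = "C + D"])
    fix x assume x: "x \<in> hs_carrier H"
    show "hs_norm K (A x + B x) \<le> (C + D) * hs_norm H x"
      using hs_norm_triangle[OF assms(4), of "A x" "B x"] C(2)[OF x] D(2)[OF x] x assms
      by (simp add: bounded_ops_mem distrib_right)
  qed (use assms in \<open>simp_all add: bounded_ops_mem bounded_ops_add bounded_ops_scale scaleC_add_right\<close>)
qed

lemma bounded_ops_scaleC:
  assumes "A \<in> bounded_ops H K" "hilbert_space H" "hilbert_space K"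
  shows "(\<lambda>x. c *\<^sub>C A x) \<in> bounded_ops H K"
proof -
  obtain C where C: "C \<ge> 0" "\<And>x. x \<in> hs_carrier H \<Longrightarrow> hs_norm K (A x) \<le> C * hs_norm H x"
    using bounded_ops_bound[OF assms(1,2)] by blast
  show ?thesis
  proof (rule bounded_opsI[where C = "cmod c * C"])
    fix x assume x: "x \<in> hs_carrier H"
    show "hs_norm K (c *\<^sub>C A x) \<le> cmod c * C * hs_norm H x"
      using C(2)[OF x] x assms by (simp add: bounded_ops_mem mult.assoc mult_left_mono)
  qed (use assms in \<open>simp_all add: bounded_ops_mem bounded_ops_add bounded_ops_scale scaleC_add_right
      scaleC_scaleC mult.commute\<close>)
qed

lemma bounded_ops_diff_op:
  assumes "A \<in> bounded_ops H K" "B \<in> bounded_ops H K" "hilbert_space H" "hilbert_space K"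
  shows "(\<lambda>x. A x - B x) \<in> bounded_ops H K"
  using bounded_ops_plus[OF assms(1) bounded_ops_scaleC[OF assms(2-4), of "-1"] assms(3,4)] by simp

lemma bounded_ops_sum_op:
  assumes "\<And>i. i \<in> I \<Longrightarrow> A i \<in> bounded_ops H K" "hilbert_space H" "hilbert_space K"
  shows "(\<lambda>x. \<Sum>i\<in>I. A i x) \<in> bounded_ops H K"
  using assms(1)
  by (induction I rule: infinite_finite_induct)
    (use assms(2,3) in \<open>auto intro!: bounded_ops_plus bounded_ops_const_zero\<close>)

lemma bounded_ops_cong:
  assumes "A \<in> bounded_ops H K" "\<And>x. x \<in> hs_carrier H \<Longrightarrow> B x = A x" "hilbert_space H"
  shows "B \<in> bounded_ops H K"
  using assms by (auto simp: bounded_ops_def)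

lemma bounded_ops_sub_dom: "A \<in> bounded_ops H K \<Longrightarrow> V \<subseteq> hs_carrier H \<Longrightarrow> A \<in> bounded_ops (hs_sub H V) K"
  unfolding bounded_ops_def hs_sub_simps by blast

lemma bounded_ops_sub_ran:
  "A \<in> bounded_ops H K \<Longrightarrow> (\<And>x. x \<in> hs_carrier H \<Longrightarrow> A x \<in> V) \<Longrightarrow> A \<in> bounded_ops H (hs_sub K V)"
  unfolding bounded_ops_def hs_sub_simps by blast

lemma bounded_ops_sub_incl: "A \<in> bounded_ops H (hs_sub K V) \<Longrightarrow> V \<subseteq> hs_carrier K \<Longrightarrow> A \<in> bounded_ops H K"
  unfolding bounded_ops_def hs_sub_simps by blast

lemma hs_lim_bounded_ops:
  assumes A: "A \<in> bounded_ops H K" and H: "hilbert_space H" "hilbert_space K"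
    and s: "\<And>n. s n \<in> hs_carrier H" "x \<in> hs_carrier H" "hs_lim H s x"
  shows "hs_lim K (\<lambda>n. A (s n)) (A x)"
  unfolding hs_lim_def
proof -
  obtain C where C: "\<And>x. x \<in> hs_carrier H \<Longrightarrow> hs_norm K (A x) \<le> C * hs_norm H x"
    using bounded_ops_bound[OF A H(1)] by blast
  show "(\<lambda>n. hs_norm K (A (s n) - A x)) \<longlonglongrightarrow> 0"
  proof (rule tendsto_sandwich[OF _ _ tendsto_const])
    show "(\<lambda>n. C * hs_norm H (s n - x)) \<longlonglongrightarrow> 0"
      using tendsto_mult_left[OF s(3)[unfolded hs_lim_def], of C] by simp
    have "hs_norm K (A (s n) - A x) \<le> C * hs_norm H (s n - x)" for n
      using C[of "s n - x"] s H A by (simp add: bounded_ops_diff)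
    then show "\<forall>\<^sub>F n in sequentially. hs_norm K (A (s n) - A x) \<le> C * hs_norm H (s n - x)" by simp
  qed (use H A s in \<open>auto simp: bounded_ops_mem\<close>)
qed

lemma bounded_ops_image_linear:
  assumes "A \<in> bounded_ops H K" "hilbert_space H" "linear_subset V" "V \<subseteq> hs_carrier H"
  shows "linear_subset (A ` V)"
proof -
  have "A 0 \<in> A ` V" using assms by (auto intro: linear_subset_zero)
  moreover have "A x + A y \<in> A ` V" if "x \<in> V" "y \<in> V" for x y
  proof -
    have "A x + A y = A (x + y)" by (rule bounded_ops_add[OF assms(1), symmetric]) (use that assms(4) in auto)
    then show ?thesis using that assms(3) by (simp add: linear_subset_add)
  qed
  moreover have "c *\<^sub>C A x \<in> A ` V" if "x \<in> V" for x c
  proof -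
    have "c *\<^sub>C A x = A (c *\<^sub>C x)" by (rule bounded_ops_scale[OF assms(1), symmetric]) (use that assms(4) in auto)
    then show ?thesis using that assms(3) by (simp add: linear_subset_scale)
  qed
  ultimately show ?thesis using assms by (auto simp: linear_subset_def bounded_ops_zero)
qed


section \<open>Adjoints\<close>

text \<open>Riesz in the first variable for each fixed second one; inserting x = A y gives the norm
  bound. Adjoints and square roots are both obtained from their forms in this way.\<close>

lemma operator_of_form:
  assumes H: "hilbert_space H" and K: "hilbert_space K"
    and addl: "\<And>x x' y. \<lbrakk>x \<in> hs_carrier H; x' \<in> hs_carrier H; y \<in> hs_carrier K\<rbrakk> \<Longrightarrow> g (x + x') y = g x y + g x' y"
    and scalel: "\<And>c x y. \<lbrakk>x \<in> hs_carrier H; y \<in> hs_carrier K\<rbrakk> \<Longrightarrow> g (c *\<^sub>C x) y = c * g x y"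
    and addr: "\<And>x y y'. \<lbrakk>x \<in> hs_carrier H; y \<in> hs_carrier K; y' \<in> hs_carrier K\<rbrakk> \<Longrightarrow> g x (y + y') = g x y + g x y'"
    and scaler: "\<And>c x y. \<lbrakk>x \<in> hs_carrier H; y \<in> hs_carrier K\<rbrakk> \<Longrightarrow> g x (c *\<^sub>C y) = cnj c * g x y"
    and C: "C \<ge> 0"
    and bound: "\<And>x y. \<lbrakk>x \<in> hs_carrier H; y \<in> hs_carrier K\<rbrakk> \<Longrightarrow> cmod (g x y) \<le> C * hs_norm H x * hs_norm K y"
  obtains A where "A \<in> bounded_ops K H"
    "\<And>x y. \<lbrakk>x \<in> hs_carrier H; y \<in> hs_carrier K\<rbrakk> \<Longrightarrow> g x y = hs_inner H x (A y)"
    "\<And>y. y \<in> hs_carrier K \<Longrightarrow> hs_norm H (A y) \<le> C * hs_norm K y"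
proof -
  have "\<exists>a \<in> hs_carrier H. \<forall>x \<in> hs_carrier H. g x y = hs_inner H x a" if y: "y \<in> hs_carrier K" for y
  proof (rule riesz_on_linear_subset[OF H order_refl hs_carrier_linear[OF H], where f = "\<lambda>x. g x y" and C = "C * hs_norm K y"])
    show "cmod (g x y) \<le> C * hs_norm K y * hs_norm H x" if "x \<in> hs_carrier H" for x
      using bound[OF that y] by (simp add: mult_ac)
  next
    fix a assume "a \<in> hs_closure H (hs_carrier H)" "\<And>x. x \<in> hs_carrier H \<Longrightarrow> g x y = hs_inner H x a"
    then show ?thesis using hs_closure_subset by blast
  qed (simp_all add: addl scalel y)
  then obtain A where A: "\<And>y. y \<in> hs_carrier K \<Longrightarrow> A y \<in> hs_carrier H"
    "\<And>x y. \<lbrakk>x \<in> hs_carrier H; y \<in> hs_carrier K\<rbrakk> \<Longrightarrow> g x y = hs_inner H x (A y)" by metis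
  have An: "hs_norm H (A y) \<le> C * hs_norm K y" if y: "y \<in> hs_carrier K" for y
  proof (cases "A y = 0")
    case False
    have "(hs_norm H (A y))\<^sup>2 = Re (g (A y) y)" using A y H by (simp add: hs_norm_sq)
    also have "\<dots> \<le> hs_norm H (A y) * (C * hs_norm K y)"
      using bound[of "A y" y] A y complex_Re_le_cmod[of "g (A y) y"] by (simp add: mult_ac)
    finally have "hs_norm H (A y) * hs_norm H (A y) \<le> hs_norm H (A y) * (C * hs_norm K y)"
      by (simp add: power2_eq_square)
    moreover have "hs_norm H (A y) > 0"
      using False A(1)[OF y] H hs_norm_eq_0[of H "A y"] hs_norm_nonneg[of H "A y"] by linarith
    ultimately show ?thesis by (simp add: mult_le_cancel_left_pos)
  qed (use H K C y in simp)
  have "A \<in> bounded_ops K H"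
  proof (rule bounded_opsI[OF A(1) _ _ An])
    show "A (x + y) = A x + A y" if "x \<in> hs_carrier K" "y \<in> hs_carrier K" for x y
      by (rule hs_eq_if_inner_eq[OF H]) (use that A(1) H K in \<open>simp_all add: A(2)[symmetric] addr\<close>)
    show "A (c *\<^sub>C x) = c *\<^sub>C A x" if "x \<in> hs_carrier K" for c x
      by (rule hs_eq_if_inner_eq[OF H]) (use that A(1) H K in \<open>simp_all add: A(2)[symmetric] scaler\<close>)
  qed auto
  with A(2) An that show thesis by blast
qed

lemma hs_adj_eqI:
  assumes "hilbert_space H" "x \<in> hs_carrier H"
    and "\<And>h. h \<in> hs_carrier H \<Longrightarrow> hs_inner K (A h) y = hs_inner H h x"
  shows "hs_adj H K A y = x"
  unfolding hs_adj_def
proof (rule the_equality)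
  fix x' assume x': "x' \<in> hs_carrier H \<and> (\<forall>h\<in>hs_carrier H. hs_inner K (A h) y = hs_inner H h x')"
  show "x' = x" by (rule hs_eq_if_inner_eq[of H]) (use x' assms in auto)
qed (use assms in auto)

lemma hs_adj_ex:
  assumes H: "hilbert_space H" and K: "hilbert_space K" and A: "A \<in> bounded_ops H K"
  obtains B where "B \<in> bounded_ops K H" "\<And>y. y \<in> hs_carrier K \<Longrightarrow> hs_adj H K A y = B y"
    "\<And>x y. \<lbrakk>x \<in> hs_carrier H; y \<in> hs_carrier K\<rbrakk> \<Longrightarrow> hs_inner K (A x) y = hs_inner H x (B y)"
proof -
  obtain C where C: "C \<ge> 0" "\<And>x. x \<in> hs_carrier H \<Longrightarrow> hs_norm K (A x) \<le> C * hs_norm H x"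
    using bounded_ops_bound[OF A H] by blast
  obtain B where B: "B \<in> bounded_ops K H"
    "\<And>x y. \<lbrakk>x \<in> hs_carrier H; y \<in> hs_carrier K\<rbrakk> \<Longrightarrow> hs_inner K (A x) y = hs_inner H x (B y)"
  proof (rule operator_of_form[OF H K, where C = C and g = "\<lambda>x y. hs_inner K (A x) y"])
    fix x y assume xy: "x \<in> hs_carrier H" "y \<in> hs_carrier K"
    have "cmod (hs_inner K (A x) y) \<le> hs_norm K (A x) * hs_norm K y"
      using A xy K by (intro hs_Cauchy_Schwarz) (auto simp: bounded_ops_mem)
    also have "\<dots> \<le> C * hs_norm H x * hs_norm K y"
      using C(2)[OF xy(1)] K xy by (intro mult_right_mono) auto
    finally show "cmod (hs_inner K (A x) y) \<le> C * hs_norm H x * hs_norm K y" .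
  qed (use A H K C in \<open>simp_all add: bounded_ops_mem bounded_ops_add bounded_ops_scale\<close>)
  moreover have "hs_adj H K A y = B y" if "y \<in> hs_carrier K" for y
    using that B H by (intro hs_adj_eqI) (auto simp: bounded_ops_mem)
  ultimately show thesis using that by blast
qed

lemma hs_adj_bounded:
  assumes "hilbert_space H" "hilbert_space K" "A \<in> bounded_ops H K"
  shows "hs_adj H K A \<in> bounded_ops K H"
  using hs_adj_ex[OF assms] bounded_ops_cong assms(2) by metis

lemma hs_adj_mem:
  assumes "hilbert_space H" "hilbert_space K" "A \<in> bounded_ops H K" "y \<in> hs_carrier K"
  shows "hs_adj H K A y \<in> hs_carrier H"
  using hs_adj_bounded[OF assms(1-3)] assms(4) by (rule bounded_ops_mem)

lemma hs_adj_inner: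
  assumes "hilbert_space H" "hilbert_space K" "A \<in> bounded_ops H K" "x \<in> hs_carrier H" "y \<in> hs_carrier K"
  shows "hs_inner H x (hs_adj H K A y) = hs_inner K (A x) y"
  using hs_adj_ex[OF assms(1-3)] assms(4,5) by metis

lemma hs_adj_inner':
  assumes "hilbert_space H" "hilbert_space K" "A \<in> bounded_ops H K" "x \<in> hs_carrier H" "y \<in> hs_carrier K"
  shows "hs_inner H (hs_adj H K A y) x = hs_inner K y (A x)"
  using arg_cong[OF hs_adj_inner[OF assms], of cnj] assms
  by (simp add: hs_inner_cnj hs_adj_mem bounded_ops_mem)

lemma hs_adj_norm_le:
  assumes H: "hilbert_space H" and K: "hilbert_space K" and A: "A \<in> bounded_ops H K"
    and C: "C \<ge> 0" "\<And>x. x \<in> hs_carrier H \<Longrightarrow> hs_norm K (A x) \<le> C * hs_norm H x"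
    and y: "y \<in> hs_carrier K"
  shows "hs_norm H (hs_adj H K A y) \<le> C * hs_norm K y"
proof -
  define u where "u = hs_adj H K A y"
  have u: "u \<in> hs_carrier H" using H K A y by (simp add: u_def hs_adj_mem)
  have "(hs_norm H u)\<^sup>2 = Re (hs_inner K (A u) y)"
    using u H K A y hs_adj_inner[OF H K A u y] by (simp add: hs_norm_sq u_def)
  also have "\<dots> \<le> hs_norm K (A u) * hs_norm K y"
    using hs_Cauchy_Schwarz[OF K, of "A u" y] complex_Re_le_cmod[of "hs_inner K (A u) y"] A u y
    by (simp add: bounded_ops_mem)
  also have "\<dots> \<le> C * hs_norm H u * hs_norm K y"
    using C(2)[OF u] K y by (intro mult_right_mono) auto
  finally have *: "hs_norm H u * hs_norm H u \<le> hs_norm H u * (C * hs_norm K y)"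
    by (simp add: power2_eq_square mult_ac)
  show ?thesis
  proof (cases "u = 0")
    case False
    then have "hs_norm H u > 0"
      using u H hs_norm_eq_0[of H u] hs_norm_nonneg[of H u] by linarith
    then show ?thesis using * by (simp add: mult_le_cancel_left_pos u_def)
  qed (use H K C y in \<open>simp add: u_def\<close>)
qed

lemma contraction_adj:
  assumes "hilbert_space H" "hilbert_space K" "contraction_op H K A" "y \<in> hs_carrier K"
  shows "hs_norm H (hs_adj H K A y) \<le> hs_norm K y"
  using hs_adj_norm_le[of H K A 1 y] assms by (auto simp: contraction_op_def)

text \<open>Reduces the vanishing of A at a vector to a statement about the range of its adjoint,
  which can be tested on a total family such as the kernel functions.\<close>

lemma hs_adj_eq_zero_imp:
  assumes H: "hilbert_space H" and K: "hilbert_space K" and A: "A \<in> bounded_ops H K"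
    and x: "x \<in> hs_carrier H" and orth: "\<And>y. y \<in> hs_carrier K \<Longrightarrow> hs_inner H x (hs_adj H K A y) = 0"
  shows "A x = 0"
proof -
  have "hs_inner K (A x) (A x) = 0"
    using orth[of "A x"] hs_adj_inner[OF H K A x, of "A x"] A x by (simp add: bounded_ops_mem)
  then show ?thesis using hs_inner_self_pos[OF K, of "A x"] A x by (fastforce simp: bounded_ops_mem)
qed

text \<open>Surjectivity of \<open>I - T\<close> is the Riesz theorem on the range of \<open>I - T\<^sup>*\<close>, which is bounded below.\<close>

lemma strict_contraction_fixpoint:
  assumes H: "hilbert_space H" and T: "T \<in> bounded_ops H H"
    and q: "0 \<le> q" "q < 1" "\<And>x. x \<in> hs_carrier H \<Longrightarrow> hs_norm H (T x) \<le> q * hs_norm H x"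
    and y: "y \<in> hs_carrier H"
  obtains x where "x \<in> hs_carrier H" "x - T x = y"
proof -
  define S where "S = hs_adj H H T"
  have S: "S \<in> bounded_ops H H" and Sn: "\<And>x. x \<in> hs_carrier H \<Longrightarrow> hs_norm H (S x) \<le> q * hs_norm H x"
    using hs_adj_bounded[OF H H T] hs_adj_norm_le[OF H H T q(1,3)] by (auto simp: S_def)
  define V where "V = (\<lambda>x. x - S x) ` hs_carrier H"
  have IS: "(\<lambda>x. x - S x) \<in> bounded_ops H H"
    using bounded_ops_diff_op[OF bounded_ops_ident S H H] .
  have V: "V \<subseteq> hs_carrier H" "linear_subset V"
    using bounded_ops_mem[OF IS] bounded_ops_image_linear[OF IS H hs_carrier_linear[OF H]] by (auto simp: V_def)
  have below: "(1 - q) * hs_norm H x \<le> hs_norm H (x - S x)" if "x \<in> hs_carrier H" for x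
    using hs_norm_triangle_sub[OF H that bounded_ops_mem[OF S that]] Sn[OF that] by (simp add: left_diff_distrib)
  have inj: "x = x'" if x: "x \<in> hs_carrier H" "x' \<in> hs_carrier H" and eq: "x - S x = x' - S x'" for x x'
  proof -
    have "(1 - q) * hs_norm H (x - x') \<le> hs_norm H ((x - x') - S (x - x'))"
      by (rule below) (use x H in auto)
    also have "(x - x') - S (x - x') = (x - S x) - (x' - S x')"
      using x H S by (simp add: bounded_ops_diff)
    also have "\<dots> = 0" using eq by simp
    finally have "hs_norm H (x - x') \<le> 0" using q H by (simp add: mult_le_0_iff)
    then have "hs_norm H (x - x') = 0" using x H by (intro antisym) auto
    then show ?thesis using x H by simp
  qed
  \<comment> \<open>\<open>pre\<close> inverts I - S on its range. Injectivity makes it linear, and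
    the lower estimate bounds it by 1/(1 - q).\<close>
  define pre where "pre v = (SOME x. x \<in> hs_carrier H \<and> x - S x = v)" for v
  have pre: "pre v \<in> hs_carrier H" "pre v - S (pre v) = v" if "v \<in> V" for v
    using someI_ex[of "\<lambda>x. x \<in> hs_carrier H \<and> x - S x = v"] that by (auto simp: pre_def V_def)
  \<comment> \<open>As S is the adjoint of T, the vector that represents v \<mapsto> <pre v, y> has
    to solve u - T u = y.\<close>
  obtain u where u: "u \<in> hs_closure H V" "\<And>v. v \<in> V \<Longrightarrow> hs_inner H (pre v) y = hs_inner H v u"
  proof (rule riesz_on_linear_subset[OF H V, where f = "\<lambda>v. hs_inner H (pre v) y" and C = "hs_norm H y / (1 - q)"])
    fix v w assume vw: "v \<in> V" "w \<in> V"
    have "pre (v + w) = pre v + pre w"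
    proof (rule inj)
      have "pre v + pre w - S (pre v + pre w) = (pre v - S (pre v)) + (pre w - S (pre w))"
        using pre(1)[OF vw(1)] pre(1)[OF vw(2)] S by (simp add: bounded_ops_add)
      then show "pre (v + w) - S (pre (v + w)) = pre v + pre w - S (pre v + pre w)"
        using pre(2)[OF vw(1)] pre(2)[OF vw(2)] pre(2)[of "v + w"] vw V by (simp add: linear_subset_add)
    qed (use pre vw V H in \<open>auto simp: linear_subset_add\<close>)
    then show "hs_inner H (pre (v + w)) y = hs_inner H (pre v) y + hs_inner H (pre w) y"
      using pre vw H y by simp
  next
    fix c v assume v: "v \<in> V"
    have "pre (c *\<^sub>C v) = c *\<^sub>C pre v"
    proof (rule inj)
      have "c *\<^sub>C pre v - S (c *\<^sub>C pre v) = c *\<^sub>C (pre v - S (pre v))"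
        using pre(1)[OF v] S by (simp add: bounded_ops_scale cvec.scale_right_diff_distrib)
      then show "pre (c *\<^sub>C v) - S (pre (c *\<^sub>C v)) = c *\<^sub>C pre v - S (c *\<^sub>C pre v)"
        using pre[of "c *\<^sub>C v"] pre(2)[OF v] v V by (simp add: linear_subset_scale)
    qed (use pre v V H in \<open>auto simp: linear_subset_scale\<close>)
    then show "hs_inner H (pre (c *\<^sub>C v)) y = c * hs_inner H (pre v) y"
      using pre v H y by simp
  next
    fix v assume v: "v \<in> V"
    have "(1 - q) * hs_norm H (pre v) \<le> hs_norm H v" using below[OF pre(1)[OF v]] pre(2)[OF v] by simp
    then have "hs_norm H (pre v) \<le> hs_norm H v / (1 - q)" using q by (simp add: field_simps)
    then have "hs_norm H (pre v) * hs_norm H y \<le> hs_norm H v / (1 - q) * hs_norm H y"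
      using H y by (intro mult_right_mono) auto
    then show "cmod (hs_inner H (pre v) y) \<le> hs_norm H y / (1 - q) * hs_norm H v"
      using hs_Cauchy_Schwarz[OF H pre(1)[OF v] y] by (simp add: mult_ac)
  qed blast
  have uc: "u \<in> hs_carrier H" using u(1) hs_closure_subset by auto
  have "y = u - T u"
  proof (rule hs_eq_if_inner_eq[OF H y])
    fix h assume h: "h \<in> hs_carrier H"
    then have "h - S h \<in> V" by (simp add: V_def)
    moreover have "pre (h - S h) = h"
      by (rule inj) (use pre[OF calculation] h in simp_all)
    ultimately have "hs_inner H h y = hs_inner H (h - S h) u" using u(2)[of "h - S h"] by simp
    also have "\<dots> = hs_inner H h (u - T u)"
      using h uc H S T hs_adj_inner'[OF H H T uc h] by (simp add: S_def bounded_ops_mem)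
    finally show "hs_inner H h y = hs_inner H h (u - T u)" .
  qed (use uc H T in \<open>auto simp: bounded_ops_mem\<close>)
  with that uc show thesis by metis
qed


section \<open>Extension from dense subspaces\<close>

lemma scaleC_prod_simps [simp]: "fst (c *\<^sub>C p) = c *\<^sub>C fst p" "snd (c *\<^sub>C p) = c *\<^sub>C snd p"
  "c *\<^sub>C (x, y) = (c *\<^sub>C x, c *\<^sub>C y)"
  by (simp_all add: scaleC_prod_def)

lemma scaleC_fun_apply [simp]: "(c *\<^sub>C f) x = c *\<^sub>C f x"
  by (simp add: scaleC_fun_def)

lemma sum_fun_apply: "(\<Sum>i\<in>I. f i) x = (\<Sum>i\<in>I. f i x)" for f :: "'i \<Rightarrow> 'a \<Rightarrow> 'b::ab_group_add"
  by (induction I rule: infinite_finite_induct) auto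

lemma linear_subset_fst_image:
  assumes "linear_subset G"
  shows "linear_subset (fst ` G)"
  unfolding linear_subset_def
proof (intro conjI ballI allI)
  show "0 \<in> fst ` G" using imageI[OF linear_subset_zero[OF assms], of fst] by (simp add: zero_prod_def)
next
  fix x y assume "x \<in> fst ` G" "y \<in> fst ` G"
  then obtain p q where "p \<in> G" "q \<in> G" "x = fst p" "y = fst q" by auto
  then show "x + y \<in> fst ` G" using imageI[OF linear_subset_add[OF assms, of p q], of fst] by simp
next
  fix c x assume "x \<in> fst ` G"
  then obtain p where "p \<in> G" "x = fst p" by auto
  then show "c *\<^sub>C x \<in> fst ` G" using imageI[OF linear_subset_scale[OF assms, of p c], of fst] by simp
qed

text \<open>Such an x is a limit of vectors that are orthogonal to it.\<close>

lemma closure_orth_imp_zero: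
  assumes H: "hilbert_space H" and V: "V \<subseteq> hs_carrier H"
    and x: "x \<in> hs_closure H V" "\<And>v. v \<in> V \<Longrightarrow> hs_inner H v x = 0"
  shows "x = 0"
proof -
  obtain s where s: "x \<in> hs_carrier H" "\<And>n. s n \<in> V" "hs_lim H s x"
    using x(1) by (auto simp: hs_closure_def)
  have "(\<lambda>n. hs_inner H (s n) x) \<longlonglongrightarrow> hs_inner H x x" using s V by (intro hs_lim_inner[OF H]) auto
  then have "hs_inner H x x = 0" using x(2) s(2) LIMSEQ_unique[OF _ tendsto_const] by force
  then show ?thesis using hs_inner_self_pos[OF H s(1)] by fastforce
qed

lemma bounded_ops_eq_on_closure:
  assumes H: "hilbert_space H" and K: "hilbert_space K" and V: "V \<subseteq> hs_carrier H" "linear_subset V"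
    and A: "A \<in> bounded_ops (hs_sub H (hs_closure H V)) K" and B: "B \<in> bounded_ops (hs_sub H (hs_closure H V)) K"
    and eq: "\<And>v. v \<in> V \<Longrightarrow> A v = B v" and x: "x \<in> hs_closure H V"
  shows "A x = B x"
proof -
  let ?W = "hs_sub H (hs_closure H V)"
  have W: "hilbert_space ?W" using hilbert_space_sub[OF H closed_subspace_closure[OF H V]] .
  obtain s where s: "\<And>n. s n \<in> V" "hs_lim H s x" using x by (auto simp: hs_closure_def)
  have sc: "s n \<in> hs_closure H V" for n using s hs_closure_incl[OF H V(1)] by auto
  have "hs_lim K (\<lambda>n. A (s n)) (A x)" "hs_lim K (\<lambda>n. B (s n)) (B x)"
    using hs_lim_bounded_ops[OF A W K, of s x] hs_lim_bounded_ops[OF B W K, of s x] sc x s by auto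
  then show ?thesis
    using eq[OF s(1)] bounded_ops_mem[OF A] bounded_ops_mem[OF B] sc x
      hs_lim_unique[OF K, of "\<lambda>n. B (s n)" "A x" "B x"] by simp
qed

definition isometry_op ::
    "'a::complex_vector hspace \<Rightarrow> 'b::complex_vector hspace \<Rightarrow> ('a \<Rightarrow> 'b) \<Rightarrow> bool" where
  "isometry_op H K A \<longleftrightarrow> A \<in> bounded_ops H K \<and>
     (\<forall>x\<in>hs_carrier H. \<forall>y\<in>hs_carrier H. hs_inner K (A x) (A y) = hs_inner H x y)"

lemma isometry_opD:
  assumes "isometry_op H K A"
  shows "A \<in> bounded_ops H K"
    and "x \<in> hs_carrier H \<Longrightarrow> y \<in> hs_carrier H \<Longrightarrow> hs_inner K (A x) (A y) = hs_inner H x y"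
    and "x \<in> hs_carrier H \<Longrightarrow> hs_norm K (A x) = hs_norm H x"
  using assms by (auto simp: isometry_op_def hs_norm_def)

lemma isometry_opI:
  assumes "\<And>x. x \<in> hs_carrier H \<Longrightarrow> A x \<in> hs_carrier K"
    and "\<And>x y. x \<in> hs_carrier H \<Longrightarrow> y \<in> hs_carrier H \<Longrightarrow> A (x + y) = A x + A y"
    and "\<And>c x. x \<in> hs_carrier H \<Longrightarrow> A (c *\<^sub>C x) = c *\<^sub>C A x"
    and "\<And>x y. x \<in> hs_carrier H \<Longrightarrow> y \<in> hs_carrier H \<Longrightarrow> hs_inner K (A x) (A y) = hs_inner H x y"
  shows "isometry_op H K A"
  unfolding isometry_op_def
  using assms by (auto intro!: bounded_opsI[where C = 1] simp: hs_norm_def)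

text \<open>An operator is prescribed on a linear subset by its graph \<open>G\<close>, so that well-definedness follows from
  boundedness; the extension to the closure is the adjoint of an operator given by the Riesz theorem.\<close>

lemma bounded_extension:
  fixes H :: "'a::complex_vector hspace" and K :: "'b::complex_vector hspace"
  assumes H: "hilbert_space H" and K: "hilbert_space K"
    and G: "linear_subset G" "G \<subseteq> hs_carrier H \<times> hs_carrier K"
    and C: "C \<ge> 0" "\<And>x y. (x, y) \<in> G \<Longrightarrow> hs_norm K y \<le> C * hs_norm H x"
  obtains A where "A \<in> bounded_ops (hs_sub H (hs_closure H (fst ` G))) K"
    "\<And>x y. (x, y) \<in> G \<Longrightarrow> A x = y"
    "\<And>x. x \<in> hs_closure H (fst ` G) \<Longrightarrow> hs_norm K (A x) \<le> C * hs_norm H x"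
proof -
  define V where "V = fst ` G"
  let ?W = "hs_sub H (hs_closure H V)"
  have Gadd: "(x + x', y + y') \<in> G" if "(x, y) \<in> G" "(x', y') \<in> G" for x y x' y'
    using linear_subset_add[OF G(1) that] by simp
  have Gscale: "(c *\<^sub>C x, c *\<^sub>C y) \<in> G" if "(x, y) \<in> G" for x y c
    using linear_subset_scale[OF G(1) that, of c] by (simp add: scaleC_prod_def)
  have G0: "(0, 0) \<in> G" using linear_subset_zero[OF G(1)] by (simp add: zero_prod_def)
  have Vc: "V \<subseteq> hs_carrier H" using G(2) by (auto simp: V_def)
  have Vl: "linear_subset V" using linear_subset_fst_image[OF G(1)] by (simp add: V_def)
  have W: "hilbert_space ?W" using hilbert_space_sub[OF H closed_subspace_closure[OF H Vc Vl]] .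
  \<comment> \<open>Two values over the same point differ by a value over 0, which the bound forces
    to vanish.\<close>
  have uniq: "y = y'" if "(x, y) \<in> G" "(x, y') \<in> G" for x y y'
  proof -
    have "(0, y - y') \<in> G" using linear_subset_diff[OF G(1) that] by simp
    then have "hs_norm K (y - y') \<le> 0" "y - y' \<in> hs_carrier K" using C(2)[of 0 "y - y'"] H G(2) by auto
    then have "hs_norm K (y - y') = 0" using K by (intro antisym) auto
    then show ?thesis using \<open>y - y' \<in> hs_carrier K\<close> K by simp
  qed
  define f where "f x = (SOME y. (x, y) \<in> G)" for x
  have fG: "(x, f x) \<in> G" if "x \<in> V" for x
  proof -
    have "\<exists>y. (x, y) \<in> G" using that by (auto simp: V_def)
    then show ?thesis unfolding f_def by (rule someI_ex)
  qed
  have f: "f x = y" if "(x, y) \<in> G" for x y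
    using uniq[OF fG that] that by (force simp: V_def)
  have fc: "f x \<in> hs_carrier K" if "x \<in> V" for x using fG[OF that] G(2) by auto
  have bound: "cmod (hs_inner K (f x) y) \<le> C * hs_norm H x * hs_norm K y" if "x \<in> V" "y \<in> hs_carrier K" for x y
  proof -
    have "cmod (hs_inner K (f x) y) \<le> hs_norm K (f x) * hs_norm K y"
      using K fc that by (intro hs_Cauchy_Schwarz) auto
    also have "\<dots> \<le> C * hs_norm H x * hs_norm K y"
      using C(2)[OF fG] K that by (intro mult_right_mono) auto
    finally show ?thesis .
  qed
  \<comment> \<open>The Riesz vectors are taken inside the closure of V, where a vector is
    determined by its inner products with V; this is what makes the choice \<open>g\<close>
    linear.\<close>
  have "\<exists>u\<in>hs_closure H V. \<forall>v\<in>V. hs_inner K (f v) y = hs_inner H v u" if y: "y \<in> hs_carrier K" for y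
  proof (rule riesz_on_linear_subset[OF H Vc Vl, where f = "\<lambda>v. hs_inner K (f v) y" and C = "C * hs_norm K y"])
    fix v w assume "v \<in> V" "w \<in> V"
    then show "hs_inner K (f (v + w)) y = hs_inner K (f v) y + hs_inner K (f w) y"
      using f[OF Gadd[OF fG fG]] K fc y by simp
  next
    fix c v assume "v \<in> V"
    then show "hs_inner K (f (c *\<^sub>C v)) y = c * hs_inner K (f v) y"
      using f[OF Gscale[OF fG]] K fc y by simp
  next
    fix v assume "v \<in> V"
    then show "cmod (hs_inner K (f v) y) \<le> C * hs_norm K y * hs_norm H v"
      using bound[OF _ y] by (simp add: mult_ac)
  qed blast
  then obtain g where g: "\<And>y. y \<in> hs_carrier K \<Longrightarrow> g y \<in> hs_closure H V"
    "\<And>v y. v \<in> V \<Longrightarrow> y \<in> hs_carrier K \<Longrightarrow> hs_inner K (f v) y = hs_inner H v (g y)" by metis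
  have gc: "g y \<in> hs_carrier H" if "y \<in> hs_carrier K" for y using g(1)[OF that] hs_closure_subset by auto
  have Wl: "linear_subset (hs_closure H V)" using hs_closure_linear[OF H Vc Vl] .
  have gn: "hs_norm H (g y) \<le> C * hs_norm K y" if y: "y \<in> hs_carrier K" for y
  proof -
    obtain s where s: "\<And>n. s n \<in> V" "hs_lim H s (g y)" using g(1)[OF y] by (auto simp: hs_closure_def)
    have sc: "s n \<in> hs_carrier H" for n using s Vc by auto
    have "(\<lambda>n. Re (hs_inner H (s n) (g y))) \<longlonglongrightarrow> Re (hs_inner H (g y) (g y))"
      using s sc gc[OF y] H by (intro tendsto_Re hs_lim_inner) auto
    moreover have "(\<lambda>n. C * hs_norm K y * hs_norm H (s n)) \<longlonglongrightarrow> C * hs_norm K y * hs_norm H (g y)"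
      using hs_lim_norm[OF H sc gc[OF y] s(2)] by (intro tendsto_intros)
    moreover have "Re (hs_inner H (s n) (g y)) \<le> C * hs_norm K y * hs_norm H (s n)" for n
      using bound[OF s(1) y, of n] g(2)[OF s(1) y, of n] complex_Re_le_cmod[of "hs_inner K (f (s n)) y"]
      by (simp add: mult_ac)
    ultimately have "Re (hs_inner H (g y) (g y)) \<le> C * hs_norm K y * hs_norm H (g y)"
      by (intro LIMSEQ_le) auto
    then have *: "hs_norm H (g y) * hs_norm H (g y) \<le> C * hs_norm K y * hs_norm H (g y)"
      using hs_norm_sq[OF H gc[OF y]] by (simp add: power2_eq_square)
    show ?thesis
    proof (cases "g y = 0")
      case False
      then have "hs_norm H (g y) > 0"
        using gc[OF y] H hs_norm_eq_0[of H "g y"] hs_norm_nonneg[of H "g y"] by linarith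
      then show ?thesis using * by (simp add: mult_le_cancel_right_pos)
    qed (use H K C y in simp)
  qed
  have gW: "g \<in> bounded_ops K ?W"
  proof (rule bounded_opsI[where C = C])
    show "g (x + y) = g x + g y" if "x \<in> hs_carrier K" "y \<in> hs_carrier K" for x y
    proof -
      have "g (x + y) - (g x + g y) = 0"
      proof (rule closure_orth_imp_zero[OF H Vc])
        show "g (x + y) - (g x + g y) \<in> hs_closure H V"
          using g(1) that K by (intro linear_subset_diff[OF Wl] linear_subset_add[OF Wl]) auto
        show "hs_inner H v (g (x + y) - (g x + g y)) = 0" if "v \<in> V" for v
          using that \<open>x \<in> _\<close> \<open>y \<in> _\<close> H K gc Vc fc by (auto simp: g(2)[symmetric] subset_iff)
      qed
      then show ?thesis by simp
    qed
    show "g (c *\<^sub>C x) = c *\<^sub>C g x" if "x \<in> hs_carrier K" for c x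
    proof -
      have "g (c *\<^sub>C x) - c *\<^sub>C g x = 0"
      proof (rule closure_orth_imp_zero[OF H Vc])
        show "g (c *\<^sub>C x) - c *\<^sub>C g x \<in> hs_closure H V"
          using g(1) that K by (intro linear_subset_diff[OF Wl] linear_subset_scale[OF Wl]) auto
        show "hs_inner H v (g (c *\<^sub>C x) - c *\<^sub>C g x) = 0" if "v \<in> V" for v
          using that \<open>x \<in> _\<close> H K gc Vc fc by (auto simp: g(2)[symmetric] subset_iff)
      qed
      then show ?thesis by simp
    qed
  qed (use g gn in auto)
  define A where "A = hs_adj K ?W g"
  have A: "A \<in> bounded_ops ?W K" using hs_adj_bounded[OF K W gW] by (simp add: A_def)
  have "A x = y" if xy: "(x, y) \<in> G" for x y
  proof -
    have x: "x \<in> V" using xy by (force simp: V_def)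
    have "A x = f x"
      unfolding A_def
    proof (rule hs_adj_eqI[OF K fc[OF x]])
      fix h assume h: "h \<in> hs_carrier K"
      have "hs_inner H (g h) x = cnj (hs_inner H x (g h))"
        using h x Vc gc H by (subst hs_inner_cnj) auto
      also have "\<dots> = hs_inner K h (f x)"
        using h x K fc by (simp flip: g(2) add: hs_inner_cnj)
      finally show "hs_inner ?W (g h) x = hs_inner K h (f x)" by simp
    qed
    then show ?thesis using f[OF xy] by simp
  qed
  moreover have "hs_norm K (A x) \<le> C * hs_norm H x" if "x \<in> hs_closure H V" for x
    using hs_adj_norm_le[OF K W gW C(1), of x] gn that by (simp add: A_def)
  ultimately show thesis using A that by (auto simp: V_def)
qed

text \<open>Preservation of inner products on the graph says that A followed by its adjoint is the
  identity on the domain of the graph. By continuity it is the identity on the closure, so the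
  bounded extension is isometric.\<close>

lemma isometric_extension:
  fixes H :: "'a::complex_vector hspace" and K :: "'b::complex_vector hspace"
  assumes H: "hilbert_space H" and K: "hilbert_space K"
    and G: "linear_subset G" "G \<subseteq> hs_carrier H \<times> hs_carrier K"
    and iso: "\<And>x y x' y'. (x, y) \<in> G \<Longrightarrow> (x', y') \<in> G \<Longrightarrow> hs_inner K y y' = hs_inner H x x'"
  obtains A where "isometry_op (hs_sub H (hs_closure H (fst ` G))) K A"
    "\<And>x y. (x, y) \<in> G \<Longrightarrow> A x = y"
    "linear_subset (fst ` G)"
proof -
  let ?V = "fst ` G" let ?W = "hs_sub H (hs_closure H ?V)"
  obtain A where A: "A \<in> bounded_ops ?W K" "\<And>x y. (x, y) \<in> G \<Longrightarrow> A x = y"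
  proof (rule bounded_extension[OF H K G, of 1])
    show "hs_norm K y \<le> 1 * hs_norm H x" if "(x, y) \<in> G" for x y
      using iso[OF that that] by (simp add: hs_norm_def)
  qed auto
  have Vc: "?V \<subseteq> hs_carrier H" using G(2) by auto
  have Vl: "linear_subset ?V" using linear_subset_fst_image[OF G(1)] .
  have W: "hilbert_space ?W" using hilbert_space_sub[OF H closed_subspace_closure[OF H Vc Vl]] .
  let ?AA = "\<lambda>x. hs_adj ?W K A (A x)"
  have AA: "?AA \<in> bounded_ops ?W ?W"
    using bounded_ops_compose[OF hs_adj_bounded[OF W K A(1)] A(1) W K] .
  have AAV: "?AA v = v" if v: "v \<in> ?V" for v
  proof -
    have vW: "v \<in> hs_closure H ?V" using hs_closure_incl[OF H Vc] v by auto
    have "?AA v - v = 0"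
    proof (rule closure_orth_imp_zero[OF H Vc])
      show AAvv: "?AA v - v \<in> hs_closure H ?V"
        using hs_carrier_simps(5)[OF W, of "?AA v" v] bounded_ops_mem[OF AA, of v] vW by simp
      fix w assume w: "w \<in> ?V"
      then have wW: "w \<in> hs_closure H ?V" using hs_closure_incl[OF H Vc] by auto
      have "hs_inner ?W w (?AA v - v) = hs_inner K (A w) (A v) - hs_inner H w v"
        using W wW vW bounded_ops_mem[OF AA, of v] hs_adj_inner[OF W K A(1), of w "A v"]
          bounded_ops_mem[OF A(1)]
        by (simp del: hs_sub_simps add: hs_sub_simps(1)) simp
      also have "\<dots> = 0" using iso A(2) v w by fastforce
      finally show "hs_inner H w (?AA v - v) = 0" by simp
    qed
    then show ?thesis by simp
  qed
  have AAid: "?AA x = x" if "x \<in> hs_closure H ?V" for x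
    using bounded_ops_eq_on_closure[OF H W Vc Vl AA bounded_ops_ident AAV that] by simp
  have "isometry_op ?W K A"
    unfolding isometry_op_def
  proof (intro conjI ballI)
    fix x y assume "x \<in> hs_carrier ?W" "y \<in> hs_carrier ?W"
    then show "hs_inner K (A x) (A y) = hs_inner ?W x y"
      using hs_adj_inner[OF W K A(1), of x "A y"] AAid[of y] bounded_ops_mem[OF A(1), of y] by simp
  qed (rule A(1))
  then show thesis using A(2) Vl that by blast
qed

lemma isometry_adj_left_inverse:
  assumes "hilbert_space H" "hilbert_space K" "isometry_op H K A" "x \<in> hs_carrier H"
  shows "hs_adj H K A (A x) = x"
  using assms(4) by (intro hs_adj_eqI[OF assms(1)]) (auto simp: isometry_opD[OF assms(3)])

text \<open>Distances are preserved, so a convergent sequence of images has a Cauchy sequence of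
  preimages, and the limit of the latter is mapped to the limit of the former.\<close>

lemma isometry_image_closed:
  assumes H: "hilbert_space H" and K: "hilbert_space K" and A: "isometry_op H K A"
    and V: "closed_subspace H V"
  shows "closed_subspace K (A ` V)"
  unfolding closed_subspace_def
proof (intro conjI subsetI)
  note V' = closed_subspaceD[OF V] and Ab = isometry_opD(1)[OF A]
  have Vc: "x \<in> hs_carrier H" if "x \<in> V" for x using that V' by auto
  show "y \<in> hs_carrier K" if "y \<in> A ` V" for y using that Vc bounded_ops_mem[OF Ab] by auto
  show "linear_subset (A ` V)" using bounded_ops_image_linear[OF Ab H V'(2,1)] .
  fix y assume "y \<in> hs_closure K (A ` V)"
  then obtain t where t: "y \<in> hs_carrier K" "\<And>n. t n \<in> A ` V" "hs_lim K t y" by (auto simp: hs_closure_def)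
  have "\<forall>n. \<exists>x. x \<in> V \<and> t n = A x" using t(2) by blast
  then obtain s where s: "\<And>n. s n \<in> V" "\<And>n. t n = A (s n)" by metis
  have diff: "hs_norm H (s i - s j) = hs_norm K (t i - t j)" for i j
    using isometry_opD(3)[OF A, of "s i - s j"] Vc[OF s(1)] H by (simp add: s(2) bounded_ops_diff[OF Ab])
  have tc: "t n \<in> hs_carrier K" for n using s Vc bounded_ops_mem[OF Ab] by auto
  obtain x where x: "x \<in> hs_carrier H" "hs_lim H s x"
  proof (rule hs_complete[OF H Vc[OF s(1)]])
    show "\<exists>N. \<forall>i\<ge>N. \<forall>j\<ge>N. hs_norm H (s i - s j) < \<epsilon>" if "\<epsilon> > 0" for \<epsilon>
      using hs_lim_Cauchy[OF K tc t(1) t(3) that] by (simp add: diff)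
  qed auto
  have "hs_lim K t (A x)"
    using hs_lim_bounded_ops[OF Ab H K Vc[OF s(1)] x] s(2) by (simp add: s(2)[abs_def])
  then have "y = A x" using hs_lim_unique[OF K tc t(1) _ t(3)] x bounded_ops_mem[OF Ab] by blast
  moreover have "x \<in> V" using V'(3)[OF x(1) s(1) x(2)] .
  ultimately show "y \<in> A ` V" by simp
qed


section \<open>Direct sums\<close>

lemma hs_sum_simps [simp]:
  "hs_carrier (hs_sum H K) = hs_carrier H \<times> hs_carrier K"
  "hs_inner (hs_sum H K) p q = hs_inner H (fst p) (fst q) + hs_inner K (snd p) (snd q)"
  by (simp_all add: hs_sum_def)

lemma hs_pow_simps [simp]:
  "v \<in> hs_carrier (hs_pow H) \<longleftrightarrow> (\<forall>i. v i \<in> hs_carrier H)"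
  "hs_inner (hs_pow H) v w = (\<Sum>i\<in>UNIV. hs_inner H (v i) (w i))"
  by (simp_all add: hs_pow_def)

lemma hs_norm_sum_sq:
  assumes "hilbert_space H" "hilbert_space K" "p \<in> hs_carrier (hs_sum H K)"
  shows "(hs_norm (hs_sum H K) p)\<^sup>2 = (hs_norm H (fst p))\<^sup>2 + (hs_norm K (snd p))\<^sup>2"
  using assms by (auto simp: hs_norm_def hs_inner_self_nonneg)

lemma hs_norm_pow_sq:
  assumes "hilbert_space H" "v \<in> hs_carrier (hs_pow H)"
  shows "(hs_norm (hs_pow H) v)\<^sup>2 = (\<Sum>i\<in>UNIV. (hs_norm H (v i))\<^sup>2)"
  using assms by (simp add: hs_norm_def hs_inner_self_nonneg sum_nonneg)

lemma hs_norm_sum_eq: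
  assumes "hilbert_space H" "hilbert_space K" "p \<in> hs_carrier (hs_sum H K)"
  shows "hs_norm (hs_sum H K) p = sqrt ((hs_norm H (fst p))\<^sup>2 + (hs_norm K (snd p))\<^sup>2)"
  using assms by (auto simp: hs_norm_def hs_inner_self_nonneg)

lemma hs_norm_pow_eq:
  assumes "hilbert_space H" "v \<in> hs_carrier (hs_pow H)"
  shows "hs_norm (hs_pow H) v = sqrt (\<Sum>i\<in>UNIV. (hs_norm H (v i))\<^sup>2)"
  using assms by (simp add: hs_norm_def hs_inner_self_nonneg sum_nonneg)

lemma hs_norm_pow_component_le:
  assumes "hilbert_space H" "v \<in> hs_carrier (hs_pow H)"
  shows "hs_norm H (v i) \<le> hs_norm (hs_pow H) v"
  unfolding hs_norm_pow_eq[OF assms]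
  by (rule real_le_rsqrt) (use assms in \<open>auto intro!: member_le_sum\<close>)

lemma hilbert_space_sum [simp]:
  fixes H :: "'a::complex_vector hspace" and K :: "'b::complex_vector hspace"
  assumes H: "hilbert_space H" and K: "hilbert_space K"
  shows "hilbert_space (hs_sum H K)"
  unfolding hilbert_space_def
proof (intro conjI ballI allI impI)
  show "linear_subset (hs_carrier (hs_sum H K))"
    using H K by (auto simp: linear_subset_def zero_prod_def)
  show "0 < Re (hs_inner (hs_sum H K) p p)" if "p \<in> hs_carrier (hs_sum H K)" "p \<noteq> 0" for p
  proof (cases "fst p = 0")
    case True
    then have "snd p \<noteq> 0" using that by (auto simp: prod_eq_iff)
    then show ?thesis
      using that H K by (auto intro!: add_nonneg_pos hs_inner_self_nonneg hs_inner_self_pos)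
  next
    case False
    then show ?thesis
      using that H K by (auto intro!: add_pos_nonneg hs_inner_self_nonneg hs_inner_self_pos)
  qed
  show "hs_inner (hs_sum H K) q p = cnj (hs_inner (hs_sum H K) p q)"
    if "p \<in> hs_carrier (hs_sum H K)" "q \<in> hs_carrier (hs_sum H K)" for p q
    using that H K by (auto simp: hs_inner_cnj)
  show "hs_inner (hs_sum H K) (c *\<^sub>C p) q = c * hs_inner (hs_sum H K) p q"
    if "p \<in> hs_carrier (hs_sum H K)" "q \<in> hs_carrier (hs_sum H K)" for c p q
    using that H K by (auto simp: distrib_left)
next
  fix s :: "nat \<Rightarrow> 'a \<times> 'b"
  assume s: "(\<forall>n. s n \<in> hs_carrier (hs_sum H K)) \<and>
    (\<forall>\<epsilon>>0. \<exists>N. \<forall>i\<ge>N. \<forall>j\<ge>N. hs_norm (hs_sum H K) (s i - s j) < \<epsilon>)"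
  then have sc: "fst (s n) \<in> hs_carrier H" "snd (s n) \<in> hs_carrier K" for n
    by (auto simp: mem_Times_iff)
  have le: "hs_norm H (fst (s i) - fst (s j)) \<le> hs_norm (hs_sum H K) (s i - s j)"
    "hs_norm K (snd (s i) - snd (s j)) \<le> hs_norm (hs_sum H K) (s i - s j)" for i j
    using sc H K by (auto simp: hs_norm_sum_eq mem_Times_iff intro!: real_le_rsqrt)
  obtain x where x: "x \<in> hs_carrier H" "hs_lim H (\<lambda>n. fst (s n)) x"
  proof (rule hs_complete[OF H, of "\<lambda>n. fst (s n)"])
    show "\<exists>N. \<forall>i\<ge>N. \<forall>j\<ge>N. hs_norm H (fst (s i) - fst (s j)) < \<epsilon>" if "\<epsilon> > 0" for \<epsilon>
      using s that by (meson le(1) le_less_trans)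
  qed (use sc in auto)
  obtain y where y: "y \<in> hs_carrier K" "hs_lim K (\<lambda>n. snd (s n)) y"
  proof (rule hs_complete[OF K, of "\<lambda>n. snd (s n)"])
    show "\<exists>N. \<forall>i\<ge>N. \<forall>j\<ge>N. hs_norm K (snd (s i) - snd (s j)) < \<epsilon>" if "\<epsilon> > 0" for \<epsilon>
      using s that by (meson le(2) le_less_trans)
  qed (use sc in auto)
  have "(\<lambda>n. sqrt ((hs_norm H (fst (s n) - x))\<^sup>2 + (hs_norm K (snd (s n) - y))\<^sup>2)) \<longlonglongrightarrow> sqrt (0\<^sup>2 + 0\<^sup>2)"
    using x(2) y(2) unfolding hs_lim_def by (intro tendsto_intros)
  moreover have "hs_norm (hs_sum H K) (s n - (x, y)) =
      sqrt ((hs_norm H (fst (s n) - x))\<^sup>2 + (hs_norm K (snd (s n) - y))\<^sup>2)" for n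
    using sc x y H K by (simp add: hs_norm_sum_eq mem_Times_iff)
  ultimately have "hs_lim (hs_sum H K) s (x, y)" by (simp add: hs_lim_def)
  then show "\<exists>p\<in>hs_carrier (hs_sum H K). hs_lim (hs_sum H K) s p" using x y by force
qed (use H K in auto)

lemma hilbert_space_pow [simp]:
  fixes H :: "'a::complex_vector hspace"
  assumes H: "hilbert_space H"
  shows "hilbert_space (hs_pow H :: ('n::finite \<Rightarrow> 'a) hspace)"
  unfolding hilbert_space_def
proof (intro conjI ballI allI impI)
  let ?P = "hs_pow H :: ('n \<Rightarrow> 'a) hspace"
  show "linear_subset (hs_carrier ?P)"
    using H by (auto simp: linear_subset_def)
  show "0 < Re (hs_inner ?P v v)" if v: "v \<in> hs_carrier ?P" "v \<noteq> 0" for v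
  proof -
    obtain i where i: "v i \<noteq> 0" using v(2) by (auto simp: fun_eq_iff)
    have "0 < (\<Sum>i\<in>UNIV. Re (hs_inner H (v i) (v i)))"
      by (rule sum_pos2[of _ i]) (use v i H in \<open>auto intro!: hs_inner_self_pos hs_inner_self_nonneg\<close>)
    then show ?thesis by simp
  qed
  show "hs_inner ?P w v = cnj (hs_inner ?P v w)" if "v \<in> hs_carrier ?P" "w \<in> hs_carrier ?P" for v w
    using that H by (simp add: hs_inner_cnj)
  show "hs_inner ?P (u + v) w = hs_inner ?P u w + hs_inner ?P v w"
    if "u \<in> hs_carrier ?P" "v \<in> hs_carrier ?P" "w \<in> hs_carrier ?P" for u v w
    using that H by (simp add: sum.distrib)
  show "hs_inner ?P (c *\<^sub>C v) w = c * hs_inner ?P v w"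
    if "v \<in> hs_carrier ?P" "w \<in> hs_carrier ?P" for c v w
    using that H by (simp add: sum_distrib_left)
  fix s :: "nat \<Rightarrow> 'n \<Rightarrow> 'a"
  assume s: "(\<forall>n. s n \<in> hs_carrier ?P) \<and>
    (\<forall>\<epsilon>>0. \<exists>N. \<forall>i\<ge>N. \<forall>j\<ge>N. hs_norm ?P (s i - s j) < \<epsilon>)"
  then have sc: "s n i \<in> hs_carrier H" for n i by simp
  have le: "hs_norm H (s k i - s j i) \<le> hs_norm ?P (s k - s j)" for i j k
    using hs_norm_pow_component_le[OF H, of "s k - s j" i] sc H by simp
  have "\<exists>x\<in>hs_carrier H. hs_lim H (\<lambda>n. s n i) x" for i
  proof (rule hs_complete[OF H, of "\<lambda>n. s n i"])
    show "\<exists>N. \<forall>k\<ge>N. \<forall>j\<ge>N. hs_norm H (s k i - s j i) < \<epsilon>" if "\<epsilon> > 0" for \<epsilon>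
      using s that by (meson le le_less_trans)
  qed (use sc in auto)
  then obtain x where x: "\<And>i. x i \<in> hs_carrier H" "\<And>i. hs_lim H (\<lambda>n. s n i) (x i)" by metis
  have "(\<lambda>n. sqrt (\<Sum>i\<in>UNIV. (hs_norm H (s n i - x i))\<^sup>2)) \<longlonglongrightarrow> sqrt (\<Sum>i\<in>(UNIV::'n set). 0\<^sup>2)"
    using x(2) unfolding hs_lim_def by (intro tendsto_intros)
  moreover have "hs_norm ?P (s n - x) = sqrt (\<Sum>i\<in>UNIV. (hs_norm H (s n i - x i))\<^sup>2)" for n
    using sc x H by (simp add: hs_norm_pow_eq)
  ultimately have "hs_lim ?P s x" by (simp add: hs_lim_def)
  then show "\<exists>x\<in>hs_carrier ?P. hs_lim ?P s x" using x by (intro bexI[of _ x]) auto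
qed

lemma bounded_ops_pow:
  fixes A :: "'i::finite \<Rightarrow> 'a::complex_vector \<Rightarrow> 'b::complex_vector"
  assumes H: "hilbert_space H" and K: "hilbert_space K" and A: "\<And>i. A i \<in> bounded_ops H K"
  shows "(\<lambda>x i. A i x) \<in> bounded_ops H (hs_pow K)"
proof -
  have "\<exists>C. \<forall>x\<in>hs_carrier H. hs_norm K (A i x) \<le> C * hs_norm H x" for i
    using A by (auto simp: bounded_ops_def)
  then obtain C where C: "\<And>i x. x \<in> hs_carrier H \<Longrightarrow> hs_norm K (A i x) \<le> C i * hs_norm H x" by metis
  show ?thesis
  proof (rule bounded_opsI[where C = "\<Sum>i\<in>UNIV. C i"])
    fix x assume x: "x \<in> hs_carrier H"
    have Ax: "A i x \<in> hs_carrier K" for i using bounded_ops_mem[OF A x] .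
    have "hs_norm (hs_pow K) (\<lambda>i. A i x) = L2_set (\<lambda>i. hs_norm K (A i x)) UNIV"
      using Ax K by (simp add: hs_norm_pow_eq L2_set_def)
    also have "\<dots> \<le> (\<Sum>i\<in>UNIV. hs_norm K (A i x))" using Ax K by (intro L2_set_le_sum) auto
    also have "\<dots> \<le> (\<Sum>i\<in>UNIV. C i * hs_norm H x)" using C[OF x] by (intro sum_mono)
    finally show "hs_norm (hs_pow K) (\<lambda>i. A i x) \<le> (\<Sum>i\<in>UNIV. C i) * hs_norm H x"
      by (simp add: sum_distrib_right)
  qed (auto simp: bounded_ops_mem[OF A] bounded_ops_add[OF A] bounded_ops_scale[OF A] fun_eq_iff)
qed

lemma bounded_ops_pow_component:
  assumes "hilbert_space K"
  shows "(\<lambda>v. v i) \<in> bounded_ops (hs_pow K) K"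
  by (rule bounded_opsI[where C = 1]) (use assms hs_norm_pow_component_le in auto)

text \<open>Serves as a summand of the auxiliary space that supplies a nonzero vector, and with it
  infinite dimension.\<close>

definition complex_hspace :: "complex hspace" where
  "complex_hspace = \<lparr>hs_carrier = UNIV, hs_inner = (\<lambda>x y. x * cnj y)\<rparr>"

lemma hilbert_space_complex: "hilbert_space complex_hspace"
proof -
  have norm: "hs_norm complex_hspace x = cmod x" for x
    by (simp add: hs_norm_def complex_hspace_def cmod_def power2_eq_square)
  have lim: "hs_lim complex_hspace s x \<longleftrightarrow> s \<longlonglongrightarrow> x" for s x
    by (simp add: hs_lim_def norm LIM_zero_iff tendsto_norm_zero_iff)
  show ?thesis
    unfolding hilbert_space_def
  proof (intro conjI ballI allI impI)
    fix s :: "nat \<Rightarrow> complex"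
    assume "(\<forall>n. s n \<in> hs_carrier complex_hspace) \<and>
      (\<forall>\<epsilon>>0. \<exists>N. \<forall>i\<ge>N. \<forall>j\<ge>N. hs_norm complex_hspace (s i - s j) < \<epsilon>)"
    then have "Cauchy s" by (simp add: Cauchy_iff norm)
    then obtain x where "s \<longlonglongrightarrow> x" using Cauchy_convergent_iff convergent_def by blast
    then show "\<exists>x\<in>hs_carrier complex_hspace. hs_lim complex_hspace s x"
      by (intro bexI[of _ x]) (simp add: lim, simp add: complex_hspace_def)
  next
    fix x :: complex assume "x \<noteq> 0"
    then show "0 < Re (hs_inner complex_hspace x x)"
      by (simp add: complex_hspace_def complex_neq_0 power2_eq_square)
  qed (simp_all add: complex_hspace_def linear_subset_def scaleC_complex_def algebra_simps)
qed


section \<open>Positive operators and square roots\<close>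

lemma positive_op_bounded: "positive_op H A \<Longrightarrow> A \<in> bounded_ops H H"
  by (simp add: positive_op_def)

lemma positive_op_mem: "positive_op H A \<Longrightarrow> x \<in> hs_carrier H \<Longrightarrow> A x \<in> hs_carrier H"
  unfolding positive_op_def using bounded_ops_mem by blast

lemma positive_opD:
  assumes "positive_op H A" "x \<in> hs_carrier H"
  shows "Im (hs_inner H (A x) x) = 0" "0 \<le> Re (hs_inner H (A x) x)"
  using assms by (auto simp: positive_op_def complex_is_Real_iff)

text \<open>Polarization: the form is real at x + y and at x + i y, which yields the imaginary and
  the real part of the symmetry respectively.\<close>

lemma positive_op_adjoint:
  assumes H: "hilbert_space H" and A: "positive_op H A" and xy: "x \<in> hs_carrier H" "y \<in> hs_carrier H"
  shows "hs_inner H (A x) y = hs_inner H x (A y)"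
proof -
  note b = positive_op_bounded[OF A]
  have c: "A x \<in> hs_carrier H" "A y \<in> hs_carrier H" using b xy by (auto simp: bounded_ops_mem)
  note z = positive_opD(1)[OF A]
  have 1: "Im (hs_inner H (A (x + y)) (x + y)) = 0" by (rule z) (use xy H in auto)
  have 2: "Im (hs_inner H (A (x + \<i> *\<^sub>C y)) (x + \<i> *\<^sub>C y)) = 0" by (rule z) (use xy H in auto)
  have "hs_inner H (A x) y = cnj (hs_inner H (A y) x)"
    using 1 2 z[OF xy(1)] z[OF xy(2)] xy c H b
    by (simp add: bounded_ops_add bounded_ops_scale complex_eq_iff)
  then show ?thesis using hs_inner_cnj[OF H c(2) xy(1)] by simp
qed

lemma positive_op_Cauchy_Schwarz:
  assumes H: "hilbert_space H" and A: "positive_op H A" and xy: "x \<in> hs_carrier H" "y \<in> hs_carrier H"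
  shows "(cmod (hs_inner H (A x) y))\<^sup>2 \<le> Re (hs_inner H (A x) x) * Re (hs_inner H (A y) y)"
proof (rule semi_inner_Cauchy_Schwarz[OF hs_carrier_linear[OF H] xy])
  note b = positive_op_bounded[OF A]
  show "hs_inner H (A y) x = cnj (hs_inner H (A x) y)" if "x \<in> hs_carrier H" "y \<in> hs_carrier H" for x y
    using that positive_op_adjoint[OF H A that(2,1)] hs_inner_cnj[OF H, of "A x" y] b by (simp add: bounded_ops_mem)
qed (use H positive_op_bounded[OF A] positive_opD(2)[OF A] in
    \<open>simp_all add: bounded_ops_mem bounded_ops_add bounded_ops_scale\<close>)

text \<open>The Cauchy-Schwarz inequality of the form, applied to x and A x.\<close>

lemma positive_op_inner_zero:
  assumes H: "hilbert_space H" and A: "positive_op H A" and x: "x \<in> hs_carrier H"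
    and 0: "Re (hs_inner H (A x) x) = 0"
  shows "A x = 0"
proof -
  have c: "A x \<in> hs_carrier H" using positive_op_mem[OF A x] .
  have "(cmod (hs_inner H (A x) (A x)))\<^sup>2 \<le> 0"
    using positive_op_Cauchy_Schwarz[OF H A x c] 0 by simp
  then show ?thesis using hs_inner_self_pos[OF H c] by fastforce
qed

text \<open>The Taylor coefficients of \<open>\<surd>(1 - x)\<close>.\<close>

definition sqrt_coeff :: "nat \<Rightarrow> real" where
  "sqrt_coeff k = (- 1) ^ k * ((1/2) gchoose k)"

lemma sqrt_coeff_0 [simp]: "sqrt_coeff 0 = 1"
  by (simp add: sqrt_coeff_def)

lemma sqrt_coeff_nonpos: "k \<noteq> 0 \<Longrightarrow> sqrt_coeff k \<le> 0"
proof (cases k)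
  case (Suc j)
  have "sqrt_coeff k = pochhammer (- (1/2)) k / fact k"
    by (simp add: sqrt_coeff_def gbinomial_pochhammer flip: power_mult_distrib mult.assoc)
  also have "\<dots> = - (1/2) * pochhammer (1/2) j / fact k"
    by (simp add: Suc pochhammer_rec)
  also have "\<dots> \<le> 0" using pochhammer_pos[of "1/2 :: real" j] by simp
  finally show ?thesis .
qed auto

text \<open>The partial sums of the coefficients of \<surd>(1 - x) are the coefficients of \<surd>(1
  - x) / (1 - x) = 1 / \<surd>(1 - x), which are positive.\<close>

lemma sqrt_coeff_sum_nonneg: "0 \<le> (\<Sum>k\<le>n. sqrt_coeff k)"
proof -
  have "(\<Sum>k\<le>n. sqrt_coeff k) = (- 1) ^ n * ((1/2 - 1 :: real) gchoose n)"
    using gbinomial_sum_lower_neg[of "1/2 :: real" n] by (simp add: sqrt_coeff_def mult.commute)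
  also have "\<dots> = pochhammer (1/2) n / fact n"
    by (simp add: gbinomial_pochhammer flip: power_mult_distrib mult.assoc)
  finally show ?thesis using pochhammer_pos[of "1/2 :: real" n] by simp
qed

text \<open>Only the zeroth coefficient, which is 1, is positive. Reversing the other signs turns a
  partial sum s into 2 - s, and s \<ge> 0.\<close>

lemma sqrt_coeff_abs_sum: "(\<Sum>k\<le>n. \<bar>sqrt_coeff k\<bar>) \<le> 2"
proof -
  have "(\<Sum>k\<le>n. \<bar>sqrt_coeff k\<bar>) = (\<Sum>k\<le>n. (if k = 0 then 2 else 0) - sqrt_coeff k)"
    by (intro sum.cong) (auto simp: sqrt_coeff_nonpos)
  also have "\<dots> = 2 - (\<Sum>k\<le>n. sqrt_coeff k)" by (simp add: sum_subtractf)
  finally show ?thesis using sqrt_coeff_sum_nonneg[of n] by simp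
qed

lemma sqrt_coeff_abs_summable: "summable (\<lambda>k. \<bar>sqrt_coeff k\<bar>)"
proof (rule bounded_imp_summable)
  show "(\<Sum>k\<le>n. \<bar>sqrt_coeff k\<bar>) \<le> 2" for n by (rule sqrt_coeff_abs_sum)
qed auto

text \<open>The square of \<surd>(1 - x) is 1 - x, read off coefficientwise from the Vandermonde
  identity.\<close>

lemma sqrt_coeff_convolution:
  "(\<Sum>i\<le>n. sqrt_coeff i * sqrt_coeff (n - i)) = (if n = 0 then 1 else if n = 1 then - 1 else 0)"
proof -
  have "sqrt_coeff i * sqrt_coeff (n - i) = (- 1) ^ n * (((1/2) gchoose i) * ((1/2) gchoose (n - i)))"
    if "i \<le> n" for i
  proof -
    have "(- 1 :: real) ^ n = (- 1) ^ i * (- 1) ^ (n - i)" using that by (simp flip: power_add)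
    then show ?thesis by (simp add: sqrt_coeff_def)
  qed
  then have "(\<Sum>i\<le>n. sqrt_coeff i * sqrt_coeff (n - i)) =
      (- 1) ^ n * (\<Sum>i\<le>n. ((1/2) gchoose i) * ((1/2) gchoose (n - i)))"
    by (simp add: sum_distrib_left)
  also have "\<dots> = (- 1) ^ n * ((1 :: real) gchoose n)"
    using gbinomial_Vandermonde[of "1/2 :: real" "1/2" n] by (simp add: atLeast0AtMost)
  also have "(1 :: real) gchoose n = of_nat (1 choose n)"
    using binomial_gbinomial[of 1 n, where 'a = real] by simp
  finally show ?thesis by (cases n) (auto simp: binomial_eq_0)
qed

text \<open>Regrouping by n = j + k. With \<open>c n\<close> = <B^n h, y> the left side is the
  iterated series for <h, R (R y)>. The bound M and the absolute summability of b make the double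
  series absolutely summable.\<close>

lemma infsum_Cauchy_product_shift:
  fixes b :: "nat \<Rightarrow> real" and c :: "nat \<Rightarrow> complex"
  assumes b: "summable (\<lambda>k. \<bar>b k\<bar>)" and c: "\<And>n. cmod (c n) \<le> M"
  shows "(\<Sum>\<^sub>\<infinity>j. of_real (b j) * (\<Sum>\<^sub>\<infinity>k. of_real (b k) * c (j + k)))
    = (\<Sum>\<^sub>\<infinity>n. of_real (\<Sum>i\<le>n. b i * b (n - i)) * c n)"
proof -
  define f where "f = (\<lambda>(j, k). of_real (b j * b k) * c (j + k))"
  have M: "M \<ge> 0" using c[of 0] norm_ge_zero order_trans by blast
  have bs: "(\<lambda>k. \<bar>b k\<bar>) summable_on UNIV" using b by (rule summable_nonneg_imp_summable_on) auto
  have "(\<lambda>(j, k). \<bar>b j\<bar> * (M * \<bar>b k\<bar>)) summable_on UNIV \<times> UNIV"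
    by (rule summable_on_SigmaI[where g = "\<lambda>j. \<bar>b j\<bar> * (M * (\<Sum>\<^sub>\<infinity>k. \<bar>b k\<bar>))"])
      (use bs M in \<open>auto intro!: has_sum_cmult_right summable_on_cmult_left\<close>)
  then have "(\<lambda>p. norm (f p)) summable_on UNIV \<times> UNIV"
  proof (rule Infinite_Sum.abs_summable_on_comparison_test')
    fix p :: "nat \<times> nat"
    show "norm (f p) \<le> (case p of (j, k) \<Rightarrow> \<bar>b j\<bar> * (M * \<bar>b k\<bar>))"
      using mult_left_mono[OF c, of "\<bar>b (fst p)\<bar> * \<bar>b (snd p)\<bar>" "fst p + snd p"]
      by (auto simp: f_def norm_mult mult_ac split: prod.splits)
  qed
  then have fs: "f summable_on UNIV \<times> UNIV" by (rule abs_summable_summable)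
  have bij: "bij_betw (\<lambda>(n, i). (i, n - i)) (Sigma UNIV (\<lambda>n :: nat. {..n})) (UNIV \<times> UNIV)"
    by (rule bij_betwI[where g = "\<lambda>(j, k). (j + k, j)"]) auto
  have fs': "(\<lambda>(n, i). f (i, n - i)) summable_on Sigma UNIV (\<lambda>n. {..n})"
    using fs summable_on_reindex_bij_betw[OF bij, of f] by (simp add: case_prod_unfold)
  have "(\<Sum>\<^sub>\<infinity>j. of_real (b j) * (\<Sum>\<^sub>\<infinity>k. of_real (b k) * c (j + k))) = (\<Sum>\<^sub>\<infinity>j. \<Sum>\<^sub>\<infinity>k. f (j, k))"
    by (simp add: f_def mult.assoc infsum_cmult_right')
  also have "\<dots> = infsum f (UNIV \<times> UNIV)" using fs by (rule infsum_Sigma_banach)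
  also have "\<dots> = infsum (\<lambda>(n, i). f (i, n - i)) (Sigma UNIV (\<lambda>n. {..n}))"
    using infsum_reindex_bij_betw[OF bij, of f] by (simp add: case_prod_unfold)
  also have "\<dots> = (\<Sum>\<^sub>\<infinity>n. \<Sum>\<^sub>\<infinity>i\<in>{..n}. f (i, n - i))"
    using infsum_Sigma_banach[OF fs'] by simp
  also have "\<dots> = (\<Sum>\<^sub>\<infinity>n. of_real (\<Sum>i\<le>n. b i * b (n - i)) * c n)"
    by (rule infsum_cong) (simp add: f_def sum_distrib_right)
  finally show ?thesis .
qed

lemma funpow_bounded_ops:
  assumes "hilbert_space H" "B \<in> bounded_ops H H"
  shows "(B ^^ k) \<in> bounded_ops H H"
proof (induction k)
  case (Suc k)
  then show ?case using bounded_ops_compose[OF assms(2) Suc assms(1,1)] by (simp add: comp_def)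
qed (simp add: bounded_ops_ident id_def)

lemma funpow_contraction:
  assumes "hilbert_space H" "B \<in> bounded_ops H H"
    "\<And>x. x \<in> hs_carrier H \<Longrightarrow> hs_norm H (B x) \<le> hs_norm H x" "x \<in> hs_carrier H"
  shows "hs_norm H ((B ^^ k) x) \<le> hs_norm H x"
proof (induction k)
  case (Suc k)
  then show ?case
    using assms(3)[of "(B ^^ k) x"] funpow_bounded_ops[OF assms(1,2), of k] assms(4)
    by (simp add: bounded_ops_mem)
qed simp

text \<open>The root is defined weakly by the binomial series, so that only scalar series occur.\<close>

lemma sqrt_one_minus:
  assumes H: "hilbert_space H" and B: "B \<in> bounded_ops H H"
    and Bn: "\<And>x. x \<in> hs_carrier H \<Longrightarrow> hs_norm H (B x) \<le> hs_norm H x"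
    and Bh: "\<And>x y. x \<in> hs_carrier H \<Longrightarrow> y \<in> hs_carrier H \<Longrightarrow> hs_inner H (B x) y = hs_inner H x (B y)"
  obtains R where "positive_op H R" "\<And>x. x \<in> hs_carrier H \<Longrightarrow> R (R x) = x - B x"
    "\<And>Z. \<lbrakk>positive_op H Z; \<And>x. x \<in> hs_carrier H \<Longrightarrow> Z (B x) = B (Z x)\<rbrakk>
      \<Longrightarrow> \<forall>x\<in>hs_carrier H. Z (R x) = R (Z x)"
proof -
  let ?b = "\<lambda>k. complex_of_real (sqrt_coeff k)"
  define g where "g x y = (\<Sum>\<^sub>\<infinity>k. ?b k * hs_inner H ((B ^^ k) x) y)" for x y
  have Bk: "(B ^^ k) \<in> bounded_ops H H" for k by (rule funpow_bounded_ops[OF H B])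
  have Bkc: "(B ^^ k) x \<in> hs_carrier H" if "x \<in> hs_carrier H" for k x using bounded_ops_mem[OF Bk that] .
  have cb: "cmod (hs_inner H ((B ^^ k) x) y) \<le> hs_norm H x * hs_norm H y"
    if "x \<in> hs_carrier H" "y \<in> hs_carrier H" for x y k
  proof -
    have "cmod (hs_inner H ((B ^^ k) x) y) \<le> hs_norm H ((B ^^ k) x) * hs_norm H y"
      using that H Bkc by (intro hs_Cauchy_Schwarz) auto
    also have "\<dots> \<le> hs_norm H x * hs_norm H y"
      using funpow_contraction[OF H B Bn that(1)] that H by (intro mult_right_mono) auto
    finally show ?thesis .
  qed
  have bs: "(\<lambda>k. \<bar>sqrt_coeff k\<bar>) summable_on UNIV"
    using sqrt_coeff_abs_summable by (rule summable_nonneg_imp_summable_on) auto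
  have abs: "(\<lambda>k. norm (?b k * hs_inner H ((B ^^ k) x) y)) summable_on UNIV"
    if "x \<in> hs_carrier H" "y \<in> hs_carrier H" for x y
    by (rule Infinite_Sum.abs_summable_on_comparison_test'[OF summable_on_cmult_left[OF bs, of "hs_norm H x * hs_norm H y"]])
      (use cb[OF that] in \<open>auto simp: norm_mult intro: mult_left_mono\<close>)
  note summ = abs_summable_summable[OF abs]
  have sum2: "(\<Sum>\<^sub>\<infinity>k. \<bar>sqrt_coeff k\<bar>) \<le> 2"
  proof -
    have "(\<Sum>\<^sub>\<infinity>k. \<bar>sqrt_coeff k\<bar>) = (\<Sum>k. \<bar>sqrt_coeff k\<bar>)"
      using sqrt_coeff_abs_summable by (intro infsumI sums_nonneg_imp_has_sum summable_sums) auto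
    also have "\<dots> \<le> 2"
      using sqrt_coeff_abs_sum by (intro LIMSEQ_le_const2[OF summable_LIMSEQ'[OF sqrt_coeff_abs_summable]]) blast
    finally show ?thesis .
  qed
  have gb: "cmod (g x y) \<le> 2 * hs_norm H x * hs_norm H y" if "x \<in> hs_carrier H" "y \<in> hs_carrier H" for x y
  proof -
    have "cmod (g x y) \<le> (\<Sum>\<^sub>\<infinity>k. norm (?b k * hs_inner H ((B ^^ k) x) y))"
      unfolding g_def by (rule norm_infsum_bound[OF abs[OF that]])
    also have "\<dots> \<le> (\<Sum>\<^sub>\<infinity>k. \<bar>sqrt_coeff k\<bar> * (hs_norm H x * hs_norm H y))"
      by (rule infsum_mono[OF abs[OF that] summable_on_cmult_left[OF bs]])
        (use cb[OF that] in \<open>auto simp: norm_mult intro: mult_left_mono\<close>)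
    also have "\<dots> = (\<Sum>\<^sub>\<infinity>k. \<bar>sqrt_coeff k\<bar>) * (hs_norm H x * hs_norm H y)"
      by (rule infsum_cmult_left')
    also have "\<dots> \<le> 2 * (hs_norm H x * hs_norm H y)"
      using sum2 that H by (intro mult_right_mono) auto
    finally show ?thesis by simp
  qed
  obtain R where R: "R \<in> bounded_ops H H"
    "\<And>x y. \<lbrakk>x \<in> hs_carrier H; y \<in> hs_carrier H\<rbrakk> \<Longrightarrow> g x y = hs_inner H x (R y)"
  proof (rule operator_of_form[OF H H, where g = g and C = 2])
    show "g (x + x') y = g x y + g x' y"
      if "x \<in> hs_carrier H" "x' \<in> hs_carrier H" "y \<in> hs_carrier H" for x x' y
      using that H Bk Bkc summ by (simp add: g_def bounded_ops_add[OF Bk] distrib_left infsum_add)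
    show "g x (y + y') = g x y + g x y'"
      if "x \<in> hs_carrier H" "y \<in> hs_carrier H" "y' \<in> hs_carrier H" for x y y'
      using that H Bkc summ by (simp add: g_def distrib_left infsum_add)
    show "g (c *\<^sub>C x) y = c * g x y" if "x \<in> hs_carrier H" "y \<in> hs_carrier H" for c x y
      using that H Bkc by (simp add: g_def bounded_ops_scale[OF Bk] mult.left_commute[of _ c] infsum_cmult_right')
    show "g x (c *\<^sub>C y) = cnj c * g x y" if "x \<in> hs_carrier H" "y \<in> hs_carrier H" for c x y
      using that H Bkc by (simp add: g_def mult.left_commute[of _ "cnj c"] infsum_cmult_right')
  qed (use gb in auto)
  have Rc: "R x \<in> hs_carrier H" if "x \<in> hs_carrier H" for x using bounded_ops_mem[OF R(1) that] .
  have Bkh: "hs_inner H ((B ^^ k) x) y = hs_inner H x ((B ^^ k) y)"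
    if "x \<in> hs_carrier H" "y \<in> hs_carrier H" for x y k
    using that
  proof (induction k arbitrary: x)
    case (Suc k)
    have "hs_inner H ((B ^^ Suc k) x) y = hs_inner H ((B ^^ k) (B x)) y" by (simp add: funpow_swap1)
    also have "\<dots> = hs_inner H x (B ((B ^^ k) y))"
      using Suc bounded_ops_mem[OF B] Bkc Bh by simp
    finally show ?case by simp
  qed simp
  have gh: "g y x = cnj (g x y)" if "x \<in> hs_carrier H" "y \<in> hs_carrier H" for x y
    unfolding g_def infsum_cnj[symmetric]
    by (rule infsum_cong) (use that Bkc H Bkh in \<open>simp add: hs_inner_cnj\<close>)
  have pos: "positive_op H R"
    unfolding positive_op_def
  proof (intro conjI ballI R(1))
    fix x assume x: "x \<in> hs_carrier H"
    have eq: "hs_inner H (R x) x = g x x"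
      using R(2)[OF x x] gh[OF x x] hs_inner_cnj[OF H x Rc[OF x]] by simp
    show "hs_inner H (R x) x \<in> \<real>"
      using gh[OF x x] by (simp add: eq complex_is_Real_iff complex_eq_iff)
    \<comment> \<open>For k \<ge> 1 the coefficient is nonpositive and Re <B^k x, x> is at most the
      squared norm of x. So the series is at least the squared norm times the sum of all
      coefficients.\<close>
    have "0 \<le> (\<Sum>\<^sub>\<infinity>k. sqrt_coeff k * (hs_norm H x)\<^sup>2)"
    proof -
      have "(\<Sum>\<^sub>\<infinity>k. sqrt_coeff k) = (\<Sum>k. sqrt_coeff k)"
        using sqrt_coeff_abs_summable by (intro infsumI norm_summable_imp_has_sum) (auto intro: summable_sums summable_rabs_cancel)
      also have "\<dots> \<ge> 0"
      proof (rule LIMSEQ_le_const)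
        show "(\<lambda>n. \<Sum>k\<le>n. sqrt_coeff k) \<longlonglongrightarrow> (\<Sum>k. sqrt_coeff k)"
          using sqrt_coeff_abs_summable by (intro summable_LIMSEQ') (rule summable_rabs_cancel)
      qed (use sqrt_coeff_sum_nonneg in blast)
      finally show ?thesis by (simp add: infsum_cmult_left')
    qed
    also have "\<dots> \<le> (\<Sum>\<^sub>\<infinity>k. Re (?b k * hs_inner H ((B ^^ k) x) x))"
    proof (rule infsum_mono)
      show "(\<lambda>k. sqrt_coeff k * (hs_norm H x)\<^sup>2) summable_on UNIV"
        using bs by (intro summable_on_cmult_left) (simp add: summable_on_iff_abs_summable_on_real[of sqrt_coeff])
      show "(\<lambda>k. Re (?b k * hs_inner H ((B ^^ k) x) x)) summable_on UNIV"
        using summ[OF x x] by (rule summable_on_Re)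
      fix k
      have le: "Re (hs_inner H ((B ^^ k) x) x) \<le> (hs_norm H x)\<^sup>2"
        using cb[OF x x, of k] complex_Re_le_cmod[of "hs_inner H ((B ^^ k) x) x"] by (simp add: power2_eq_square)
      show "sqrt_coeff k * (hs_norm H x)\<^sup>2 \<le> Re (?b k * hs_inner H ((B ^^ k) x) x)"
      proof (cases "k = 0")
        case False
        then show ?thesis using le by (simp add: mult_left_mono_neg sqrt_coeff_nonpos)
      qed (use x H in \<open>simp add: hs_norm_sq\<close>)
    qed
    also have "\<dots> = Re (g x x)" unfolding g_def by (rule infsum_Re[OF summ[OF x x]])
    finally show "0 \<le> Re (hs_inner H (R x) x)" by (simp add: eq)
  qed
  have RR: "R (R y) = y - B y" if y: "y \<in> hs_carrier H" for y
  proof (rule hs_eq_if_inner_eq[OF H])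
    fix h assume h: "h \<in> hs_carrier H"
    have "hs_inner H h (R (R y)) = g h (R y)" using R(2)[OF h Rc[OF y]] by simp
    also have "\<dots> = (\<Sum>\<^sub>\<infinity>j. ?b j * g ((B ^^ j) h) y)"
      unfolding g_def[of h] using R(2)[OF Bkc[OF h] y] by simp
    also have "\<dots> = (\<Sum>\<^sub>\<infinity>j. ?b j * (\<Sum>\<^sub>\<infinity>k. ?b k * hs_inner H ((B ^^ (j + k)) h) y))"
    proof -
      have "(B ^^ (j + k)) h = (B ^^ k) ((B ^^ j) h)" for j k
        by (subst add.commute) (simp add: funpow_add)
      then show ?thesis by (simp add: g_def)
    qed
    also have "\<dots> = (\<Sum>\<^sub>\<infinity>n. of_real (\<Sum>i\<le>n. sqrt_coeff i * sqrt_coeff (n - i)) * hs_inner H ((B ^^ n) h) y)"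
      by (rule infsum_Cauchy_product_shift[OF sqrt_coeff_abs_summable cb[OF h y]])
    \<comment> \<open>By the convolution identity only n = 0 and n = 1 contribute.\<close>
    also have "\<dots> = (\<Sum>\<^sub>\<infinity>n\<in>{0, 1}. of_real (\<Sum>i\<le>n. sqrt_coeff i * sqrt_coeff (n - i)) * hs_inner H ((B ^^ n) h) y)"
      by (rule infsum_cong_neutral) (auto simp del: of_real_sum simp: sqrt_coeff_convolution)
    also have "\<dots> = hs_inner H h (y - B y)"
      using h y H B by (simp del: of_real_sum add: sqrt_coeff_convolution bounded_ops_mem Bh)
    finally show "hs_inner H h (R (R y)) = hs_inner H h (y - B y)" .
  qed (use that y Rc H B in \<open>auto simp: bounded_ops_mem\<close>)
  \<comment> \<open>Z commutes with every power of B, and the weak definition lets it move through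
    the series term by term. Uniqueness of the root rests on this.\<close>
  have comm: "\<forall>x\<in>hs_carrier H. Z (R x) = R (Z x)"
    if Z: "positive_op H Z" "\<And>x. x \<in> hs_carrier H \<Longrightarrow> Z (B x) = B (Z x)" for Z
  proof
    fix x assume x: "x \<in> hs_carrier H"
    have Zc: "Z y \<in> hs_carrier H" if "y \<in> hs_carrier H" for y using positive_op_mem[OF Z(1) that] .
    have ZB: "Z ((B ^^ k) y) = (B ^^ k) (Z y)" if "y \<in> hs_carrier H" for k y
      using that by (induction k) (auto simp: Z(2) Bkc)
    show "Z (R x) = R (Z x)"
    proof (rule hs_eq_if_inner_eq[OF H])
      fix h assume h: "h \<in> hs_carrier H"
      have "hs_inner H h (Z (R x)) = hs_inner H (Z h) (R x)"
        using positive_op_adjoint[OF H Z(1) h Rc[OF x]] by simp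
      also have "\<dots> = g (Z h) x" using R(2)[OF Zc[OF h] x] by simp
      also have "\<dots> = g h (Z x)"
        unfolding g_def
        by (rule infsum_cong) (use h x Bkc positive_op_adjoint[OF H Z(1)] in \<open>simp flip: ZB\<close>)
      also have "\<dots> = hs_inner H h (R (Z x))" using R(2)[OF h Zc[OF x]] by simp
      finally show "hs_inner H h (Z (R x)) = hs_inner H h (R (Z x))" .
    qed (use x Zc Rc in auto)
  qed
  show thesis using that pos RR comm by blast
qed

section \<open>Existence and uniqueness of positive square roots\<close>

lemma positive_op_scale:
  assumes "hilbert_space H" "positive_op H A" "c \<ge> 0"
  shows "positive_op H (\<lambda>x. of_real c *\<^sub>C A x)"
  unfolding positive_op_def
proof (intro conjI ballI)
  show "(\<lambda>x. of_real c *\<^sub>C A x) \<in> bounded_ops H H"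
    using bounded_ops_scaleC[OF positive_op_bounded[OF assms(2)] assms(1,1)] .
qed (use assms positive_opD[OF assms(2)] positive_op_mem[OF assms(2)] in \<open>auto simp: complex_is_Real_iff\<close>)

lemma positive_op_cong:
  assumes "hilbert_space H" "positive_op H A" "\<And>x. x \<in> hs_carrier H \<Longrightarrow> B x = A x"
  shows "positive_op H B"
  using assms bounded_ops_cong[of A H H B] by (auto simp: positive_op_def)

text \<open>For c large enough B = I - A/c is a hermitian contraction, and \<surd>c times the root
  of I - B is a root of A.\<close>

lemma positive_sqrt_ex:
  assumes H: "hilbert_space H" and A: "positive_op H A"
  obtains R where "positive_op H R" "\<And>x. x \<in> hs_carrier H \<Longrightarrow> R (R x) = A x"
    "\<And>Z. \<lbrakk>positive_op H Z; \<And>x. x \<in> hs_carrier H \<Longrightarrow> Z (A x) = A (Z x)\<rbrakk>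
      \<Longrightarrow> \<forall>x\<in>hs_carrier H. Z (R x) = R (Z x)"
proof -
  note Ab = positive_op_bounded[OF A]
  obtain C where C: "C \<ge> 0" "\<And>x. x \<in> hs_carrier H \<Longrightarrow> hs_norm H (A x) \<le> C * hs_norm H x"
    using bounded_ops_bound[OF Ab H] by blast
  \<comment> \<open>The summand 1 keeps c positive even if C = 0; the contraction estimate for B
    uses only C \<le> 2 c.\<close>
  define c where "c = C + 1"
  have c: "c > 0" "C \<le> 2 * c" using C by (auto simp: c_def)
  define B where "B x = x - of_real (1 / c) *\<^sub>C A x" for x
  have B: "B \<in> bounded_ops H H"
    unfolding B_def by (intro bounded_ops_diff_op bounded_ops_ident bounded_ops_scaleC Ab H)
  have Ac: "A x \<in> hs_carrier H" if "x \<in> hs_carrier H" for x using bounded_ops_mem[OF Ab that] .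
  \<comment> \<open>The operator inequality A^2 \<le> C A: Cauchy-Schwarz for the form of A at x and
    A x, after cancelling one squared norm of A x.\<close>
  have A_sq: "(hs_norm H (A x))\<^sup>2 \<le> C * Re (hs_inner H (A x) x)" if x: "x \<in> hs_carrier H" for x
  proof (cases "A x = 0")
    case False
    have n: "(hs_norm H (A x))\<^sup>2 > 0" using False Ac[OF x] H by simp
    have "(cmod (hs_inner H (A x) (A x)))\<^sup>2 \<le> Re (hs_inner H (A x) x) * Re (hs_inner H (A (A x)) (A x))"
      by (rule positive_op_Cauchy_Schwarz[OF H A x Ac[OF x]])
    also have "\<dots> \<le> Re (hs_inner H (A x) x) * (C * (hs_norm H (A x))\<^sup>2)"
    proof (rule mult_left_mono)
      have "Re (hs_inner H (A (A x)) (A x)) \<le> hs_norm H (A (A x)) * hs_norm H (A x)"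
        using hs_Cauchy_Schwarz[OF H Ac[OF Ac[OF x]] Ac[OF x]]
          complex_Re_le_cmod[of "hs_inner H (A (A x)) (A x)"] by linarith
      also have "\<dots> \<le> C * hs_norm H (A x) * hs_norm H (A x)"
        using C(2)[OF Ac[OF x]] Ac[OF x] H by (intro mult_right_mono) auto
      finally show "Re (hs_inner H (A (A x)) (A x)) \<le> C * (hs_norm H (A x))\<^sup>2"
        by (simp add: power2_eq_square mult.assoc)
    qed (use positive_opD[OF A x] in auto)
    finally have "(hs_norm H (A x))\<^sup>2 * (hs_norm H (A x))\<^sup>2 \<le> C * Re (hs_inner H (A x) x) * (hs_norm H (A x))\<^sup>2"
      using hs_inner_self[OF H Ac[OF x]] by (simp add: power2_eq_square norm_mult mult_ac)
    then show ?thesis by (rule mult_right_le_imp_le[OF _ n])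
  qed (use H x positive_opD[OF A x] C in simp)
  have Bn: "hs_norm H (B x) \<le> hs_norm H x" if x: "x \<in> hs_carrier H" for x
  proof (rule power2_le_imp_le)
    define a where "a = Re (hs_inner H (A x) x)"
    have a: "a \<ge> 0" using positive_opD[OF A x] by (simp add: a_def)
    have "Re (hs_inner H x (A x)) = a" using positive_op_adjoint[OF H A x x] by (simp add: a_def)
    then have "(hs_norm H (B x))\<^sup>2 = (hs_norm H x)\<^sup>2 - 2 * a / c + (hs_norm H (A x))\<^sup>2 / c\<^sup>2"
      using x Ac[OF x] H c by (simp add: B_def hs_norm_diff_sq power_mult_distrib power_divide
          del: of_real_divide)
    also have "\<dots> \<le> (hs_norm H x)\<^sup>2 - 2 * a / c + C * a / c\<^sup>2"
      using A_sq[OF x] c by (simp add: a_def divide_right_mono)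
    also have "\<dots> \<le> (hs_norm H x)\<^sup>2"
    proof -
      have "C * a / c\<^sup>2 \<le> 2 * c * a / c\<^sup>2" using c a by (intro divide_right_mono mult_right_mono) auto
      then show ?thesis using c by (simp add: power2_eq_square)
    qed
    finally show "(hs_norm H (B x))\<^sup>2 \<le> (hs_norm H x)\<^sup>2" .
  qed (use x H in auto)
  have Bh: "hs_inner H (B x) y = hs_inner H x (B y)" if "x \<in> hs_carrier H" "y \<in> hs_carrier H" for x y
    using that H Ac positive_op_adjoint[OF H A that] by (simp add: B_def)
  obtain Q where Q: "positive_op H Q" "\<And>x. x \<in> hs_carrier H \<Longrightarrow> Q (Q x) = x - B x"
    "\<And>Z. \<lbrakk>positive_op H Z; \<And>x. x \<in> hs_carrier H \<Longrightarrow> Z (B x) = B (Z x)\<rbrakk>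
      \<Longrightarrow> \<forall>x\<in>hs_carrier H. Z (Q x) = Q (Z x)"
    using sqrt_one_minus[OF H B Bn Bh] by blast
  define R where "R x = of_real (sqrt c) *\<^sub>C Q x" for x
  have "positive_op H R"
    unfolding R_def by (intro positive_op_scale H Q(1)) (use c in auto)
  moreover have "R (R x) = A x" if x: "x \<in> hs_carrier H" for x
  proof -
    have cc: "complex_of_real (sqrt c) * complex_of_real (sqrt c) = complex_of_real c"
      using c by (simp flip: of_real_mult)
    have "R (R x) = (complex_of_real (sqrt c) * complex_of_real (sqrt c)) *\<^sub>C Q (Q x)"
      using positive_op_mem[OF Q(1) x] by (simp add: R_def bounded_ops_scale[OF positive_op_bounded[OF Q(1)]] scaleC_scaleC)
    also have "\<dots> = A x"
      using c by (simp add: cc Q(2)[OF x] B_def scaleC_scaleC scaleC_one)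
    finally show ?thesis .
  qed
  moreover have "\<forall>x\<in>hs_carrier H. Z (R x) = R (Z x)"
    if Z: "positive_op H Z" "\<And>x. x \<in> hs_carrier H \<Longrightarrow> Z (A x) = A (Z x)" for Z
  proof -
    note Zb = positive_op_bounded[OF Z(1)]
    have "Z (B x) = B (Z x)" if "x \<in> hs_carrier H" for x
      using that H Ac[OF that] Z(2) by (simp add: B_def bounded_ops_diff[OF Zb] bounded_ops_scale[OF Zb])
    from Q(3)[OF Z(1) this] show ?thesis
      using positive_op_mem[OF Q(1)] by (auto simp: R_def bounded_ops_scale[OF Zb])
  qed
  ultimately show thesis using that by blast
qed

text \<open>With D = R - S, commutation gives (R + S) D = R^2 - S^2 = 0. The forms of R and S at D x
  are nonnegative with sum 0, so R D = S D = 0. Then D^2 = 0, and D is self-adjoint.\<close>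

lemma positive_sqrt_unique:
  assumes H: "hilbert_space H" and A: "positive_op H A"
    and R: "positive_op H R" "\<And>x. x \<in> hs_carrier H \<Longrightarrow> R (R x) = A x"
    and S: "positive_op H S" "\<And>x. x \<in> hs_carrier H \<Longrightarrow> S (S x) = A x"
    and comm: "\<And>x. x \<in> hs_carrier H \<Longrightarrow> S (R x) = R (S x)"
    and x: "x \<in> hs_carrier H"
  shows "R x = S x"
proof -
  note Rb = positive_op_bounded[OF R(1)] and Sb = positive_op_bounded[OF S(1)]
  note Rc = bounded_ops_mem[OF Rb] and Sc = bounded_ops_mem[OF Sb]
  define D where "D x = R x - S x" for x
  have D: "D \<in> bounded_ops H H" unfolding D_def by (intro bounded_ops_diff_op Rb Sb H)
  note Dc = bounded_ops_mem[OF D]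
  have Dh: "hs_inner H (D x) y = hs_inner H x (D y)" if "x \<in> hs_carrier H" "y \<in> hs_carrier H" for x y
    using that H Rc Sc positive_op_adjoint[OF H R(1) that] positive_op_adjoint[OF H S(1) that] by (simp add: D_def)
  have RS: "R (D x) + S (D x) = 0" if "x \<in> hs_carrier H" for x
    using that H Rc Sc R(2) S(2) comm by (simp add: D_def bounded_ops_diff[OF Rb] bounded_ops_diff[OF Sb])
  have RSD: "R (D x) = 0" "S (D x) = 0" if "x \<in> hs_carrier H" for x
  proof -
    have "hs_inner H (R (D x)) (D x) + hs_inner H (S (D x)) (D x) = hs_inner H (R (D x) + S (D x)) (D x)"
      using that Rc Sc Dc H by simp
    also have "\<dots> = 0" using RS[OF that] Dc[OF that] H by simp
    finally have s: "hs_inner H (R (D x)) (D x) + hs_inner H (S (D x)) (D x) = 0" .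
    then have "Re (hs_inner H (R (D x)) (D x)) + Re (hs_inner H (S (D x)) (D x)) = 0"
      by (simp flip: plus_complex.simps(1))
    then have "Re (hs_inner H (R (D x)) (D x)) = 0" "Re (hs_inner H (S (D x)) (D x)) = 0"
      using positive_opD(2)[OF R(1) Dc[OF that]] positive_opD(2)[OF S(1) Dc[OF that]] by linarith+
    then show "R (D x) = 0" "S (D x) = 0"
      using positive_op_inner_zero[OF H R(1) Dc[OF that]] positive_op_inner_zero[OF H S(1) Dc[OF that]] by auto
  qed
  have "hs_inner H (D x) (D x) = hs_inner H x (D (D x))" using Dh[OF x Dc[OF x]] .
  also have "D (D x) = 0" using RSD[OF x] by (simp add: D_def)
  finally have "D x = 0" using hs_inner_self_pos[OF H Dc[OF x]] x H by fastforce
  then show ?thesis by (simp add: D_def)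
qed

text \<open>Any candidate Z of the description commutes with its own square A, hence with the root Q
  constructed from A, so uniqueness among commuting roots applies.\<close>

lemma op_sqrt:
  assumes H: "hilbert_space H" and A: "positive_op H A"
  shows "positive_op H (op_sqrt H A)" "x \<in> hs_carrier H \<Longrightarrow> op_sqrt H A (op_sqrt H A x) = A x"
proof -
  obtain Q where Q: "positive_op H Q" "\<And>x. x \<in> hs_carrier H \<Longrightarrow> Q (Q x) = A x"
    "\<And>Z. \<lbrakk>positive_op H Z; \<And>x. x \<in> hs_carrier H \<Longrightarrow> Z (A x) = A (Z x)\<rbrakk>
      \<Longrightarrow> \<forall>x\<in>hs_carrier H. Z (Q x) = Q (Z x)"
    using positive_sqrt_ex[OF H A] by blast
  define R where "R x = (if x \<in> hs_carrier H then Q x else 0)" for x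
  let ?P = "\<lambda>R. positive_op H R \<and> (\<forall>x\<in>hs_carrier H. R (R x) = A x) \<and> (\<forall>x. x \<notin> hs_carrier H \<longrightarrow> R x = 0)"
  have PR: "?P R"
    using positive_op_cong[OF H Q(1), of R] Q(2) positive_op_mem[OF Q(1)] by (auto simp: R_def)
  moreover have "Z = R" if Z: "?P Z" for Z
  proof
    fix x
    show "Z x = R x"
    proof (cases "x \<in> hs_carrier H")
      case True
      have "Z (A x) = A (Z x)" if "x \<in> hs_carrier H" for x
        using Z that positive_op_mem[of H Z x] by metis
      then have ZQ: "\<forall>x\<in>hs_carrier H. Z (Q x) = Q (Z x)" using Q(3) Z by blast
      have "Q x = Z x"
        by (rule positive_sqrt_unique[OF H A Q(1,2)]) (use Z ZQ True in auto)
      then show ?thesis using True by (simp add: R_def)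
    qed (use Z in \<open>simp add: R_def\<close>)
  qed
  ultimately have "op_sqrt H A = R" unfolding op_sqrt_def by (intro the_equality)
  with PR show "positive_op H (op_sqrt H A)" "x \<in> hs_carrier H \<Longrightarrow> op_sqrt H A (op_sqrt H A x) = A x" by auto
qed

lemma op_sqrt_inner:
  assumes H: "hilbert_space H" and A: "positive_op H A" and xy: "x \<in> hs_carrier H" "y \<in> hs_carrier H"
  shows "hs_inner H (op_sqrt H A x) (op_sqrt H A y) = hs_inner H (A x) y"
proof -
  note R = op_sqrt[OF H A]
  show ?thesis
    using positive_op_adjoint[OF H R(1) positive_op_mem[OF R(1) xy(1)] xy(2)] R(2)[OF xy(1)] by simp
qed

lemma closed_range_simps [simp]:
  "hs_carrier (closed_range H A) = hs_closure H (A ` hs_carrier H)"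
  "hs_inner (closed_range H A) = hs_inner H" "hs_norm (closed_range H A) = hs_norm H"
  by (simp_all add: closed_range_def)

lemma
  assumes H: "hilbert_space H" and A: "A \<in> bounded_ops H H"
  shows hilbert_space_closed_range: "hilbert_space (closed_range H A)"
    and closed_range_mem: "x \<in> hs_carrier H \<Longrightarrow> A x \<in> hs_closure H (A ` hs_carrier H)"
proof -
  have sub: "A ` hs_carrier H \<subseteq> hs_carrier H" using bounded_ops_mem[OF A] by auto
  have cl: "closed_subspace H (hs_closure H (A ` hs_carrier H))"
    by (rule closed_subspace_closure[OF H sub bounded_ops_image_linear[OF A H hs_carrier_linear[OF H] order_refl]])
  show "hilbert_space (closed_range H A)"
    unfolding closed_range_def by (rule hilbert_space_sub[OF H cl])
  show "x \<in> hs_carrier H \<Longrightarrow> A x \<in> hs_closure H (A ` hs_carrier H)"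
    using hs_closure_incl[OF H sub] by auto
qed


section \<open>Isometric embeddings\<close>

lemma hs_inner_orthogonal_sum:
  assumes "hilbert_space H" "a \<in> hs_carrier H" "b \<in> hs_carrier H" "c \<in> hs_carrier H" "d \<in> hs_carrier H"
    and "hs_inner H a d = 0" "hs_inner H b c = 0"
  shows "hs_inner H (a + b) (c + d) = hs_inner H a c + hs_inner H b d"
  using assms by simp

lemma hs_proj_add_scale:
  assumes H: "hilbert_space H" and V: "closed_subspace H V" and x: "x \<in> hs_carrier H" "y \<in> hs_carrier H"
  shows "hs_proj H V (x + y) = hs_proj H V x + hs_proj H V y"
    and "hs_proj H V (c *\<^sub>C x) = c *\<^sub>C hs_proj H V x"
proof -
  note V' = closed_subspaceD[OF V]
  have c: "hs_proj H V x \<in> hs_carrier H" "hs_proj H V y \<in> hs_carrier H"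
    using hs_proj(1)[OF H V] x V' by auto
  have vc: "v \<in> hs_carrier H" if "v \<in> V" for v using that V' by auto
  show "hs_proj H V (x + y) = hs_proj H V x + hs_proj H V y"
  proof (rule hs_proj_unique[OF H V'(1,2)])
    fix v assume v: "v \<in> V"
    show "hs_inner H (x + y - (hs_proj H V x + hs_proj H V y)) v = 0"
      using hs_proj(3)[OF H V x(1) v] hs_proj(3)[OF H V x(2) v] x c vc[OF v] H by simp
  qed (use x H hs_proj(1)[OF H V] V' in \<open>auto intro: linear_subset_add\<close>)
  show "hs_proj H V (c *\<^sub>C x) = c *\<^sub>C hs_proj H V x"
  proof (rule hs_proj_unique[OF H V'(1,2)])
    fix v assume v: "v \<in> V"
    have "hs_inner H (c *\<^sub>C x - c *\<^sub>C hs_proj H V x) v = c * hs_inner H (x - hs_proj H V x) v"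
      using x c vc[OF v] H by (simp add: right_diff_distrib)
    then show "hs_inner H (c *\<^sub>C x - c *\<^sub>C hs_proj H V x) v = 0"
      using hs_proj(3)[OF H V x(1) v] by simp
  qed (use x H hs_proj(1)[OF H V] V' in \<open>auto intro: linear_subset_scale\<close>)
qed

lemma hs_proj_inner:
  assumes H: "hilbert_space H" and V: "closed_subspace H V" and x: "x \<in> hs_carrier H" and v: "v \<in> V"
  shows "hs_inner H (hs_proj H V x) v = hs_inner H x v"
  using hs_proj(1,3)[OF H V x] v closed_subspaceD(1)[OF V] H x by (auto simp: subset_iff)

lemma hs_proj_bounded:
  assumes H: "hilbert_space H" and V: "closed_subspace H V"
  shows "hs_proj H V \<in> bounded_ops H (hs_sub H V)"
proof (rule bounded_opsI[where C = 1])
  fix x assume x: "x \<in> hs_carrier H"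
  let ?p = "hs_proj H V x"
  have p: "?p \<in> hs_carrier H" "x - ?p \<in> hs_carrier H"
    using hs_proj(1)[OF H V x] closed_subspaceD(1)[OF V] x H by auto
  have "(hs_norm H (?p + (x - ?p)))\<^sup>2 = (hs_norm H ?p)\<^sup>2 + (hs_norm H (x - ?p))\<^sup>2"
    using hs_norm_add_sq[OF H p] hs_proj(4)[OF H V x hs_proj(1)[OF H V x]] by simp
  then have "(hs_norm H ?p)\<^sup>2 \<le> (hs_norm H x)\<^sup>2" by simp
  then show "hs_norm (hs_sub H V) ?p \<le> 1 * hs_norm H x"
    using x H by (auto intro: power2_le_imp_le)
qed (use hs_proj(1)[OF H V] hs_proj_add_scale[OF H V] in auto)

text \<open>Isometric embeddability stands in for the comparison of Hilbert space dimensions, so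
  that no orthonormal bases have to be chosen.\<close>

definition embeds :: "'a::complex_vector hspace \<Rightarrow> 'b::complex_vector hspace \<Rightarrow> bool" (infix "\<lesssim>\<^sub>H" 50) where
  "H \<lesssim>\<^sub>H K \<longleftrightarrow> (\<exists>A. isometry_op H K A)"

lemma isometry_op_compose:
  assumes "isometry_op K L B" "isometry_op H K A" "hilbert_space H" "hilbert_space K"
  shows "isometry_op H L (\<lambda>x. B (A x))"
proof -
  note A = isometry_opD[OF assms(2)] and B = isometry_opD[OF assms(1)]
  show ?thesis
    unfolding isometry_op_def
  proof (intro conjI ballI)
    show "(\<lambda>x. B (A x)) \<in> bounded_ops H L" by (rule bounded_ops_compose[OF B(1) A(1) assms(3,4)])
  qed (use A(2) B(2) bounded_ops_mem[OF A(1)] in simp)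
qed

lemma embeds_trans [trans]:
  "H \<lesssim>\<^sub>H K \<Longrightarrow> K \<lesssim>\<^sub>H L \<Longrightarrow> hilbert_space H \<Longrightarrow> hilbert_space K \<Longrightarrow> H \<lesssim>\<^sub>H L"
  unfolding embeds_def using isometry_op_compose by blast

lemma embeds_sub: "V \<subseteq> hs_carrier H \<Longrightarrow> hs_sub H V \<lesssim>\<^sub>H H"
  unfolding embeds_def by (rule exI[of _ "\<lambda>x. x"]) (auto intro!: isometry_opI)

lemma embeds_sum_mono:
  assumes "H \<lesssim>\<^sub>H H'" "K \<lesssim>\<^sub>H K'"
  shows "hs_sum H K \<lesssim>\<^sub>H hs_sum H' K'"
proof -
  obtain A B where A: "isometry_op H H' A" and B: "isometry_op K K' B"
    using assms by (auto simp: embeds_def)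
  note A' = isometry_opD[OF A] and B' = isometry_opD[OF B]
  have "isometry_op (hs_sum H K) (hs_sum H' K') (\<lambda>p. (A (fst p), B (snd p)))"
    by (rule isometry_opI)
      (auto simp: bounded_ops_mem[OF A'(1)] bounded_ops_mem[OF B'(1)] bounded_ops_add[OF A'(1)]
        bounded_ops_add[OF B'(1)] bounded_ops_scale[OF A'(1)] bounded_ops_scale[OF B'(1)] A'(2) B'(2))
  then show ?thesis by (auto simp: embeds_def)
qed

lemma embeds_pow_mono:
  assumes "H \<lesssim>\<^sub>H K"
  shows "(hs_pow H :: ('i::finite \<Rightarrow> _) hspace) \<lesssim>\<^sub>H (hs_pow K :: ('i \<Rightarrow> _) hspace)"
proof -
  obtain A where A: "isometry_op H K A" using assms by (auto simp: embeds_def)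
  note A' = isometry_opD[OF A]
  have "isometry_op (hs_pow H :: ('i::finite \<Rightarrow> _) hspace) (hs_pow K) (\<lambda>v i. A (v i))"
    by (rule isometry_opI)
      (auto simp: bounded_ops_mem[OF A'(1)] bounded_ops_add[OF A'(1)] bounded_ops_scale[OF A'(1)] A'(2))
  then show ?thesis by (auto simp: embeds_def)
qed

lemma isometry_inl: "hilbert_space H \<Longrightarrow> hilbert_space K \<Longrightarrow> isometry_op H (hs_sum H K) (\<lambda>x. (x, 0))"
  by (rule isometry_opI) auto

lemma isometry_inr: "hilbert_space H \<Longrightarrow> hilbert_space K \<Longrightarrow> isometry_op K (hs_sum H K) (\<lambda>x. (0, x))"
  by (rule isometry_opI) auto

lemma isometry_pow_single:
  assumes "hilbert_space H"
  shows "isometry_op H (hs_pow H) (\<lambda>x i. if i = i0 then x else 0)"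
proof (rule isometry_opI)
  fix x y assume "x \<in> hs_carrier H" "y \<in> hs_carrier H"
  have "(\<Sum>i\<in>UNIV. hs_inner H (if i = i0 then x else 0) (if i = i0 then y else 0))
      = (\<Sum>i\<in>UNIV. if i = i0 then hs_inner H x y else 0)"
    using assms by (intro sum.cong) auto
  then show "hs_inner (hs_pow H) (\<lambda>i. if i = i0 then x else 0) (\<lambda>i. if i = i0 then y else 0) = hs_inner H x y"
    by simp
qed (use assms in \<open>auto simp: fun_eq_iff\<close>)

lemma bounded_ops_pair:
  assumes H: "hilbert_space H" and K: "hilbert_space K" and L: "hilbert_space L"
    and A: "A \<in> bounded_ops H K" and B: "B \<in> bounded_ops H L"
  shows "(\<lambda>x. (A x, B x)) \<in> bounded_ops H (hs_sum K L)"
proof -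
  have "(\<lambda>x. (A x, 0) + (0, B x)) \<in> bounded_ops H (hs_sum K L)"
    by (intro bounded_ops_plus bounded_ops_compose[OF isometry_opD(1)[OF isometry_inl[OF K L]] A]
        bounded_ops_compose[OF isometry_opD(1)[OF isometry_inr[OF K L]] B] H K L hilbert_space_sum)
  then show ?thesis by simp
qed

lemma bounded_ops_fst: "hilbert_space K \<Longrightarrow> hilbert_space L \<Longrightarrow> fst \<in> bounded_ops (hs_sum K L) K"
  by (rule bounded_opsI[where C = 1]) (auto simp: hs_norm_sum_eq intro!: real_le_rsqrt)

lemma bounded_ops_snd: "hilbert_space K \<Longrightarrow> hilbert_space L \<Longrightarrow> snd \<in> bounded_ops (hs_sum K L) L"
  by (rule bounded_opsI[where C = 1]) (auto simp: hs_norm_sum_eq intro!: real_le_rsqrt)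

lemma hs_norm_fst_le: "\<lbrakk>hilbert_space K; hilbert_space L; p \<in> hs_carrier (hs_sum K L)\<rbrakk>
    \<Longrightarrow> hs_norm K (fst p) \<le> hs_norm (hs_sum K L) p"
  and hs_norm_snd_le: "\<lbrakk>hilbert_space K; hilbert_space L; p \<in> hs_carrier (hs_sum K L)\<rbrakk>
    \<Longrightarrow> hs_norm L (snd p) \<le> hs_norm (hs_sum K L) p"
  by (auto simp: hs_norm_sum_eq intro!: real_le_rsqrt)

lemma embeds_inl: "hilbert_space H \<Longrightarrow> hilbert_space K \<Longrightarrow> H \<lesssim>\<^sub>H hs_sum H K"
  and embeds_inr: "hilbert_space H \<Longrightarrow> hilbert_space K \<Longrightarrow> K \<lesssim>\<^sub>H hs_sum H K"
  unfolding embeds_def using isometry_inl isometry_inr by blast+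

text \<open>Turns a binary sum into a finite power, so that \<open>embeds_pow_ell2\<close> covers
  both.\<close>

lemma embeds_sum_pow_bool: "hilbert_space H \<Longrightarrow> hs_sum H H \<lesssim>\<^sub>H (hs_pow H :: (bool \<Rightarrow> _) hspace)"
  unfolding embeds_def
  by (rule exI[of _ "\<lambda>p i. if i then fst p else snd p"], rule isometry_opI)
    (auto simp: UNIV_bool fun_eq_iff add.commute)


section \<open>Square-summable sequences\<close>

text \<open>The model for the auxiliary space: it contains copies of all its finite powers, which is
  what lets it absorb the defects of an isometry between sums and powers.\<close>

definition ell2 :: "'a::complex_vector hspace \<Rightarrow> (nat \<Rightarrow> 'a) hspace" where
  "ell2 G = \<lparr>hs_carrier = {a. (\<forall>t. a t \<in> hs_carrier G) \<and> (\<lambda>t. (hs_norm G (a t))\<^sup>2) summable_on UNIV},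
     hs_inner = (\<lambda>a b. \<Sum>\<^sub>\<infinity>t. hs_inner G (a t) (b t))\<rparr>"

lemma ell2_simps:
  "a \<in> hs_carrier (ell2 G) \<longleftrightarrow>
     (\<forall>t. a t \<in> hs_carrier G) \<and> (\<lambda>t. (hs_norm G (a t))\<^sup>2) summable_on UNIV"
  "hs_inner (ell2 G) a b = (\<Sum>\<^sub>\<infinity>t. hs_inner G (a t) (b t))"
  by (simp_all add: ell2_def)

lemma ell2_inner_summable:
  assumes G: "hilbert_space G" and ab: "a \<in> hs_carrier (ell2 G)" "b \<in> hs_carrier (ell2 G)"
  shows "(\<lambda>t. norm (hs_inner G (a t) (b t))) summable_on UNIV"
    and "(\<lambda>t. hs_inner G (a t) (b t)) summable_on UNIV"
proof -
  show "(\<lambda>t. norm (hs_inner G (a t) (b t))) summable_on UNIV"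
  proof (rule Infinite_Sum.abs_summable_on_comparison_test')
    show "(\<lambda>t. (hs_norm G (a t))\<^sup>2 + (hs_norm G (b t))\<^sup>2) summable_on UNIV"
      using ab by (intro summable_on_add) (auto simp: ell2_simps)
    fix t
    have "cmod (hs_inner G (a t) (b t)) \<le> hs_norm G (a t) * hs_norm G (b t)"
      using ab by (intro hs_Cauchy_Schwarz[OF G]) (auto simp: ell2_simps)
    also have "\<dots> \<le> (hs_norm G (a t))\<^sup>2 + (hs_norm G (b t))\<^sup>2"
      using sum_squares_bound[of "hs_norm G (a t)" "hs_norm G (b t)"]
        zero_le_power2[of "hs_norm G (a t)"] zero_le_power2[of "hs_norm G (b t)"] by linarith
    finally show "norm (hs_inner G (a t) (b t)) \<le> (hs_norm G (a t))\<^sup>2 + (hs_norm G (b t))\<^sup>2" .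
  qed
  then show "(\<lambda>t. hs_inner G (a t) (b t)) summable_on UNIV" by (rule abs_summable_summable)
qed

lemma ell2_Re_inner:
  assumes G: "hilbert_space G" and a: "a \<in> hs_carrier (ell2 G)"
  shows "Re (hs_inner (ell2 G) a a) = (\<Sum>\<^sub>\<infinity>t. (hs_norm G (a t))\<^sup>2)"
proof -
  have "Re (hs_inner (ell2 G) a a) = (\<Sum>\<^sub>\<infinity>t. Re (hs_inner G (a t) (a t)))"
    unfolding ell2_simps by (rule infsum_Re[symmetric, OF ell2_inner_summable(2)[OF G a a]])
  also have "\<dots> = (\<Sum>\<^sub>\<infinity>t. (hs_norm G (a t))\<^sup>2)"
    using a G by (intro infsum_cong) (auto simp: ell2_simps hs_norm_sq)
  finally show ?thesis .
qed

lemma ell2_norm_sq: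
  assumes G: "hilbert_space G" and a: "a \<in> hs_carrier (ell2 G)"
  shows "(hs_norm (ell2 G) a)\<^sup>2 = (\<Sum>\<^sub>\<infinity>t. (hs_norm G (a t))\<^sup>2)" "0 \<le> hs_norm (ell2 G) a"
  using ell2_Re_inner[OF assms] infsum_nonneg[of UNIV "\<lambda>t. (hs_norm G (a t))\<^sup>2"]
  by (simp_all add: hs_norm_def[of "ell2 G"])

lemma ell2_finite_sum_le:
  assumes G: "hilbert_space G" and a: "a \<in> hs_carrier (ell2 G)" and F: "finite F"
  shows "(\<Sum>t\<in>F. (hs_norm G (a t))\<^sup>2) \<le> (hs_norm (ell2 G) a)\<^sup>2"
  unfolding ell2_norm_sq[OF G a]
  using a F by (intro finite_sum_le_infsum) (auto simp: ell2_simps)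

lemma ell2_linear:
  assumes G: "hilbert_space G"
  shows "linear_subset (hs_carrier (ell2 G))"
  unfolding linear_subset_def
proof (intro conjI ballI allI)
  show "0 \<in> hs_carrier (ell2 G)" using G by (simp add: ell2_simps)
next
  fix a b assume ab: "a \<in> hs_carrier (ell2 G)" "b \<in> hs_carrier (ell2 G)"
  have "(\<lambda>t. (hs_norm G ((a + b) t))\<^sup>2) summable_on UNIV"
  proof (rule summable_on_comparison_test)
    show "(\<lambda>t. 2 * (hs_norm G (a t))\<^sup>2 + 2 * (hs_norm G (b t))\<^sup>2) summable_on UNIV"
      using ab by (intro summable_on_add summable_on_cmult_right) (auto simp: ell2_simps)
  qed (use ab G hs_parallelogram_le[OF G] in \<open>auto simp: ell2_simps\<close>)
  then show "a + b \<in> hs_carrier (ell2 G)" using ab G by (auto simp: ell2_simps)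
next
  fix c a assume a: "a \<in> hs_carrier (ell2 G)"
  have "(\<lambda>t. (hs_norm G ((c *\<^sub>C a) t))\<^sup>2) summable_on UNIV \<longleftrightarrow>
      (\<lambda>t. (cmod c)\<^sup>2 * (hs_norm G (a t))\<^sup>2) summable_on UNIV"
    using a G by (intro summable_on_cong) (auto simp: ell2_simps power_mult_distrib)
  then show "c *\<^sub>C a \<in> hs_carrier (ell2 G)"
    using a G by (auto simp: ell2_simps intro: summable_on_cmult_right)
qed

lemma hilbert_space_ell2 [simp]:
  fixes G :: "'a::complex_vector hspace"
  assumes G: "hilbert_space G"
  shows "hilbert_space (ell2 G)"
  unfolding hilbert_space_def
proof (intro conjI ballI allI impI)
  note lin = ell2_linear[OF G]
  note summ = ell2_inner_summable(2)[OF G]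
  have c: "a t \<in> hs_carrier G" if "a \<in> hs_carrier (ell2 G)" for a t using that by (auto simp: ell2_simps)
  show "linear_subset (hs_carrier (ell2 G))" by (rule lin)
  show "hs_inner (ell2 G) (x + y) z = hs_inner (ell2 G) x z + hs_inner (ell2 G) y z"
    if "x \<in> hs_carrier (ell2 G)" "y \<in> hs_carrier (ell2 G)" "z \<in> hs_carrier (ell2 G)" for x y z
    using that summ c G by (simp add: ell2_simps(2) infsum_add)
  show "hs_inner (ell2 G) (k *\<^sub>C x) y = k * hs_inner (ell2 G) x y"
    if "x \<in> hs_carrier (ell2 G)" "y \<in> hs_carrier (ell2 G)" for k x y
    using that c G by (simp add: ell2_simps(2) infsum_cmult_right')
  show "hs_inner (ell2 G) y x = cnj (hs_inner (ell2 G) x y)"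
    if "x \<in> hs_carrier (ell2 G)" "y \<in> hs_carrier (ell2 G)" for x y
    using that c G by (simp add: ell2_simps(2) hs_inner_cnj flip: infsum_cnj)
  show "0 < Re (hs_inner (ell2 G) x x)" if x: "x \<in> hs_carrier (ell2 G)" "x \<noteq> 0" for x
  proof -
    obtain t where t: "x t \<noteq> 0" using x(2) by (auto simp: fun_eq_iff)
    have "0 < (hs_norm G (x t))\<^sup>2" using t c[OF x(1)] G by simp
    also have "\<dots> \<le> (hs_norm (ell2 G) x)\<^sup>2" using ell2_finite_sum_le[OF G x(1), of "{t}"] by simp
    also have "\<dots> = Re (hs_inner (ell2 G) x x)"
      using ell2_norm_sq(1)[OF G x(1)] ell2_Re_inner[OF G x(1)] by simp
    finally show ?thesis .
  qed
  fix s :: "nat \<Rightarrow> nat \<Rightarrow> 'a"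
  assume "(\<forall>n. s n \<in> hs_carrier (ell2 G)) \<and>
    (\<forall>\<epsilon>>0. \<exists>N. \<forall>i\<ge>N. \<forall>j\<ge>N. hs_norm (ell2 G) (s i - s j) < \<epsilon>)"
  then have s: "\<And>n. s n \<in> hs_carrier (ell2 G)"
    and cauchy: "\<And>\<epsilon>. \<epsilon> > 0 \<Longrightarrow> \<exists>N. \<forall>i\<ge>N. \<forall>j\<ge>N. hs_norm (ell2 G) (s i - s j) < \<epsilon>" by auto
  have sd: "s i - s j \<in> hs_carrier (ell2 G)" for i j using lin s by (intro linear_subset_diff)
  have le: "hs_norm G (s i t - s j t) \<le> hs_norm (ell2 G) (s i - s j)" for i j t
    using ell2_finite_sum_le[OF G sd, of "{t}" i j] ell2_norm_sq(2)[OF G sd, of i j]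
    by (auto intro: power2_le_imp_le)
  have "\<exists>x\<in>hs_carrier G. hs_lim G (\<lambda>n. s n t) x" for t
  proof (rule hs_complete[OF G, of "\<lambda>n. s n t"])
    show "\<exists>N. \<forall>i\<ge>N. \<forall>j\<ge>N. hs_norm G (s i t - s j t) < \<epsilon>" if "\<epsilon> > 0" for \<epsilon>
      using cauchy[OF that] by (meson le le_less_trans)
  qed (use c s in auto)
  then obtain x where x: "\<And>t. x t \<in> hs_carrier G" "\<And>t. hs_lim G (\<lambda>n. s n t) (x t)" by metis
  \<comment> \<open>Letting n tend to infinity in the finite partial sums gives one bound with two
    consequences: the difference is square-summable, and it is small.\<close>
  have key: "s i - x \<in> hs_carrier (ell2 G) \<and> hs_norm (ell2 G) (s i - x) \<le> \<epsilon>"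
    if \<epsilon>: "\<epsilon> > 0" and N: "\<And>j. j \<ge> N \<Longrightarrow> hs_norm (ell2 G) (s i - s j) < \<epsilon>" for \<epsilon> N i
  proof -
    have fin: "(\<Sum>t\<in>F. (hs_norm G ((s i - x) t))\<^sup>2) \<le> \<epsilon>\<^sup>2" if F: "finite F" for F
    proof (rule LIMSEQ_le_const2)
      have "(\<lambda>n. hs_norm G (s i t - s n t)) \<longlonglongrightarrow> hs_norm G (s i t - x t)" for t
      proof (rule hs_lim_norm[OF G])
        have "hs_norm G (s i t - s n t - (s i t - x t)) = hs_norm G (s n t - x t)" for n
          using hs_norm_minus_commute[OF G, of "x t" "s n t"] x(1) c[OF s] by simp
        then show "hs_lim G (\<lambda>n. s i t - s n t) (s i t - x t)"
          using x(2)[of t] by (simp add: hs_lim_def)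
      qed (use c[OF s] x G in auto)
      then show "(\<lambda>n. \<Sum>t\<in>F. (hs_norm G ((s i - s n) t))\<^sup>2) \<longlonglongrightarrow> (\<Sum>t\<in>F. (hs_norm G ((s i - x) t))\<^sup>2)"
        by (auto intro!: tendsto_sum tendsto_power)
      show "\<exists>N. \<forall>n\<ge>N. (\<Sum>t\<in>F. (hs_norm G ((s i - s n) t))\<^sup>2) \<le> \<epsilon>\<^sup>2"
      proof (intro exI allI impI)
        fix n assume "n \<ge> N"
        have "(\<Sum>t\<in>F. (hs_norm G ((s i - s n) t))\<^sup>2) \<le> (hs_norm (ell2 G) (s i - s n))\<^sup>2"
          by (rule ell2_finite_sum_le[OF G sd F])
        also have "\<dots> \<le> \<epsilon>\<^sup>2"
          using N[OF \<open>n \<ge> N\<close>] ell2_norm_sq(2)[OF G sd] by (intro power_mono) auto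
        finally show "(\<Sum>t\<in>F. (hs_norm G ((s i - s n) t))\<^sup>2) \<le> \<epsilon>\<^sup>2" .
      qed
    qed
    have "(\<lambda>t. (hs_norm G ((s i - x) t))\<^sup>2) summable_on UNIV"
      by (rule nonneg_bdd_above_summable_on) (use fin in \<open>auto intro!: bdd_aboveI\<close>)
    then have mem: "s i - x \<in> hs_carrier (ell2 G)" using c[OF s] x G by (simp add: ell2_simps)
    have "(hs_norm (ell2 G) (s i - x))\<^sup>2 \<le> \<epsilon>\<^sup>2"
      unfolding ell2_norm_sq[OF G mem]
      using mem fin by (intro infsum_le_finite_sums) (auto simp: ell2_simps)
    with mem \<epsilon> show ?thesis by (auto intro: power2_le_imp_le)
  qed
  have lim: "hs_lim (ell2 G) s x"
    unfolding hs_lim_def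
  proof (rule LIMSEQ_I)
    fix r :: real assume r: "0 < r"
    then obtain N where N: "\<And>i j. i \<ge> N \<Longrightarrow> j \<ge> N \<Longrightarrow> hs_norm (ell2 G) (s i - s j) < r / 2"
      using cauchy[of "r / 2"] by auto
    have "norm (hs_norm (ell2 G) (s i - x) - 0) < r" if "i \<ge> N" for i
      using key[of "r / 2" N i] N[OF that] r ell2_norm_sq(2)[OF G, of "s i - x"] by auto
    then show "\<exists>N. \<forall>n\<ge>N. norm (hs_norm (ell2 G) (s n - x) - 0) < r" by blast
  qed
  obtain N where N: "\<And>i j. i \<ge> N \<Longrightarrow> j \<ge> N \<Longrightarrow> hs_norm (ell2 G) (s i - s j) < 1"
    using cauchy[of 1] by auto
  \<comment> \<open>Membership of the limit: x is the difference of two members.\<close>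
  have "s N - (s N - x) \<in> hs_carrier (ell2 G)"
    by (rule linear_subset_diff[OF lin s]) (use key[of 1 N N] N in auto)
  then show "\<exists>x\<in>hs_carrier (ell2 G). hs_lim (ell2 G) s x" using lim by auto
qed

lemma ell2_single:
  assumes G: "hilbert_space G" and x: "x \<in> hs_carrier G"
  shows "(\<lambda>t. if t = t0 then x else 0) \<in> hs_carrier (ell2 G)"
proof -
  have "(\<lambda>t. (hs_norm G (if t = t0 then x else 0))\<^sup>2) summable_on UNIV"
    by (rule finite_nonzero_values_imp_summable_on, rule finite_subset[of _ "{t0}"]) (use G in auto)
  then show ?thesis using G x by (simp add: ell2_simps)
qed

lemma embeds_ell2:
  assumes G: "hilbert_space G"
  shows "G \<lesssim>\<^sub>H ell2 G"
  unfolding embeds_def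
proof (intro exI, rule isometry_opI)
  fix x y assume xy: "x \<in> hs_carrier G" "y \<in> hs_carrier G"
  have "hs_inner (ell2 G) (\<lambda>t. if t = 0 then x else 0) (\<lambda>t. if t = 0 then y else 0)
      = (\<Sum>\<^sub>\<infinity>t\<in>{0 :: nat}. hs_inner G (if t = 0 then x else 0) (if t = 0 then y else 0))"
    unfolding ell2_simps by (rule infsum_cong_neutral) (use G in auto)
  then show "hs_inner (ell2 G) (\<lambda>t. if t = 0 then x else 0) (\<lambda>t. if t = 0 then y else 0) = hs_inner G x y"
    by simp
qed (use G ell2_single in \<open>auto simp: fun_eq_iff\<close>)

text \<open>Finitely many sequences are merged into one along a bijection between pairs (index,
  position) and positions.\<close>

lemma embeds_pow_ell2:
  assumes G: "hilbert_space G"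
  shows "(hs_pow (ell2 G) :: ('i::finite \<Rightarrow> _) hspace) \<lesssim>\<^sub>H ell2 G"
proof -
  have "infinite (UNIV :: ('i \<times> nat) set)" by (simp add: finite_prod)
  moreover have "countable (UNIV :: ('i \<times> nat) set)"
    unfolding UNIV_Times_UNIV[symmetric] by (intro countable_SIGMA) (auto intro: countable_finite)
  ultimately obtain f :: "'i \<times> nat \<Rightarrow> nat" where f: "bij_betw f UNIV UNIV"
    using countableE_infinite by blast
  define e where "e = inv f"
  have e: "bij_betw e UNIV UNIV" using f by (simp add: e_def bij_betw_inv_into)
  define A where "A v t = v (fst (e t)) (snd (e t))" for v :: "'i \<Rightarrow> nat \<Rightarrow> 'a" and t
  have sum_on: "(\<lambda>(i, t). (hs_norm G (v i t))\<^sup>2) summable_on UNIV"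
    if v: "v \<in> hs_carrier (hs_pow (ell2 G))" for v :: "'i \<Rightarrow> nat \<Rightarrow> 'a"
  proof -
    have "(\<lambda>(i, t). (hs_norm G (v i t))\<^sup>2) summable_on UNIV \<times> UNIV"
      by (rule summable_on_SigmaI[where g = "\<lambda>i. \<Sum>\<^sub>\<infinity>t. (hs_norm G (v i t))\<^sup>2"])
        (use v in \<open>auto simp: ell2_simps intro!: has_sum_infsum\<close>)
    then show ?thesis by simp
  qed
  have mem: "A v \<in> hs_carrier (ell2 G)" if v: "v \<in> hs_carrier (hs_pow (ell2 G))" for v
    using summable_on_reindex_bij_betw[OF e, of "\<lambda>(i, t). (hs_norm G (v i t))\<^sup>2"] sum_on[OF v] v
    by (auto simp: A_def ell2_simps case_prod_unfold)
  have "isometry_op (hs_pow (ell2 G)) (ell2 G) A"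
  proof (rule isometry_opI)
    fix v w :: "'i \<Rightarrow> nat \<Rightarrow> 'a"
    assume v: "v \<in> hs_carrier (hs_pow (ell2 G))" and w: "w \<in> hs_carrier (hs_pow (ell2 G))"
    let ?g = "\<lambda>(i, t). hs_inner G (v i t) (w i t)"
    have "(?g \<circ> e) summable_on UNIV"
      using ell2_inner_summable(2)[OF G mem[OF v] mem[OF w]] by (simp add: A_def case_prod_unfold comp_def)
    then have "?g summable_on UNIV"
      using summable_on_reindex_bij_betw[OF e, of ?g] by (simp add: comp_def)
    then have summ: "?g summable_on UNIV \<times> UNIV" by simp
    have "hs_inner (ell2 G) (A v) (A w) = (\<Sum>\<^sub>\<infinity>t. ?g (e t))"
      by (simp add: ell2_simps A_def case_prod_unfold)
    also have "\<dots> = infsum ?g (UNIV \<times> UNIV)" using infsum_reindex_bij_betw[OF e, of ?g] by simp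
    also have "\<dots> = (\<Sum>\<^sub>\<infinity>i. \<Sum>\<^sub>\<infinity>t. hs_inner G (v i t) (w i t))"
      using infsum_Sigma_banach[OF summ] by simp
    also have "\<dots> = hs_inner (hs_pow (ell2 G)) v w" by (simp add: ell2_simps)
    finally show "hs_inner (ell2 G) (A v) (A w) = hs_inner (hs_pow (ell2 G)) v w" .
  qed (use mem in \<open>auto simp: A_def fun_eq_iff\<close>)
  then show ?thesis by (auto simp: embeds_def)
qed

lemma infinite_dimensional_ell2:
  assumes G: "hilbert_space G" and g: "g \<in> hs_carrier G" "g \<noteq> 0"
  shows "infinite_dimensional (ell2 G)"
  unfolding infinite_dimensional_def
proof
  assume "\<exists>B. finite B \<and> B \<subseteq> hs_carrier (ell2 G) \<and>
    (\<forall>x\<in>hs_carrier (ell2 G). \<exists>c. x = (\<Sum>b\<in>B. c b *\<^sub>C b))"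
  then obtain B where B: "finite B" "\<And>x. x \<in> hs_carrier (ell2 G) \<Longrightarrow> \<exists>c. x = (\<Sum>b\<in>B. c b *\<^sub>C b)" by blast
  \<comment> \<open>The vector g placed at position \<open>t0\<close>. These sequences are infinite
    in number and linearly independent, which no finite spanning set admits.\<close>
  define \<delta> where "\<delta> t0 = (\<lambda>t :: nat. if t = t0 then g else 0)" for t0
  have inj: "inj \<delta>" by (rule injI) (metis (full_types) \<delta>_def g(2))
  have "cvec.independent (range \<delta>)"
    unfolding cvec.independent_explicit_module
  proof (intro allI impI)
    fix S u v assume S: "finite S" "S \<subseteq> range \<delta>" "(\<Sum>v\<in>S. u v *\<^sub>C v) = 0" "v \<in> S"
    then obtain t where t: "v = \<delta> t" by auto
    have "0 = (\<Sum>v\<in>S. u v *\<^sub>C v) t" using S(3) by simp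
    also have "\<dots> = (\<Sum>w\<in>S. if w = v then u v *\<^sub>C g else 0)"
      unfolding sum_fun_apply
    proof (intro sum.cong refl)
      fix w assume "w \<in> S"
      then obtain t' where "w = \<delta> t'" using S(2) by auto
      moreover have "t' = t" if "w = v" using that inj calculation t by (auto dest: injD)
      ultimately show "(u w *\<^sub>C w) t = (if w = v then u v *\<^sub>C g else 0)"
        by (cases "t' = t") (auto simp: t \<delta>_def)
    qed
    also have "\<dots> = u v *\<^sub>C g" using S by simp
    finally show "u v = 0" using g by simp
  qed
  moreover have "range \<delta> \<subseteq> cvec.span B"
  proof
    fix x assume "x \<in> range \<delta>"
    then have "x \<in> hs_carrier (ell2 G)" using ell2_single[OF G g(1)] by (auto simp: \<delta>_def)
    then obtain c where "x = (\<Sum>b\<in>B. c b *\<^sub>C b)" using B(2) by blast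
    then show "x \<in> cvec.span B" by (auto intro: cvec.span_sum cvec.span_scale cvec.span_base)
  qed
  ultimately have "finite (range \<delta>)" using cvec.independent_span_bound[OF B(1)] by blast
  then show False using inj finite_imageD by blast
qed


section \<open>Extending isometries to unitaries\<close>

text \<open>With \<open>Y = \<beta> \<alpha>\<close>, the unitary acts as \<open>Y\<close> on the smallest
  \<open>Y\<close>-invariant closed subspace \<open>P\<close> containing the complement of the range of \<open>\<beta>\<close>, and as the
  identity on the complement of \<open>P\<close>.\<close>

lemma hilbert_Cantor_Bernstein:
  fixes H :: "'a::complex_vector hspace" and K :: "'b::complex_vector hspace"
  assumes H: "hilbert_space H" and K: "hilbert_space K" and "H \<lesssim>\<^sub>H K" "K \<lesssim>\<^sub>H H"
  obtains U where "unitary_op H K U"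
proof -
  obtain \<alpha> \<beta> where \<alpha>: "isometry_op H K \<alpha>" and \<beta>: "isometry_op K H \<beta>"
    using assms(3,4) by (auto simp: embeds_def)
  define Y where "Y x = \<beta> (\<alpha> x)" for x
  have Y: "isometry_op H H Y" unfolding Y_def by (rule isometry_op_compose[OF \<beta> \<alpha> H K])
  note Y' = isometry_opD[OF Y] and \<alpha>' = isometry_opD[OF \<alpha>] and \<beta>' = isometry_opD[OF \<beta>]
  define W where "W = \<beta> ` hs_carrier K"
  have K_closed: "closed_subspace K (hs_carrier K)"
    by (simp add: closed_subspace_def hs_carrier_linear[OF K] hs_closure_subset)
  have W: "closed_subspace H W" unfolding W_def by (rule isometry_image_closed[OF K H \<beta> K_closed])
  have YW: "Y x \<in> W" if "x \<in> hs_carrier H" for x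
    using bounded_ops_mem[OF \<alpha>'(1) that] by (simp add: Y_def W_def)
  \<comment> \<open>M is what \<beta> misses; it is orthogonal to the range of Y, which lies in that
    of \<beta>.\<close>
  define M where "M = hs_perp H W"
  have Wc: "w \<in> hs_carrier H" if "w \<in> W" for w using closed_subspaceD(1)[OF W] that by auto
  have M: "closed_subspace H M" unfolding M_def using Wc by (intro closed_subspace_perp[OF H]) auto
  have Mc: "a \<in> hs_carrier H" if "a \<in> M" for a using that by (simp add: M_def hs_perp_def)
  have MW: "hs_inner H a w = 0" "hs_inner H w a = 0" if "a \<in> M" "w \<in> W" for a w
  proof -
    show "hs_inner H a w = 0" using that by (simp add: M_def hs_perp_def)
    then show "hs_inner H w a = 0" using hs_inner_cnj[OF H Mc[OF that(1)] Wc[OF that(2)]] by simp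
  qed
  define \<C> where "\<C> = {C. closed_subspace H C \<and> M \<subseteq> C \<and> Y ` C \<subseteq> C}"
  define P where "P = \<Inter> \<C>"
  have carrier_\<C>: "hs_carrier H \<in> \<C>"
    using bounded_ops_mem[OF Y'(1)] Mc
    by (auto simp: \<C>_def closed_subspace_def hs_carrier_linear[OF H] hs_closure_subset)
  have P: "closed_subspace H P"
    unfolding closed_subspace_def
  proof (intro conjI)
    show "P \<subseteq> hs_carrier H" using carrier_\<C> by (auto simp: P_def)
    have "linear_subset C" if "C \<in> \<C>" for C using that closed_subspaceD(2) by (auto simp: \<C>_def)
    then show "linear_subset P" unfolding P_def linear_subset_def by blast
    show "hs_closure H P \<subseteq> P"
    proof
      fix x assume "x \<in> hs_closure H P"
      then obtain s where s: "x \<in> hs_carrier H" "\<And>n. s n \<in> P" "hs_lim H s x" by (auto simp: hs_closure_def)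
      have "x \<in> C" if "C \<in> \<C>" for C
        using that s closed_subspaceD(3)[of H C x s] by (auto simp: P_def \<C>_def)
      then show "x \<in> P" by (simp add: P_def)
    qed
  qed
  have MP: "M \<subseteq> P" and YP: "Y x \<in> P" if "x \<in> P" for x using that by (auto simp: P_def \<C>_def)
  note P' = closed_subspaceD[OF P]
  have Pc: "x \<in> hs_carrier H" if "x \<in> P" for x using P'(1) that by auto
  have MP: "M \<subseteq> P" by (auto simp: P_def \<C>_def)
  have YPclosed: "closed_subspace H (Y ` P)" by (rule isometry_image_closed[OF H H Y P])
  \<comment> \<open>Minimality of P: the sums a + Y p' themselves form a Y-invariant closed subspace
    containing M, hence exhaust P.\<close>
  have decomp: "\<exists>a\<in>M. \<exists>p'\<in>P. p = a + Y p'" if p: "p \<in> P" for p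
  proof -
    define C where "C = {a + Y p' | a p'. a \<in> M \<and> p' \<in> P}"
    note M' = closed_subspaceD[OF M] and YP' = closed_subspaceD[OF YPclosed]
    have Clin: "linear_subset C"
      unfolding linear_subset_def C_def
    proof (safe)
      show "\<exists>a p'. 0 = a + Y p' \<and> a \<in> M \<and> p' \<in> P"
        using linear_subset_zero[OF M'(2)] linear_subset_zero[OF P'(2)] bounded_ops_zero[OF Y'(1) H]
        by (metis add.right_neutral)
    next
      fix a b p q assume "a \<in> M" "b \<in> M" "p \<in> P" "q \<in> P"
      then show "\<exists>c r. a + Y p + (b + Y q) = c + Y r \<and> c \<in> M \<and> r \<in> P"
        using linear_subset_add[OF M'(2)] linear_subset_add[OF P'(2)] bounded_ops_add[OF Y'(1) Pc Pc]
        by (intro exI[of _ "a + b"] exI[of _ "p + q"]) (simp add: algebra_simps)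
    next
      fix k a p assume "a \<in> M" "p \<in> P"
      then show "\<exists>c r. k *\<^sub>C (a + Y p) = c + Y r \<and> c \<in> M \<and> r \<in> P"
        using linear_subset_scale[OF M'(2)] linear_subset_scale[OF P'(2)] bounded_ops_scale[OF Y'(1) Pc]
        by (intro exI[of _ "k *\<^sub>C a"] exI[of _ "k *\<^sub>C p"]) (simp add: scaleC_add_right)
    qed
    have Csub: "C \<subseteq> hs_carrier H"
      using Mc Pc bounded_ops_mem[OF Y'(1)] H by (auto simp: C_def)
    have "C \<in> \<C>"
      unfolding \<C>_def
    proof (intro CollectI conjI)
      show "M \<subseteq> C"
      proof
        fix a assume "a \<in> M"
        then show "a \<in> C" unfolding C_def
          using linear_subset_zero[OF P'(2)] bounded_ops_zero[OF Y'(1) H]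
          by (intro CollectI exI[of _ a] exI[of _ 0]) auto
      qed
      show "Y ` C \<subseteq> C"
      proof
        fix y assume "y \<in> Y ` C"
        then obtain a p where ap: "a \<in> M" "p \<in> P" "y = Y (a + Y p)" by (auto simp: C_def)
        then have "a + Y p \<in> P" using MP YP linear_subset_add[OF P'(2)] by auto
        then show "y \<in> C" unfolding C_def
          using ap linear_subset_zero[OF M'(2)] by (intro CollectI exI[of _ 0] exI[of _ "a + Y p"]) auto
      qed
      show "closed_subspace H C"
        unfolding closed_subspace_def
      proof (intro conjI Clin Csub subsetI)
        fix x assume "x \<in> hs_closure H C"
        then obtain s where s: "x \<in> hs_carrier H" "\<And>n. s n \<in> C" "hs_lim H s x" by (auto simp: hs_closure_def)
        have sc: "s n \<in> hs_carrier H" for n using s(2) Csub by auto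
        \<comment> \<open>M and the image of P under Y are orthogonal, so the projection onto M
          splits a convergent sequence of sums into two convergent sequences, and each limit stays
          in its closed summand.\<close>
        define \<pi> where "\<pi> = hs_proj H M"
        have \<pi>: "\<pi> \<in> bounded_ops H H"
          using bounded_ops_sub_incl[OF hs_proj_bounded[OF H M] M'(1)] by (simp add: \<pi>_def)
        have "s n - \<pi> (s n) \<in> Y ` P" for n
        proof -
          obtain a p where ap: "a \<in> M" "p \<in> P" "s n = a + Y p" using s(2)[of n] by (auto simp: C_def)
          have "\<pi> (s n) = a"
            unfolding \<pi>_def
          proof (rule hs_proj_unique[OF H M'(1,2) sc ap(1)])
            show "hs_inner H (s n - a) v = 0" if "v \<in> M" for v
              using that MW(2)[OF that YW[OF Pc[OF ap(2)]]] ap by simp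
          qed
          then show ?thesis using ap by auto
        qed
        moreover have "hs_lim H (\<lambda>n. s n - \<pi> (s n)) (x - \<pi> x)"
          using hs_lim_bounded_ops[OF bounded_ops_diff_op[OF bounded_ops_ident \<pi> H H] H H sc s(1,3)] .
        ultimately have "x - \<pi> x \<in> Y ` P"
          using YP'(3)[of "x - \<pi> x" "\<lambda>n. s n - \<pi> (s n)"] s(1) bounded_ops_mem[OF \<pi> s(1)] H by simp
        then obtain p where "p \<in> P" "x = \<pi> x + Y p" by (auto simp: algebra_simps)
        moreover have "\<pi> x \<in> M" using hs_proj(1)[OF H M s(1)] by (simp add: \<pi>_def)
        ultimately show "x \<in> C" by (auto simp: C_def)
      qed
    qed
    then have "p \<in> C" using p by (auto simp: P_def)
    then show ?thesis by (auto simp: C_def)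
  qed
  define \<pi> where "\<pi> = hs_proj H P"
  have \<pi>: "\<pi> \<in> bounded_ops H H"
    using bounded_ops_sub_incl[OF hs_proj_bounded[OF H P] P'(1)] by (simp add: \<pi>_def)
  have \<pi>P: "\<pi> x \<in> P" and \<pi>c: "\<pi> x \<in> hs_carrier H"
    and \<pi>orth: "\<And>p. p \<in> P \<Longrightarrow> hs_inner H (x - \<pi> x) p = 0" "\<And>p. p \<in> P \<Longrightarrow> hs_inner H p (x - \<pi> x) = 0"
    if "x \<in> hs_carrier H" for x
    using hs_proj[OF H P that] Pc by (auto simp: \<pi>_def)
  define V where "V x = Y (\<pi> x) + (x - \<pi> x)" for x
  have Vb: "V \<in> bounded_ops H H"
    unfolding V_def
    by (intro bounded_ops_plus bounded_ops_diff_op bounded_ops_ident \<pi> H bounded_ops_compose[OF Y'(1) \<pi>])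
  have Vi: "hs_inner H (V x) (V y) = hs_inner H x y" if x: "x \<in> hs_carrier H" and y: "y \<in> hs_carrier H" for x y
  proof -
    have c: "Y (\<pi> x) \<in> hs_carrier H" "x - \<pi> x \<in> hs_carrier H" "Y (\<pi> y) \<in> hs_carrier H" "y - \<pi> y \<in> hs_carrier H"
      using x y H \<pi>c bounded_ops_mem[OF Y'(1)] by auto
    have "hs_inner H (V x) (V y) = hs_inner H (\<pi> x) (\<pi> y) + hs_inner H (x - \<pi> x) (y - \<pi> y)"
      unfolding V_def Y'(2)[OF \<pi>c[OF x] \<pi>c[OF y], symmetric]
      using \<pi>orth(1)[OF x YP[OF \<pi>P[OF y]]] \<pi>orth(2)[OF y YP[OF \<pi>P[OF x]]] c H
      by (intro hs_inner_orthogonal_sum) auto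
    also have "\<dots> = hs_inner H (\<pi> x + (x - \<pi> x)) (\<pi> y + (y - \<pi> y))"
      using \<pi>orth(1)[OF x \<pi>P[OF y]] \<pi>orth(2)[OF y \<pi>P[OF x]] c H \<pi>c[OF x] \<pi>c[OF y]
      by (intro hs_inner_orthogonal_sum[symmetric]) auto
    finally show ?thesis by simp
  qed
  \<comment> \<open>The part of x orthogonal to P is in particular orthogonal to M, hence lies in W,
    as does the range of Y.\<close>
  have VW: "V x \<in> W" if x: "x \<in> hs_carrier H" for x
  proof -
    have "x - \<pi> x \<in> W"
    proof (rule hs_perp_perp[OF H W])
      show "hs_inner H (x - \<pi> x) v = 0" if "v \<in> hs_perp H W" for v
        using \<pi>orth(1)[OF x] MP that by (auto simp: M_def)
    qed (use x \<pi>c H in auto)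
    then show ?thesis
      using YW[OF \<pi>c[OF x]] closed_subspaceD(2)[OF W] by (simp add: V_def linear_subset_add)
  qed
  \<comment> \<open>Write the part of w in P as a + Y p. Since w, its part off P and Y p are all
    orthogonal to a, it follows that a = 0; replacing Y p by p then gives a preimage of w.\<close>
  have Vsurj: "\<exists>x\<in>hs_carrier H. V x = w" if w: "w \<in> W" for w
  proof -
    note wc = Wc[OF w]
    obtain a p where ap: "a \<in> M" "p \<in> P" "\<pi> w = a + Y p" using decomp[OF \<pi>P[OF wc]] by blast
    note ac = Mc[OF ap(1)] and pc = Pc[OF ap(2)]
    have Yc: "Y p \<in> hs_carrier H" using bounded_ops_mem[OF Y'(1) pc] .
    have "hs_inner H a a = hs_inner H a (\<pi> w) - hs_inner H a (Y p)" using ap ac Yc H by simp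
    also have "hs_inner H a (\<pi> w) = hs_inner H a w - hs_inner H a (w - \<pi> w)" using ac wc \<pi>c[OF wc] H by simp
    also have "\<dots> = 0" using MW(1)[OF ap(1) w] \<pi>orth(2)[OF wc, of a] MP ap(1) by auto
    also have "hs_inner H a (Y p) = 0" by (rule MW(1)[OF ap(1) YW[OF pc]])
    finally have "a = 0" using hs_inner_self_pos[OF H ac] by fastforce
    then have \<pi>w: "\<pi> w = Y p" using ap by simp
    define x where "x = p + (w - \<pi> w)"
    have xc: "x \<in> hs_carrier H" using pc wc \<pi>c[OF wc] H by (simp add: x_def)
    have "\<pi> x = p"
      unfolding \<pi>_def
    proof (rule hs_proj_unique[OF H P'(1,2) xc ap(2)])
      show "hs_inner H (x - p) v = 0" if "v \<in> P" for v
        using \<pi>orth(1)[OF wc that] by (simp add: x_def)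
    qed
    then have "V x = w" by (simp add: V_def x_def \<pi>w)
    with xc show ?thesis by blast
  qed
  \<comment> \<open>V maps onto W, the range of \<beta>, where the adjoint of \<beta> is its
    inverse.\<close>
  define U where "U x = hs_adj K H \<beta> (V x)" for x
  have \<beta>U: "\<beta> (U x) = V x" if x: "x \<in> hs_carrier H" for x
  proof -
    obtain k where "k \<in> hs_carrier K" "V x = \<beta> k" using VW[OF x] by (auto simp: W_def)
    then show ?thesis by (simp add: U_def isometry_adj_left_inverse[OF K H \<beta>])
  qed
  have Ub: "U \<in> bounded_ops H K"
    unfolding U_def by (rule bounded_ops_compose[OF hs_adj_bounded[OF K H \<beta>'(1)] Vb H H])
  have "U ` hs_carrier H = hs_carrier K"
  proof (intro equalityI subsetI)
    fix k assume k: "k \<in> hs_carrier K"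
    then obtain x where "x \<in> hs_carrier H" "V x = \<beta> k" using Vsurj[of "\<beta> k"] by (auto simp: W_def)
    then show "k \<in> U ` hs_carrier H" using isometry_adj_left_inverse[OF K H \<beta> k] by (force simp: U_def)
  qed (use bounded_ops_mem[OF Ub] in auto)
  moreover have "hs_inner K (U x) (U y) = hs_inner H x y" if "x \<in> hs_carrier H" "y \<in> hs_carrier H" for x y
    using \<beta>'(2)[of "U x" "U y"] bounded_ops_mem[OF Ub] that \<beta>U Vi by simp
  ultimately have "unitary_op H K U" using Ub by (simp add: unitary_op_def)
  then show thesis by (rule that)
qed

text \<open>The isometry given by G extends to the closure, and it remains to match the orthogonal
  complements of its domain and range. Both embed in L as subspaces of P and Q, and both contain a
  copy of L through \<iota> and \<kappa>. So each embeds in the other, and a unitary between them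
  exists.\<close>

lemma unitary_extension:
  fixes P :: "'a::complex_vector hspace" and Q :: "'b::complex_vector hspace" and L :: "'c::complex_vector hspace"
  assumes P: "hilbert_space P" and Q: "hilbert_space Q" and L: "hilbert_space L"
    and G: "linear_subset G" "G \<subseteq> hs_carrier P \<times> hs_carrier Q"
    and iso: "\<And>x y x' y'. (x, y) \<in> G \<Longrightarrow> (x', y') \<in> G \<Longrightarrow> hs_inner Q y y' = hs_inner P x x'"
    and PL: "P \<lesssim>\<^sub>H L" and QL: "Q \<lesssim>\<^sub>H L"
    and \<iota>: "isometry_op L P \<iota>" "\<And>x y l. (x, y) \<in> G \<Longrightarrow> l \<in> hs_carrier L \<Longrightarrow> hs_inner P (\<iota> l) x = 0"
    and \<kappa>: "isometry_op L Q \<kappa>" "\<And>x y l. (x, y) \<in> G \<Longrightarrow> l \<in> hs_carrier L \<Longrightarrow> hs_inner Q (\<kappa> l) y = 0"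
  obtains U where "unitary_op P Q U" "\<And>x y. (x, y) \<in> G \<Longrightarrow> U x = y"
proof -
  define V where "V = hs_closure P (fst ` G)"
  obtain A where A: "isometry_op (hs_sub P V) Q A" "\<And>x y. (x, y) \<in> G \<Longrightarrow> A x = y"
    and Glin: "linear_subset (fst ` G)"
    using isometric_extension[OF P Q G iso] unfolding V_def by metis
  note A' = isometry_opD[OF A(1)]
  have Gc: "fst ` G \<subseteq> hs_carrier P" using G(2) by auto
  have V: "closed_subspace P V" unfolding V_def by (rule closed_subspace_closure[OF P Gc Glin])
  note V' = closed_subspaceD[OF V]
  have VH: "hilbert_space (hs_sub P V)" by (rule hilbert_space_sub[OF P V])
  have V_closed: "closed_subspace (hs_sub P V) V"
    using V V'(2) by (auto simp: closed_subspace_def hs_closure_def)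
  define W where "W = A ` V"
  have W: "closed_subspace Q W" unfolding W_def by (rule isometry_image_closed[OF VH Q A(1) V_closed])
  note W' = closed_subspaceD[OF W]
  have AV: "A v \<in> hs_carrier Q" if "v \<in> V" for v using bounded_ops_mem[OF A'(1)] that by simp
  have lim: "\<exists>s. (\<forall>n. \<exists>y. (s n, y) \<in> G) \<and> hs_lim P s v" if "v \<in> V" for v
    using that by (force simp: V_def hs_closure_def)
  \<comment> \<open>Orthogonality to the second components of G extends by continuity to the range
    of the extended isometry.\<close>
  have \<kappa>W: "\<kappa> l \<in> hs_perp Q W" if l: "l \<in> hs_carrier L" for l
    unfolding hs_perp_def W_def
  proof (safe)
    have \<kappa>c: "\<kappa> l \<in> hs_carrier Q" using bounded_ops_mem[OF isometry_opD(1)[OF \<kappa>(1)] l] .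
    then show "\<kappa> l \<in> hs_carrier Q" .
    fix v assume v: "v \<in> V"
    obtain s y where s: "\<And>n. (s n, y n) \<in> G" "hs_lim P s v" using lim[OF v] by metis
    have sV: "s n \<in> V" for n using hs_closure_incl[OF P Gc] s(1)[of n] by (force simp: V_def)
    have "hs_lim Q (\<lambda>n. A (s n)) (A v)"
      using hs_lim_bounded_ops[OF A'(1) VH Q, of s v] sV v s(2) by simp
    then have "(\<lambda>n. hs_inner Q (A (s n)) (\<kappa> l)) \<longlonglongrightarrow> hs_inner Q (A v) (\<kappa> l)"
      using sV v AV \<kappa>c by (intro hs_lim_inner[OF Q]) auto
    moreover have "hs_inner Q (A (s n)) (\<kappa> l) = 0" for n
    proof -
      have "hs_inner Q (\<kappa> l) (A (s n)) = 0" using \<kappa>(2)[OF s(1) l] A(2)[OF s(1)] by simp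
      then show ?thesis using hs_inner_cnj[OF Q \<kappa>c AV[OF sV]] by (metis complex_cnj_zero)
    qed
    ultimately have "hs_inner Q (A v) (\<kappa> l) = 0" using LIMSEQ_unique[OF _ tendsto_const] by force
    then show "hs_inner Q (\<kappa> l) (A v) = 0" using hs_inner_cnj[OF Q AV[OF v] \<kappa>c] by (metis complex_cnj_zero)
  qed
  have \<iota>V: "\<iota> l \<in> hs_perp P V" if l: "l \<in> hs_carrier L" for l
    unfolding hs_perp_def
  proof (safe)
    have \<iota>c: "\<iota> l \<in> hs_carrier P" using bounded_ops_mem[OF isometry_opD(1)[OF \<iota>(1)] l] .
    then show "\<iota> l \<in> hs_carrier P" .
    fix v assume v: "v \<in> V"
    then have vc: "v \<in> hs_carrier P" using V' by auto
    obtain s y where s: "\<And>n. (s n, y n) \<in> G" "hs_lim P s v" using lim[OF v] by metis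
    have sc: "s n \<in> hs_carrier P" for n using G(2) s(1)[of n] by auto
    have "(\<lambda>n. hs_inner P (s n) (\<iota> l)) \<longlonglongrightarrow> hs_inner P v (\<iota> l)"
      using sc vc \<iota>c s(2) by (intro hs_lim_inner[OF P]) auto
    moreover have "hs_inner P (s n) (\<iota> l) = 0" for n
      using \<iota>(2)[OF s(1) l] hs_inner_cnj[OF P \<iota>c sc] by (metis complex_cnj_zero)
    ultimately have "hs_inner P v (\<iota> l) = 0" using LIMSEQ_unique[OF _ tendsto_const] by force
    then show "hs_inner P (\<iota> l) v = 0" using hs_inner_cnj[OF P vc \<iota>c] by (metis complex_cnj_zero)
  qed
  let ?V = "hs_sub P (hs_perp P V)" and ?W = "hs_sub Q (hs_perp Q W)"
  have VpH: "hilbert_space ?V" using hilbert_space_sub[OF P closed_subspace_perp[OF P V'(1)]] .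
  have WpH: "hilbert_space ?W" using hilbert_space_sub[OF Q closed_subspace_perp[OF Q W'(1)]] .
  have Vpc: "hs_perp P V \<subseteq> hs_carrier P" and Wpc: "hs_perp Q W \<subseteq> hs_carrier Q" by (auto simp: hs_perp_def)
  have LV: "L \<lesssim>\<^sub>H ?V" and LW: "L \<lesssim>\<^sub>H ?W"
    unfolding embeds_def isometry_op_def
    using \<iota>(1) \<kappa>(1) \<iota>V \<kappa>W by (auto simp: isometry_op_def intro!: exI[of _ \<iota>] exI[of _ \<kappa>] bounded_ops_sub_ran)
  have VL: "?V \<lesssim>\<^sub>H L" using embeds_trans[OF embeds_sub[OF Vpc] PL VpH P] .
  have WL: "?W \<lesssim>\<^sub>H L" using embeds_trans[OF embeds_sub[OF Wpc] QL WpH Q] .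
  obtain B where B: "unitary_op ?V ?W B"
    using hilbert_Cantor_Bernstein[OF VpH WpH embeds_trans[OF VL LW VpH L] embeds_trans[OF WL LV WpH L]] by blast
  have Bb: "B \<in> bounded_ops ?V ?W" and Bs: "B ` hs_perp P V = hs_perp Q W"
    and Bi: "\<And>x y. x \<in> hs_perp P V \<Longrightarrow> y \<in> hs_perp P V \<Longrightarrow> hs_inner Q (B x) (B y) = hs_inner P x y"
    using B by (auto simp: unitary_op_def)
  define \<pi> where "\<pi> = hs_proj P V"
  have \<pi>: "\<pi> \<in> bounded_ops P (hs_sub P V)" using hs_proj_bounded[OF P V] by (simp add: \<pi>_def)
  have \<pi>V: "\<pi> x \<in> V" and \<pi>p: "x - \<pi> x \<in> hs_perp P V" if "x \<in> hs_carrier P" for x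
    using hs_proj(1,2)[OF P V that] by (auto simp: \<pi>_def)
  have \<pi>P: "\<pi> \<in> bounded_ops P P" using bounded_ops_sub_incl[OF \<pi> V'(1)] .
  define U where "U x = A (\<pi> x) + B (x - \<pi> x)" for x
  have U1: "(\<lambda>x. A (\<pi> x)) \<in> bounded_ops P Q" by (rule bounded_ops_compose[OF A'(1) \<pi> P VH])
  have "(\<lambda>x. x - \<pi> x) \<in> bounded_ops P ?V"
    by (rule bounded_ops_sub_ran[OF bounded_ops_diff_op[OF bounded_ops_ident \<pi>P P P] \<pi>p])
  then have "(\<lambda>x. B (x - \<pi> x)) \<in> bounded_ops P ?W" by (rule bounded_ops_compose[OF Bb _ P VpH])
  then have U2: "(\<lambda>x. B (x - \<pi> x)) \<in> bounded_ops P Q" by (rule bounded_ops_sub_incl[OF _ Wpc])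
  have Ub: "U \<in> bounded_ops P Q" unfolding U_def by (rule bounded_ops_plus[OF U1 U2 P Q])
  have orthW: "hs_inner Q b a = 0" "hs_inner Q a b = 0" if "a \<in> W" "b \<in> hs_perp Q W" for a b
  proof -
    show "hs_inner Q b a = 0" using that by (simp add: hs_perp_def)
    then show "hs_inner Q a b = 0"
      using that W'(1) hs_inner_cnj[OF Q, of b a] by (auto simp: hs_perp_def)
  qed
  have orthV: "hs_inner P b a = 0" "hs_inner P a b = 0" if "a \<in> V" "b \<in> hs_perp P V" for a b
  proof -
    show "hs_inner P b a = 0" using that by (simp add: hs_perp_def)
    then show "hs_inner P a b = 0"
      using that V'(1) hs_inner_cnj[OF P, of b a] by (auto simp: hs_perp_def)
  qed
  have Ui: "hs_inner Q (U x) (U y) = hs_inner P x y" if x: "x \<in> hs_carrier P" and y: "y \<in> hs_carrier P" for x y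
  proof -
    have m: "A (\<pi> x) \<in> W" "A (\<pi> y) \<in> W" "B (x - \<pi> x) \<in> hs_perp Q W" "B (y - \<pi> y) \<in> hs_perp Q W"
      using \<pi>V[OF x] \<pi>V[OF y] \<pi>p[OF x] \<pi>p[OF y] Bs by (auto simp: W_def)
    have mc: "A (\<pi> x) \<in> hs_carrier Q" "A (\<pi> y) \<in> hs_carrier Q"
        "B (x - \<pi> x) \<in> hs_carrier Q" "B (y - \<pi> y) \<in> hs_carrier Q"
        "\<pi> x \<in> hs_carrier P" "\<pi> y \<in> hs_carrier P" "x - \<pi> x \<in> hs_carrier P" "y - \<pi> y \<in> hs_carrier P"
      using m W'(1) Wpc V'(1) \<pi>V[OF x] \<pi>V[OF y] x y P by auto
    have "hs_inner Q (U x) (U y) = hs_inner P (\<pi> x) (\<pi> y) + hs_inner P (x - \<pi> x) (y - \<pi> y)"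
      unfolding U_def
      using mc Q orthW[OF m(1,4)] orthW[OF m(2,3)] A'(2)[of "\<pi> x" "\<pi> y"] \<pi>V[OF x] \<pi>V[OF y]
        Bi[OF \<pi>p[OF x] \<pi>p[OF y]] by simp
    also have "\<dots> = hs_inner P (\<pi> x + (x - \<pi> x)) (\<pi> y + (y - \<pi> y))"
      using mc P orthV(2)[OF \<pi>V[OF x] \<pi>p[OF y]] orthV(1)[OF \<pi>V[OF y] \<pi>p[OF x]]
      by (intro hs_inner_orthogonal_sum[symmetric]) auto
    finally show ?thesis by simp
  qed
  have Us: "U ` hs_carrier P = hs_carrier Q"
  proof (intro equalityI subsetI)
    fix q assume q: "q \<in> hs_carrier Q"
    obtain v where v: "v \<in> V" "A v = hs_proj Q W q" using hs_proj(1)[OF Q W q] by (auto simp: W_def)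
    obtain u where u: "u \<in> hs_perp P V" "B u = q - hs_proj Q W q" using hs_proj(2)[OF Q W q] Bs by (metis imageE)
    have vc: "v \<in> hs_carrier P" "u \<in> hs_carrier P" using v u V'(1) Vpc by auto
    have "\<pi> (v + u) = v"
      unfolding \<pi>_def by (rule hs_proj_unique[OF P V'(1,2) _ v(1)]) (use vc P orthV(1)[OF _ u(1)] in auto)
    then have "U (v + u) = q" by (simp add: U_def v u)
    then show "q \<in> U ` hs_carrier P" using vc P by force
  qed (use bounded_ops_mem[OF Ub] in auto)
  have "U x = y" if xy: "(x, y) \<in> G" for x y
  proof -
    have x: "x \<in> V" "x \<in> hs_carrier P" using hs_closure_incl[OF P Gc] xy G(2) by (force simp: V_def)+
    have "\<pi> x = x"
      unfolding \<pi>_def by (rule hs_proj_unique[OF P V'(1,2) x(2,1)]) (use P V'(1) in auto)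
    moreover have "B 0 = 0" by (rule bounded_ops_zero[OF Bb VpH])
    ultimately show ?thesis using A(2)[OF xy] by (simp add: U_def)
  qed
  moreover have "unitary_op P Q U" using Ub Us Ui by (simp add: unitary_op_def)
  ultimately show thesis by (rule that[rotated])
qed


section \<open>Positive kernels on the ball\<close>

lemma cdot_zero [simp]: "cdot z 0 = 0" "cdot 0 z = 0"
  by (simp_all add: cdot_def)

lemma cmod_cdot_le: "cmod (cdot z w) \<le> norm z * norm w"
proof -
  have "cmod (cdot z w) \<le> (\<Sum>i\<in>UNIV. \<bar>cmod (z $ i)\<bar> * \<bar>cmod (w $ i)\<bar>)"
    unfolding cdot_def by (rule order.trans[OF norm_sum]) (simp add: norm_mult)
  also have "\<dots> \<le> norm z * norm w" unfolding norm_vec_def by (rule L2_set_mult_ineq)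
  finally show ?thesis .
qed

lemma cmod_cdot_less_1:
  assumes "z \<in> unit_ball" "w \<in> unit_ball"
  shows "cmod (cdot z w) < 1"
proof -
  have "norm z * norm w \<le> norm z * 1" using assms by (intro mult_left_mono) auto
  then show ?thesis using assms cmod_cdot_le[of z w] by simp
qed

lemma one_minus_cdot_nonzero: "z \<in> unit_ball \<Longrightarrow> w \<in> unit_ball \<Longrightarrow> 1 - cdot z w \<noteq> 0"
  using cmod_cdot_less_1[of z w] by auto

text \<open>An operator-valued kernel is encoded by its forms, x being the vector at w and y the
  vector at z. Homogeneity is recorded because multiplication by <z, w> absorbs coordinates of the
  points into the vectors.\<close>

definition psd_kernel :: "'e::complex_vector hspace \<Rightarrow>
    (complex ^ 'n \<Rightarrow> complex ^ 'n \<Rightarrow> 'e \<Rightarrow> 'e \<Rightarrow> complex) \<Rightarrow> bool" where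
  "psd_kernel E B \<longleftrightarrow>
     (\<forall>z\<in>unit_ball. \<forall>w\<in>unit_ball. \<forall>x\<in>hs_carrier E. \<forall>y\<in>hs_carrier E. \<forall>c d.
        B z w (c *\<^sub>C x) (d *\<^sub>C y) = c * cnj d * B z w x y) \<and>
     (\<forall>F \<phi>. finite F \<and> F \<subseteq> unit_ball \<and> (\<forall>w\<in>F. \<phi> w \<in> hs_carrier E) \<longrightarrow>
        0 \<le> Re (\<Sum>z\<in>F. \<Sum>w\<in>F. B z w (\<phi> w) (\<phi> z)))"

lemma psd_kernelI:
  assumes "\<And>z w x y c d. \<lbrakk>z \<in> unit_ball; w \<in> unit_ball; x \<in> hs_carrier E; y \<in> hs_carrier E\<rbrakk>
      \<Longrightarrow> B z w (c *\<^sub>C x) (d *\<^sub>C y) = c * cnj d * B z w x y"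
    and "\<And>F \<phi>. \<lbrakk>finite F; F \<subseteq> unit_ball; \<And>w. w \<in> F \<Longrightarrow> \<phi> w \<in> hs_carrier E\<rbrakk>
      \<Longrightarrow> 0 \<le> Re (\<Sum>z\<in>F. \<Sum>w\<in>F. B z w (\<phi> w) (\<phi> z))"
  shows "psd_kernel E B"
  using assms by (simp add: psd_kernel_def)

lemma psd_kernelD:
  assumes "psd_kernel E B"
  shows "\<lbrakk>z \<in> unit_ball; w \<in> unit_ball; x \<in> hs_carrier E; y \<in> hs_carrier E\<rbrakk>
      \<Longrightarrow> B z w (c *\<^sub>C x) (d *\<^sub>C y) = c * cnj d * B z w x y"
    and "\<lbrakk>finite F; F \<subseteq> unit_ball; \<And>w. w \<in> F \<Longrightarrow> \<phi> w \<in> hs_carrier E\<rbrakk>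
      \<Longrightarrow> 0 \<le> Re (\<Sum>z\<in>F. \<Sum>w\<in>F. B z w (\<phi> w) (\<phi> z))"
  using assms by (simp_all add: psd_kernel_def)

lemma psd_kernel_cong:
  fixes E :: "'e::complex_vector hspace" and B :: "complex ^ 'n \<Rightarrow> complex ^ 'n \<Rightarrow> 'e \<Rightarrow> 'e \<Rightarrow> complex"
  assumes B: "psd_kernel E B" and E: "hilbert_space E"
    and eq: "\<And>z w x y. \<lbrakk>z \<in> unit_ball; w \<in> unit_ball; x \<in> hs_carrier E; y \<in> hs_carrier E\<rbrakk>
      \<Longrightarrow> B' z w x y = B z w x y"
  shows "psd_kernel E B'"
proof (rule psd_kernelI)
  fix F and \<phi> :: "complex ^ 'n \<Rightarrow> 'e"
  assume F: "finite F" "F \<subseteq> unit_ball" "\<And>w. w \<in> F \<Longrightarrow> \<phi> w \<in> hs_carrier E"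
  have "(\<Sum>z\<in>F. \<Sum>w\<in>F. B' z w (\<phi> w) (\<phi> z)) = (\<Sum>z\<in>F. \<Sum>w\<in>F. B z w (\<phi> w) (\<phi> z))"
    using F by (intro sum.cong eq) auto
  then show "0 \<le> Re (\<Sum>z\<in>F. \<Sum>w\<in>F. B' z w (\<phi> w) (\<phi> z))" using psd_kernelD(2)[OF B F] by simp
qed (use psd_kernelD(1)[OF B] E eq in auto)

lemma psd_kernel_add:
  fixes E :: "'e::complex_vector hspace" and B :: "complex ^ 'n \<Rightarrow> complex ^ 'n \<Rightarrow> 'e \<Rightarrow> 'e \<Rightarrow> complex"
  assumes "psd_kernel E B" "psd_kernel E B'"
  shows "psd_kernel E (\<lambda>z w x y. B z w x y + B' z w x y)"
proof (rule psd_kernelI)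
  fix F and \<phi> :: "complex ^ 'n \<Rightarrow> 'e"
  assume F: "finite F" "F \<subseteq> unit_ball" "\<And>w. w \<in> F \<Longrightarrow> \<phi> w \<in> hs_carrier E"
  show "0 \<le> Re (\<Sum>z\<in>F. \<Sum>w\<in>F. B z w (\<phi> w) (\<phi> z) + B' z w (\<phi> w) (\<phi> z))"
    using psd_kernelD(2)[OF assms(1) F] psd_kernelD(2)[OF assms(2) F] by (simp add: sum.distrib)
qed (simp add: psd_kernelD(1)[OF assms(1)] psd_kernelD(1)[OF assms(2)] distrib_left)

text \<open>A Schur product: each summand z_i cnj(w_i) of <z, w> is absorbed by scaling the vector
  at w with cnj(w_i), so the double sum is a sum of nonnegative ones, one for each
  coordinate.\<close>

lemma psd_kernel_cdot:
  fixes E :: "'e::complex_vector hspace" and B :: "complex ^ 'n \<Rightarrow> complex ^ 'n \<Rightarrow> 'e \<Rightarrow> 'e \<Rightarrow> complex"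
  assumes E: "hilbert_space E" and B: "psd_kernel E B"
  shows "psd_kernel E (\<lambda>z w x y. cdot z w * B z w x y)"
proof (rule psd_kernelI)
  fix F and \<phi> :: "complex ^ 'n \<Rightarrow> 'e"
  assume F: "finite F" "F \<subseteq> unit_ball" "\<And>w. w \<in> F \<Longrightarrow> \<phi> w \<in> hs_carrier E"
  have "cdot z w * B z w (\<phi> w) (\<phi> z) =
      (\<Sum>i\<in>UNIV. B z w (cnj (w $ i) *\<^sub>C \<phi> w) (cnj (z $ i) *\<^sub>C \<phi> z))" if "z \<in> F" "w \<in> F" for z w
    using that F by (simp add: psd_kernelD(1)[OF B] subset_iff cdot_def sum_distrib_left sum_distrib_right mult_ac)
  then have "(\<Sum>z\<in>F. \<Sum>w\<in>F. cdot z w * B z w (\<phi> w) (\<phi> z)) =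
      (\<Sum>z\<in>F. \<Sum>w\<in>F. \<Sum>i\<in>UNIV. B z w (cnj (w $ i) *\<^sub>C \<phi> w) (cnj (z $ i) *\<^sub>C \<phi> z))" by simp
  also have "\<dots> = (\<Sum>z\<in>F. \<Sum>i\<in>UNIV. \<Sum>w\<in>F. B z w (cnj (w $ i) *\<^sub>C \<phi> w) (cnj (z $ i) *\<^sub>C \<phi> z))"
    by (intro sum.cong refl) (rule sum.swap)
  also have "\<dots> = (\<Sum>i\<in>UNIV. \<Sum>z\<in>F. \<Sum>w\<in>F. B z w (cnj (w $ i) *\<^sub>C \<phi> w) (cnj (z $ i) *\<^sub>C \<phi> z))"
    by (rule sum.swap)
  finally have eq: "(\<Sum>z\<in>F. \<Sum>w\<in>F. cdot z w * B z w (\<phi> w) (\<phi> z)) = \<dots>" .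
  show "0 \<le> Re (\<Sum>z\<in>F. \<Sum>w\<in>F. cdot z w * B z w (\<phi> w) (\<phi> z))"
    unfolding eq Re_sum[of _ UNIV]
    by (intro sum_nonneg psd_kernelD(2)[OF B, where \<phi> = "\<lambda>w. cnj (w $ i) *\<^sub>C \<phi> w" for i])
      (use F E in auto)
qed (simp add: psd_kernelD(1)[OF B])

text \<open>The quotient is the geometric series in <z, w>, which has modulus below 1 on the ball,
  and multiplication by each power preserves positivity.\<close>

lemma psd_kernel_divide:
  fixes E :: "'e::complex_vector hspace" and B :: "complex ^ 'n \<Rightarrow> complex ^ 'n \<Rightarrow> 'e \<Rightarrow> 'e \<Rightarrow> complex"
  assumes E: "hilbert_space E" and B: "psd_kernel E B"
  shows "psd_kernel E (\<lambda>z w x y. B z w x y / (1 - cdot z w))"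
proof (rule psd_kernelI)
  fix F and \<phi> :: "complex ^ 'n \<Rightarrow> 'e"
  assume F: "finite F" "F \<subseteq> unit_ball" "\<And>w. w \<in> F \<Longrightarrow> \<phi> w \<in> hs_carrier E"
  have pow: "psd_kernel E (\<lambda>z w x y. cdot z w ^ d * B z w x y)" for d
  proof (induction d)
    case (Suc d)
    then show ?case using psd_kernel_cdot[OF E Suc] by (simp add: mult.assoc)
  qed (simp add: B)
  have "(\<lambda>d. \<Sum>z\<in>F. \<Sum>w\<in>F. cdot z w ^ d * B z w (\<phi> w) (\<phi> z)) sums
      (\<Sum>z\<in>F. \<Sum>w\<in>F. 1 / (1 - cdot z w) * B z w (\<phi> w) (\<phi> z))"
    using F by (intro sums_sum sums_mult2 geometric_sums cmod_cdot_less_1) auto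
  then have "(\<lambda>d. Re (\<Sum>z\<in>F. \<Sum>w\<in>F. cdot z w ^ d * B z w (\<phi> w) (\<phi> z))) sums
      Re (\<Sum>z\<in>F. \<Sum>w\<in>F. 1 / (1 - cdot z w) * B z w (\<phi> w) (\<phi> z))"
    by (rule sums_Re)
  then have "0 \<le> Re (\<Sum>z\<in>F. \<Sum>w\<in>F. 1 / (1 - cdot z w) * B z w (\<phi> w) (\<phi> z))"
    by (rule sums_le[rotated 1, OF sums_zero]) (rule psd_kernelD(2)[OF pow F])
  then show "0 \<le> Re (\<Sum>z\<in>F. \<Sum>w\<in>F. B z w (\<phi> w) (\<phi> z) / (1 - cdot z w))" by simp
qed (simp add: psd_kernelD(1)[OF B])

lemma psd_kernel_divide_pow:
  assumes E: "hilbert_space E" and B: "psd_kernel E B"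
  shows "psd_kernel E (\<lambda>z w x y. B z w x y / (1 - cdot z w) ^ j)"
proof (induction j)
  case (Suc j)
  then show ?case using psd_kernel_divide[OF E Suc] by (simp add: mult.commute)
qed (simp add: B)

lemma psd_kernel_gram:
  fixes E :: "'e::complex_vector hspace" and g :: "complex ^ 'n \<Rightarrow> 'e \<Rightarrow> 'r::complex_vector"
  assumes E: "hilbert_space E" and R: "hilbert_space R"
    and g: "\<And>w x. w \<in> unit_ball \<Longrightarrow> x \<in> hs_carrier E \<Longrightarrow> g w x \<in> hs_carrier R"
    and scale: "\<And>w x c. w \<in> unit_ball \<Longrightarrow> x \<in> hs_carrier E \<Longrightarrow> g w (c *\<^sub>C x) = c *\<^sub>C g w x"
  shows "psd_kernel E (\<lambda>z w x y. hs_inner R (g w x) (g z y))"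
proof (rule psd_kernelI)
  fix F and \<phi> :: "complex ^ 'n \<Rightarrow> 'e"
  assume F: "finite F" "F \<subseteq> unit_ball" "\<And>w. w \<in> F \<Longrightarrow> \<phi> w \<in> hs_carrier E"
  have c: "g w (\<phi> w) \<in> hs_carrier R" if "w \<in> F" for w using F g that by auto
  have "(\<Sum>z\<in>F. \<Sum>w\<in>F. hs_inner R (g w (\<phi> w)) (g z (\<phi> z))) =
      hs_inner R (\<Sum>w\<in>F. g w (\<phi> w)) (\<Sum>z\<in>F. g z (\<phi> z))"
    using c R by (simp add: hs_inner_sum_left hs_inner_sum_right)
  then show "0 \<le> Re (\<Sum>z\<in>F. \<Sum>w\<in>F. hs_inner R (g w (\<phi> w)) (g z (\<phi> z)))"
    using c R by (simp add: hs_inner_self_nonneg)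
qed (use assms in simp)

lemma psd_kernel_const:
  assumes E: "hilbert_space E"
  shows "psd_kernel E (\<lambda>z w x y. hs_inner E x y)"
  by (rule psd_kernel_gram[OF E E]) auto

text \<open>The constant kernel of I - C^* C: the double sum collapses to the form at the sum of the
  vectors. It accounts for the part of the coefficient space that the defect space does not
  reach.\<close>

lemma psd_kernel_const_defect:
  fixes E :: "'e::complex_vector hspace"
  assumes E: "hilbert_space E" and R: "hilbert_space R" and C: "C \<in> bounded_ops E R"
    and le: "\<And>x. x \<in> hs_carrier E \<Longrightarrow> hs_norm R (C x) \<le> hs_norm E x"
  shows "psd_kernel E (\<lambda>(z :: complex ^ 'n) w x y. hs_inner E x y - hs_inner R (C x) (C y))"
proof (rule psd_kernelI)
  fix F and \<phi> :: "complex ^ 'n \<Rightarrow> 'e"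
  assume F: "finite F" "F \<subseteq> unit_ball" "\<And>w. w \<in> F \<Longrightarrow> \<phi> w \<in> hs_carrier E"
  define s where "s = (\<Sum>w\<in>F. \<phi> w)"
  have s: "s \<in> hs_carrier E" using F E by (auto simp: s_def)
  have "(\<Sum>z\<in>F. \<Sum>w\<in>F. hs_inner E (\<phi> w) (\<phi> z) - hs_inner R (C (\<phi> w)) (C (\<phi> z)))
      = hs_inner E s s - hs_inner R (C s) (C s)"
    using F E R C bounded_ops_mem[OF C]
    by (simp add: sum_subtractf s_def bounded_ops_sum hs_inner_sum_left hs_inner_sum_right)
  moreover have "(hs_norm R (C s))\<^sup>2 \<le> (hs_norm E s)\<^sup>2"
    using le[OF s] R bounded_ops_mem[OF C s] by (intro power_mono) auto
  ultimately show "0 \<le> Re (\<Sum>z\<in>F. \<Sum>w\<in>F. hs_inner E (\<phi> w) (\<phi> z) - hs_inner R (C (\<phi> w)) (C (\<phi> z)))"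
    using s E R bounded_ops_mem[OF C s] by (simp add: hs_norm_sq)
qed (use assms bounded_ops_mem[OF C] in \<open>simp add: bounded_ops_scale right_diff_distrib\<close>)


section \<open>Powers of \<open>1 - \<sigma>\<close> as sesquilinear forms\<close>

text \<open>With \<open>N\<close> the adjoints of T and \<open>b\<close> the form of Y, this is the
  form of the j-th power of 1 - \<sigma> at Y. Only adjoints occur, so the same expression serves
  the full shift and its compression to a co-invariant subspace.\<close>

primrec dform :: "('n::finite \<Rightarrow> 'a \<Rightarrow> 'a) \<Rightarrow> nat \<Rightarrow> ('a \<Rightarrow> 'a \<Rightarrow> complex) \<Rightarrow> 'a \<Rightarrow> 'a \<Rightarrow> complex" where
  "dform N 0 b h g = b h g"
| "dform N (Suc j) b h g = dform N j b h g - (\<Sum>i\<in>UNIV. dform N j b (N i h) (N i g))"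

text \<open>Besides exchanging equal forms, with \<phi> the identity, this carries forms along an
  intertwining map such as the adjoint of X.\<close>

lemma dform_transport:
  assumes "\<And>i x. x \<in> V \<Longrightarrow> N i x \<in> V" "\<And>i x. x \<in> V \<Longrightarrow> \<phi> (N i x) = N' i (\<phi> x)"
    and "\<And>x y. x \<in> V \<Longrightarrow> y \<in> V \<Longrightarrow> b x y = b' (\<phi> x) (\<phi> y)"
    and "h \<in> V" "g \<in> V"
  shows "dform N j b h g = dform N' j b' (\<phi> h) (\<phi> g)"
  using assms(4,5) by (induction j arbitrary: h g) (use assms(1-3) in simp_all)

lemma dform_diff: "dform N j (\<lambda>h g. b h g - b' h g) h g = dform N j b h g - dform N j b' h g"
  by (induction j arbitrary: h g) (simp_all add: sum_subtractf)

lemma dform_hermitian: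
  assumes "\<And>i x. x \<in> V \<Longrightarrow> N i x \<in> V" "\<And>x y. x \<in> V \<Longrightarrow> y \<in> V \<Longrightarrow> cnj (b x y) = b y x" "h \<in> V" "g \<in> V"
  shows "cnj (dform N j b h g) = dform N j b g h"
  using assms(3,4) by (induction j arbitrary: h g) (use assms(1,2) in simp_all)

text \<open>On joint eigenvectors every step of the recursion contributes the factor 1 - <z, w>. The
  scalars c and d are carried along because N rescales the vectors, which the induction has to
  follow.\<close>

lemma dform_eigen:
  fixes h g :: "'a::complex_vector" and w z :: "complex ^ 'n"
  assumes "\<And>i c. N i (c *\<^sub>C h) = (c * cnj (w $ i)) *\<^sub>C h" "\<And>i c. N i (c *\<^sub>C g) = (c * cnj (z $ i)) *\<^sub>C g"
    and "\<And>c d. b (c *\<^sub>C h) (d *\<^sub>C g) = c * cnj d * b h g"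
  shows "dform N j b (c *\<^sub>C h) (d *\<^sub>C g) = c * cnj d * ((1 - cdot z w) ^ j * b h g)"
proof (induction j arbitrary: c d)
  case (Suc j)
  have "dform N (Suc j) b (c *\<^sub>C h) (d *\<^sub>C g) = c * cnj d * ((1 - cdot z w) ^ j * b h g)
      - (\<Sum>i\<in>UNIV. c * cnj (w $ i) * cnj (d * cnj (z $ i)) * ((1 - cdot z w) ^ j * b h g))"
    by (simp only: dform.simps assms(1,2) Suc)
  also have "(\<Sum>i\<in>UNIV. c * cnj (w $ i) * cnj (d * cnj (z $ i)) * ((1 - cdot z w) ^ j * b h g))
      = c * cnj d * cdot z w * ((1 - cdot z w) ^ j * b h g)"
    by (simp add: cdot_def sum_distrib_left sum_distrib_right mult_ac)
  finally show ?case by (simp add: algebra_simps)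
qed (use assms(3) in simp)

lemma one_minus_sigma_pow_form:
  assumes K: "hilbert_space K" and T: "\<And>i. T i \<in> bounded_ops K K" and Y: "Y \<in> bounded_ops K K"
  shows "one_minus_sigma_pow K T j Y \<in> bounded_ops K K"
    and "\<lbrakk>h \<in> hs_carrier K; g \<in> hs_carrier K\<rbrakk> \<Longrightarrow> hs_inner K (one_minus_sigma_pow K T j Y h) g
      = dform (\<lambda>i. hs_adj K K (T i)) j (\<lambda>h g. hs_inner K (Y h) g) h g"
proof -
  define Z where "Z j = one_minus_sigma_pow K T j Y" for j
  have Z_Suc: "Z (Suc j) = (\<lambda>h. Z j h - op_sigma K T (Z j) h)" for j
    by (simp add: Z_def one_minus_sigma_pow_def)
  have Z_b: "Z j \<in> bounded_ops K K" for j
  proof (induction j)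
    case (Suc j)
    have "op_sigma K T (Z j) \<in> bounded_ops K K"
      unfolding op_sigma_def
      by (intro bounded_ops_sum_op K bounded_ops_compose[OF T] bounded_ops_compose[OF Suc] hs_adj_bounded T)
    then show ?case unfolding Z_Suc by (rule bounded_ops_diff_op[OF Suc _ K K])
  qed (simp add: Z_def one_minus_sigma_pow_def Y)
  then show "one_minus_sigma_pow K T j Y \<in> bounded_ops K K" by (simp add: Z_def)
  have "hs_inner K (Z j h) g = dform (\<lambda>i. hs_adj K K (T i)) j (\<lambda>h g. hs_inner K (Y h) g) h g"
    if "h \<in> hs_carrier K" "g \<in> hs_carrier K" for h g
    using that
  proof (induction j arbitrary: h g)
    case (Suc j)
    have c: "hs_adj K K (T i) x \<in> hs_carrier K" if "x \<in> hs_carrier K" for i x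
      by (rule hs_adj_mem[OF K K T that])
    have "hs_inner K (op_sigma K T (Z j) h) g = (\<Sum>i\<in>UNIV. hs_inner K (T i (Z j (hs_adj K K (T i) h))) g)"
      unfolding op_sigma_def
      by (intro hs_inner_sum_left K Suc.prems bounded_ops_mem[OF T] bounded_ops_mem[OF Z_b] c)
    also have "\<dots> = (\<Sum>i\<in>UNIV. hs_inner K (Z j (hs_adj K K (T i) h)) (hs_adj K K (T i) g))"
      by (intro sum.cong refl hs_adj_inner[OF K K T, symmetric] bounded_ops_mem[OF Z_b] c Suc.prems)
    finally have \<sigma>: "hs_inner K (op_sigma K T (Z j) h) g
      = (\<Sum>i\<in>UNIV. hs_inner K (Z j (hs_adj K K (T i) h)) (hs_adj K K (T i) g))" .
    have "op_sigma K T (Z j) h \<in> hs_carrier K"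
      unfolding op_sigma_def
      by (intro hs_carrier_simps(6) K Suc.prems bounded_ops_mem[OF T] bounded_ops_mem[OF Z_b] c)
    then show ?case
      using Suc bounded_ops_mem[OF Z_b, of h] K c by (simp add: Z_Suc \<sigma>)
  qed (simp add: Z_def one_minus_sigma_pow_def)
  then show "\<lbrakk>h \<in> hs_carrier K; g \<in> hs_carrier K\<rbrakk> \<Longrightarrow> hs_inner K (one_minus_sigma_pow K T j Y h) g
      = dform (\<lambda>i. hs_adj K K (T i)) j (\<lambda>h g. hs_inner K (Y h) g) h g" by (simp add: Z_def)
qed


section \<open>Weighted Bergman spaces\<close>

lemma kernel_fun_add: "kernel_fun m w (x + y) = kernel_fun m w x + kernel_fun m w y"
  by (auto simp: kernel_fun_def fun_eq_iff scaleC_add_right)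

lemma kernel_fun_scale: "kernel_fun m w (c *\<^sub>C x) = c *\<^sub>C kernel_fun m w x"
  by (auto simp: kernel_fun_def fun_eq_iff scaleC_scaleC mult.commute)

lemma kernel_fun_zero [simp]: "kernel_fun m w 0 = 0"
  by (auto simp: kernel_fun_def fun_eq_iff)

locale bergman_space =
  fixes m :: nat and E :: "'e::complex_vector hspace" and H :: "(complex ^ 'n \<Rightarrow> 'e) hspace"
  assumes m: "m \<ge> 1" and E: "hilbert_space E" and bergman: "weighted_bergman m E H"
begin

lemma H: "hilbert_space H" using bergman by (simp add: weighted_bergman_def)

lemma
  assumes "f \<in> hs_carrier H"
  shows value_mem: "z \<in> unit_ball \<Longrightarrow> f z \<in> hs_carrier E" and value_off: "z \<notin> unit_ball \<Longrightarrow> f z = 0"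
  using bergman assms by (auto simp: weighted_bergman_def holomorphic_vec_def)

lemma
  assumes "w \<in> unit_ball" "\<eta> \<in> hs_carrier E"
  shows kernel_mem: "kernel_fun m w \<eta> \<in> hs_carrier H"
    and kernel_inner: "f \<in> hs_carrier H \<Longrightarrow> hs_inner H f (kernel_fun m w \<eta>) = hs_inner E (f w) \<eta>"
  using bergman assms by (auto simp: weighted_bergman_def)

lemma kernel_inner_kernel:
  assumes "w \<in> unit_ball" "\<eta> \<in> hs_carrier E" "z \<in> unit_ball" "\<zeta> \<in> hs_carrier E"
  shows "hs_inner H (kernel_fun m w \<eta>) (kernel_fun m z \<zeta>) = hs_inner E \<eta> \<zeta> / (1 - cdot z w) ^ m"
  using assms E kernel_inner[OF assms(3,4) kernel_mem[OF assms(1,2)]] by (simp add: kernel_fun_def)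

lemma eq_if_values_eq:
  assumes "f \<in> hs_carrier H" "\<And>z. z \<notin> unit_ball \<Longrightarrow> g z = 0" "\<And>z. z \<in> unit_ball \<Longrightarrow> g z \<in> hs_carrier E"
    and "\<And>w \<eta>. w \<in> unit_ball \<Longrightarrow> \<eta> \<in> hs_carrier E \<Longrightarrow> hs_inner E \<eta> (f w) = hs_inner E \<eta> (g w)"
  shows "f = g"
proof
  fix z show "f z = g z"
  proof (cases "z \<in> unit_ball")
    case True
    then show ?thesis
      using hs_eq_if_inner_eq[OF E value_mem[OF assms(1)] assms(3)] assms(4) by blast
  qed (simp add: value_off[OF assms(1)] assms(2))
qed

lemma kernel_total:
  assumes "f \<in> hs_carrier H" "\<And>w \<eta>. w \<in> unit_ball \<Longrightarrow> \<eta> \<in> hs_carrier E \<Longrightarrow> hs_inner H f (kernel_fun m w \<eta>) = 0"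
  shows "f = 0"
proof (rule eq_if_values_eq[OF assms(1)])
  fix w :: "complex ^ 'n" and \<eta> assume w: "w \<in> unit_ball" "\<eta> \<in> hs_carrier E"
  have "hs_inner E (f w) \<eta> = 0" using kernel_inner[OF w assms(1)] assms(2)[OF w] by simp
  then show "hs_inner E \<eta> (f w) = hs_inner E \<eta> (0 w)"
    using hs_inner_cnj[OF E value_mem[OF assms(1) w(1)] w(2)] E w by simp
qed (use E in auto)

definition kspan :: "(complex ^ 'n \<Rightarrow> 'e) set" where
  "kspan = {\<Sum>w\<in>F. kernel_fun m w (\<phi> w) | F \<phi>. finite F \<and> F \<subseteq> unit_ball \<and> (\<forall>w\<in>F. \<phi> w \<in> hs_carrier E)}"

text \<open>The adjoint of the difference takes values orthogonal to every kernel function, so it is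
  0 by totality.\<close>

lemma bounded_ops_eq_on_kernels:
  assumes R: "hilbert_space R" and A: "A \<in> bounded_ops H R" and B: "B \<in> bounded_ops H R"
    and eq: "\<And>w \<eta>. w \<in> unit_ball \<Longrightarrow> \<eta> \<in> hs_carrier E \<Longrightarrow> A (kernel_fun m w \<eta>) = B (kernel_fun m w \<eta>)"
    and f: "f \<in> hs_carrier H"
  shows "A f = B f"
proof -
  define D where "D f = A f - B f" for f
  have D: "D \<in> bounded_ops H R" unfolding D_def by (rule bounded_ops_diff_op[OF A B H R])
  have "D f = 0"
  proof (rule hs_adj_eq_zero_imp[OF H R D f])
    fix y assume y: "y \<in> hs_carrier R"
    have "hs_adj H R D y = 0"
    proof (rule kernel_total)
      fix w :: "complex ^ 'n" and \<eta> assume w: "w \<in> unit_ball" "\<eta> \<in> hs_carrier E"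
      then have "D (kernel_fun m w \<eta>) = 0" by (simp add: D_def eq)
      then show "hs_inner H (hs_adj H R D y) (kernel_fun m w \<eta>) = 0"
        using hs_adj_inner'[OF H R D kernel_mem[OF w] y] y R by simp
    qed (rule hs_adj_mem[OF H R D y])
    then show "hs_inner H f (hs_adj H R D y) = 0" using f H by simp
  qed
  then show ?thesis by (simp add: D_def)
qed

text \<open>Merges two finite families indexed by points; at a common point the vectors are added. A
  general \<kappa> covers both the kernel functions and their prescribed images.\<close>

lemma sum_kernel_union:
  fixes \<kappa> :: "complex ^ 'n \<Rightarrow> 'e \<Rightarrow> 'c::ab_group_add"
  assumes "finite F" "finite F'" "\<And>w. \<kappa> w 0 = 0"
    and "\<And>w x y. w \<in> F \<union> F' \<Longrightarrow> x \<in> hs_carrier E \<Longrightarrow> y \<in> hs_carrier E \<Longrightarrow> \<kappa> w (x + y) = \<kappa> w x + \<kappa> w y"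
    and "\<And>w. w \<in> F \<Longrightarrow> \<phi> w \<in> hs_carrier E" "\<And>w. w \<in> F' \<Longrightarrow> \<psi> w \<in> hs_carrier E"
  shows "(\<Sum>w\<in>F \<union> F'. \<kappa> w ((if w \<in> F then \<phi> w else 0) + (if w \<in> F' then \<psi> w else 0)))
    = (\<Sum>w\<in>F. \<kappa> w (\<phi> w)) + (\<Sum>w\<in>F'. \<kappa> w (\<psi> w))"
proof -
  have "(\<Sum>w\<in>F \<union> F'. \<kappa> w ((if w \<in> F then \<phi> w else 0) + (if w \<in> F' then \<psi> w else 0)))
      = (\<Sum>w\<in>F \<union> F'. (if w \<in> F then \<kappa> w (\<phi> w) else 0) + (if w \<in> F' then \<kappa> w (\<psi> w) else 0))"
    using assms E by (intro sum.cong) auto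
  also have "\<dots> = (\<Sum>w\<in>F. \<kappa> w (\<phi> w)) + (\<Sum>w\<in>F'. \<kappa> w (\<psi> w))"
    using assms(1,2) by (simp add: sum.distrib sum.If_cases Int_absorb1 Int_absorb2 Un_Int_distrib inf_commute)
  finally show ?thesis .
qed

text \<open>Positivity of the difference of the two kernels says that k_w \<eta> \<mapsto> e_w
  \<eta> is contractive on finite sums. Such a sum may have several representations, so the map
  enters through its graph and well-definedness comes with the bound.\<close>

lemma kernel_extension:
  fixes R :: "'r::complex_vector hspace" and e :: "complex ^ 'n \<Rightarrow> 'e \<Rightarrow> 'r"
  assumes R: "hilbert_space R"
    and e: "\<And>w. w \<in> unit_ball \<Longrightarrow> e w \<in> bounded_ops E R"
    and psd: "psd_kernel E (\<lambda>z w x y. hs_inner E x y / (1 - cdot z w) ^ m - hs_inner R (e w x) (e z y))"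
  obtains A where "A \<in> bounded_ops H R" "\<And>f. f \<in> hs_carrier H \<Longrightarrow> hs_norm R (A f) \<le> hs_norm H f"
    "\<And>w \<eta>. w \<in> unit_ball \<Longrightarrow> \<eta> \<in> hs_carrier E \<Longrightarrow> A (kernel_fun m w \<eta>) = e w \<eta>"
proof -
  \<comment> \<open>Outside the ball nothing is known about \<open>e\<close>. Extension by 0 gives
    \<open>e' w 0 = 0\<close> for every w, as \<open>sum_kernel_union\<close> demands.\<close>
  define e' where "e' w x = (if w \<in> unit_ball then e w x else 0)" for w x
  have e'0: "e' w 0 = 0" for w using bounded_ops_zero[OF e E] by (simp add: e'_def)
  define P where "P F \<phi> \<longleftrightarrow> finite F \<and> F \<subseteq> unit_ball \<and> (\<forall>w\<in>F. \<phi> w \<in> hs_carrier E)"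
    for F and \<phi> :: "complex ^ 'n \<Rightarrow> 'e"
  define pr where "pr F \<phi> = (\<Sum>w\<in>F. kernel_fun m w (\<phi> w), \<Sum>w\<in>F. e' w (\<phi> w))" for F \<phi>
  define G where "G = {pr F \<phi> | F \<phi>. P F \<phi>}"
  have ec: "e' w x \<in> hs_carrier R" if "w \<in> unit_ball" "x \<in> hs_carrier E" for w x
    using bounded_ops_mem[OF e] that by (simp add: e'_def)
  have Gc: "G \<subseteq> hs_carrier H \<times> hs_carrier R"
    using H R kernel_mem ec by (fastforce simp: G_def P_def pr_def subset_iff)
  have Glin: "linear_subset G"
    unfolding linear_subset_def
  proof (intro conjI ballI allI)
    have "P {} (\<lambda>_. 0)" "pr {} (\<lambda>_. 0) = 0" by (auto simp: P_def pr_def zero_prod_def)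
    then show "0 \<in> G" unfolding G_def by force
  next
    fix p q assume "p \<in> G" "q \<in> G"
    then obtain F \<phi> F' \<psi> where p: "p = pr F \<phi>" "P F \<phi>" and q: "q = pr F' \<psi>" "P F' \<psi>"
      by (auto simp: G_def)
    let ?\<chi> = "\<lambda>w. (if w \<in> F then \<phi> w else 0) + (if w \<in> F' then \<psi> w else 0)"
    have "P (F \<union> F') ?\<chi>" using p q E by (auto simp: P_def)
    moreover have "pr (F \<union> F') ?\<chi> = p + q"
    proof -
      have "(\<Sum>w\<in>F \<union> F'. kernel_fun m w (?\<chi> w)) = (\<Sum>w\<in>F. kernel_fun m w (\<phi> w)) + (\<Sum>w\<in>F'. kernel_fun m w (\<psi> w))"
        using p q by (intro sum_kernel_union) (auto simp: P_def kernel_fun_add)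
      moreover have "(\<Sum>w\<in>F \<union> F'. e' w (?\<chi> w)) = (\<Sum>w\<in>F. e' w (\<phi> w)) + (\<Sum>w\<in>F'. e' w (\<psi> w))"
        using p q e'0 bounded_ops_add[OF e] by (intro sum_kernel_union) (auto simp: P_def e'_def)
      ultimately show ?thesis by (simp add: pr_def p q)
    qed
    ultimately show "p + q \<in> G" unfolding G_def by force
  next
    fix c p assume "p \<in> G"
    then obtain F \<phi> where p: "p = pr F \<phi>" "P F \<phi>" by (auto simp: G_def)
    have "P F (\<lambda>w. c *\<^sub>C \<phi> w)" using p E by (auto simp: P_def)
    moreover have "pr F (\<lambda>w. c *\<^sub>C \<phi> w) = c *\<^sub>C p"
    proof -
      have "e' w (c *\<^sub>C \<phi> w) = c *\<^sub>C e' w (\<phi> w)" if "w \<in> F" for w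
        using p that bounded_ops_scale[OF e, of w "\<phi> w" c] by (auto simp: P_def e'_def)
      then show ?thesis by (simp add: pr_def p kernel_fun_scale cvec.scale_sum_right)
    qed
    ultimately show "c *\<^sub>C p \<in> G" unfolding G_def by force
  qed
  have bound: "hs_norm R y \<le> 1 * hs_norm H x" if xyG: "(x, y) \<in> G" for x y
  proof -
    obtain F \<phi> where xy: "(x, y) = pr F \<phi>" "P F \<phi>" using xyG unfolding G_def by blast
    then have F: "finite F" "F \<subseteq> unit_ball" "\<And>w. w \<in> F \<Longrightarrow> \<phi> w \<in> hs_carrier E" by (auto simp: P_def)
    have Fb: "w \<in> unit_ball" if "w \<in> F" for w using F that by auto
    have y: "y = (\<Sum>w\<in>F. e w (\<phi> w))" and x: "x = (\<Sum>w\<in>F. kernel_fun m w (\<phi> w))"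
      using xy Fb by (auto simp: pr_def e'_def)
    have ec: "e w (\<phi> w) \<in> hs_carrier R" if "w \<in> F" for w
      using F that Fb bounded_ops_mem[OF e] by auto
    have xyc: "x \<in> hs_carrier H" "y \<in> hs_carrier R" using that Gc by auto
    have "hs_inner H x x = (\<Sum>z\<in>F. \<Sum>w\<in>F. hs_inner E (\<phi> w) (\<phi> z) / (1 - cdot z w) ^ m)"
      unfolding x using F Fb H kernel_mem
      by (simp add: hs_inner_sum_left hs_inner_sum_right kernel_inner_kernel)
    moreover have "hs_inner R y y = (\<Sum>z\<in>F. \<Sum>w\<in>F. hs_inner R (e w (\<phi> w)) (e z (\<phi> z)))"
      unfolding y using ec R by (simp add: hs_inner_sum_left hs_inner_sum_right)
    ultimately have "0 \<le> Re (hs_inner H x x) - Re (hs_inner R y y)"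
      using psd_kernelD(2)[OF psd F] by (simp add: sum_subtractf)
    then have "(hs_norm R y)\<^sup>2 \<le> (hs_norm H x)\<^sup>2" using xyc H R by (simp add: hs_norm_sq)
    then show ?thesis using xyc H by (auto intro: power2_le_imp_le)
  qed
  obtain A where A: "A \<in> bounded_ops (hs_sub H (hs_closure H (fst ` G))) R" "\<And>x y. (x, y) \<in> G \<Longrightarrow> A x = y"
    "\<And>x. x \<in> hs_closure H (fst ` G) \<Longrightarrow> hs_norm R (A x) \<le> 1 * hs_norm H x"
    using bounded_extension[OF H R Glin Gc _ bound] by auto
  have kG: "(kernel_fun m w \<eta>, e w \<eta>) \<in> G" if "w \<in> unit_ball" "\<eta> \<in> hs_carrier E" for w \<eta>
  proof -
    have "P {w} (\<lambda>_. \<eta>)" "pr {w} (\<lambda>_. \<eta>) = (kernel_fun m w \<eta>, e w \<eta>)"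
      using that by (auto simp: P_def pr_def e'_def)
    then show ?thesis unfolding G_def by force
  qed
  have "hs_closure H (fst ` G) = hs_carrier H"
  proof (rule hs_closure_eq_carrier[OF H _ linear_subset_fst_image[OF Glin]])
    fix x assume x: "x \<in> hs_carrier H" "\<And>v. v \<in> fst ` G \<Longrightarrow> hs_inner H x v = 0"
    show "x = 0" by (rule kernel_total[OF x(1)]) (use x(2) kG in force)
  qed (use Gc in auto)
  then have "A \<in> bounded_ops H R" "\<And>f. f \<in> hs_carrier H \<Longrightarrow> hs_norm R (A f) \<le> hs_norm H f"
    using A(1,3) by (simp_all add: bounded_ops_def)
  then show thesis using that A(2) kG by blast
qed

lemma kspan_dense: "hs_closure H kspan = hs_carrier H" and kspan_linear: "linear_subset kspan"
  and kspan_carrier: "kspan \<subseteq> hs_carrier H"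
proof -
  show c: "kspan \<subseteq> hs_carrier H" using H kernel_mem by (fastforce simp: kspan_def subset_iff)
  show l: "linear_subset kspan"
    unfolding linear_subset_def
  proof (intro conjI ballI allI)
    show "0 \<in> kspan" unfolding kspan_def by (intro CollectI exI[of _ "{}"]) auto
  next
    fix f g assume "f \<in> kspan" "g \<in> kspan"
    then obtain F \<phi> F' \<psi> where f: "f = (\<Sum>w\<in>F. kernel_fun m w (\<phi> w))" "finite F" "F \<subseteq> unit_ball" "\<forall>w\<in>F. \<phi> w \<in> hs_carrier E"
      and g: "g = (\<Sum>w\<in>F'. kernel_fun m w (\<psi> w))" "finite F'" "F' \<subseteq> unit_ball" "\<forall>w\<in>F'. \<psi> w \<in> hs_carrier E"
      unfolding kspan_def by blast
    have "f + g = (\<Sum>w\<in>F \<union> F'. kernel_fun m w ((if w \<in> F then \<phi> w else 0) + (if w \<in> F' then \<psi> w else 0)))"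
      unfolding f g using f g by (intro sum_kernel_union[symmetric]) (auto simp: kernel_fun_add)
    then show "f + g \<in> kspan"
      unfolding kspan_def using f(2-4) g(2-4) E
      by (intro CollectI exI[of _ "F \<union> F'"] exI[of _ "\<lambda>w. (if w \<in> F then \<phi> w else 0) + (if w \<in> F' then \<psi> w else 0)"]) auto
  next
    fix c f assume "f \<in> kspan"
    then obtain F \<phi> where f: "f = (\<Sum>w\<in>F. kernel_fun m w (\<phi> w))" "finite F" "F \<subseteq> unit_ball" "\<forall>w\<in>F. \<phi> w \<in> hs_carrier E"
      unfolding kspan_def by blast
    have "c *\<^sub>C f = (\<Sum>w\<in>F. kernel_fun m w (c *\<^sub>C \<phi> w))" by (simp add: f kernel_fun_scale cvec.scale_sum_right)
    then show "c *\<^sub>C f \<in> kspan" unfolding kspan_def using f(2-4) E by (intro CollectI exI[of _ F] exI[of _ "\<lambda>w. c *\<^sub>C \<phi> w"]) auto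
  qed
  have k: "kernel_fun m w \<eta> \<in> kspan" if "w \<in> unit_ball" "\<eta> \<in> hs_carrier E" for w \<eta>
    unfolding kspan_def using that by (intro CollectI exI[of _ "{w}"] exI[of _ "\<lambda>_. \<eta>"]) auto
  show "hs_closure H kspan = hs_carrier H"
    by (rule hs_closure_eq_carrier[OF H c l]) (use kernel_total k in blast)
qed

text \<open>On sums of kernel functions the quadratic form is the double sum of B; the rest is
  density together with continuity of the quadratic form.\<close>

lemma positive_if_kernel_positive:
  assumes D: "D \<in> bounded_ops H H" and psd: "psd_kernel E B"
    and eq: "\<And>w z x y. \<lbrakk>w \<in> unit_ball; z \<in> unit_ball; x \<in> hs_carrier E; y \<in> hs_carrier E\<rbrakk>
      \<Longrightarrow> hs_inner H (D (kernel_fun m w x)) (kernel_fun m z y) = B z w x y"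
    and f: "f \<in> hs_carrier H"
  shows "0 \<le> Re (hs_inner H (D f) f)"
proof -
  have span: "0 \<le> Re (hs_inner H (D g) g)" if g_span: "g \<in> kspan" for g
  proof -
    obtain F \<phi> where g: "g = (\<Sum>w\<in>F. kernel_fun m w (\<phi> w))" and F': "finite F" "F \<subseteq> unit_ball" "\<forall>w\<in>F. \<phi> w \<in> hs_carrier E"
      using g_span unfolding kspan_def by blast
    note F = F'(1,2) F'(3)[rule_format]
    have k: "kernel_fun m w (\<phi> w) \<in> hs_carrier H" "w \<in> unit_ball" if "w \<in> F" for w using F that kernel_mem by auto
    have "hs_inner H (D g) g = (\<Sum>z\<in>F. \<Sum>w\<in>F. hs_inner H (D (kernel_fun m w (\<phi> w))) (kernel_fun m z (\<phi> z)))"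
      unfolding g using k H bounded_ops_mem[OF D]
      by (simp add: bounded_ops_sum[OF D H] hs_inner_sum_left hs_inner_sum_right)
    also have "\<dots> = (\<Sum>z\<in>F. \<Sum>w\<in>F. B z w (\<phi> w) (\<phi> z))"
      using k F by (intro sum.cong refl eq) auto
    finally show ?thesis using psd_kernelD(2)[OF psd F] by simp
  qed
  obtain s where s: "\<And>n. s n \<in> kspan" "hs_lim H s f"
    using f kspan_dense unfolding hs_closure_def by blast
  have sc: "s n \<in> hs_carrier H" for n using s kspan_carrier by auto
  note Dc = bounded_ops_mem[OF D]
  obtain C where C: "C \<ge> 0" "\<And>x. x \<in> hs_carrier H \<Longrightarrow> hs_norm H (D x) \<le> C * hs_norm H x"
    using bounded_ops_bound[OF D H] by blast
  have "(\<lambda>n. hs_inner H (D (s n)) f) \<longlonglongrightarrow> hs_inner H (D f) f"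
    using sc f Dc by (intro hs_lim_inner[OF H] hs_lim_bounded_ops[OF D H H] s) auto
  \<comment> \<open>The first argument has just been passed to the limit. The second can be
    exchanged because the norms of \<open>D (s n)\<close> stay bounded.\<close>
  moreover have "(\<lambda>n. hs_inner H (D (s n)) (s n) - hs_inner H (D (s n)) f) \<longlonglongrightarrow> 0"
  proof (rule tendsto_norm_zero_cancel, rule tendsto_sandwich[OF _ _ tendsto_const])
    have "norm (hs_inner H (D (s n)) (s n) - hs_inner H (D (s n)) f) \<le> C * hs_norm H (s n) * hs_norm H (s n - f)" for n
    proof -
      have "norm (hs_inner H (D (s n)) (s n) - hs_inner H (D (s n)) f) \<le> hs_norm H (D (s n)) * hs_norm H (s n - f)"
        using hs_Cauchy_Schwarz[OF H Dc[OF sc], of "s n - f"] sc f H Dc[OF sc] by simp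
      also have "\<dots> \<le> C * hs_norm H (s n) * hs_norm H (s n - f)"
        using C(2)[OF sc] sc f H by (intro mult_right_mono) auto
      finally show ?thesis .
    qed
    then show "\<forall>\<^sub>F n in sequentially. norm (hs_inner H (D (s n)) (s n) - hs_inner H (D (s n)) f)
        \<le> C * hs_norm H (s n) * hs_norm H (s n - f)" by simp
    have "(\<lambda>n. C * hs_norm H (s n) * hs_norm H (s n - f)) \<longlonglongrightarrow> C * hs_norm H f * 0"
      using hs_lim_norm[OF H sc f s(2)] s(2) unfolding hs_lim_def by (intro tendsto_intros)
    then show "(\<lambda>n. C * hs_norm H (s n) * hs_norm H (s n - f)) \<longlonglongrightarrow> 0" by simp
  qed auto
  ultimately have "(\<lambda>n. hs_inner H (D (s n)) (s n)) \<longlonglongrightarrow> hs_inner H (D f) f"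
    using tendsto_add by fastforce
  then have "(\<lambda>n. Re (hs_inner H (D (s n)) (s n))) \<longlonglongrightarrow> Re (hs_inner H (D f) f)" by (rule tendsto_Re)
  then show ?thesis by (rule LIMSEQ_le_const) (use span[OF s(1)] in blast)
qed

end


section \<open>The shift on a weighted Bergman space\<close>

text \<open>The sum of q over all words of length p in N applied to f. For q the squared norm and N
  the adjoints of T this is <\<sigma>^p(I) f, f>, whose decay is purity.\<close>

primrec col_iter :: "('n::finite \<Rightarrow> 'a \<Rightarrow> 'a) \<Rightarrow> ('a \<Rightarrow> real) \<Rightarrow> nat \<Rightarrow> 'a \<Rightarrow> real" where
  "col_iter N q 0 f = q f"
| "col_iter N q (Suc p) f = (\<Sum>i\<in>UNIV. col_iter N q p (N i f))"

lemma col_iter_mono: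
  assumes "\<And>i x. x \<in> V \<Longrightarrow> N i x \<in> V" "\<And>x. x \<in> V \<Longrightarrow> a x \<le> b x" "f \<in> V"
  shows "col_iter N a p f \<le> col_iter N b p f"
  using assms(3) by (induction p arbitrary: f) (use assms(1,2) in \<open>auto intro: sum_mono\<close>)

lemma col_iter_mult: "col_iter N (\<lambda>x. C * a x) p f = C * col_iter N a p f"
  by (induction p arbitrary: f) (simp_all add: sum_distrib_left)

lemma col_iter_ge:
  assumes "\<And>i x. x \<in> V \<Longrightarrow> N i x \<in> V" "\<And>x. x \<in> V \<Longrightarrow> a x \<le> (\<Sum>i\<in>UNIV. a (N i x))" "f \<in> V"
  shows "a f \<le> col_iter N a p f"
  using assms(3)
proof (induction p arbitrary: f)
  case (Suc p)
  have "a f \<le> (\<Sum>i\<in>UNIV. a (N i f))" using assms(2) Suc by simp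
  also have "\<dots> \<le> (\<Sum>i\<in>UNIV. col_iter N a p (N i f))" using assms(1) Suc by (intro sum_mono) auto
  finally show ?case by simp
qed simp

lemma col_iter_nonneg:
  assumes "\<And>i x. x \<in> V \<Longrightarrow> N i x \<in> V" "\<And>x. x \<in> V \<Longrightarrow> 0 \<le> a x" "f \<in> V"
  shows "0 \<le> col_iter N a p f"
  using assms(3) by (induction p arbitrary: f) (use assms(1,2) in \<open>auto intro: sum_nonneg\<close>)

context bergman_space
begin

lemma kernel_inner':
  assumes "w \<in> unit_ball" "\<eta> \<in> hs_carrier E" "f \<in> hs_carrier H"
  shows "hs_inner H (kernel_fun m w \<eta>) f = hs_inner E \<eta> (f w)"
  using arg_cong[OF kernel_inner[OF assms], of cnj] hs_inner_cnj[OF H assms(3) kernel_mem[OF assms(1,2)]]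
    hs_inner_cnj[OF E value_mem[OF assms(3,1)] assms(2)] by simp

lemma kernel_bounded:
  assumes w: "w \<in> unit_ball"
  shows "kernel_fun m w \<in> bounded_ops E H"
proof (rule bounded_opsI[where C = "sqrt (cmod (1 / (1 - cdot w w) ^ m))"])
  fix x assume x: "x \<in> hs_carrier E"
  have "(hs_norm H (kernel_fun m w x))\<^sup>2 = cmod (hs_inner H (kernel_fun m w x) (kernel_fun m w x))"
    using hs_inner_self[OF H kernel_mem[OF w x]] by (simp add: norm_power)
  also have "\<dots> = cmod (1 / (1 - cdot w w) ^ m) * (hs_norm E x)\<^sup>2"
    using kernel_inner_kernel[OF w x w x] hs_inner_self[OF E x] by (simp add: norm_divide norm_power)
  finally have "hs_norm H (kernel_fun m w x) = sqrt (cmod (1 / (1 - cdot w w) ^ m) * (hs_norm E x)\<^sup>2)"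
    using H kernel_mem[OF w x] by (metis hs_norm_nonneg real_sqrt_unique)
  then show "hs_norm H (kernel_fun m w x) \<le> sqrt (cmod (1 / (1 - cdot w w) ^ m)) * hs_norm E x"
    using E x by (simp add: real_sqrt_mult)
qed (use kernel_mem w in \<open>auto simp: kernel_fun_add kernel_fun_scale\<close>)

text \<open>The coordinate multiplications are the adjoints of the components of the contraction
  \<open>k\<^sub>w \<eta> \<mapsto> (cnj w\<^sub>i k\<^sub>w \<eta>)\<^sub>i\<close>.\<close>

lemma
  shows coord_mult_bounded: "coord_mult i \<in> bounded_ops H H"
    and shift_adj_kernel: "\<lbrakk>w \<in> unit_ball; \<eta> \<in> hs_carrier E\<rbrakk> \<Longrightarrow>
      hs_adj H H (coord_mult i) (kernel_fun m w \<eta>) = cnj (w $ i) *\<^sub>C kernel_fun m w \<eta>"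
    and shift_adj_row_contraction: "f \<in> hs_carrier H \<Longrightarrow>
      (\<Sum>i\<in>UNIV. (hs_norm H (hs_adj H H (coord_mult i) f))\<^sup>2) \<le> (hs_norm H f)\<^sup>2"
proof -
  have P: "hilbert_space (hs_pow H :: ('n \<Rightarrow> _) hspace)" using H by simp
  define e where "e w \<eta> i = cnj (w $ i) *\<^sub>C kernel_fun m w \<eta>" for w :: "complex ^ 'n" and \<eta> :: 'e and i
  \<comment> \<open>The column multiplies the kernel by <z, w>, so the difference of the two kernels
    has lost one factor 1 - <z, w> in the denominator. It has the exponent m - 1, available as m
    \<ge> 1, and is positive.\<close>
  have "psd_kernel E (\<lambda>(z :: complex ^ 'n) w x y. hs_inner E x y / (1 - cdot z w) ^ (m - 1))"
    by (rule psd_kernel_divide_pow[OF E psd_kernel_const[OF E]])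
  then have psd: "psd_kernel E (\<lambda>z w x y. hs_inner E x y / (1 - cdot z w) ^ m - hs_inner (hs_pow H) (e w x) (e z y))"
  proof (rule psd_kernel_cong[OF _ E])
    fix z w :: "complex ^ 'n" and x y
    assume zw: "z \<in> unit_ball" "w \<in> unit_ball" and xy: "x \<in> hs_carrier E" "y \<in> hs_carrier E"
    have pw: "hs_inner (hs_pow H) (e w x) (e z y) = cdot z w * (hs_inner E x y / (1 - cdot z w) ^ m)"
    proof -
      have "hs_inner (hs_pow H) (e w x) (e z y)
          = (\<Sum>i\<in>UNIV. z $ i * cnj (w $ i) * (hs_inner E x y / (1 - cdot z w) ^ m))"
        using H kernel_mem zw xy by (simp add: e_def kernel_inner_kernel mult_ac)
      then show ?thesis by (simp only: cdot_def[of z w] sum_distrib_right)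
    qed
    have "hs_inner E x y / (1 - cdot z w) ^ m - hs_inner (hs_pow H) (e w x) (e z y) =
        (1 - cdot z w) * (hs_inner E x y / (1 - cdot z w) ^ m)"
      unfolding pw by (simp only: left_diff_distrib mult_1_left)
    also have "\<dots> = hs_inner E x y / (1 - cdot z w) ^ (m - 1)"
      using m one_minus_cdot_nonzero[OF zw] by (cases m) auto
    finally show "hs_inner E x y / (1 - cdot z w) ^ m - hs_inner (hs_pow H) (e w x) (e z y)
        = hs_inner E x y / (1 - cdot z w) ^ (m - 1)" .
  qed
  obtain N where N: "N \<in> bounded_ops H (hs_pow H)"
      "\<And>f. f \<in> hs_carrier H \<Longrightarrow> hs_norm (hs_pow H) (N f) \<le> hs_norm H f"
      "\<And>w \<eta>. w \<in> unit_ball \<Longrightarrow> \<eta> \<in> hs_carrier E \<Longrightarrow> N (kernel_fun m w \<eta>) = e w \<eta>"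
  proof (rule kernel_extension[OF P _ psd])
    show "e w \<in> bounded_ops E (hs_pow H)" if "w \<in> unit_ball" for w
      unfolding e_def
      by (intro bounded_ops_pow[OF E H] bounded_ops_scaleC kernel_bounded that E H)
  qed blast
  define Ni where "Ni i f = N f i" for i f
  have Ni: "Ni i \<in> bounded_ops H H" for i
    unfolding Ni_def by (rule bounded_ops_compose[OF bounded_ops_pow_component[OF H] N(1) H P])
  \<comment> \<open>Tested on kernel functions, the adjoint of the i-th component is pointwise
    multiplication by z_i. In this way coordinate multiplication is seen to map the space boundedly
    into itself.\<close>
  have adj: "hs_adj H H (Ni i) f = coord_mult i f" if f: "f \<in> hs_carrier H" for i f
  proof (rule eq_if_values_eq[OF hs_adj_mem[OF H H Ni f]])
    show "coord_mult i f z = 0" if "z \<notin> unit_ball" for z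
      using value_off[OF f that] by (simp add: coord_mult_def)
    show "coord_mult i f z \<in> hs_carrier E" if "z \<in> unit_ball" for z
      using value_mem[OF f that] E by (simp add: coord_mult_def)
    fix w :: "complex ^ 'n" and \<eta> assume w: "w \<in> unit_ball" "\<eta> \<in> hs_carrier E"
    have "hs_inner E \<eta> (hs_adj H H (Ni i) f w) = hs_inner H (kernel_fun m w \<eta>) (hs_adj H H (Ni i) f)"
      by (rule kernel_inner'[OF w hs_adj_mem[OF H H Ni f], symmetric])
    also have "\<dots> = hs_inner H (Ni i (kernel_fun m w \<eta>)) f" by (rule hs_adj_inner[OF H H Ni kernel_mem[OF w] f])
    also have "\<dots> = cnj (w $ i) * hs_inner E \<eta> (f w)"
      using w f H kernel_mem[OF w] by (simp add: Ni_def N(3) e_def kernel_inner')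
    also have "\<dots> = hs_inner E \<eta> (coord_mult i f w)"
      using w value_mem[OF f w(1)] E by (simp add: coord_mult_def)
    finally show "hs_inner E \<eta> (hs_adj H H (Ni i) f w) = hs_inner E \<eta> (coord_mult i f w)" .
  qed
  show cb: "coord_mult i \<in> bounded_ops H H" for i
    by (rule bounded_ops_cong[OF hs_adj_bounded[OF H H Ni] _ H]) (simp add: adj)
  have adj': "hs_adj H H (coord_mult i) f = Ni i f" if f: "f \<in> hs_carrier H" for i f
  proof (rule hs_adj_eqI[OF H bounded_ops_mem[OF Ni f]])
    fix h assume h: "h \<in> hs_carrier H"
    show "hs_inner H (coord_mult i h) f = hs_inner H h (Ni i f)"
      using hs_adj_inner'[OF H H Ni f h] by (simp add: adj[OF h])
  qed
  show "hs_adj H H (coord_mult i) (kernel_fun m w \<eta>) = cnj (w $ i) *\<^sub>C kernel_fun m w \<eta>"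
    if "w \<in> unit_ball" "\<eta> \<in> hs_carrier E"
    using that adj'[OF kernel_mem[OF that]] by (simp add: Ni_def N(3) e_def)
  show "(\<Sum>i\<in>UNIV. (hs_norm H (hs_adj H H (coord_mult i) f))\<^sup>2) \<le> (hs_norm H f)\<^sup>2"
    if f: "f \<in> hs_carrier H"
  proof -
    have "(\<Sum>i\<in>UNIV. (hs_norm H (hs_adj H H (coord_mult i) f))\<^sup>2) = (hs_norm (hs_pow H) (N f))\<^sup>2"
      using bounded_ops_mem[OF N(1) f] H by (simp add: hs_norm_pow_sq adj'[OF f] Ni_def)
    also have "\<dots> \<le> (hs_norm H f)\<^sup>2" using N(2)[OF f] bounded_ops_mem[OF N(1) f] P by (intro power_mono hs_norm_nonneg)
    finally show ?thesis .
  qed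
qed

abbreviation shift_adj :: "'n \<Rightarrow> (complex ^ 'n \<Rightarrow> 'e) \<Rightarrow> complex ^ 'n \<Rightarrow> 'e" where
  "shift_adj i \<equiv> hs_adj H H (coord_mult i)"

lemma shift_adj_bounded: "shift_adj i \<in> bounded_ops H H"
  by (rule hs_adj_bounded[OF H H coord_mult_bounded])

lemma shift_adj_mem: "f \<in> hs_carrier H \<Longrightarrow> shift_adj i f \<in> hs_carrier H"
  by (rule bounded_ops_mem[OF shift_adj_bounded])

lemma shift_adj_scale_kernel:
  "\<lbrakk>w \<in> unit_ball; \<eta> \<in> hs_carrier E\<rbrakk> \<Longrightarrow>
    shift_adj i (c *\<^sub>C kernel_fun m w \<eta>) = (c * cnj (w $ i)) *\<^sub>C kernel_fun m w \<eta>"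
  by (simp add: bounded_ops_scale[OF shift_adj_bounded] kernel_mem shift_adj_kernel scaleC_scaleC)

text \<open>On a kernel function at w the expression is the squared norm times |w|^(2p), which tends
  to 0. Row contractivity bounds it by the squared norm of f for every p, so the decay passes from
  the span of the kernels to its closure.\<close>

lemma shift_pure:
  assumes f: "f \<in> hs_carrier H"
  shows "(\<lambda>p. col_iter shift_adj (\<lambda>f. (hs_norm H f)\<^sup>2) p f) \<longlonglongrightarrow> 0"
proof -
  let ?q = "col_iter shift_adj (\<lambda>f. (hs_norm H f)\<^sup>2)"
  have q0: "0 \<le> ?q p f" if "f \<in> hs_carrier H" for p f
    by (rule col_iter_nonneg[OF _ _ that]) (auto simp: shift_adj_mem)
  have q_Suc: "?q (Suc p) f = (\<Sum>i\<in>UNIV. ?q p (shift_adj i f))" for p f by simp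
  \<comment> \<open>Subadditivity up to a factor 2, from the parallelogram law; unlike the triangle
    inequality for norms it goes through the recursion summand by summand.\<close>
  have q_add': "\<forall>f\<in>hs_carrier H. \<forall>g\<in>hs_carrier H. ?q p (f + g) \<le> 2 * ?q p f + 2 * ?q p g" for p
  proof (induction p)
    case (Suc p)
    show ?case
    proof (intro ballI)
      fix f g assume fg: "f \<in> hs_carrier H" "g \<in> hs_carrier H"
      have "?q p (shift_adj i (f + g)) \<le> 2 * ?q p (shift_adj i f) + 2 * ?q p (shift_adj i g)" for i
        unfolding bounded_ops_add[OF shift_adj_bounded fg]
        by (rule Suc[rule_format, OF shift_adj_mem[OF fg(1)] shift_adj_mem[OF fg(2)]])
      then have "(\<Sum>i\<in>UNIV. ?q p (shift_adj i (f + g)))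
          \<le> (\<Sum>i\<in>UNIV. 2 * ?q p (shift_adj i f) + 2 * ?q p (shift_adj i g))" by (rule sum_mono)
      then show "?q (Suc p) (f + g) \<le> 2 * ?q (Suc p) f + 2 * ?q (Suc p) g"
        unfolding q_Suc by (simp only: sum.distrib sum_distrib_left)
    qed
  next
    case 0
    show ?case unfolding col_iter.simps using hs_parallelogram_le[OF H] by blast
  qed
  have q_add: "?q p (f + g) \<le> 2 * ?q p f + 2 * ?q p g" if "f \<in> hs_carrier H" "g \<in> hs_carrier H" for p f g
    by (rule q_add'[rule_format, OF that])
  have q_le: "?q p f \<le> (hs_norm H f)\<^sup>2" if "f \<in> hs_carrier H" for p f
    using that
  proof (induction p arbitrary: f)
    case (Suc p)
    have "?q (Suc p) f \<le> (\<Sum>i\<in>UNIV. (hs_norm H (shift_adj i f))\<^sup>2)"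
      using Suc by (auto intro!: sum_mono simp: shift_adj_mem)
    also have "\<dots> \<le> (hs_norm H f)\<^sup>2" by (rule shift_adj_row_contraction[OF Suc.prems])
    finally show ?case .
  qed simp
  have q_kernel: "?q p (c *\<^sub>C kernel_fun m w \<eta>) = (norm w)\<^sup>2 ^ p * (cmod c)\<^sup>2 * (hs_norm H (kernel_fun m w \<eta>))\<^sup>2"
    if w: "w \<in> unit_ball" "\<eta> \<in> hs_carrier E" for p c w \<eta>
  proof -
    have "\<forall>c. ?q p (c *\<^sub>C kernel_fun m w \<eta>) = (norm w)\<^sup>2 ^ p * (cmod c)\<^sup>2 * (hs_norm H (kernel_fun m w \<eta>))\<^sup>2"
    proof (induction p)
      case (Suc p)
      have norm: "(\<Sum>i\<in>UNIV. (cmod (w $ i))\<^sup>2) = (norm w)\<^sup>2"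
        by (simp add: norm_vec_def L2_set_def sum_nonneg)
      show ?case
      proof
        fix c
        have "?q (Suc p) (c *\<^sub>C kernel_fun m w \<eta>) =
            (\<Sum>i\<in>UNIV. (norm w)\<^sup>2 ^ p * (cmod (c * cnj (w $ i)))\<^sup>2 * (hs_norm H (kernel_fun m w \<eta>))\<^sup>2)"
          unfolding q_Suc shift_adj_scale_kernel[OF w] by (rule sum.cong[OF refl]) (rule Suc[rule_format])
        also have "\<dots> = (\<Sum>i\<in>UNIV. (cmod (w $ i))\<^sup>2) * ((norm w)\<^sup>2 ^ p * (cmod c)\<^sup>2 * (hs_norm H (kernel_fun m w \<eta>))\<^sup>2)"
          by (simp add: norm_mult power_mult_distrib sum_distrib_left sum_distrib_right mult_ac)
        finally show "?q (Suc p) (c *\<^sub>C kernel_fun m w \<eta>) =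
            (norm w)\<^sup>2 ^ Suc p * (cmod c)\<^sup>2 * (hs_norm H (kernel_fun m w \<eta>))\<^sup>2"
          unfolding norm by (simp only: power_Suc mult.assoc)
      qed
    next
      case 0
      show ?case
        unfolding col_iter.simps hs_norm_scale[OF H kernel_mem[OF w]] by (simp add: power_mult_distrib)
    qed
    then show ?thesis by blast
  qed
  have q_span: "(\<lambda>p. ?q p g) \<longlonglongrightarrow> 0" if "g \<in> kspan" for g
  proof -
    have "(\<lambda>p. ?q p (\<Sum>w\<in>F. kernel_fun m w (\<phi> w))) \<longlonglongrightarrow> 0"
      if "finite F" "F \<subseteq> unit_ball" "\<forall>w\<in>F. \<phi> w \<in> hs_carrier E" for F and \<phi> :: "complex ^ 'n \<Rightarrow> 'e"
      using that
    proof (induction F rule: finite_induct)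
      case empty
      have "?q p 0 = 0" for p using q_le[of 0 p] q0[of 0 p] H by simp
      then show ?case unfolding sum.empty by (simp only: tendsto_const)
    next
      case (insert w F)
      define k where "k = kernel_fun m w (\<phi> w)"
      define g where "g = (\<Sum>w\<in>F. kernel_fun m w (\<phi> w))"
      have w: "w \<in> unit_ball" "\<phi> w \<in> hs_carrier E" using insert by auto
      have kg: "k \<in> hs_carrier H" "g \<in> hs_carrier H"
        using insert.prems w kernel_mem H by (auto simp: k_def g_def subset_iff intro!: hs_carrier_simps(6))
      have "(norm w)\<^sup>2 < 1" using w by (simp add: power_less_one_iff abs_square_less_1)
      then have "(\<lambda>p. (norm w)\<^sup>2 ^ p * (cmod 1)\<^sup>2 * (hs_norm H k)\<^sup>2) \<longlonglongrightarrow> 0 * (cmod 1)\<^sup>2 * (hs_norm H k)\<^sup>2"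
        by (intro tendsto_mult LIMSEQ_power_zero tendsto_const) auto
      then have "(\<lambda>p. ?q p k) \<longlonglongrightarrow> 0" using q_kernel[OF w, of _ 1] by (simp add: k_def scaleC_one)
      moreover have "(\<lambda>p. ?q p g) \<longlonglongrightarrow> 0" using insert by (simp add: g_def)
      ultimately have "(\<lambda>p. 2 * ?q p k + 2 * ?q p g) \<longlonglongrightarrow> 2 * 0 + 2 * 0" by (intro tendsto_intros)
      then have lim0: "(\<lambda>p. 2 * ?q p k + 2 * ?q p g) \<longlonglongrightarrow> 0" by (simp only: mult_zero_right add_0)
      have "(\<lambda>p. ?q p (k + g)) \<longlonglongrightarrow> 0"
      proof (rule tendsto_sandwich[OF _ _ tendsto_const lim0])
        show "\<forall>\<^sub>F p in sequentially. 0 \<le> ?q p (k + g)"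
          by (intro always_eventually allI q0 hs_carrier_simps(2) H kg)
        show "\<forall>\<^sub>F p in sequentially. ?q p (k + g) \<le> 2 * ?q p k + 2 * ?q p g"
          by (intro always_eventually allI q_add kg)
      qed
      then show ?case unfolding sum.insert[OF insert.hyps] k_def g_def .
    qed
    then show ?thesis using that unfolding kspan_def by blast
  qed
  show ?thesis
  proof (rule LIMSEQ_I)
    fix r :: real assume r: "0 < r"
    obtain s where s: "\<And>n. s n \<in> kspan" "hs_lim H s f"
      using f kspan_dense unfolding hs_closure_def by blast
    have sc: "s n \<in> hs_carrier H" for n using s(1) kspan_carrier by auto
    \<comment> \<open>Both quantities are made smaller than r/4, and \<open>q_add\<close> doubles
      each of them, which adds up to r.\<close>
    have "(\<lambda>n. (hs_norm H (s n - f))\<^sup>2) \<longlonglongrightarrow> 0\<^sup>2" using s(2) unfolding hs_lim_def by (intro tendsto_power)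
    then have "\<forall>\<^sub>F n in sequentially. (hs_norm H (s n - f))\<^sup>2 < r / 4"
      by (rule order_tendstoD(2)) (use r in simp)
    then obtain n where n: "(hs_norm H (s n - f))\<^sup>2 < r / 4" by (auto simp: eventually_sequentially)
    have "\<forall>\<^sub>F p in sequentially. ?q p (s n) < r / 4" 
      using q_span[OF s(1)] by (rule order_tendstoD(2)) (use r in simp)
    then obtain N where N: "\<And>p. p \<ge> N \<Longrightarrow> ?q p (s n) < r / 4" by (auto simp: eventually_sequentially)
    have "norm (?q p f - 0) < r" if "p \<ge> N" for p
    proof -
      have "?q p (f - s n + s n) \<le> 2 * ?q p (f - s n) + 2 * ?q p (s n)"
        using f sc H by (intro q_add) auto
      moreover have "?q p (f - s n) \<le> (hs_norm H (f - s n))\<^sup>2" using f sc H by (intro q_le) auto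
      ultimately show ?thesis
        using n N[OF that] q0[OF f, of p] hs_norm_minus_commute[OF H f sc, of n] by simp
    qed
    then show "\<exists>N. \<forall>p\<ge>N. norm (?q p f - 0) < r" by blast
  qed
qed

text \<open>Iterating the last condition bounds \<open>a f\<close> by the sum of \<open>a\<close>
  over all words of length p, hence by C times the expression that tends to 0 by purity.\<close>

lemma pure_vanishing:
  assumes V: "V \<subseteq> hs_carrier H" "\<And>i f. f \<in> V \<Longrightarrow> shift_adj i f \<in> V"
    and a: "\<And>f. f \<in> V \<Longrightarrow> 0 \<le> a f" "\<And>f. f \<in> V \<Longrightarrow> a f \<le> C * (hs_norm H f)\<^sup>2"
      "\<And>f. f \<in> V \<Longrightarrow> a f \<le> (\<Sum>i\<in>UNIV. a (shift_adj i f))"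
    and f: "f \<in> V"
  shows "a f = 0"
proof -
  have le: "a f \<le> C * col_iter shift_adj (\<lambda>f. (hs_norm H f)\<^sup>2) p f" for p
  proof -
    have "a f \<le> col_iter shift_adj a p f" by (rule col_iter_ge[OF V(2) a(3) f])
    also have "\<dots> \<le> col_iter shift_adj (\<lambda>f. C * (hs_norm H f)\<^sup>2) p f" by (rule col_iter_mono[OF V(2) a(2) f])
    finally show ?thesis by (simp add: col_iter_mult)
  qed
  have "(\<lambda>p. C * col_iter shift_adj (\<lambda>f. (hs_norm H f)\<^sup>2) p f) \<longlonglongrightarrow> C * 0"
    using shift_pure f V(1) by (intro tendsto_intros) auto
  then have "a f \<le> C * 0" by (rule LIMSEQ_le_const) (use le in blast)
  then show ?thesis using a(1)[OF f] by simp
qed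

lemma dform_kernels:
  assumes "w \<in> unit_ball" "x \<in> hs_carrier E" "z \<in> unit_ball" "y \<in> hs_carrier E"
    and "\<And>c d. b (c *\<^sub>C kernel_fun m w x) (d *\<^sub>C kernel_fun m z y) = c * cnj d * b (kernel_fun m w x) (kernel_fun m z y)"
  shows "dform shift_adj j b (kernel_fun m w x) (kernel_fun m z y)
    = (1 - cdot z w) ^ j * b (kernel_fun m w x) (kernel_fun m z y)"
  using dform_eigen[where N = shift_adj and h = "kernel_fun m w x" and w = w and g = "kernel_fun m z y" and z = z
      and b = b and c = 1 and d = 1 and j = j] assms
  by (simp add: shift_adj_scale_kernel scaleC_one)

text \<open>On kernel functions the factor (1 - <z, w>)^m cancels the denominator of the reproducing
  kernel and leaves <x, y>. So the operator is the projection onto the constants, whose form is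
  given by the values at 0.\<close>

lemma dform_m_eq:
  assumes f: "f \<in> hs_carrier H" and g: "g \<in> hs_carrier H"
  shows "dform shift_adj m (hs_inner H) f g = hs_inner E (f 0) (g 0)"
proof -
  define D where "D = one_minus_sigma_pow H coord_mult m (\<lambda>h. h)"
  note form = one_minus_sigma_pow_form[OF H coord_mult_bounded bounded_ops_ident]
  have D: "D \<in> bounded_ops H H" unfolding D_def by (rule form)
  have Df: "hs_inner H (D h) g = dform shift_adj m (hs_inner H) h g"
    if "h \<in> hs_carrier H" "g \<in> hs_carrier H" for h g
    using form(2)[OF that, where j = m] by (simp add: D_def)
  \<comment> \<open>The kernel functions at 0 are constant on the ball, so c embeds E as the
    constants and its adjoint is evaluation at 0.\<close>
  define c :: "'e \<Rightarrow> complex ^ 'n \<Rightarrow> 'e" where "c = kernel_fun m 0"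
  have c: "c \<in> bounded_ops E H" unfolding c_def by (rule kernel_bounded) simp
  have c_adj: "hs_adj E H c h = h 0" if h: "h \<in> hs_carrier H" for h
    using h by (intro hs_adj_eqI[OF E]) (auto simp: c_def kernel_inner' value_mem)
  have "D f = c (hs_adj E H c f)"
  proof (rule bounded_ops_eq_on_kernels[OF H D bounded_ops_compose[OF c hs_adj_bounded[OF E H c] H E] _ f])
    fix w :: "complex ^ 'n" and x assume w: "w \<in> unit_ball" "x \<in> hs_carrier E"
    note k = kernel_mem[OF w]
    have c0: "c (hs_adj E H c (kernel_fun m w x)) = c x"
      using c_adj[OF k] by (simp add: kernel_fun_def[of m w] scaleC_one)
    have "D (kernel_fun m w x) - c x = 0"
    proof (rule kernel_total)
      show "D (kernel_fun m w x) - c x \<in> hs_carrier H"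
        using bounded_ops_mem[OF D k] bounded_ops_mem[OF c w(2)] H by simp
      fix z :: "complex ^ 'n" and y assume z: "z \<in> unit_ball" "y \<in> hs_carrier E"
      note kz = kernel_mem[OF z]
      have "hs_inner H (D (kernel_fun m w x)) (kernel_fun m z y) = hs_inner E x y"
        unfolding Df[OF k kz]
        using dform_kernels[OF w z, of "hs_inner H" m] k kz H one_minus_cdot_nonzero[OF z(1) w(1)]
        by (simp add: kernel_inner_kernel[OF w z])
      moreover have "hs_inner H (c x) (kernel_fun m z y) = hs_inner E x y"
        using kernel_inner_kernel[of 0 x z y] w z by (simp add: c_def)
      ultimately show "hs_inner H (D (kernel_fun m w x) - c x) (kernel_fun m z y) = 0"
        using bounded_ops_mem[OF D k] bounded_ops_mem[OF c w(2)] kz H by simp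
    qed
    then show "D (kernel_fun m w x) = c (hs_adj E H c (kernel_fun m w x))" by (simp add: c0)
  qed
  then have "hs_inner H (D f) g = hs_inner H (c (f 0)) g" by (simp only: c_adj[OF f])
  also have "\<dots> = hs_inner E (f 0) (g 0)"
    unfolding c_def by (rule kernel_inner') (use value_mem[OF f] g in auto)
  finally show ?thesis using Df[OF f g] by simp
qed

text \<open>Descending induction from \<open>(1 - \<sigma>)\<^sup>m(I)\<close> to \<open>I\<close>, each step being an instance of purity.\<close>

lemma zero_if_values_at_0:
  assumes V: "V \<subseteq> hs_carrier H" "\<And>i f. f \<in> V \<Longrightarrow> shift_adj i f \<in> V" and 0: "\<And>f. f \<in> V \<Longrightarrow> f 0 = 0"
    and f: "f \<in> V"
  shows "f = 0"
proof -
  define \<phi> where "\<phi> j f = dform shift_adj j (hs_inner H) f f" for j f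
  note form = one_minus_sigma_pow_form[OF H coord_mult_bounded bounded_ops_ident]
  \<comment> \<open>Each intermediate form belongs to a bounded operator, which provides the bound
    by the squared norm that \<open>pure_vanishing\<close> asks for.\<close>
  have bound: "\<exists>C. \<forall>f\<in>V. cmod (\<phi> j f) \<le> C * (hs_norm H f)\<^sup>2" for j
  proof -
    define Z where "Z = one_minus_sigma_pow H coord_mult j (\<lambda>h. h)"
    have Z: "Z \<in> bounded_ops H H" unfolding Z_def by (rule form(1))
    obtain C where C: "C \<ge> 0" "\<And>x. x \<in> hs_carrier H \<Longrightarrow> hs_norm H (Z x) \<le> C * hs_norm H x"
      using bounded_ops_bound[OF Z H] by blast
    have "cmod (\<phi> j f) \<le> C * (hs_norm H f)\<^sup>2" if "f \<in> V" for f
    proof -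
      have f: "f \<in> hs_carrier H" using that V by auto
      have "cmod (\<phi> j f) \<le> hs_norm H (Z f) * hs_norm H f"
        using hs_Cauchy_Schwarz[OF H bounded_ops_mem[OF Z f] f]
        unfolding \<phi>_def Z_def form(2)[OF f f] .
      also have "\<dots> \<le> C * hs_norm H f * hs_norm H f" using C(2)[OF f] f H by (intro mult_right_mono) auto
      finally show ?thesis by (simp add: power2_eq_square mult.assoc)
    qed
    then show ?thesis by blast
  qed
  have "\<forall>f\<in>V. \<phi> 0 f = 0"
  proof (rule inc_induct[of 0 m])
    show "\<forall>f\<in>V. \<phi> m f = 0"
    proof
      fix f assume f: "f \<in> V"
      then have "f \<in> hs_carrier H" using V(1) by auto
      then show "\<phi> m f = 0" using dform_m_eq[of f f] E by (simp add: \<phi>_def 0[OF f])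
    qed
  next
    \<comment> \<open>That form j + 1 vanishes says that form j at f is the sum of its values at the
      shifted functions. The sign of form j is not known here, hence the modulus.\<close>
    fix j assume step: "\<forall>f\<in>V. \<phi> (Suc j) f = 0"
    obtain C where C: "\<And>f. f \<in> V \<Longrightarrow> cmod (\<phi> j f) \<le> C * (hs_norm H f)\<^sup>2" using bound by blast
    have "cmod (\<phi> j f) = 0" if "f \<in> V" for f
    proof (rule pure_vanishing[OF V, where a = "\<lambda>f. cmod (\<phi> j f)" and C = C])
      fix f assume "f \<in> V"
      then have "\<phi> j f = (\<Sum>i\<in>UNIV. \<phi> j (shift_adj i f))" using step by (simp add: \<phi>_def)
      then show "cmod (\<phi> j f) \<le> (\<Sum>i\<in>UNIV. cmod (\<phi> j (shift_adj i f)))" by (simp add: norm_sum)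
    qed (use C that in auto)
    then show "\<forall>f\<in>V. \<phi> j f = 0" by simp
  qed simp
  then have "hs_inner H f f = 0" using f by (simp add: \<phi>_def)
  then show ?thesis using hs_inner_self_pos[OF H, of f] f V by fastforce
qed

lemma value_0_bounded: "(\<lambda>f. f 0) \<in> bounded_ops H E"
proof (rule bounded_ops_cong[OF hs_adj_bounded[OF E H kernel_bounded[of 0]] _ H])
  show "f 0 = hs_adj E H (kernel_fun m 0) f" if "f \<in> hs_carrier H" for f
    using that by (intro hs_adj_eqI[OF E, symmetric]) (auto simp: kernel_inner' value_mem)
qed simp

text \<open>Telescoping: with s = <z, w>, raising the exponent from j + 1 to j + 2 adds s / (1 -
  s)^(j + 2), a positive kernel. This is what makes \<Gamma> bounded on the space with exponent
  m.\<close>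

lemma psd_kernel_power_diff:
  "psd_kernel E (\<lambda>(z :: complex ^ 'n) w x y. hs_inner E x y / (1 - cdot z w) ^ m - hs_inner E x y / (1 - cdot z w))"
proof -
  have "psd_kernel E (\<lambda>(z :: complex ^ 'n) w x y. hs_inner E x y / (1 - cdot z w) ^ Suc j - hs_inner E x y / (1 - cdot z w))" for j
  proof (induction j)
    case 0
    show ?case by (rule psd_kernelI) auto
  next
    case (Suc j)
    note k = psd_kernel_cdot[OF E psd_kernel_divide_pow[OF E psd_kernel_const[OF E]], of "Suc (Suc j)"]
    show ?case
    proof (rule psd_kernel_cong[OF psd_kernel_add[OF Suc k] E])
      fix z w :: "complex ^ 'n" and x y
      assume "z \<in> unit_ball" "w \<in> unit_ball"
      then show "hs_inner E x y / (1 - cdot z w) ^ Suc (Suc j) - hs_inner E x y / (1 - cdot z w) =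
        hs_inner E x y / (1 - cdot z w) ^ Suc j - hs_inner E x y / (1 - cdot z w)
        + cdot z w * (hs_inner E x y / (1 - cdot z w) ^ Suc (Suc j))"
        using one_minus_cdot_nonzero[of z w] by (simp add: divide_simps) (simp add: algebra_simps)
    qed
  qed
  from this[of "m - 1"] show ?thesis using m by simp
qed

end


section \<open>Multipliers\<close>

locale bergman_pair = S1: bergman_space m E1 H1 + S2: bergman_space m E2 H2
  for m :: nat and E1 :: "'a::complex_vector hspace" and H1 :: "(complex ^ 'n \<Rightarrow> 'a) hspace"
    and E2 :: "'b::complex_vector hspace" and H2 :: "(complex ^ 'n \<Rightarrow> 'b) hspace"
begin

text \<open>For exponent j, the form of I - M M^* on kernel functions, where M is multiplication by
  \<Phi>. It involves the coefficient spaces only, so it can be moved between exponents.\<close>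

definition mult_kernel :: "nat \<Rightarrow> (complex ^ 'n \<Rightarrow> 'a \<Rightarrow> 'b) \<Rightarrow>
    complex ^ 'n \<Rightarrow> complex ^ 'n \<Rightarrow> 'b \<Rightarrow> 'b \<Rightarrow> complex" where
  "mult_kernel j \<Phi> z w x y =
     (hs_inner E2 x y - hs_inner E1 (hs_adj E1 E2 (\<Phi> w) x) (hs_adj E1 E2 (\<Phi> z) y)) / (1 - cdot z w) ^ j"

lemma mult_adj_kernel:
  assumes M: "mult_op \<Phi> \<in> bounded_ops H1 H2" and \<Phi>: "\<And>z. z \<in> unit_ball \<Longrightarrow> \<Phi> z \<in> bounded_ops E1 E2"
    and w: "w \<in> unit_ball" "\<eta> \<in> hs_carrier E2"
  shows "hs_adj H1 H2 (mult_op \<Phi>) (kernel_fun m w \<eta>) = kernel_fun m w (hs_adj E1 E2 (\<Phi> w) \<eta>)"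
proof (rule hs_adj_eqI[OF S1.H])
  have adj: "hs_adj E1 E2 (\<Phi> w) \<eta> \<in> hs_carrier E1" by (rule hs_adj_mem[OF S1.E S2.E \<Phi>[OF w(1)] w(2)])
  then show "kernel_fun m w (hs_adj E1 E2 (\<Phi> w) \<eta>) \<in> hs_carrier H1" by (rule S1.kernel_mem[OF w(1)])
  fix h assume h: "h \<in> hs_carrier H1"
  have "hs_inner H2 (mult_op \<Phi> h) (kernel_fun m w \<eta>) = hs_inner E2 (\<Phi> w (h w)) \<eta>"
    using S2.kernel_inner[OF w bounded_ops_mem[OF M h]] w by (simp add: mult_op_def)
  also have "\<dots> = hs_inner E1 (h w) (hs_adj E1 E2 (\<Phi> w) \<eta>)"
    using hs_adj_inner[OF S1.E S2.E \<Phi>[OF w(1)] S1.value_mem[OF h w(1)] w(2)] by simp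
  also have "\<dots> = hs_inner H1 h (kernel_fun m w (hs_adj E1 E2 (\<Phi> w) \<eta>))"
    by (rule S1.kernel_inner[OF w(1) adj h, symmetric])
  finally show "hs_inner H2 (mult_op \<Phi> h) (kernel_fun m w \<eta>)
    = hs_inner H1 h (kernel_fun m w (hs_adj E1 E2 (\<Phi> w) \<eta>))" .
qed

lemma mult_adj_shift:
  assumes M: "mult_op \<Phi> \<in> bounded_ops H1 H2" and \<Phi>: "\<And>z. z \<in> unit_ball \<Longrightarrow> \<Phi> z \<in> bounded_ops E1 E2"
    and f: "f \<in> hs_carrier H2"
  shows "hs_adj H1 H2 (mult_op \<Phi>) (S2.shift_adj i f) = S1.shift_adj i (hs_adj H1 H2 (mult_op \<Phi>) f)"
proof (rule S2.bounded_ops_eq_on_kernels[OF S1.H _ _ _ f])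
  let ?Y = "hs_adj H1 H2 (mult_op \<Phi>)"
  have Y: "?Y \<in> bounded_ops H2 H1" by (rule hs_adj_bounded[OF S1.H S2.H M])
  show "(\<lambda>f. ?Y (S2.shift_adj i f)) \<in> bounded_ops H2 H1"
    by (rule bounded_ops_compose[OF Y S2.shift_adj_bounded S2.H S2.H])
  show "(\<lambda>f. S1.shift_adj i (?Y f)) \<in> bounded_ops H2 H1"
    by (rule bounded_ops_compose[OF S1.shift_adj_bounded Y S2.H S1.H])
  fix w :: "complex ^ 'n" and \<eta> assume w: "w \<in> unit_ball" "\<eta> \<in> hs_carrier E2"
  have mk: "hs_adj H1 H2 (mult_op \<Phi>) (kernel_fun m w \<eta>) = kernel_fun m w (hs_adj E1 E2 (\<Phi> w) \<eta>)"
    if "w \<in> unit_ball" "\<eta> \<in> hs_carrier E2" for w \<eta>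
    by (rule mult_adj_kernel[OF M \<Phi> that])
  show "?Y (S2.shift_adj i (kernel_fun m w \<eta>)) = S1.shift_adj i (?Y (kernel_fun m w \<eta>))"
    using w by (simp add: S2.shift_adj_kernel bounded_ops_scale[OF Y] S2.kernel_mem mk
        S1.shift_adj_kernel hs_adj_mem[OF S1.E S2.E \<Phi>])
qed

lemma mult_kernel_psd_if_contraction:
  assumes M: "contraction_op H1 H2 (mult_op \<Phi>)" and \<Phi>: "\<And>z. z \<in> unit_ball \<Longrightarrow> \<Phi> z \<in> bounded_ops E1 E2"
  shows "psd_kernel E2 (mult_kernel m \<Phi>)"
proof (rule psd_kernelI)
  let ?A = "\<lambda>w. hs_adj E1 E2 (\<Phi> w)" and ?Y = "hs_adj H1 H2 (mult_op \<Phi>)"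
  have Mb: "mult_op \<Phi> \<in> bounded_ops H1 H2" using M by (simp add: contraction_op_def)
  have Y: "?Y \<in> bounded_ops H2 H1" by (rule hs_adj_bounded[OF S1.H S2.H Mb])
  fix F and \<phi> :: "complex ^ 'n \<Rightarrow> 'b"
  assume F: "finite F" "F \<subseteq> unit_ball" "\<And>w. w \<in> F \<Longrightarrow> \<phi> w \<in> hs_carrier E2"
  have Fb: "w \<in> unit_ball" if "w \<in> F" for w using F that by auto
  define f where "f = (\<Sum>w\<in>F. kernel_fun m w (\<phi> w))"
  have k: "kernel_fun m w (\<phi> w) \<in> hs_carrier H2" if "w \<in> F" for w using S2.kernel_mem F Fb that by auto
  then have fc: "f \<in> hs_carrier H2" using S2.H by (simp add: f_def)
  have A: "?A w (\<phi> w) \<in> hs_carrier E1" if "w \<in> F" for w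
    using that F Fb by (intro hs_adj_mem[OF S1.E S2.E \<Phi>]) auto
  have k1: "kernel_fun m w (?A w (\<phi> w)) \<in> hs_carrier H1" if "w \<in> F" for w
    using S1.kernel_mem[OF Fb A] that by auto
  have mk: "hs_adj H1 H2 (mult_op \<Phi>) (kernel_fun m w \<eta>) = kernel_fun m w (hs_adj E1 E2 (\<Phi> w) \<eta>)"
    if "w \<in> unit_ball" "\<eta> \<in> hs_carrier E2" for w \<eta>
    by (rule mult_adj_kernel[OF Mb \<Phi> that])
  have Yf: "?Y f = (\<Sum>w\<in>F. kernel_fun m w (?A w (\<phi> w)))"
    unfolding f_def using k F Fb by (simp add: bounded_ops_sum[OF Y S2.H] mk)
  have "hs_inner H2 f f = (\<Sum>z\<in>F. \<Sum>w\<in>F. hs_inner E2 (\<phi> w) (\<phi> z) / (1 - cdot z w) ^ m)"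
    unfolding f_def using k F Fb S2.H
    by (simp add: hs_inner_sum_left hs_inner_sum_right S2.kernel_inner_kernel)
  moreover have "hs_inner H1 (?Y f) (?Y f) = (\<Sum>z\<in>F. \<Sum>w\<in>F. hs_inner E1 (?A w (\<phi> w)) (?A z (\<phi> z)) / (1 - cdot z w) ^ m)"
    unfolding Yf using k1 A Fb S1.H
    by (simp add: hs_inner_sum_left hs_inner_sum_right S1.kernel_inner_kernel)
  moreover have "(hs_norm H1 (?Y f))\<^sup>2 \<le> (hs_norm H2 f)\<^sup>2"
    using contraction_adj[OF S1.H S2.H M fc] bounded_ops_mem[OF Y fc] S1.H by (intro power_mono hs_norm_nonneg)
  ultimately show "0 \<le> Re (\<Sum>z\<in>F. \<Sum>w\<in>F. mult_kernel m \<Phi> z w (\<phi> w) (\<phi> z))"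
    using fc bounded_ops_mem[OF Y fc] S1.H S2.H
    by (simp add: hs_norm_sq mult_kernel_def sum_subtractf diff_divide_distrib)
next
  fix z w :: "complex ^ 'n" and x y c d
  assume "z \<in> unit_ball" "w \<in> unit_ball" "x \<in> hs_carrier E2" "y \<in> hs_carrier E2"
  then show "mult_kernel m \<Phi> z w (c *\<^sub>C x) (d *\<^sub>C y) = c * cnj d * mult_kernel m \<Phi> z w x y"
    using S1.E S2.E hs_adj_mem[OF S1.E S2.E \<Phi>] bounded_ops_scale[OF hs_adj_bounded[OF S1.E S2.E \<Phi>]]
    by (simp add: mult_kernel_def right_diff_distrib)
qed

text \<open>By comparison of kernels, k_w \<eta> \<mapsto> k_w (\<Phi>(w)^* \<eta>) extends to a
  contraction Y. The values of its adjoint are pointwise products with \<Phi>, so multiplication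
  maps into the second space.\<close>

lemma contraction_if_mult_kernel_psd:
  assumes psd: "psd_kernel E2 (mult_kernel m \<Phi>)" and \<Phi>: "\<And>z. z \<in> unit_ball \<Longrightarrow> \<Phi> z \<in> bounded_ops E1 E2"
  shows "contraction_op H1 H2 (mult_op \<Phi>)"
proof -
  let ?A = "\<lambda>w. hs_adj E1 E2 (\<Phi> w)"
  have A: "?A w x \<in> hs_carrier E1" if "w \<in> unit_ball" "x \<in> hs_carrier E2" for w x
    using that by (intro hs_adj_mem[OF S1.E S2.E \<Phi>])
  define e where "e w x = kernel_fun m w (?A w x)" for w x
  have eb: "e w \<in> bounded_ops E2 H1" if "w \<in> unit_ball" for w
    unfolding e_def
    by (rule bounded_ops_compose[OF S1.kernel_bounded[OF that] hs_adj_bounded[OF S1.E S2.E \<Phi>[OF that]] S2.E S1.E])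
  have psd': "psd_kernel E2 (\<lambda>z w x y. hs_inner E2 x y / (1 - cdot z w) ^ m - hs_inner H1 (e w x) (e z y))"
    by (rule psd_kernel_cong[OF psd S2.E])
      (simp add: e_def S1.kernel_inner_kernel A mult_kernel_def diff_divide_distrib)
  obtain Y where Y: "Y \<in> bounded_ops H2 H1" "\<And>f. f \<in> hs_carrier H2 \<Longrightarrow> hs_norm H1 (Y f) \<le> hs_norm H2 f"
    "\<And>w \<eta>. w \<in> unit_ball \<Longrightarrow> \<eta> \<in> hs_carrier E2 \<Longrightarrow> Y (kernel_fun m w \<eta>) = e w \<eta>"
    using S2.kernel_extension[OF S1.H eb psd'] by blast
  have adj: "mult_op \<Phi> f = hs_adj H2 H1 Y f" if f: "f \<in> hs_carrier H1" for f
  proof (rule S2.eq_if_values_eq[symmetric, OF hs_adj_mem[OF S2.H S1.H Y(1) f]])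
    show "mult_op \<Phi> f z = 0" if "z \<notin> unit_ball" for z using that by (simp add: mult_op_def)
    show "mult_op \<Phi> f z \<in> hs_carrier E2" if "z \<in> unit_ball" for z
      using bounded_ops_mem[OF \<Phi>[OF that] S1.value_mem[OF f that]] that by (simp add: mult_op_def)
    fix w :: "complex ^ 'n" and \<eta> assume w: "w \<in> unit_ball" "\<eta> \<in> hs_carrier E2"
    have "hs_inner E2 \<eta> (hs_adj H2 H1 Y f w) = hs_inner H2 (kernel_fun m w \<eta>) (hs_adj H2 H1 Y f)"
      by (rule S2.kernel_inner'[OF w hs_adj_mem[OF S2.H S1.H Y(1) f], symmetric])
    also have "\<dots> = hs_inner H1 (kernel_fun m w (?A w \<eta>)) f"
      using hs_adj_inner[OF S2.H S1.H Y(1) S2.kernel_mem[OF w] f] w by (simp add: Y(3) e_def)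
    also have "\<dots> = hs_inner E1 (?A w \<eta>) (f w)" by (rule S1.kernel_inner'[OF w(1) A[OF w] f])
    also have "\<dots> = hs_inner E2 \<eta> (mult_op \<Phi> f w)"
      using hs_adj_inner'[OF S1.E S2.E \<Phi>[OF w(1)] S1.value_mem[OF f w(1)] w(2)] w by (simp add: mult_op_def)
    finally show "hs_inner E2 \<eta> (hs_adj H2 H1 Y f w) = hs_inner E2 \<eta> (mult_op \<Phi> f w)" .
  qed
  show ?thesis
    unfolding contraction_op_def
  proof (intro conjI ballI)
    show "mult_op \<Phi> \<in> bounded_ops H1 H2"
      by (rule bounded_ops_cong[OF hs_adj_bounded[OF S2.H S1.H Y(1)] adj S1.H])
    show "hs_norm H2 (mult_op \<Phi> f) \<le> hs_norm H1 f" if "f \<in> hs_carrier H1" for f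
      using hs_adj_norm_le[OF S2.H S1.H Y(1), of 1 f] Y(2) that by (simp add: adj)
  qed
qed

text \<open>Dividing m - 1 times by 1 - <z, w> preserves positivity; hence a Schur-Agler function is
  a contractive multiplier also for exponent m.\<close>

lemma mult_kernel_raise:
  assumes "psd_kernel E2 (mult_kernel 1 \<Phi>)"
  shows "psd_kernel E2 (mult_kernel m \<Phi>)"
proof (rule psd_kernel_cong[OF psd_kernel_divide_pow[OF S2.E assms, of "m - 1"] S2.E])
  fix z w :: "complex ^ 'n" and x y assume "z \<in> unit_ball" "w \<in> unit_ball"
  then show "mult_kernel m \<Phi> z w x y = mult_kernel 1 \<Phi> z w x y / (1 - cdot z w) ^ (m - 1)"
    using S1.m by (cases m) (auto simp: mult_kernel_def)
qed

text \<open>Applying m - 1 powers of 1 - \<sigma> to I - M M^* lowers the exponent of its kernel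
  from m to 1, where the kernel is positive by hypothesis.\<close>

lemma mult_defect_form_nonneg:
  assumes psd: "psd_kernel E2 (mult_kernel 1 \<Phi>)" and M: "mult_op \<Phi> \<in> bounded_ops H1 H2"
    and \<Phi>: "\<And>z. z \<in> unit_ball \<Longrightarrow> \<Phi> z \<in> bounded_ops E1 E2" and f: "f \<in> hs_carrier H2"
  defines "Y \<equiv> hs_adj H1 H2 (mult_op \<Phi>)"
  shows "0 \<le> Re (dform S2.shift_adj (m - 1) (\<lambda>h g. hs_inner H2 h g - hs_inner H1 (Y h) (Y g)) f f)"
proof -
  let ?b = "\<lambda>h g. hs_inner H2 h g - hs_inner H1 (Y h) (Y g)"
  have Y: "Y \<in> bounded_ops H2 H1" unfolding Y_def by (rule hs_adj_bounded[OF S1.H S2.H M])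
  note Yc = bounded_ops_mem[OF Y]
  define Z where "Z h = h - mult_op \<Phi> (Y h)" for h
  have Z: "Z \<in> bounded_ops H2 H2"
    unfolding Z_def
    by (intro bounded_ops_diff_op bounded_ops_ident bounded_ops_compose[OF M Y] S1.H S2.H)
  have mk: "hs_adj H1 H2 (mult_op \<Phi>) (kernel_fun m w \<eta>) = kernel_fun m w (hs_adj E1 E2 (\<Phi> w) \<eta>)"
    if "w \<in> unit_ball" "\<eta> \<in> hs_carrier E2" for w \<eta>
    by (rule mult_adj_kernel[OF M \<Phi> that])
  have Zb: "hs_inner H2 (Z h) g = ?b h g" if "h \<in> hs_carrier H2" "g \<in> hs_carrier H2" for h g
    using that S2.H bounded_ops_mem[OF M] Yc hs_adj_inner[OF S1.H S2.H M Yc[OF that(1)] that(2)]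
    by (simp add: Z_def Y_def)
  define D where "D = one_minus_sigma_pow H2 coord_mult (m - 1) Z"
  note form = one_minus_sigma_pow_form[OF S2.H S2.coord_mult_bounded Z]
  have D: "D \<in> bounded_ops H2 H2" unfolding D_def by (rule form(1))
  have Db: "hs_inner H2 (D h) g = dform S2.shift_adj (m - 1) ?b h g"
    if "h \<in> hs_carrier H2" "g \<in> hs_carrier H2" for h g
    unfolding D_def form(2)[OF that]
    by (rule dform_transport[where V = "hs_carrier H2" and \<phi> = "\<lambda>x. x"]) (use that Zb S2.shift_adj_mem in auto)
  have "0 \<le> Re (hs_inner H2 (D f) f)"
  proof (rule S2.positive_if_kernel_positive[OF D psd _ f])
    fix w z :: "complex ^ 'n" and x y
    assume w: "w \<in> unit_ball" and z: "z \<in> unit_ball" and x: "x \<in> hs_carrier E2" and y: "y \<in> hs_carrier E2"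
    note k = S2.kernel_mem[OF w x] S2.kernel_mem[OF z y]
    have "dform S2.shift_adj (m - 1) ?b (kernel_fun m w x) (kernel_fun m z y)
        = (1 - cdot z w) ^ (m - 1) * ?b (kernel_fun m w x) (kernel_fun m z y)"
      by (rule S2.dform_kernels[OF w x z y])
        (use k Yc S1.H S2.H in \<open>simp add: bounded_ops_scale[OF Y] right_diff_distrib\<close>)
    also have "?b (kernel_fun m w x) (kernel_fun m z y) = mult_kernel m \<Phi> z w x y"
      using w x z y by (simp add: Y_def mk S1.kernel_inner_kernel S2.kernel_inner_kernel
          hs_adj_mem[OF S1.E S2.E \<Phi>] mult_kernel_def diff_divide_distrib)
    also have "(1 - cdot z w) ^ (m - 1) * mult_kernel m \<Phi> z w x y = mult_kernel 1 \<Phi> z w x y"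
      using S1.m one_minus_cdot_nonzero[OF z w] by (cases m) (auto simp: mult_kernel_def)
    finally show "hs_inner H2 (D (kernel_fun m w x)) (kernel_fun m z y) = mult_kernel 1 \<Phi> z w x y"
      by (simp add: Db[OF k])
  qed
  then show ?thesis by (simp add: Db[OF f f])
qed

end


section \<open>Compressions to co-invariant subspaces\<close>

locale coinvariant = bergman_space m E H
  for m :: nat and E :: "'e::complex_vector hspace" and H :: "(complex ^ 'n \<Rightarrow> 'e) hspace" +
  fixes Q :: "(complex ^ 'n \<Rightarrow> 'e) set"
  assumes coinvariant: "coinvariant_subspace H Q"
begin

definition K :: "(complex ^ 'n \<Rightarrow> 'e) hspace" where "K = hs_sub H Q"

definition T :: "'n \<Rightarrow> (complex ^ 'n \<Rightarrow> 'e) \<Rightarrow> complex ^ 'n \<Rightarrow> 'e" where "T = compression H Q"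

lemma Q: "closed_subspace H Q" and shift_adj_Q: "f \<in> Q \<Longrightarrow> shift_adj i f \<in> Q"
  using coinvariant by (auto simp: coinvariant_subspace_def)

lemma Q_carrier: "f \<in> Q \<Longrightarrow> f \<in> hs_carrier H"
  using closed_subspaceD(1)[OF Q] by auto

lemma K: "hilbert_space K" unfolding K_def by (rule hilbert_space_sub[OF H Q])

lemma K_simps [simp]: "hs_carrier K = Q" "hs_inner K = hs_inner H" "hs_norm K = hs_norm H"
  by (simp_all add: K_def)

lemma T_bounded: "T i \<in> bounded_ops K K"
proof -
  have "(\<lambda>f. hs_proj H Q (coord_mult i f)) \<in> bounded_ops H (hs_sub H Q)"
    by (rule bounded_ops_compose[OF hs_proj_bounded[OF H Q] coord_mult_bounded H H])
  then show ?thesis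
    unfolding T_def compression_def K_def
    by (rule bounded_ops_sub_dom) (use closed_subspaceD(1)[OF Q] in auto)
qed

text \<open>By co-invariance \<open>shift_adj i f\<close> already lies in Q, so the projection
  inside the compression drops out when tested against Q.\<close>

lemma T_adj: "f \<in> Q \<Longrightarrow> hs_adj K K (T i) f = shift_adj i f"
proof (rule hs_adj_eqI[OF K])
  fix h assume f: "f \<in> Q" and "h \<in> hs_carrier K"
  then have h: "h \<in> Q" by simp
  show "hs_inner K (T i h) f = hs_inner K h (shift_adj i f)"
    using hs_proj_inner[OF H Q bounded_ops_mem[OF coord_mult_bounded Q_carrier[OF h]] f]
      hs_adj_inner[OF H H coord_mult_bounded Q_carrier[OF h] Q_carrier[OF f]]
    by (simp add: T_def compression_def)
qed (use shift_adj_Q in auto)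

lemma sigma_pow_form:
  assumes Y: "Y \<in> bounded_ops K K" and b: "\<And>h g. h \<in> Q \<Longrightarrow> g \<in> Q \<Longrightarrow> hs_inner H (Y h) g = b h g"
    and hg: "h \<in> Q" "g \<in> Q"
  shows "hs_inner H (one_minus_sigma_pow K T j Y h) g = dform shift_adj j b h g"
proof -
  have "hs_inner K (one_minus_sigma_pow K T j Y h) g
      = dform (\<lambda>i. hs_adj K K (T i)) j (\<lambda>h g. hs_inner K (Y h) g) h g"
    using one_minus_sigma_pow_form(2)[OF K T_bounded Y, where h = h and g = g and j = j] hg by simp
  also have "\<dots> = dform shift_adj j b h g"
    by (rule dform_transport[where V = Q and \<phi> = "\<lambda>x. x"]) (use hg b T_adj shift_adj_Q in auto)
  finally show ?thesis by simp
qed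

text \<open>The form of the m-th power for the compression is that of the full shift restricted to
  Q, namely <f(0), g(0)>. This proves positivity, so the root exists, and it gives the inner
  products of defect vectors.\<close>

lemma
  shows defect_positive: "positive_op K (defect_op K T m)"
    and defect_inner: "\<lbrakk>f \<in> Q; g \<in> Q\<rbrakk> \<Longrightarrow>
      hs_inner H (defect_op K T m f) (defect_op K T m g) = hs_inner E (f 0) (g 0)"
proof -
  let ?Z = "one_minus_sigma_pow K T m (\<lambda>h. h)"
  have Z: "hs_inner H (?Z f) g = hs_inner E (f 0) (g 0)" if "f \<in> Q" "g \<in> Q" for f g
    using sigma_pow_form[OF bounded_ops_ident, where b = "hs_inner H" and h = f and g = g and j = m] that
    by (simp add: dform_m_eq Q_carrier)
  have pos: "positive_op K ?Z"
    unfolding positive_op_def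
    using one_minus_sigma_pow_form(1)[OF K T_bounded bounded_ops_ident]
      hs_inner_self_nonneg[OF E value_mem[OF Q_carrier]] hs_inner_self_Im[OF E value_mem[OF Q_carrier]]
    by (auto simp: Z complex_is_Real_iff)
  show "positive_op K (defect_op K T m)" unfolding defect_op_def by (rule op_sqrt(1)[OF K pos])
  show "hs_inner H (defect_op K T m f) (defect_op K T m g) = hs_inner E (f 0) (g 0)" if "f \<in> Q" "g \<in> Q"
    using op_sqrt_inner[OF K pos, of f g] that by (simp add: defect_op_def Z)
qed

definition DS :: "(complex ^ 'n \<Rightarrow> 'e) hspace" where "DS = defect_space K T m"

definition J :: "(complex ^ 'n \<Rightarrow> 'e) \<Rightarrow> 'e" where "J = defect_embedding m E K T"

lemma defect_bounded: "defect_op K T m \<in> bounded_ops K K"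
  by (rule positive_op_bounded[OF defect_positive])

lemma DS: "hilbert_space DS"
  unfolding DS_def defect_space_def by (rule hilbert_space_closed_range[OF K defect_bounded])

lemma DS_inner [simp]: "hs_inner DS = hs_inner H"
  by (simp add: DS_def defect_space_def)

lemma DS_embeds_K: "DS \<lesssim>\<^sub>H K"
  unfolding DS_def defect_space_def closed_range_def
  by (rule embeds_sub[OF hs_closure_subset])

lemma defect_mem: "f \<in> Q \<Longrightarrow> defect_op K T m f \<in> hs_carrier DS"
  using closed_range_mem[OF K defect_bounded, of f] by (simp add: DS_def defect_space_def)

text \<open>By \<open>defect_inner\<close> the map from defect vectors to values at 0 preserves
  inner products, so it extends from the range of the defect operator to its closure; continuity
  makes the extension unique.\<close>

lemma
  shows J_isometry: "isometry_op DS E J" and J_defect: "f \<in> Q \<Longrightarrow> J (defect_op K T m f) = f 0"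
proof -
  let ?D = "defect_op K T m"
  define G where "G = (\<lambda>f. (?D f, f 0)) ` Q"
  note lin = closed_subspaceD(2)[OF Q]
  have Dadd: "?D (f + g) = ?D f + ?D g" if "f \<in> Q" "g \<in> Q" for f g
    using bounded_ops_add[OF defect_bounded, of f g] that by simp
  have Dscale: "?D (c *\<^sub>C f) = c *\<^sub>C ?D f" if "f \<in> Q" for f c
    using bounded_ops_scale[OF defect_bounded, of f c] that by simp
  have Dc: "?D f \<in> Q" if "f \<in> Q" for f using bounded_ops_mem[OF defect_bounded, of f] that by simp
  have Glin: "linear_subset G"
    unfolding linear_subset_def G_def
  proof (intro conjI ballI allI)
    have "(0, 0) = (?D 0, (0 :: complex ^ 'n \<Rightarrow> 'e) 0)" using bounded_ops_zero[OF defect_bounded K] by simp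
    then show "0 \<in> (\<lambda>f. (?D f, f 0)) ` Q" using linear_subset_zero[OF lin] unfolding zero_prod_def by (rule image_eqI)
  next
    fix p q assume "p \<in> (\<lambda>f. (?D f, f 0)) ` Q" "q \<in> (\<lambda>f. (?D f, f 0)) ` Q"
    then obtain f g where "f \<in> Q" "g \<in> Q" "p = (?D f, f 0)" "q = (?D g, g 0)" by auto
    then show "p + q \<in> (\<lambda>f. (?D f, f 0)) ` Q"
      by (intro image_eqI[where x = "f + g"]) (simp_all add: Dadd linear_subset_add[OF lin])
  next
    fix c p assume "p \<in> (\<lambda>f. (?D f, f 0)) ` Q"
    then obtain f where "f \<in> Q" "p = (?D f, f 0)" by auto
    then show "c *\<^sub>C p \<in> (\<lambda>f. (?D f, f 0)) ` Q"
      by (intro image_eqI[where x = "c *\<^sub>C f"]) (simp_all add: Dscale linear_subset_scale[OF lin])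
  qed
  have fst: "fst ` G = ?D ` Q" by (auto simp: G_def image_image)
  obtain A where A: "isometry_op (hs_sub K (hs_closure K (fst ` G))) E A" "\<And>x y. (x, y) \<in> G \<Longrightarrow> A x = y"
  proof (rule isometric_extension[OF K E Glin])
    show "G \<subseteq> hs_carrier K \<times> hs_carrier E"
      using Dc value_mem[OF Q_carrier] by (auto simp: G_def)
    show "hs_inner E y y' = hs_inner K x x'" if "(x, y) \<in> G" "(x', y') \<in> G" for x y x' y'
      using that defect_inner by (auto simp: G_def)
  qed blast
  have DS_eq: "hs_sub K (hs_closure K (fst ` G)) = DS"
    by (simp add: DS_def defect_space_def closed_range_def fst)
  \<comment> \<open>The value 0 off the carrier singles out one function, as the description in
    \<open>defect_embedding\<close> requires.\<close>
  define A' where "A' x = (if x \<in> hs_carrier DS then A x else 0)" for x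
  have A'i: "isometry_op DS E A'"
    using A(1) bounded_ops_cong[of A DS E A', OF _ _ DS] by (auto simp: isometry_op_def DS_eq A'_def)
  have A'D: "A' (?D f) = f 0" if "f \<in> Q" for f
    using that A(2) defect_mem[OF that] by (auto simp: A'_def G_def)
  let ?P = "\<lambda>J. J \<in> bounded_ops DS E \<and> (\<forall>f\<in>Q. J (?D f) = f 0) \<and> (\<forall>x. x \<notin> hs_carrier DS \<longrightarrow> J x = 0)"
  have "J = A'"
    unfolding J_def defect_embedding_def DS_def[symmetric] K_simps
  proof (rule the_equality)
    show "?P A'" using isometry_opD(1)[OF A'i] A'D by (simp add: A'_def)
    fix B assume B: "?P B"
    show "B = A'"
    proof
      fix x show "B x = A' x"
      proof (cases "x \<in> hs_carrier DS")
        case True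
        have V: "?D ` Q \<subseteq> hs_carrier K" "linear_subset (?D ` Q)"
          using Dc linear_subset_fst_image[OF Glin] by (auto simp: fst)
        show ?thesis
        proof (rule bounded_ops_eq_on_closure[OF K E V, where A = B and B = A'])
          show "B \<in> bounded_ops (hs_sub K (hs_closure K (?D ` Q))) E"
            "A' \<in> bounded_ops (hs_sub K (hs_closure K (?D ` Q))) E"
            using B isometry_opD(1)[OF A'i] by (simp_all add: DS_eq[symmetric] fst)
          show "x \<in> hs_closure K (?D ` Q)" using True by (simp add: DS_eq[symmetric] fst)
        qed (use B A'D in auto)
      qed (use B in \<open>simp add: A'_def\<close>)
    qed
  qed
  then show "isometry_op DS E J" "f \<in> Q \<Longrightarrow> J (?D f) = f 0" using A'i A'D by auto
qed

end


section \<open>Transfer functions\<close>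

locale unitary_colligation =
  fixes F :: "'f::complex_vector hspace" and E :: "'e::complex_vector hspace" and R :: "'r::complex_vector hspace"
    and U :: "'f \<times> ('n::finite \<Rightarrow> 'r) \<Rightarrow> 'e \<times> 'r"
  assumes F: "hilbert_space F" and E: "hilbert_space E" and R: "hilbert_space R"
    and U: "unitary_op (hs_sum F (hs_pow R)) (hs_sum E R) U"
begin

lemma P: "hilbert_space (hs_pow R :: ('n \<Rightarrow> 'r) hspace)" using R by simp

lemma hilbert_dom: "hilbert_space (hs_sum F (hs_pow R :: ('n \<Rightarrow> 'r) hspace))" and hilbert_ran: "hilbert_space (hs_sum E R)"
  using F P E R by simp_all

lemma U_bounded: "U \<in> bounded_ops (hs_sum F (hs_pow R)) (hs_sum E R)"
  and U_inner: "\<lbrakk>p \<in> hs_carrier (hs_sum F (hs_pow R)); q \<in> hs_carrier (hs_sum F (hs_pow R))\<rbrakk>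
    \<Longrightarrow> hs_inner (hs_sum E R) (U p) (U q) = hs_inner (hs_sum F (hs_pow R)) p q"
  using U unfolding unitary_op_def by blast+

lemma U_norm: "p \<in> hs_carrier (hs_sum F (hs_pow R)) \<Longrightarrow>
    hs_norm (hs_sum E R) (U p) = hs_norm (hs_sum F (hs_pow R)) p"
  using U_inner by (simp add: hs_norm_def)

definition A where "A x = fst (U (x, 0))"
definition B where "B v = fst (U (0, v))"
definition C where "C x = snd (U (x, 0))"
definition D where "D v = snd (U (0, v))"

lemma A: "A \<in> bounded_ops F E" and C: "C \<in> bounded_ops F R"
  unfolding A_def C_def
  by (intro bounded_ops_compose[OF bounded_ops_fst[OF E R]] bounded_ops_compose[OF bounded_ops_snd[OF E R]]
      bounded_ops_compose[OF U_bounded] isometry_opD(1)[OF isometry_inl] F P E R hilbert_ran hilbert_dom)+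

lemma B: "B \<in> bounded_ops (hs_pow R) E" and D: "D \<in> bounded_ops (hs_pow R) R"
  unfolding B_def D_def
  by (intro bounded_ops_compose[OF bounded_ops_fst[OF E R]] bounded_ops_compose[OF bounded_ops_snd[OF E R]]
      bounded_ops_compose[OF U_bounded] isometry_opD(1)[OF isometry_inr] F P E R hilbert_ran hilbert_dom)+

lemma U_blocks:
  assumes "x \<in> hs_carrier F" "v \<in> hs_carrier (hs_pow R)"
  shows "U (x, v) = (A x + B v, C x + D v)"
proof -
  have "U ((x, 0) + (0, v)) = U (x, 0) + U (0, v)"
    by (rule bounded_ops_add[OF U_bounded]) (use assms F R in auto)
  then show ?thesis by (simp add: A_def B_def C_def D_def prod_eq_iff)
qed

lemma C_norm: "x \<in> hs_carrier F \<Longrightarrow> hs_norm R (C x) \<le> 1 * hs_norm F x"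
  using hs_norm_snd_le[OF E R bounded_ops_mem[OF U_bounded], of "(x, 0)"] U_norm[of "(x, 0)"]
    isometry_opD(3)[OF isometry_inl[OF F P], of x] F R by (simp add: C_def)

lemma B_norm: "v \<in> hs_carrier (hs_pow R) \<Longrightarrow> hs_norm E (B v) \<le> 1 * hs_norm (hs_pow R) v"
  using hs_norm_fst_le[OF E R bounded_ops_mem[OF U_bounded], of "(0, v)"] U_norm[of "(0, v)"]
    isometry_opD(3)[OF isometry_inr[OF F P], of v] F R by (simp add: B_def)

lemma D_norm: "v \<in> hs_carrier (hs_pow R) \<Longrightarrow> hs_norm R (D v) \<le> 1 * hs_norm (hs_pow R) v"
  using hs_norm_snd_le[OF E R bounded_ops_mem[OF U_bounded], of "(0, v)"] U_norm[of "(0, v)"]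
    isometry_opD(3)[OF isometry_inr[OF F P], of v] F R by (simp add: D_def)

abbreviation "As \<equiv> hs_adj F E A"
abbreviation "Bs \<equiv> hs_adj (hs_pow R) E B"
abbreviation "Cs \<equiv> hs_adj F R C"
abbreviation "Ds \<equiv> hs_adj (hs_pow R) R D"

lemma adj_bounded:
  "As \<in> bounded_ops E F" "Bs \<in> bounded_ops E (hs_pow R)" "Cs \<in> bounded_ops R F" "Ds \<in> bounded_ops R (hs_pow R)"
  by (intro hs_adj_bounded F E R P A B C D)+

lemma Bs_norm: "e \<in> hs_carrier E \<Longrightarrow> hs_norm (hs_pow R) (Bs e) \<le> hs_norm E e"
  using hs_adj_norm_le[OF P E B, of 1 e] B_norm by simp

lemma Cs_norm: "r \<in> hs_carrier R \<Longrightarrow> hs_norm F (Cs r) \<le> hs_norm R r"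
  using hs_adj_norm_le[OF F R C, of 1 r] C_norm by simp

lemma Ds_norm: "r \<in> hs_carrier R \<Longrightarrow> hs_norm (hs_pow R) (Ds r) \<le> hs_norm R r"
  using hs_adj_norm_le[OF P R D, of 1 r] D_norm by simp

text \<open>The adjoint of the row operator \<open>row_Z z\<close>.\<close>

definition Zs :: "complex ^ 'n \<Rightarrow> 'r \<Rightarrow> 'n \<Rightarrow> 'r" where "Zs z r i = cnj (z $ i) *\<^sub>C r"

lemma row_Z_mem: "v \<in> hs_carrier (hs_pow R) \<Longrightarrow> row_Z z v \<in> hs_carrier R"
  using R by (simp add: row_Z_def)

lemma Zs_mem: "r \<in> hs_carrier R \<Longrightarrow> Zs z r \<in> hs_carrier (hs_pow R)"
  using R by (simp add: Zs_def)

lemma row_Z_inner: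
  assumes "v \<in> hs_carrier (hs_pow R)" "r \<in> hs_carrier R"
  shows "hs_inner R (row_Z z v) r = hs_inner (hs_pow R) v (Zs z r)"
  using assms R by (simp add: row_Z_def Zs_def hs_inner_sum_left)

lemma row_Z_norm:
  assumes v: "v \<in> hs_carrier (hs_pow R)"
  shows "hs_norm R (row_Z z v) \<le> norm z * hs_norm (hs_pow R) v"
proof -
  have "hs_norm R (row_Z z v) \<le> (\<Sum>i\<in>UNIV. hs_norm R (z $ i *\<^sub>C v i))"
    unfolding row_Z_def by (rule hs_norm_sum_le[OF R]) (use v R in auto)
  also have "\<dots> = (\<Sum>i\<in>UNIV. \<bar>norm (z $ i)\<bar> * \<bar>hs_norm R (v i)\<bar>)"
    using v R by (intro sum.cong) auto
  also have "\<dots> \<le> L2_set (\<lambda>i. norm (z $ i)) UNIV * L2_set (\<lambda>i. hs_norm R (v i)) UNIV"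
    by (rule L2_set_mult_ineq)
  also have "\<dots> = norm z * hs_norm (hs_pow R) v"
    using v R by (simp add: norm_vec_def hs_norm_pow_eq L2_set_def)
  finally show ?thesis .
qed

lemma row_Z_bounded: "row_Z (z :: complex ^ 'n) \<in> bounded_ops (hs_pow R) R"
proof (rule bounded_opsI[OF row_Z_mem _ _ row_Z_norm])
  show "row_Z z (u + v) = row_Z z u + row_Z z v" for u v :: "'n \<Rightarrow> 'r"
    by (simp add: row_Z_def scaleC_add_right sum.distrib)
  show "row_Z z (c *\<^sub>C v) = c *\<^sub>C row_Z z v" for c and v :: "'n \<Rightarrow> 'r"
    by (simp add: row_Z_def cvec.scale_sum_right scaleC_scaleC mult.commute)
qed

lemma row_Z_add: "row_Z (z + h) v = row_Z z v + row_Z h v"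
  by (simp add: row_Z_def scaleC_add_left sum.distrib)

definition L :: "complex ^ 'n \<Rightarrow> 'r \<Rightarrow> 'r" where "L z r = row_Z z (Ds r)"

lemma L_bounded: "L z \<in> bounded_ops R R"
  unfolding L_def by (rule bounded_ops_compose[OF row_Z_bounded adj_bounded(4) R P])

lemma L_norm: "r \<in> hs_carrier R \<Longrightarrow> hs_norm R (L z r) \<le> norm z * hs_norm R r"
  unfolding L_def
  using row_Z_norm[OF bounded_ops_mem[OF adj_bounded(4)], of r z] mult_left_mono[OF Ds_norm[of r], of "norm z"]
  by simp

text \<open>The resolvent of \<open>L z\<close>, written with the very expression that
  \<open>adj_transfer_function\<close> uses for its inverse.\<close>

definition N :: "complex ^ 'n \<Rightarrow> 'r \<Rightarrow> 'r" where "N z = inv_into (hs_carrier R) (\<lambda>r. r - row_Z z (Ds r))"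

lemma resolvent_below:
  assumes "r \<in> hs_carrier R"
  shows "(1 - norm z) * hs_norm R r \<le> hs_norm R (r - L z r)"
  using hs_norm_triangle_sub[OF R assms bounded_ops_mem[OF L_bounded assms, of z]] L_norm[OF assms, of z]
  by (simp add: left_diff_distrib)

lemma resolvent_inj:
  assumes z: "z \<in> unit_ball" and r: "r \<in> hs_carrier R" "s \<in> hs_carrier R" "r - L z r = s - L z s"
  shows "r = s"
proof -
  have d: "r - s \<in> hs_carrier R" using r R by simp
  have "(r - s) - L z (r - s) = (r - L z r) - (s - L z s)"
    using r(1,2) by (simp add: bounded_ops_diff[OF L_bounded R])
  then have "(r - s) - L z (r - s) = 0" using r(3) by simp
  then have "(1 - norm z) * hs_norm R (r - s) \<le> 0" using resolvent_below[OF d, of z] R by simp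
  then have "hs_norm R (r - s) = 0" using z d R by (intro antisym) (auto simp: mult_le_0_iff)
  then show ?thesis using d R by simp
qed

text \<open>On the ball \<open>L z\<close> is a contraction with constant norm z < 1, so I -
  \<open>L z\<close> is onto and the inverse image exists.\<close>

lemma
  assumes z: "z \<in> unit_ball" and r: "r \<in> hs_carrier R"
  shows N_mem: "N z r \<in> hs_carrier R" and N_eq: "N z r - L z (N z r) = r"
proof -
  obtain s where "s \<in> hs_carrier R" "s - L z s = r"
    using strict_contraction_fixpoint[OF R L_bounded[of z], of "norm z" r] L_norm z r by auto
  then have mem: "r \<in> (\<lambda>r. r - row_Z z (Ds r)) ` hs_carrier R" by (auto simp: L_def)
  show "N z r \<in> hs_carrier R" unfolding N_def by (rule inv_into_into[OF mem])
  show "N z r - L z (N z r) = r" unfolding N_def L_def using f_inv_into_f[OF mem] .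
qed

lemma N_unique: "\<lbrakk>z \<in> unit_ball; s \<in> hs_carrier R; s - L z s = r; r \<in> hs_carrier R\<rbrakk> \<Longrightarrow> N z r = s"
  by (rule resolvent_inj[of z]) (auto simp: N_mem N_eq)

lemma N_norm:
  assumes z: "z \<in> unit_ball" and r: "r \<in> hs_carrier R"
  shows "hs_norm R (N z r) \<le> 1 / (1 - norm z) * hs_norm R r"
  using resolvent_below[OF N_mem[OF z r], of z] z by (simp add: N_eq[OF z r] field_simps)

lemma N_bounded:
  assumes z: "z \<in> unit_ball"
  shows "N z \<in> bounded_ops R R"
proof (rule bounded_opsI[OF N_mem[OF z] _ _ N_norm[OF z]])
  show "N z (r + s) = N z r + N z s" if "r \<in> hs_carrier R" "s \<in> hs_carrier R" for r s
  proof (rule N_unique[OF z])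
    have "N z r + N z s - L z (N z r + N z s) = (N z r - L z (N z r)) + (N z s - L z (N z s))"
      using that N_mem[OF z] by (simp add: bounded_ops_add[OF L_bounded])
    then show "N z r + N z s - L z (N z r + N z s) = r + s" using that by (simp add: N_eq[OF z])
  qed (use that N_mem[OF z] R in auto)
  show "N z (c *\<^sub>C r) = c *\<^sub>C N z r" if "r \<in> hs_carrier R" for c r
  proof (rule N_unique[OF z])
    have "c *\<^sub>C N z r - L z (c *\<^sub>C N z r) = c *\<^sub>C (N z r - L z (N z r))"
      using that N_mem[OF z] by (simp add: bounded_ops_scale[OF L_bounded] cvec.scale_right_diff_distrib)
    then show "c *\<^sub>C N z r - L z (c *\<^sub>C N z r) = c *\<^sub>C r" using that by (simp add: N_eq[OF z])
  qed (use that N_mem[OF z] R in auto)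
qed

definition \<tau> :: "complex ^ 'n \<Rightarrow> 'e \<Rightarrow> 'f" where
  "\<tau> z e = As e + Cs (N z (row_Z z (Bs e)))"

lemma adj_transfer_function_eq: "adj_transfer_function F E R U z = \<tau> z"
  unfolding adj_transfer_function_def Let_def \<tau>_def[abs_def] N_def A_def[abs_def, symmetric]
    B_def[abs_def, symmetric] C_def[abs_def, symmetric] D_def[abs_def, symmetric] by simp

lemma \<tau>_bounded:
  assumes z: "z \<in> unit_ball"
  shows "\<tau> z \<in> bounded_ops E F"
  unfolding \<tau>_def
  by (intro bounded_ops_plus adj_bounded(1) bounded_ops_compose[OF adj_bounded(3)]
      bounded_ops_compose[OF N_bounded[OF z]] bounded_ops_compose[OF row_Z_bounded] adj_bounded(2) E F R P)

text \<open>The operator g_z of the state equation g = C + D Z^* g. Taking the adjoint of the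
  resolvent avoids a second inverse.\<close>

definition g :: "complex ^ 'n \<Rightarrow> 'f \<Rightarrow> 'r" where "g z x = hs_adj R R (N z) (C x)"

lemma g_bounded:
  assumes z: "z \<in> unit_ball"
  shows "g z \<in> bounded_ops F R"
  unfolding g_def by (rule bounded_ops_compose[OF hs_adj_bounded[OF R R N_bounded[OF z]] C F R])

text \<open>Each r equals the resolvent applied to r - \<open>L z r\<close>. Tested against r, this
  moves the resolvent from one side to the other, and what is left of \<open>L z\<close> becomes D
  Z^* on g.\<close>

lemma g_eq:
  assumes z: "z \<in> unit_ball" and x: "x \<in> hs_carrier F"
  shows "g z x = C x + D (Zs z (g z x))"
proof (rule hs_eq_if_inner_eq[OF R])
  have gc: "g z x \<in> hs_carrier R" by (rule bounded_ops_mem[OF g_bounded[OF z] x])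
  have Cx: "C x \<in> hs_carrier R" by (rule bounded_ops_mem[OF C x])
  have DZ: "D (Zs z (g z x)) \<in> hs_carrier R" by (rule bounded_ops_mem[OF D Zs_mem[OF gc]])
  show "g z x \<in> hs_carrier R" "C x + D (Zs z (g z x)) \<in> hs_carrier R" using gc Cx DZ R by auto
  fix r assume r: "r \<in> hs_carrier R"
  have Lr: "L z r \<in> hs_carrier R" by (rule bounded_ops_mem[OF L_bounded r])
  have "hs_inner R (L z r) (g z x) = hs_inner (hs_pow R) (Ds r) (Zs z (g z x))"
    unfolding L_def by (rule row_Z_inner[OF bounded_ops_mem[OF adj_bounded(4) r] gc])
  also have "\<dots> = hs_inner R r (D (Zs z (g z x)))" by (rule hs_adj_inner'[OF P R D Zs_mem[OF gc] r])
  finally have 1: "hs_inner R (L z r) (g z x) = hs_inner R r (D (Zs z (g z x)))" .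
  have rl: "r - L z r \<in> hs_carrier R" using r Lr R by simp
  have "hs_inner R (r - L z r) (g z x) = hs_inner R (N z (r - L z r)) (C x)"
    unfolding g_def by (rule hs_adj_inner[OF R R N_bounded[OF z] rl Cx])
  also have "N z (r - L z r) = r" by (rule N_unique[OF z r refl rl])
  finally show "hs_inner R r (g z x) = hs_inner R r (C x + D (Zs z (g z x)))"
    using 1 r Lr gc Cx DZ R by (simp add: algebra_simps)
qed

text \<open>Since \<open>U\<close> preserves inner products, this form of the realization formula gives the Gram identity for
  \<open>\<tau>\<close> at once.\<close>

lemma U_g:
  assumes z: "z \<in> unit_ball" and x: "x \<in> hs_carrier F"
  shows "U (x, Zs z (g z x)) = (hs_adj E F (\<tau> z) x, g z x)"
proof -
  have gc: "g z x \<in> hs_carrier R" by (rule bounded_ops_mem[OF g_bounded[OF z] x])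
  note Zg = Zs_mem[OF gc, of z]
  have "hs_adj E F (\<tau> z) x = A x + B (Zs z (g z x))"
  proof (rule hs_adj_eqI[OF E])
    have Ax: "A x \<in> hs_carrier E" by (rule bounded_ops_mem[OF A x])
    have BZ: "B (Zs z (g z x)) \<in> hs_carrier E" by (rule bounded_ops_mem[OF B Zg])
    show "A x + B (Zs z (g z x)) \<in> hs_carrier E" using Ax BZ E by simp
    fix e assume e: "e \<in> hs_carrier E"
    have Be: "Bs e \<in> hs_carrier (hs_pow R)" by (rule bounded_ops_mem[OF adj_bounded(2) e])
    define y where "y = row_Z z (Bs e)"
    have y: "y \<in> hs_carrier R" unfolding y_def by (rule row_Z_mem[OF Be])
    have "hs_inner F (Cs (N z y)) x = hs_inner R (N z y) (C x)"
      by (rule hs_adj_inner'[OF F R C x N_mem[OF z y]])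
    also have "\<dots> = hs_inner R y (g z x)"
      unfolding g_def by (rule hs_adj_inner[OF R R N_bounded[OF z] y bounded_ops_mem[OF C x], symmetric])
    also have "\<dots> = hs_inner (hs_pow R) (Bs e) (Zs z (g z x))" unfolding y_def by (rule row_Z_inner[OF Be gc])
    also have "\<dots> = hs_inner E e (B (Zs z (g z x)))" by (rule hs_adj_inner'[OF P E B Zg e])
    finally have "hs_inner F (Cs (N z y)) x = hs_inner E e (B (Zs z (g z x)))" .
    moreover have "hs_inner F (As e) x = hs_inner E e (A x)" by (rule hs_adj_inner'[OF F E A x e])
    ultimately show "hs_inner F (\<tau> z e) x = hs_inner E e (A x + B (Zs z (g z x)))"
      using bounded_ops_mem[OF adj_bounded(1) e] bounded_ops_mem[OF adj_bounded(3) N_mem[OF z y]] x e Ax BZ E F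
      by (simp add: \<tau>_def y_def)
  qed
  then show ?thesis using U_blocks[OF x Zg] g_eq[OF z x] by simp
qed

lemma \<tau>_gram:
  assumes z: "z \<in> unit_ball" and w: "w \<in> unit_ball" and x: "x \<in> hs_carrier F" and y: "y \<in> hs_carrier F"
  shows "hs_inner F x y - hs_inner E (hs_adj E F (\<tau> w) x) (hs_adj E F (\<tau> z) y)
    = (1 - cdot z w) * hs_inner R (g w x) (g z y)"
proof -
  have gx: "g w x \<in> hs_carrier R" and gy: "g z y \<in> hs_carrier R"
    using bounded_ops_mem[OF g_bounded] z w x y by auto
  have "hs_inner (hs_pow R) (Zs w (g w x)) (Zs z (g z y)) = (\<Sum>i\<in>UNIV. z $ i * cnj (w $ i) * hs_inner R (g w x) (g z y))"
    using gx gy R by (simp add: Zs_def mult_ac)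
  also have "\<dots> = cdot z w * hs_inner R (g w x) (g z y)" by (simp only: cdot_def sum_distrib_right)
  finally have Z: "hs_inner (hs_pow R) (Zs w (g w x)) (Zs z (g z y)) = cdot z w * hs_inner R (g w x) (g z y)" .
  have "hs_inner (hs_sum E R) (U (x, Zs w (g w x))) (U (y, Zs z (g z y))) =
      hs_inner F x y + cdot z w * hs_inner R (g w x) (g z y)"
    unfolding Z[symmetric] using x y Zs_mem[OF gx, of w] Zs_mem[OF gy, of z]
    by (subst U_inner) (auto simp del: hs_pow_simps)
  then show ?thesis unfolding U_g[OF w x] U_g[OF z y] by (simp add: algebra_simps)
qed

text \<open>The resolvent identity, used twice, writes the remainder as C^* times the resolvent at z
  + h applied to \<open>L h\<close> of a vector that is itself of size norm h. It is therefore of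
  second order, uniformly in e on bounded sets.\<close>

lemma \<tau>_holomorphic: "holomorphic_op E F \<tau>"
  unfolding holomorphic_op_def
proof (intro conjI ballI)
  show "\<tau> z \<in> bounded_ops E F" if "z \<in> unit_ball" for z by (rule \<tau>_bounded[OF that])
  fix z :: "complex ^ 'n" assume z: "z \<in> unit_ball"
  define y where "y z e = N z (row_Z z (Bs e))" for z e
  \<comment> \<open>Differentiating y - \<open>L z y\<close> = Z B^* e in the direction h gives the
    right-hand side \<open>row_Z h (v e)\<close>, so this vector generates all partial
    derivatives.\<close>
  define v where "v e = Ds (y z e) + Bs e" for e
  have yb: "y u \<in> bounded_ops E R" if "u \<in> unit_ball" for u
    unfolding y_def
    by (intro bounded_ops_compose[OF N_bounded[OF that]] bounded_ops_compose[OF row_Z_bounded] adj_bounded(2) E R P)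
  have vb: "v \<in> bounded_ops E (hs_pow R)"
    unfolding v_def
    by (intro bounded_ops_plus adj_bounded(2) bounded_ops_compose[OF adj_bounded(4) yb[OF z]] E R P)
  define d where "d i e = Cs (N z (v e i))" for i e
  have db: "d i \<in> bounded_ops E F" for i
    unfolding d_def
    by (intro bounded_ops_compose[OF adj_bounded(3)] bounded_ops_compose[OF N_bounded[OF z]]
        bounded_ops_compose[OF bounded_ops_pow_component[OF R]] vb E R P)
  define q where "q = 1 / (1 - norm z)"
  \<comment> \<open>Half the distance from z to the sphere: it keeps 1/(1 - norm (z + h)) below
    1/\<delta>. In M the factor 1/\<delta> bounds the resolvent at z + h, q the one at z, and q + 1
    the vector v.\<close>
  define \<delta> where "\<delta> = (1 - norm z) / 2"
  define M where "M = 1 / \<delta> * q * (q + 1)"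
  have nz: "norm z < 1" using z by simp
  have q: "q > 0" and \<delta>: "\<delta> > 0" using nz by (auto simp: q_def \<delta>_def)
  then have M: "M > 0" by (simp add: M_def)
  have main: "hs_norm F (\<tau> (z + h) e - \<tau> z e - (\<Sum>i\<in>UNIV. h $ i *\<^sub>C d i e)) \<le> M * norm h * norm h * hs_norm E e"
    if h: "norm h < \<delta>" and e: "e \<in> hs_carrier E" for h e
  proof -
    have nzh: "norm (z + h) \<le> 1 - \<delta>" using norm_triangle_ineq[of z h] h by (simp add: \<delta>_def field_simps)
    then have zh: "z + h \<in> unit_ball" using \<delta> by simp
    have yz: "y z e \<in> hs_carrier R" and yzh: "y (z + h) e \<in> hs_carrier R"
      using bounded_ops_mem[OF yb e] z zh by auto
    have Be: "Bs e \<in> hs_carrier (hs_pow R)" by (rule bounded_ops_mem[OF adj_bounded(2) e])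
    have ve: "v e \<in> hs_carrier (hs_pow R)" by (rule bounded_ops_mem[OF vb e])
    have Lv: "L h (y z e) + row_Z h (Bs e) = row_Z h (v e)"
      using bounded_ops_add[OF row_Z_bounded bounded_ops_mem[OF adj_bounded(4) yz] Be, of h] by (simp add: v_def L_def)
    have Ladd: "L (z + h) r = L z r + L h r" for r by (simp add: L_def row_Z_add)
    \<comment> \<open>The increment of y solves the resolvent equation at z + h with right-hand side
      s. Exchanging that resolvent for the one at z costs the error u, which carries a second factor
      of size norm h.\<close>
    define s where "s = row_Z h (v e)"
    have s: "s \<in> hs_carrier R" unfolding s_def by (rule row_Z_mem[OF ve])
    have dy: "y (z + h) e - y z e = N (z + h) s"
    proof (rule N_unique[OF zh, symmetric])
      have "y (z + h) e - L (z + h) (y (z + h) e) = row_Z (z + h) (Bs e)"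
        "y z e - L z (y z e) = row_Z z (Bs e)"
        unfolding y_def by (rule N_eq[OF zh row_Z_mem[OF Be]], rule N_eq[OF z row_Z_mem[OF Be]])
      then have "(y (z + h) e - y z e) - L (z + h) (y (z + h) e - y z e)
          = row_Z (z + h) (Bs e) - row_Z z (Bs e) + L h (y z e)"
        unfolding bounded_ops_diff[OF L_bounded R yzh yz] Ladd[of "y z e"] by (simp add: algebra_simps)
      then show "(y (z + h) e - y z e) - L (z + h) (y (z + h) e - y z e) = s"
        using Lv by (simp add: s_def row_Z_add add.commute)
    qed (use yz yzh s R in auto)
    define u where "u = L h (N z s)"
    have Ns: "N z s \<in> hs_carrier R" "N (z + h) s \<in> hs_carrier R" using N_mem z zh s by auto
    have u: "u \<in> hs_carrier R" unfolding u_def by (rule bounded_ops_mem[OF L_bounded Ns(1)])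
    have dN: "N (z + h) s - N z s = N (z + h) u"
    proof (rule N_unique[OF zh, symmetric])
      have "(N (z + h) s - N z s) - L (z + h) (N (z + h) s - N z s)
          = (N (z + h) s - L (z + h) (N (z + h) s)) - (N z s - L z (N z s)) + u"
        unfolding bounded_ops_diff[OF L_bounded R Ns(2,1)] Ladd[of "N z s"] u_def by (simp add: algebra_simps)
      then show "(N (z + h) s - N z s) - L (z + h) (N (z + h) s - N z s) = u"
        by (simp add: N_eq[OF zh s] N_eq[OF z s])
    qed (use Ns u R in auto)
    have "(\<Sum>i\<in>UNIV. h $ i *\<^sub>C d i e) = Cs (N z s)"
    proof -
      have vc: "v e i \<in> hs_carrier R" for i using ve by simp
      have Nv: "N z (v e i) \<in> hs_carrier R" for i by (rule N_mem[OF z vc])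
      have "N z s = (\<Sum>i\<in>UNIV. h $ i *\<^sub>C N z (v e i))"
        unfolding s_def row_Z_def
        by (subst bounded_ops_sum[OF N_bounded[OF z] R]) (use vc R in \<open>auto simp: bounded_ops_scale[OF N_bounded[OF z]]\<close>)
      then have "Cs (N z s) = (\<Sum>i\<in>UNIV. Cs (h $ i *\<^sub>C N z (v e i)))"
        using bounded_ops_sum[OF adj_bounded(3) R, of UNIV "\<lambda>i. h $ i *\<^sub>C N z (v e i)"] Nv R by simp
      then show ?thesis using Nv by (simp add: d_def bounded_ops_scale[OF adj_bounded(3)])
    qed
    moreover have "\<tau> (z + h) e - \<tau> z e = Cs (y (z + h) e) - Cs (y z e)" by (simp add: \<tau>_def y_def)
    ultimately have "\<tau> (z + h) e - \<tau> z e - (\<Sum>i\<in>UNIV. h $ i *\<^sub>C d i e)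
        = Cs (y (z + h) e) - Cs (y z e) - Cs (N z s)" by simp
    also have "\<dots> = Cs (y (z + h) e - y z e) - Cs (N z s)"
      by (simp only: bounded_ops_diff[OF adj_bounded(3) R yzh yz])
    also have "\<dots> = Cs (N (z + h) s - N z s)" unfolding dy by (rule bounded_ops_diff[OF adj_bounded(3) R Ns(2,1), symmetric])
    also have "\<dots> = Cs (N (z + h) u)" by (simp only: dN)
    finally have "hs_norm F (\<tau> (z + h) e - \<tau> z e - (\<Sum>i\<in>UNIV. h $ i *\<^sub>C d i e)) = hs_norm F (Cs (N (z + h) u))" by simp
    also have "\<dots> \<le> hs_norm R (N (z + h) u)" by (rule Cs_norm[OF N_mem[OF zh u]])
    also have "\<dots> \<le> 1 / (1 - norm (z + h)) * hs_norm R u" by (rule N_norm[OF zh u])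
    also have "\<dots> \<le> 1 / \<delta> * hs_norm R u"
      using nzh \<delta> u R by (intro mult_right_mono divide_left_mono) auto
    also have "\<dots> \<le> 1 / \<delta> * (norm h * (q * (norm h * ((q + 1) * hs_norm E e))))"
    proof (rule mult_left_mono)
      have "hs_norm R u \<le> norm h * hs_norm R (N z s)" unfolding u_def by (rule L_norm[OF Ns(1)])
      also have "\<dots> \<le> norm h * (q * hs_norm R s)"
        using N_norm[OF z s] by (intro mult_left_mono) (auto simp: q_def)
      also have "\<dots> \<le> norm h * (q * (norm h * hs_norm (hs_pow R) (v e)))"
        unfolding s_def using row_Z_norm[OF ve, of h] q by (intro mult_left_mono) auto
      also have "\<dots> \<le> norm h * (q * (norm h * ((q + 1) * hs_norm E e)))"
      proof (intro mult_left_mono)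
        have "hs_norm (hs_pow R) (v e) \<le> hs_norm (hs_pow R) (Ds (y z e)) + hs_norm (hs_pow R) (Bs e)"
          unfolding v_def by (rule hs_norm_triangle[OF P bounded_ops_mem[OF adj_bounded(4) yz] Be])
        also have "\<dots> \<le> hs_norm R (y z e) + hs_norm E e" using Ds_norm[OF yz] Bs_norm[OF e] by simp
        also have "hs_norm R (y z e) \<le> q * hs_norm R (row_Z z (Bs e))"
          unfolding y_def q_def by (rule N_norm[OF z row_Z_mem[OF Be]])
        also have "\<dots> \<le> q * hs_norm E e"
        proof (rule mult_left_mono)
          have "hs_norm R (row_Z z (Bs e)) \<le> norm z * hs_norm (hs_pow R) (Bs e)" by (rule row_Z_norm[OF Be])
          also have "\<dots> \<le> 1 * hs_norm E e"
            using nz Bs_norm[OF e] Be P by (intro mult_mono hs_norm_nonneg) auto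
          finally show "hs_norm R (row_Z z (Bs e)) \<le> hs_norm E e" by simp
        qed (use q in simp)
        finally show "hs_norm (hs_pow R) (v e) \<le> (q + 1) * hs_norm E e" by (simp add: distrib_right)
      qed (use q in auto)
      finally show "hs_norm R u \<le> norm h * (q * (norm h * ((q + 1) * hs_norm E e)))" .
    qed (use \<delta> in simp)
    also have "\<dots> = M * norm h * norm h * hs_norm E e" by (simp add: M_def)
    finally show ?thesis .
  qed
  show "\<exists>d. (\<forall>i. d i \<in> bounded_ops E F) \<and> (\<forall>\<epsilon>>0. \<forall>\<^sub>F h in at 0. \<forall>x\<in>hs_carrier E.
      hs_norm F (\<tau> (z + h) x - \<tau> z x - (\<Sum>i\<in>UNIV. h $ i *\<^sub>C d i x)) \<le> \<epsilon> * norm h * hs_norm E x)"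
  proof (intro exI[of _ d] conjI allI impI db)
    fix \<epsilon> :: real assume \<epsilon>: "\<epsilon> > 0"
    show "\<forall>\<^sub>F h in at 0. \<forall>x\<in>hs_carrier E.
      hs_norm F (\<tau> (z + h) x - \<tau> z x - (\<Sum>i\<in>UNIV. h $ i *\<^sub>C d i x)) \<le> \<epsilon> * norm h * hs_norm E x"
      unfolding eventually_at
    proof (intro exI[of _ "min \<delta> (\<epsilon> / M)"] conjI ballI impI)
      show "0 < min \<delta> (\<epsilon> / M)" using \<delta> \<epsilon> M by simp
      fix h :: "complex ^ 'n" and e assume h: "h \<noteq> 0 \<and> dist h 0 < min \<delta> (\<epsilon> / M)" and e: "e \<in> hs_carrier E"
      have "M * norm h \<le> \<epsilon>" using h M by (simp add: field_simps)
      then have "M * norm h * (norm h * hs_norm E e) \<le> \<epsilon> * (norm h * hs_norm E e)"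
        using e E by (intro mult_right_mono) auto
      moreover have "norm h < \<delta>" using h by simp
      ultimately show "hs_norm F (\<tau> (z + h) e - \<tau> z e - (\<Sum>i\<in>UNIV. h $ i *\<^sub>C d i e)) \<le> \<epsilon> * norm h * hs_norm E e"
        by (intro order_trans[OF main[OF _ e]]) (simp_all only: mult.assoc)
    qed
  qed
qed

end

lemma holomorphic_op_compose:
  fixes \<tau> :: "complex ^ 'n \<Rightarrow> 'e::complex_vector \<Rightarrow> 'f::complex_vector"
    and A :: "'c::complex_vector \<Rightarrow> 'e" and B :: "'f \<Rightarrow> 'd::complex_vector"
  assumes E: "hilbert_space E" and F: "hilbert_space F" and E': "hilbert_space E'" and F': "hilbert_space F'"
    and \<tau>: "holomorphic_op E F \<tau>" and A: "A \<in> bounded_ops E' E" and B: "B \<in> bounded_ops F F'"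
    and An: "\<And>x. x \<in> hs_carrier E' \<Longrightarrow> hs_norm E (A x) \<le> hs_norm E' x"
    and Bn: "\<And>x. x \<in> hs_carrier F \<Longrightarrow> hs_norm F' (B x) \<le> hs_norm F x"
  shows "holomorphic_op E' F' (\<lambda>z x. B (\<tau> z (A x)))"
  unfolding holomorphic_op_def
proof (intro conjI ballI)
  have \<tau>b: "\<tau> z \<in> bounded_ops E F" if "z \<in> unit_ball" for z using \<tau> that by (simp add: holomorphic_op_def)
  show "(\<lambda>x. B (\<tau> z (A x))) \<in> bounded_ops E' F'" if "z \<in> unit_ball" for z
    by (intro bounded_ops_compose[OF B] bounded_ops_compose[OF \<tau>b[OF that] A] E F E')
  fix z :: "complex ^ 'n" assume z: "z \<in> unit_ball"
  then obtain d where d: "\<And>i. d i \<in> bounded_ops E F"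
    and ev: "\<And>\<epsilon>. \<epsilon> > 0 \<Longrightarrow> \<forall>\<^sub>F h in at 0. \<forall>x\<in>hs_carrier E.
      hs_norm F (\<tau> (z + h) x - \<tau> z x - (\<Sum>i\<in>UNIV. h $ i *\<^sub>C d i x)) \<le> \<epsilon> * norm h * hs_norm E x"
    using \<tau> unfolding holomorphic_op_def by blast
  \<comment> \<open>The values of \<tau> at z + h are known to lie in F only when z + h is in the
    ball.\<close>
  have ball: "\<forall>\<^sub>F h in at 0. z + h \<in> unit_ball"
  proof -
    have "(\<lambda>h. z + h) \<midarrow>0\<rightarrow> z + 0" by (intro tendsto_intros)
    then show ?thesis using z by (intro topological_tendstoD) auto
  qed
  show "\<exists>d. (\<forall>i. d i \<in> bounded_ops E' F') \<and> (\<forall>\<epsilon>>0. \<forall>\<^sub>F h in at 0. \<forall>x\<in>hs_carrier E'.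
      hs_norm F' (B (\<tau> (z + h) (A x)) - B (\<tau> z (A x)) - (\<Sum>i\<in>UNIV. h $ i *\<^sub>C d i x)) \<le> \<epsilon> * norm h * hs_norm E' x)"
  proof (intro exI[of _ "\<lambda>i x. B (d i (A x))"] conjI allI impI)
    show "(\<lambda>x. B (d i (A x))) \<in> bounded_ops E' F'" for i
      by (intro bounded_ops_compose[OF B] bounded_ops_compose[OF d A] E F E')
    fix \<epsilon> :: real assume \<epsilon>: "\<epsilon> > 0"
    show "\<forall>\<^sub>F h in at 0. \<forall>x\<in>hs_carrier E'.
      hs_norm F' (B (\<tau> (z + h) (A x)) - B (\<tau> z (A x)) - (\<Sum>i\<in>UNIV. h $ i *\<^sub>C B (d i (A x)))) \<le> \<epsilon> * norm h * hs_norm E' x"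
      using ev[OF \<epsilon>] ball
    proof eventually_elim
      case (elim h)
      show ?case
      proof
        fix x assume x: "x \<in> hs_carrier E'"
        have Ax: "A x \<in> hs_carrier E" by (rule bounded_ops_mem[OF A x])
        let ?r = "\<tau> (z + h) (A x) - \<tau> z (A x) - (\<Sum>i\<in>UNIV. h $ i *\<^sub>C d i (A x))"
        have t: "\<tau> (z + h) (A x) \<in> hs_carrier F" "\<tau> z (A x) \<in> hs_carrier F" "d i (A x) \<in> hs_carrier F" for i
          using bounded_ops_mem[OF \<tau>b Ax] bounded_ops_mem[OF d Ax] z elim(2) by auto
        have S: "(\<Sum>i\<in>UNIV. h $ i *\<^sub>C d i (A x)) \<in> hs_carrier F" using t F by simp
        have r: "?r \<in> hs_carrier F" using t S F by simp
        have "B (\<Sum>i\<in>UNIV. h $ i *\<^sub>C d i (A x)) = (\<Sum>i\<in>UNIV. h $ i *\<^sub>C B (d i (A x)))"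
          using t F by (subst bounded_ops_sum[OF B F]) (auto simp: bounded_ops_scale[OF B])
        then have "B (\<tau> (z + h) (A x)) - B (\<tau> z (A x)) - (\<Sum>i\<in>UNIV. h $ i *\<^sub>C B (d i (A x))) = B ?r"
          using t S F by (simp add: bounded_ops_diff[OF B F])
        then have "hs_norm F' (B (\<tau> (z + h) (A x)) - B (\<tau> z (A x)) - (\<Sum>i\<in>UNIV. h $ i *\<^sub>C B (d i (A x)))) \<le> hs_norm F ?r"
          using Bn[OF r] by simp
        also have "\<dots> \<le> \<epsilon> * norm h * hs_norm E (A x)" using elim(1) Ax by blast
        also have "\<dots> \<le> \<epsilon> * norm h * hs_norm E' x" using An[OF x] \<epsilon> by (intro mult_left_mono) auto
        finally show "hs_norm F' (B (\<tau> (z + h) (A x)) - B (\<tau> z (A x)) - (\<Sum>i\<in>UNIV. h $ i *\<^sub>C B (d i (A x))))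
          \<le> \<epsilon> * norm h * hs_norm E' x" .
      qed
    qed
  qed
qed


section \<open>The commutant lifting theorem\<close>

locale lifting = S1: coinvariant m E1 H1 Q1 + S2: coinvariant m E2 H2 Q2
  for m :: nat and E1 :: "'a::complex_vector hspace" and H1 :: "(complex ^ 'n \<Rightarrow> 'a) hspace" and Q1
    and E2 :: "'b::complex_vector hspace" and H2 :: "(complex ^ 'n \<Rightarrow> 'b) hspace" and Q2 +
  fixes X :: "(complex ^ 'n \<Rightarrow> 'a) \<Rightarrow> complex ^ 'n \<Rightarrow> 'b"
  assumes X: "contraction_op S1.K S2.K X"
    and intertwining: "\<And>i f. f \<in> Q1 \<Longrightarrow> X (S1.T i f) = S2.T i (X f)"
begin

sublocale bergman_pair m E1 H1 E2 H2 ..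

definition Xs :: "(complex ^ 'n \<Rightarrow> 'b) \<Rightarrow> complex ^ 'n \<Rightarrow> 'a" where "Xs = hs_adj S1.K S2.K X"

lemma X_bounded: "X \<in> bounded_ops S1.K S2.K"
  using X by (simp add: contraction_op_def)

lemma Xs_bounded: "Xs \<in> bounded_ops S2.K S1.K"
  unfolding Xs_def by (rule hs_adj_bounded[OF S1.K S2.K X_bounded])

lemma Xs_mem: "k \<in> Q2 \<Longrightarrow> Xs k \<in> Q1"
  using bounded_ops_mem[OF Xs_bounded] by simp

text \<open>The adjoint of the intertwining relation; the adjoints of the compressions are the
  restricted adjoint shifts.\<close>

lemma Xs_shift:
  assumes k: "k \<in> Q2"
  shows "Xs (S2.shift_adj i k) = S1.shift_adj i (Xs k)"
  unfolding Xs_def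
proof (rule hs_adj_eqI[OF S1.K])
  show "S1.shift_adj i (hs_adj S1.K S2.K X k) \<in> hs_carrier S1.K"
    using S1.shift_adj_Q[OF Xs_mem[OF k]] by (simp add: Xs_def)
  fix h assume "h \<in> hs_carrier S1.K"
  then have h: "h \<in> Q1" by simp
  have Th: "S1.T i h \<in> Q1" using bounded_ops_mem[OF S1.T_bounded, of h] h by simp
  have Xh: "X h \<in> Q2" using bounded_ops_mem[OF X_bounded, of h] h by simp
  have "hs_inner S2.K (X h) (S2.shift_adj i k) = hs_inner S2.K (S2.T i (X h)) k"
    using hs_adj_inner[OF S2.K S2.K S2.T_bounded, of "X h" k] Xh k by (simp add: S2.T_adj)
  also have "\<dots> = hs_inner S2.K (X (S1.T i h)) k" by (simp add: intertwining[OF h])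
  also have "\<dots> = hs_inner S1.K (S1.T i h) (Xs k)"
    using hs_adj_inner[OF S1.K S2.K X_bounded, of "S1.T i h" k] Th k by (simp add: Xs_def)
  also have "\<dots> = hs_inner S1.K h (S1.shift_adj i (Xs k))"
    using hs_adj_inner[OF S1.K S1.K S1.T_bounded, of h "Xs k"] h Xs_mem[OF k] by (simp add: S1.T_adj)
  finally show "hs_inner S2.K (X h) (S2.shift_adj i k) = hs_inner S1.K h (S1.shift_adj i (hs_adj S1.K S2.K X k))"
    by (simp add: Xs_def)
qed

abbreviation b :: "(complex ^ 'n \<Rightarrow> 'b) \<Rightarrow> (complex ^ 'n \<Rightarrow> 'b) \<Rightarrow> complex" where
  "b h g \<equiv> hs_inner H2 h g - hs_inner H1 (Xs h) (Xs g)"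

definition Z :: "(complex ^ 'n \<Rightarrow> 'b) \<Rightarrow> complex ^ 'n \<Rightarrow> 'b" where
  "Z = one_minus_sigma_pow S2.K S2.T (m - 1) (\<lambda>k. k - X (hs_adj S1.K S2.K X k))"

lemma
  shows Z_bounded: "Z \<in> bounded_ops S2.K S2.K"
    and Z_form: "\<lbrakk>h \<in> Q2; g \<in> Q2\<rbrakk> \<Longrightarrow> hs_inner H2 (Z h) g = dform S2.shift_adj (m - 1) b h g"
proof -
  have Y: "(\<lambda>k. k - X (hs_adj S1.K S2.K X k)) \<in> bounded_ops S2.K S2.K"
    by (intro bounded_ops_diff_op bounded_ops_ident bounded_ops_compose[OF X_bounded]
        hs_adj_bounded[OF S1.K S2.K X_bounded] S1.K S2.K)
  show "Z \<in> bounded_ops S2.K S2.K"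
    unfolding Z_def by (rule one_minus_sigma_pow_form(1)[OF S2.K S2.T_bounded Y])
  show "hs_inner H2 (Z h) g = dform S2.shift_adj (m - 1) b h g" if "h \<in> Q2" "g \<in> Q2"
    unfolding Z_def
  proof (rule S2.sigma_pow_form[OF Y _ that])
    fix h g assume hg: "h \<in> Q2" "g \<in> Q2"
    have Xc: "X (Xs h) \<in> Q2" using bounded_ops_mem[OF X_bounded, of "Xs h"] Xs_mem[OF hg(1)] by simp
    have "hs_inner H2 (X (Xs h)) g = hs_inner H1 (Xs h) (Xs g)"
      using hs_adj_inner[OF S1.K S2.K X_bounded, of "Xs h" g] Xs_mem[OF hg(1)] hg by (simp add: Xs_def)
    then show "hs_inner H2 (h - X (hs_adj S1.K S2.K X h)) g = b h g"
      using hs_inner_diff_left[OF S2.H S2.Q_carrier[OF hg(1)] S2.Q_carrier[OF Xc] S2.Q_carrier[OF hg(2)]]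
      by (simp add: Xs_def)
  qed
qed

text \<open>On Q2 the form \<open>b\<close> sees X only through its adjoint, which is that of the
  multiplication operator. So the form of Z is a restriction of the one on the full space, where it
  is nonnegative.\<close>

lemma positive_if_lifting:
  assumes \<Phi>: "\<And>z. z \<in> unit_ball \<Longrightarrow> \<Phi> z \<in> bounded_ops E1 E2" and psd: "psd_kernel E2 (mult_kernel 1 \<Phi>)"
    and eq: "\<And>k. k \<in> Q2 \<Longrightarrow> Xs k = hs_adj H1 H2 (mult_op \<Phi>) k"
  shows "positive_op S2.K Z"
  unfolding positive_op_def
proof (intro conjI ballI)
  show "Z \<in> bounded_ops S2.K S2.K" by (rule Z_bounded)
  fix k assume "k \<in> hs_carrier S2.K"
  then have k: "k \<in> Q2" by simp
  have M: "mult_op \<Phi> \<in> bounded_ops H1 H2"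
    using contraction_if_mult_kernel_psd[OF mult_kernel_raise[OF psd] \<Phi>] by (simp add: contraction_op_def)
  let ?b = "\<lambda>h g. hs_inner H2 h g - hs_inner H1 (hs_adj H1 H2 (mult_op \<Phi>) h) (hs_adj H1 H2 (mult_op \<Phi>) g)"
  have "hs_inner H2 (Z k) k = dform S2.shift_adj (m - 1) b k k" by (rule Z_form[OF k k])
  also have "\<dots> = dform S2.shift_adj (m - 1) ?b k k"
    by (rule dform_transport[where V = Q2 and \<phi> = "\<lambda>x. x"]) (use k S2.shift_adj_Q in \<open>auto simp: eq\<close>)
  finally show "0 \<le> Re (hs_inner S2.K (Z k) k)"
    using mult_defect_form_nonneg[OF psd M \<Phi> S2.Q_carrier[OF k]] by simp
  have "cnj (dform S2.shift_adj (m - 1) b k k) = dform S2.shift_adj (m - 1) b k k"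
    by (rule dform_hermitian[where V = Q2])
      (use k S2.shift_adj_Q S2.Q_carrier S1.Q_carrier Xs_mem S1.H S2.H in \<open>auto simp: hs_inner_cnj\<close>)
  then show "hs_inner S2.K (Z k) k \<in> \<real>" by (simp add: Z_form[OF k k] Reals_cnj_iff)
qed

end

locale positive_lifting = lifting m E1 H1 Q1 E2 H2 Q2 X
  for m :: nat and E1 :: "'a::complex_vector hspace" and H1 :: "(complex ^ 'n \<Rightarrow> 'a) hspace" and Q1
    and E2 :: "'b::complex_vector hspace" and H2 :: "(complex ^ 'n \<Rightarrow> 'b) hspace" and Q2 and X +
  assumes Z_positive: "positive_op S2.K Z"
begin

definition \<Delta> :: "(complex ^ 'n \<Rightarrow> 'b) \<Rightarrow> complex ^ 'n \<Rightarrow> 'b" where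
  "\<Delta> = lifting_Delta m S1.K S2.K S2.T X"

lemma \<Delta>_eq: "\<Delta> = op_sqrt S2.K Z"
  by (simp add: \<Delta>_def lifting_Delta_def lifting_defect_def Z_def)

lemma \<Delta>_bounded: "\<Delta> \<in> bounded_ops S2.K S2.K"
  unfolding \<Delta>_eq by (rule positive_op_bounded[OF op_sqrt(1)[OF S2.K Z_positive]])

lemma \<Delta>_inner: "\<lbrakk>k \<in> Q2; l \<in> Q2\<rbrakk> \<Longrightarrow> hs_inner H2 (\<Delta> k) (\<Delta> l) = dform S2.shift_adj (m - 1) b k l"
  using op_sqrt_inner[OF S2.K Z_positive, of k l] by (simp add: \<Delta>_eq Z_form)

abbreviation "D1 \<equiv> defect_op S1.K S1.T m"
abbreviation "D2 \<equiv> defect_op S2.K S2.T m"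

text \<open>The last step of the recursion, from m - 1 to m, applied to I - X X^*. Its two summands
  become <k(0), l(0)> and, through the intertwining relation, the same expression for X^* k and X^*
  l; these are the inner products of the defect vectors.\<close>

lemma colligation_isometric:
  assumes k: "k \<in> Q2" and l: "l \<in> Q2"
  shows "hs_inner H2 (D2 k) (D2 l) + (\<Sum>i\<in>UNIV. hs_inner H2 (\<Delta> (S2.shift_adj i k)) (\<Delta> (S2.shift_adj i l)))
    = hs_inner H1 (D1 (Xs k)) (D1 (Xs l)) + hs_inner H2 (\<Delta> k) (\<Delta> l)"
proof -
  have "hs_inner H2 (\<Delta> k) (\<Delta> l) - (\<Sum>i\<in>UNIV. hs_inner H2 (\<Delta> (S2.shift_adj i k)) (\<Delta> (S2.shift_adj i l)))
      = dform S2.shift_adj (Suc (m - 1)) b k l"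
    using k l by (simp add: \<Delta>_inner S2.shift_adj_Q)
  also have "\<dots> = dform S2.shift_adj m (hs_inner H2) k l
      - dform S2.shift_adj m (\<lambda>h g. hs_inner H1 (Xs h) (Xs g)) k l"
  proof -
    have "Suc (m - 1) = m" using S1.m by simp
    then show ?thesis by (simp only: dform_diff)
  qed
  also have "dform S2.shift_adj m (\<lambda>h g. hs_inner H1 (Xs h) (Xs g)) k l
      = dform S1.shift_adj m (hs_inner H1) (Xs k) (Xs l)"
    by (rule dform_transport[where V = Q2]) (use k l S2.shift_adj_Q Xs_shift in auto)
  also have "\<dots> = hs_inner E1 (Xs k 0) (Xs l 0)"
    by (intro S1.dform_m_eq S1.Q_carrier Xs_mem k l)
  also have "dform S2.shift_adj m (hs_inner H2) k l = hs_inner E2 (k 0) (l 0)"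
    by (intro S2.dform_m_eq S2.Q_carrier k l)
  finally show ?thesis
    using S1.defect_inner[OF Xs_mem Xs_mem, OF k l] S2.defect_inner[OF k l] by (simp add: algebra_simps)
qed

abbreviation CR :: "(complex ^ 'n \<Rightarrow> 'b) hspace" where "CR \<equiv> closed_range S2.K \<Delta>"

lemma CR: "hilbert_space CR"
  by (rule hilbert_space_closed_range[OF S2.K \<Delta>_bounded])

lemma CR_embeds_K: "CR \<lesssim>\<^sub>H S2.K"
  unfolding closed_range_def by (rule embeds_sub[OF hs_closure_subset])

lemma \<Delta>_mem: "k \<in> Q2 \<Longrightarrow> \<Delta> k \<in> hs_carrier CR"
  using closed_range_mem[OF S2.K \<Delta>_bounded, of k] by simp

lemma state_space_eq: "state_space m S1.K S2.K S2.T X L = hs_sum CR L"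
  by (simp add: state_space_def \<Delta>_def)

lemma associated_unitary_iff:
  "associated_unitary m S1.K S2.K S1.T S2.T X L U \<longleftrightarrow>
     unitary_op (hs_sum S2.DS (hs_pow (hs_sum CR L))) (hs_sum S1.DS (hs_sum CR L)) U \<and>
     (\<forall>k\<in>Q2. U (D2 k, \<lambda>i. (\<Delta> (S2.shift_adj i k), 0)) = (D1 (Xs k), (\<Delta> k, 0)))"
  by (auto simp: associated_unitary_def Let_def state_space_def \<Delta>_def[symmetric] S1.DS_def S2.DS_def
      S2.T_adj Xs_def)

lemma associated_unitary_exists:
  "\<exists>(L :: (nat \<Rightarrow> complex \<times> (complex ^ 'n \<Rightarrow> 'a) \<times> (complex ^ 'n \<Rightarrow> 'b)) hspace) U.
     hilbert_space L \<and> infinite_dimensional L \<and> associated_unitary m S1.K S2.K S1.T S2.T X L U"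
proof -
  \<comment> \<open>The two model spaces contain the defect spaces and the closed range of \<Delta>,
    the scalars keep the sum from being zero, and passing to sequences makes room for all finite
    powers.\<close>
  define G0 where "G0 = hs_sum complex_hspace (hs_sum S1.K S2.K)"
  define L where "L = ell2 G0"
  note CH = hilbert_space_complex
  have G0: "hilbert_space G0" using CH S1.K S2.K by (simp add: G0_def)
  have L: "hilbert_space L" using G0 by (simp add: L_def)
  have "infinite_dimensional L"
    unfolding L_def
    by (rule infinite_dimensional_ell2[OF G0, of "(1, 0)"])
      (use hs_carrier_simps(1)[OF S1.K] hs_carrier_simps(1)[OF S2.K] in
        \<open>auto simp: G0_def complex_hspace_def zero_prod_def\<close>)
  have G0L: "G0 \<lesssim>\<^sub>H L" unfolding L_def by (rule embeds_ell2[OF G0])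
  have K12: "hs_sum S1.K S2.K \<lesssim>\<^sub>H G0" unfolding G0_def using CH S1.K S2.K by (intro embeds_inr) simp_all
  have "hs_sum S1.K S2.K \<lesssim>\<^sub>H L" by (rule embeds_trans[OF K12 G0L]) (use S1.K S2.K G0 in simp_all)
  then have K1L: "S1.K \<lesssim>\<^sub>H L" and K2L: "S2.K \<lesssim>\<^sub>H L"
    using embeds_trans[OF embeds_inl[OF S1.K S2.K]] embeds_trans[OF embeds_inr[OF S1.K S2.K]] S1.K S2.K by simp_all
  have DS1L: "S1.DS \<lesssim>\<^sub>H L" by (rule embeds_trans[OF S1.DS_embeds_K K1L S1.DS S1.K])
  have DS2L: "S2.DS \<lesssim>\<^sub>H L" by (rule embeds_trans[OF S2.DS_embeds_K K2L S2.DS S2.K])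
  have CRL: "CR \<lesssim>\<^sub>H L" by (rule embeds_trans[OF CR_embeds_K K2L CR S2.K])
  have powL: "(hs_pow L :: ('i::finite \<Rightarrow> _) hspace) \<lesssim>\<^sub>H L" unfolding L_def by (rule embeds_pow_ell2[OF G0])
  have LL: "hs_sum L L \<lesssim>\<^sub>H L"
    by (rule embeds_trans[OF embeds_sum_pow_bool[OF L] powL]) (use L in simp_all)
  have L_refl: "L \<lesssim>\<^sub>H L"
    unfolding embeds_def by (rule exI[of _ "\<lambda>x. x"]) (auto intro: isometry_opI)
  define R where "R = hs_sum CR L"
  have R: "hilbert_space R" using CR L by (simp add: R_def)
  have RL: "R \<lesssim>\<^sub>H L"
    unfolding R_def by (rule embeds_trans[OF embeds_sum_mono[OF CRL L_refl] LL]) (use CR L in simp_all)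
  let ?P = "hs_sum S2.DS (hs_pow R :: ('n \<Rightarrow> _) hspace)" and ?Q = "hs_sum S1.DS R"
  have P: "hilbert_space ?P" and Q: "hilbert_space ?Q" using S1.DS S2.DS R by simp_all
  have "(hs_pow R :: ('n \<Rightarrow> _) hspace) \<lesssim>\<^sub>H L"
    by (rule embeds_trans[OF embeds_pow_mono[OF RL] powL]) (use R L in simp_all)
  then have PL: "?P \<lesssim>\<^sub>H L"
    by (rule embeds_trans[OF embeds_sum_mono[OF DS2L] LL]) (use S2.DS R L in simp_all)
  have QL: "?Q \<lesssim>\<^sub>H L"
    by (rule embeds_trans[OF embeds_sum_mono[OF DS1L RL] LL]) (use S1.DS R L in simp_all)
  \<comment> \<open>The prescribed argument of U paired with its prescribed value, a point of the
    graph to be extended.\<close>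
  define pt where "pt k = ((D2 k, \<lambda>i :: 'n. (\<Delta> (S2.shift_adj i k), 0 :: nat \<Rightarrow> complex \<times> (complex ^ 'n \<Rightarrow> 'a) \<times> (complex ^ 'n \<Rightarrow> 'b))),
      (D1 (Xs k), (\<Delta> k, 0 :: nat \<Rightarrow> complex \<times> (complex ^ 'n \<Rightarrow> 'a) \<times> (complex ^ 'n \<Rightarrow> 'b))))" for k
  define G where "G = pt ` Q2"
  note lin = closed_subspaceD(2)[OF S2.Q]
  have pt_add: "pt (k + l) = pt k + pt l" if kl: "k \<in> Q2" "l \<in> Q2" for k l
  proof -
    have "D2 (k + l) = D2 k + D2 l" using bounded_ops_add[OF S2.defect_bounded, of k l] kl by simp
    moreover have "\<Delta> (k + l) = \<Delta> k + \<Delta> l" using bounded_ops_add[OF \<Delta>_bounded, of k l] kl by simp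
    moreover have "D1 (Xs (k + l)) = D1 (Xs k) + D1 (Xs l)"
      using bounded_ops_add[OF Xs_bounded, of k l] bounded_ops_add[OF S1.defect_bounded, of "Xs k" "Xs l"]
        kl Xs_mem by simp
    moreover have "\<Delta> (S2.shift_adj i (k + l)) = \<Delta> (S2.shift_adj i k) + \<Delta> (S2.shift_adj i l)" for i
      using bounded_ops_add[OF S2.shift_adj_bounded, of k l i] S2.Q_carrier
        bounded_ops_add[OF \<Delta>_bounded, of "S2.shift_adj i k" "S2.shift_adj i l"] kl S2.shift_adj_Q by simp
    ultimately show ?thesis unfolding pt_def by (simp only:) (simp add: plus_fun_def zero_fun_def)
  qed
  have pt_scale: "pt (c *\<^sub>C k) = c *\<^sub>C pt k" if k: "k \<in> Q2" for c k
  proof -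
    have "D2 (c *\<^sub>C k) = c *\<^sub>C D2 k" using bounded_ops_scale[OF S2.defect_bounded, of k c] k by simp
    moreover have "\<Delta> (c *\<^sub>C k) = c *\<^sub>C \<Delta> k" using bounded_ops_scale[OF \<Delta>_bounded, of k c] k by simp
    moreover have "D1 (Xs (c *\<^sub>C k)) = c *\<^sub>C D1 (Xs k)"
      using bounded_ops_scale[OF Xs_bounded, of k c] bounded_ops_scale[OF S1.defect_bounded, of "Xs k" c]
        k Xs_mem by simp
    moreover have "\<Delta> (S2.shift_adj i (c *\<^sub>C k)) = c *\<^sub>C \<Delta> (S2.shift_adj i k)" for i
      using bounded_ops_scale[OF S2.shift_adj_bounded, of k i c] S2.Q_carrier
        bounded_ops_scale[OF \<Delta>_bounded, of "S2.shift_adj i k" c] k S2.shift_adj_Q by simp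
    ultimately show ?thesis unfolding pt_def by (simp only:) (simp add: scaleC_fun_def zero_fun_def)
  qed
  have Glin: "linear_subset G"
    unfolding linear_subset_def G_def
  proof (intro conjI ballI allI)
    have "pt 0 = 0 *\<^sub>C pt 0" using pt_scale[of 0 0] linear_subset_zero[OF lin] by simp
    then have "0 = pt 0" by simp
    then show "0 \<in> pt ` Q2" using linear_subset_zero[OF lin] by (rule image_eqI)
  next
    fix p q assume "p \<in> pt ` Q2" "q \<in> pt ` Q2"
    then obtain k l where kl: "k \<in> Q2" "l \<in> Q2" "p = pt k" "q = pt l" by auto
    show "p + q \<in> pt ` Q2"
      unfolding kl(3,4) pt_add[OF kl(1,2), symmetric] by (rule imageI[OF linear_subset_add[OF lin kl(1,2)]])
  next
    fix c p assume "p \<in> pt ` Q2"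
    then obtain k where k: "k \<in> Q2" "p = pt k" by auto
    show "c *\<^sub>C p \<in> pt ` Q2"
      unfolding k(2) pt_scale[OF k(1), symmetric] by (rule imageI[OF linear_subset_scale[OF lin k(1)]])
  qed
  \<comment> \<open>One coordinate of the power of R has to host the copy of L that is orthogonal to
    the prescribed arguments. These have 0 in all their L components.\<close>
  obtain i0 :: 'n where True by blast
  obtain U where U: "unitary_op ?P ?Q U" "\<And>x y. (x, y) \<in> G \<Longrightarrow> U x = y"
  proof (rule unitary_extension[OF P Q L Glin _ _ PL QL])
    show "G \<subseteq> hs_carrier ?P \<times> hs_carrier ?Q"
      using S2.defect_mem S1.defect_mem Xs_mem \<Delta>_mem S2.shift_adj_Q L by (auto simp: G_def pt_def R_def)
    show "hs_inner ?Q y y' = hs_inner ?P x x'" if "(x, y) \<in> G" "(x', y') \<in> G" for x y x' y'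
    proof -
      obtain k l where kl: "k \<in> Q2" "l \<in> Q2" "(x, y) = pt k" "(x', y') = pt l" using \<open>(x, y) \<in> G\<close> \<open>(x', y') \<in> G\<close> by (auto simp: G_def)
      then show ?thesis using colligation_isometric[OF kl(1,2)] L by (simp add: pt_def R_def)
    qed
    show "isometry_op L ?P (\<lambda>l. (0, \<lambda>i. if i = i0 then (0, l) else 0))"
      by (rule isometry_op_compose[OF isometry_inr[OF S2.DS hilbert_space_pow[OF R]]
            isometry_op_compose[OF isometry_pow_single[OF R] isometry_inr[OF CR L, folded R_def]]])
        (use R L in simp_all)
    show "isometry_op L ?Q (\<lambda>l. (0, (0, l)))"
      by (rule isometry_op_compose[OF isometry_inr[OF S1.DS R] isometry_inr[OF CR L, folded R_def]]) (use R L in simp_all)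
    show "hs_inner ?P (0, \<lambda>i. if i = i0 then (0, l) else 0) x = 0" if xyG: "(x, y) \<in> G" and l: "l \<in> hs_carrier L" for x y l
    proof -
      obtain k where k: "k \<in> Q2" "(x, y) = pt k" using xyG by (auto simp: G_def)
      have "hs_inner R (if i = i0 then (0, l) else 0) (\<Delta> (S2.shift_adj i k), 0) = 0" for i
        using \<Delta>_mem[OF S2.shift_adj_Q[OF k(1)]] CR L l hs_inner_zero(1)[OF CR] by (simp add: R_def)
      then show ?thesis using k S2.defect_mem[OF k(1)] S2.DS hs_inner_zero(1)[OF S2.DS] by (simp add: pt_def)
    qed
    show "hs_inner ?Q (0, (0, l)) y = 0" if xyG: "(x, y) \<in> G" and l: "l \<in> hs_carrier L" for x y l
    proof -
      obtain k where k: "k \<in> Q2" "(x, y) = pt k" using xyG by (auto simp: G_def)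
      then show ?thesis
        using S1.defect_mem[OF Xs_mem[OF k(1)]] \<Delta>_mem[OF k(1)] L l
          hs_inner_zero(1)[OF S1.DS] hs_inner_zero(1)[OF CR] by (simp add: pt_def R_def)
    qed
  qed blast
  have "associated_unitary m S1.K S2.K S1.T S2.T X L U"
    unfolding associated_unitary_iff R_def[symmetric] using U by (auto simp: G_def pt_def)
  with L \<open>infinite_dimensional L\<close> show ?thesis by blast
qed

lemma transfer_multiplier_lifts:
  fixes L :: "'l::complex_vector hspace"
  assumes L: "hilbert_space L" and assoc: "associated_unitary m S1.K S2.K S1.T S2.T X L U"
  defines "\<Phi> \<equiv> transfer_multiplier m E1 E2 S1.K S2.K S1.T S2.T X L U"
  shows "holomorphic_op E1 E2 \<Phi>" "psd_kernel E2 (mult_kernel 1 \<Phi>)"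
    and "k \<in> Q2 \<Longrightarrow> Xs k = hs_adj H1 H2 (mult_op \<Phi>) k"
proof -
  define R where "R = hs_sum CR L"
  have R: "hilbert_space R" using CR L by (simp add: R_def)
  have U: "unitary_op (hs_sum S2.DS (hs_pow R)) (hs_sum S1.DS R) U"
    and Uk: "\<And>k. k \<in> Q2 \<Longrightarrow> U (D2 k, \<lambda>i. (\<Delta> (S2.shift_adj i k), 0)) = (D1 (Xs k), (\<Delta> k, 0))"
    using assoc by (auto simp: associated_unitary_iff R_def)
  interpret c: unitary_colligation S2.DS S1.DS R U
    by (rule unitary_colligation.intro[OF S2.DS S1.DS R U])
  note J1 = S1.J_isometry and J2 = S2.J_isometry
  note J1b = isometry_opD(1)[OF J1] and J2b = isometry_opD(1)[OF J2]
  \<comment> \<open>The adjoints of the embeddings project coefficients onto defect vectors. With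
    them \<Phi> is J2 \<tau> I1, so its adjoint takes values in the embedded defect space.\<close>
  define I1 where "I1 = hs_adj S1.DS E1 S1.J"
  define I2 where "I2 = hs_adj S2.DS E2 S2.J"
  have I1b: "I1 \<in> bounded_ops E1 S1.DS" unfolding I1_def by (rule hs_adj_bounded[OF S1.DS S1.E J1b])
  have I2b: "I2 \<in> bounded_ops E2 S2.DS" unfolding I2_def by (rule hs_adj_bounded[OF S2.DS S2.E J2b])
  note I1c = bounded_ops_mem[OF I1b] and I2c = bounded_ops_mem[OF I2b]
  have I1n: "hs_norm S1.DS (I1 e) \<le> hs_norm E1 e" if "e \<in> hs_carrier E1" for e
    using hs_adj_norm_le[OF S1.DS S1.E J1b, of 1 e] isometry_opD(3)[OF J1] that by (simp add: I1_def)
  have I2n: "hs_norm S2.DS (I2 e) \<le> hs_norm E2 e" if "e \<in> hs_carrier E2" for e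
    using hs_adj_norm_le[OF S2.DS S2.E J2b, of 1 e] isometry_opD(3)[OF J2] that by (simp add: I2_def)
  have I1J: "I1 (S1.J x) = x" if "x \<in> hs_carrier S1.DS" for x
    unfolding I1_def by (rule isometry_adj_left_inverse[OF S1.DS S1.E J1 that])
  have I2J: "I2 (S2.J x) = x" if "x \<in> hs_carrier S2.DS" for x
    unfolding I2_def by (rule isometry_adj_left_inverse[OF S2.DS S2.E J2 that])
  have \<Phi>_eq: "\<Phi> = (\<lambda>z e. S2.J (c.\<tau> z (I1 e)))"
    unfolding \<Phi>_def transfer_multiplier_def[abs_def] state_space_eq R_def[symmetric] S1.J_def[symmetric] S2.J_def[symmetric]
      S1.DS_def[symmetric] S2.DS_def[symmetric] I1_def[symmetric] c.adj_transfer_function_eq ..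
  show hol: "holomorphic_op E1 E2 \<Phi>"
    unfolding \<Phi>_eq
    by (rule holomorphic_op_compose[OF S1.DS S2.DS S1.E S2.E c.\<tau>_holomorphic I1b J2b I1n])
      (simp_all add: isometry_opD(3)[OF J2])
  then have \<Phi>b: "\<Phi> z \<in> bounded_ops E1 E2" if "z \<in> unit_ball" for z using that by (simp add: holomorphic_op_def)
  have \<tau>s: "hs_adj S1.DS S2.DS (c.\<tau> z) x \<in> hs_carrier S1.DS" if "z \<in> unit_ball" "x \<in> hs_carrier S2.DS" for z x
    by (rule hs_adj_mem[OF S1.DS S2.DS c.\<tau>_bounded[OF that(1)] that(2)])
  have \<Phi>s: "hs_adj E1 E2 (\<Phi> z) \<eta> = S1.J (hs_adj S1.DS S2.DS (c.\<tau> z) (I2 \<eta>))"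
    if z: "z \<in> unit_ball" and \<eta>: "\<eta> \<in> hs_carrier E2" for z \<eta>
  proof (rule hs_adj_eqI[OF S1.E])
    note t = \<tau>s[OF z I2c[OF \<eta>]]
    show "S1.J (hs_adj S1.DS S2.DS (c.\<tau> z) (I2 \<eta>)) \<in> hs_carrier E1" by (rule bounded_ops_mem[OF J1b t])
    fix e assume e: "e \<in> hs_carrier E1"
    have te: "c.\<tau> z (I1 e) \<in> hs_carrier S2.DS" by (rule bounded_ops_mem[OF c.\<tau>_bounded[OF z] I1c[OF e]])
    have "hs_inner E2 (\<Phi> z e) \<eta> = hs_inner S2.DS (c.\<tau> z (I1 e)) (I2 \<eta>)"
      unfolding \<Phi>_eq I2_def by (rule hs_adj_inner[OF S2.DS S2.E J2b te \<eta>, symmetric])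
    also have "\<dots> = hs_inner S1.DS (I1 e) (hs_adj S1.DS S2.DS (c.\<tau> z) (I2 \<eta>))"
      by (rule hs_adj_inner[OF S1.DS S2.DS c.\<tau>_bounded[OF z] I1c[OF e] I2c[OF \<eta>], symmetric])
    also have "\<dots> = hs_inner E1 e (S1.J (hs_adj S1.DS S2.DS (c.\<tau> z) (I2 \<eta>)))"
      unfolding I1_def by (rule hs_adj_inner'[OF S1.DS S1.E J1b t e])
    finally show "hs_inner E2 (\<Phi> z e) \<eta> = hs_inner E1 e (S1.J (hs_adj S1.DS S2.DS (c.\<tau> z) (I2 \<eta>)))" .
  qed
  define \<gamma> where "\<gamma> w \<eta> = c.g w (I2 \<eta>)" for w \<eta>
  have \<gamma>b: "\<gamma> w \<in> bounded_ops E2 R" if "w \<in> unit_ball" for w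
    unfolding \<gamma>_def by (rule bounded_ops_compose[OF c.g_bounded[OF that] I2b S2.E S2.DS])
  note \<gamma>c = bounded_ops_mem[OF \<gamma>b]
  \<comment> \<open>E2 may exceed the embedded defect space. The surplus is a constant positive
    kernel, and what remains is the Gram identity of \<tau>.\<close>
  have gram: "hs_inner E2 x y - hs_inner E1 (hs_adj E1 E2 (\<Phi> w) x) (hs_adj E1 E2 (\<Phi> z) y)
      = (hs_inner E2 x y - hs_inner S2.DS (I2 x) (I2 y)) + (1 - cdot z w) * hs_inner R (\<gamma> w x) (\<gamma> z y)"
    if z: "z \<in> unit_ball" and w: "w \<in> unit_ball" and x: "x \<in> hs_carrier E2" and y: "y \<in> hs_carrier E2" for z w x y
    using c.\<tau>_gram[OF z w I2c[OF x] I2c[OF y]]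
    unfolding \<Phi>s[OF w x] \<Phi>s[OF z y] isometry_opD(2)[OF J1 \<tau>s[OF w I2c[OF x]] \<tau>s[OF z I2c[OF y]]] \<gamma>_def
    by (simp add: algebra_simps)
  have psd_defect: "psd_kernel E2 (\<lambda>(z :: complex ^ 'n) w x y. (hs_inner E2 x y - hs_inner S2.DS (I2 x) (I2 y)) / (1 - cdot z w))"
    by (rule psd_kernel_divide[OF S2.E psd_kernel_const_defect[OF S2.E S2.DS I2b I2n]])
  have psd_\<gamma>: "psd_kernel E2 (\<lambda>z w x y. hs_inner R (\<gamma> w x) (\<gamma> z y))"
    by (rule psd_kernel_gram[OF S2.E R]) (use \<gamma>c bounded_ops_scale[OF \<gamma>b] in auto)
  show psd: "psd_kernel E2 (mult_kernel 1 \<Phi>)"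
  proof (rule psd_kernel_cong[OF psd_kernel_add[OF psd_defect psd_\<gamma>] S2.E])
    fix z w :: "complex ^ 'n" and x y
    assume zw: "z \<in> unit_ball" "w \<in> unit_ball" "x \<in> hs_carrier E2" "y \<in> hs_carrier E2"
    show "mult_kernel 1 \<Phi> z w x y = (hs_inner E2 x y - hs_inner S2.DS (I2 x) (I2 y)) / (1 - cdot z w)
        + hs_inner R (\<gamma> w x) (\<gamma> z y)"
      unfolding mult_kernel_def gram[OF zw] using one_minus_cdot_nonzero[OF zw(1,2)]
      by (simp add: add_divide_distrib)
  qed
  have M: "mult_op \<Phi> \<in> bounded_ops H1 H2"
    using contraction_if_mult_kernel_psd[OF mult_kernel_raise[OF psd] \<Phi>b] by (simp add: contraction_op_def)
  define Y where "Y = hs_adj H1 H2 (mult_op \<Phi>)"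
  have Yb: "Y \<in> bounded_ops H2 H1" unfolding Y_def by (rule hs_adj_bounded[OF S1.H S2.H M])
  have Yk: "Y (kernel_fun m w \<eta>) = kernel_fun m w (hs_adj E1 E2 (\<Phi> w) \<eta>)"
    if "w \<in> unit_ball" "\<eta> \<in> hs_carrier E2" for w \<eta>
    unfolding Y_def by (rule mult_adj_kernel[OF M \<Phi>b that])
  \<comment> \<open>The difference splits into three positive kernels: the excess of the exponent m
    over 1, the surplus of E2, and the Gram kernel of the adjoints of \<tau>, the last two divided
    by 1 - <z, w>.\<close>
  have psd_\<Gamma>: "psd_kernel E2 (\<lambda>z w x y. hs_inner E2 x y / (1 - cdot z w) ^ m - hs_inner R (\<gamma> w x) (\<gamma> z y))"
  proof -
    have t: "psd_kernel E2 (\<lambda>z w x y. hs_inner S1.DS (hs_adj S1.DS S2.DS (c.\<tau> w) (I2 x)) (hs_adj S1.DS S2.DS (c.\<tau> z) (I2 y)) / (1 - cdot z w))"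
      by (rule psd_kernel_divide[OF S2.E psd_kernel_gram[OF S2.E S1.DS]])
        (use \<tau>s I2c bounded_ops_scale[OF I2b] bounded_ops_scale[OF hs_adj_bounded[OF S1.DS S2.DS c.\<tau>_bounded]] in auto)
    show ?thesis
    proof (rule psd_kernel_cong[OF psd_kernel_add[OF S2.psd_kernel_power_diff psd_kernel_add[OF psd_defect t]] S2.E])
      fix z w :: "complex ^ 'n" and x y
      assume zw: "z \<in> unit_ball" "w \<in> unit_ball" "x \<in> hs_carrier E2" "y \<in> hs_carrier E2"
      have nz: "1 - cdot z w \<noteq> 0" by (rule one_minus_cdot_nonzero[OF zw(1,2)])
      let ?t = "hs_inner S1.DS (hs_adj S1.DS S2.DS (c.\<tau> w) (I2 x)) (hs_adj S1.DS S2.DS (c.\<tau> z) (I2 y))"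
      have "hs_inner R (\<gamma> w x) (\<gamma> z y) = (hs_inner S2.DS (I2 x) (I2 y) - ?t) / (1 - cdot z w)"
        unfolding c.\<tau>_gram[OF zw(1,2) I2c[OF zw(3)] I2c[OF zw(4)]] \<gamma>_def using nz by simp
      then show "hs_inner E2 x y / (1 - cdot z w) ^ m - hs_inner R (\<gamma> w x) (\<gamma> z y) =
          hs_inner E2 x y / (1 - cdot z w) ^ m - hs_inner E2 x y / (1 - cdot z w) +
          ((hs_inner E2 x y - hs_inner S2.DS (I2 x) (I2 y)) / (1 - cdot z w) + ?t / (1 - cdot z w))"
        by (simp add: diff_divide_distrib)
    qed
  qed
  obtain \<Gamma> where \<Gamma>: "\<Gamma> \<in> bounded_ops H2 R"
    "\<And>w \<eta>. w \<in> unit_ball \<Longrightarrow> \<eta> \<in> hs_carrier E2 \<Longrightarrow> \<Gamma> (kernel_fun m w \<eta>) = \<gamma> w \<eta>"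
  proof (rule S2.kernel_extension[OF R _ psd_\<Gamma>])
    show "\<gamma> w \<in> bounded_ops E2 R" if "w \<in> unit_ball" for w by (rule \<gamma>b[OF that])
    fix A assume A: "A \<in> bounded_ops H2 R"
      and Ak: "\<And>w \<eta>. w \<in> unit_ball \<Longrightarrow> \<eta> \<in> hs_carrier E2 \<Longrightarrow> A (kernel_fun m w \<eta>) = \<gamma> w \<eta>"
    show thesis by (rule that[OF A Ak])
  qed
  note \<Gamma>c = bounded_ops_mem[OF \<Gamma>(1)]
  have Y0: "(\<lambda>f. Y f 0) \<in> bounded_ops H2 E1"
    by (rule bounded_ops_compose[OF S1.value_0_bounded Yb S2.H S1.H])
  have kernel0: "kernel_fun m w \<eta> 0 = \<eta>" for w :: "complex ^ 'n" and \<eta> :: "'x::complex_vector"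
    by (simp add: kernel_fun_def scaleC_one)
  \<comment> \<open>Both sides are bounded operators in f, so kernel functions suffice. There this
    is the realization formula \<open>U_g\<close>, since k_w \<eta> takes the value \<eta> at 0 and
    is an eigenvector of the adjoint shifts.\<close>
  have U_f: "U (I2 (f 0), \<lambda>i. \<Gamma> (S2.shift_adj i f)) = (I1 (Y f 0), \<Gamma> f)" if f: "f \<in> hs_carrier H2" for f
  proof (rule S2.bounded_ops_eq_on_kernels[OF c.hilbert_ran _ _ _ f])
    show "(\<lambda>f. U (I2 (f 0), \<lambda>i. \<Gamma> (S2.shift_adj i f))) \<in> bounded_ops H2 (hs_sum S1.DS R)"
      by (intro bounded_ops_compose[OF c.U_bounded] bounded_ops_pair bounded_ops_pow
          bounded_ops_compose[OF \<Gamma>(1) S2.shift_adj_bounded] bounded_ops_compose[OF I2b S2.value_0_bounded]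
          S2.H R S2.DS S2.E c.P c.hilbert_dom)
    show "(\<lambda>f. (I1 (Y f 0), \<Gamma> f)) \<in> bounded_ops H2 (hs_sum S1.DS R)"
      by (intro bounded_ops_pair \<Gamma>(1) bounded_ops_compose[OF I1b Y0] S2.H R S1.DS S1.E)
    fix w :: "complex ^ 'n" and \<eta> assume w: "w \<in> unit_ball" "\<eta> \<in> hs_carrier E2"
    have "(\<lambda>i. \<Gamma> (S2.shift_adj i (kernel_fun m w \<eta>))) = c.Zs w (c.g w (I2 \<eta>))"
      using w by (auto simp: S2.shift_adj_kernel bounded_ops_scale[OF \<Gamma>(1)] S2.kernel_mem \<Gamma>(2) c.Zs_def \<gamma>_def)
    moreover have "Y (kernel_fun m w \<eta>) 0 = S1.J (hs_adj S1.DS S2.DS (c.\<tau> w) (I2 \<eta>))"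
      by (simp add: Yk[OF w] kernel0 \<Phi>s[OF w])
    ultimately show "U (I2 (kernel_fun m w \<eta> 0), \<lambda>i. \<Gamma> (S2.shift_adj i (kernel_fun m w \<eta>)))
        = (I1 (Y (kernel_fun m w \<eta>) 0), \<Gamma> (kernel_fun m w \<eta>))"
      using c.U_g[OF w(1) I2c[OF w(2)]] I1J[OF \<tau>s[OF w(1) I2c[OF w(2)]]]
      by (simp add: kernel0 \<Gamma>(2)[OF w] \<gamma>_def)
  qed
  \<comment> \<open>The values at 0 of the functions Y f lie in the embedded defect space, so they
    can be recovered from their projections under I1.\<close>
  have Y_range: "S1.J (I1 (Y f 0)) = Y f 0" if f: "f \<in> hs_carrier H2" for f
  proof (rule S2.bounded_ops_eq_on_kernels[OF S1.E bounded_ops_compose[OF J1b bounded_ops_compose[OF I1b Y0 S2.H S1.E] S2.H S1.DS] Y0 _ f])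
    fix w :: "complex ^ 'n" and \<eta> assume w: "w \<in> unit_ball" "\<eta> \<in> hs_carrier E2"
    show "S1.J (I1 (Y (kernel_fun m w \<eta>) 0)) = Y (kernel_fun m w \<eta>) 0"
      by (simp add: Yk[OF w] kernel0 \<Phi>s[OF w] I1J[OF \<tau>s[OF w(1) I2c[OF w(2)]]])
  qed
  define \<delta> where "\<delta> k = \<Gamma> k - (\<Delta> k, 0)" for k
  have \<Delta>R: "(\<Delta> k, 0) \<in> hs_carrier R" if "k \<in> Q2" for k using \<Delta>_mem[OF that] L by (simp add: R_def)
  have \<delta>c: "\<delta> k \<in> hs_carrier R" if "k \<in> Q2" for k
    using \<Gamma>c[OF S2.Q_carrier[OF that]] \<Delta>R[OF that] R by (simp add: \<delta>_def)
  have \<delta>b: "\<delta> \<in> bounded_ops S2.K R"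
  proof -
    have "\<Gamma> \<in> bounded_ops S2.K R"
      unfolding S2.K_def by (rule bounded_ops_sub_dom[OF \<Gamma>(1)]) (use S2.Q_carrier in auto)
    moreover have "\<Delta> \<in> bounded_ops S2.K CR"
      unfolding closed_range_def by (rule bounded_ops_sub_ran[OF \<Delta>_bounded closed_range_mem[OF S2.K \<Delta>_bounded]])
    then have "(\<lambda>k. (\<Delta> k, 0)) \<in> bounded_ops S2.K R"
      unfolding R_def by (intro bounded_ops_pair bounded_ops_const_zero S2.K CR L)
    ultimately show ?thesis unfolding \<delta>_def by (rule bounded_ops_diff_op[OF _ _ S2.K R])
  qed
  \<comment> \<open>The equations for \<Gamma> and for \<Delta> are subtracted. Their first
    arguments agree, because I2 sends k(0) back to the defect vector of k, and so they
    cancel.\<close>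
  have U_\<delta>: "U (0, \<lambda>i. \<delta> (S2.shift_adj i k)) = (I1 (Y k 0) - D1 (Xs k), \<delta> k)" if k: "k \<in> Q2" for k
  proof -
    note kc = S2.Q_carrier[OF k] and D2k = S2.defect_mem[OF k]
    have I2k: "I2 (k 0) = D2 k" using I2J[OF D2k] S2.J_defect[OF k] by simp
    let ?p = "(I2 (k 0), \<lambda>i. \<Gamma> (S2.shift_adj i k))" and ?q = "(D2 k, \<lambda>i. (\<Delta> (S2.shift_adj i k), 0 :: 'l))"
    have "?p \<in> hs_carrier (hs_sum S2.DS (hs_pow R))" "?q \<in> hs_carrier (hs_sum S2.DS (hs_pow R))"
      using I2k D2k \<Gamma>c[OF S2.shift_adj_mem[OF kc]] \<Delta>R[OF S2.shift_adj_Q[OF k]] by auto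
    then have "U (?p - ?q) = U ?p - U ?q" by (rule bounded_ops_diff[OF c.U_bounded c.hilbert_dom])
    moreover have "?p - ?q = (0, \<lambda>i. \<delta> (S2.shift_adj i k))"
      by (simp add: I2k \<delta>_def fun_eq_iff)
    ultimately show ?thesis by (simp add: U_f[OF kc] Uk[OF k] \<delta>_def)
  qed
  \<comment> \<open>U preserves norms. Dropping the first square leaves the inequality that purity
    turns into \<delta> = 0; keeping it afterwards compares the values at 0.\<close>
  have \<delta>_le: "(hs_norm S1.DS (I1 (Y k 0) - D1 (Xs k)))\<^sup>2 + (hs_norm R (\<delta> k))\<^sup>2 = (\<Sum>i\<in>UNIV. (hs_norm R (\<delta> (S2.shift_adj i k)))\<^sup>2)"
    and diff_mem: "I1 (Y k 0) - D1 (Xs k) \<in> hs_carrier S1.DS" if k: "k \<in> Q2" for k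
  proof -
    let ?v = "\<lambda>i. \<delta> (S2.shift_adj i k)"
    have v: "?v \<in> hs_carrier (hs_pow R)" using \<delta>c[OF S2.shift_adj_Q[OF k]] by simp
    then have p: "(0, ?v) \<in> hs_carrier (hs_sum S2.DS (hs_pow R))" using S2.DS by simp
    note Uc = bounded_ops_mem[OF c.U_bounded p, unfolded U_\<delta>[OF k]]
    show "I1 (Y k 0) - D1 (Xs k) \<in> hs_carrier S1.DS" using Uc by simp
    have "(hs_norm (hs_sum S1.DS R) (U (0, ?v)))\<^sup>2 = (hs_norm (hs_sum S2.DS (hs_pow R)) (0, ?v))\<^sup>2"
      using c.U_norm[OF p] by simp
    then show "(hs_norm S1.DS (I1 (Y k 0) - D1 (Xs k)))\<^sup>2 + (hs_norm R (\<delta> k))\<^sup>2 = (\<Sum>i\<in>UNIV. (hs_norm R (\<delta> (S2.shift_adj i k)))\<^sup>2)"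
      using hs_norm_sum_sq[OF S1.DS R Uc] hs_norm_sum_sq[OF S2.DS c.P p] hs_norm_pow_sq[OF R v] S2.DS
      unfolding U_\<delta>[OF k] by simp
  qed
  obtain C where C: "C \<ge> 0" "\<And>k. k \<in> hs_carrier S2.K \<Longrightarrow> hs_norm R (\<delta> k) \<le> C * hs_norm S2.K k"
    using bounded_ops_bound[OF \<delta>b S2.K] by blast
  have \<delta>0: "(hs_norm R (\<delta> k))\<^sup>2 = 0" if k: "k \<in> Q2" for k
  proof (rule S2.pure_vanishing[where V = Q2 and a = "\<lambda>k. (hs_norm R (\<delta> k))\<^sup>2" and C = "C\<^sup>2", OF _ _ _ _ _ k])
    show "Q2 \<subseteq> hs_carrier H2" using S2.Q_carrier by auto
    show "(hs_norm R (\<delta> k))\<^sup>2 \<le> C\<^sup>2 * (hs_norm H2 k)\<^sup>2" if k: "k \<in> Q2" for k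
      unfolding power_mult_distrib[symmetric]
      by (rule power_mono) (use C(2)[of k] k \<delta>c[OF k] R in simp_all)
    show "(hs_norm R (\<delta> k))\<^sup>2 \<le> (\<Sum>i\<in>UNIV. (hs_norm R (\<delta> (S2.shift_adj i k)))\<^sup>2)" if "k \<in> Q2" for k
      using \<delta>_le[OF that] zero_le_power2[of "hs_norm S1.DS (I1 (Y k 0) - D1 (Xs k))"] by linarith
  qed (use S2.shift_adj_Q in auto)
  \<comment> \<open>With \<delta> = 0 the norm identity forces its remaining square to vanish as
    well, so the projected value of Y k at 0 is the defect vector of X^* k; applying J turns both
    into values at 0.\<close>
  have at_0: "Y k 0 = Xs k 0" if k: "k \<in> Q2" for k
  proof -
    have "(\<Sum>i\<in>UNIV. (hs_norm R (\<delta> (S2.shift_adj i k)))\<^sup>2) = 0"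
      using \<delta>0[OF S2.shift_adj_Q[OF k]] by simp
    then have "(hs_norm S1.DS (I1 (Y k 0) - D1 (Xs k)))\<^sup>2 = 0" using \<delta>_le[OF k] \<delta>0[OF k] by simp
    then have "I1 (Y k 0) = D1 (Xs k)" using diff_mem[OF k] S1.DS by simp
    then show ?thesis using Y_range[OF S2.Q_carrier[OF k]] S1.J_defect[OF Xs_mem[OF k]] by simp
  qed
  show "Xs k = hs_adj H1 H2 (mult_op \<Phi>) k" if k: "k \<in> Q2" for k
  proof -
    have "Y k - Xs k = 0"
    \<comment> \<open>The differences form a set that is invariant under the adjoint shifts, as Y
      and X^* both intertwine them, so the vanishing of all values at 0 applies to the whole
      set.\<close>
    proof (rule S1.zero_if_values_at_0[where V = "(\<lambda>k. Y k - Xs k) ` Q2"])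
      have Yc: "Y k \<in> hs_carrier H1" and Xc: "Xs k \<in> hs_carrier H1" if "k \<in> Q2" for k
        using bounded_ops_mem[OF Yb S2.Q_carrier[OF that]] S1.Q_carrier[OF Xs_mem[OF that]] by auto
      show "(\<lambda>k. Y k - Xs k) ` Q2 \<subseteq> hs_carrier H1" using Yc Xc S1.H by auto
      show "S1.shift_adj i f \<in> (\<lambda>k. Y k - Xs k) ` Q2" if fV: "f \<in> (\<lambda>k. Y k - Xs k) ` Q2" for i f
      proof -
        obtain k where k: "k \<in> Q2" "f = Y k - Xs k" using fV by auto
        have "S1.shift_adj i f = S1.shift_adj i (Y k) - S1.shift_adj i (Xs k)"
          unfolding k(2) by (rule bounded_ops_diff[OF S1.shift_adj_bounded S1.H Yc[OF k(1)] Xc[OF k(1)]])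
        also have "\<dots> = Y (S2.shift_adj i k) - Xs (S2.shift_adj i k)"
        proof -
          have "Y (S2.shift_adj i k) = S1.shift_adj i (Y k)"
            unfolding Y_def by (rule mult_adj_shift[OF M \<Phi>b S2.Q_carrier[OF k(1)]])
          then show ?thesis by (simp only: Xs_shift[OF k(1)])
        qed
        finally show ?thesis using S2.shift_adj_Q[OF k(1)] by (rule image_eqI)
      qed
      show "f 0 = 0" if "f \<in> (\<lambda>k. Y k - Xs k) ` Q2" for f using that at_0 by auto
    qed (use k in auto)
    then show ?thesis by (simp add: Y_def)
  qed
qed

end

theorem theorem3p5:
  fixes m :: nat
    and E1 :: "'a::complex_vector hspace" and E2 :: "'b::complex_vector hspace"
    and H1 A1 K1 :: "(complex ^ 'n \<Rightarrow> 'a) hspace" and H2 A2 K2 :: "(complex ^ 'n \<Rightarrow> 'b) hspace"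
    and Q1 :: "(complex ^ 'n \<Rightarrow> 'a) set" and Q2 :: "(complex ^ 'n \<Rightarrow> 'b) set"
    and X :: "(complex ^ 'n \<Rightarrow> 'a) \<Rightarrow> complex ^ 'n \<Rightarrow> 'b"
    and T :: "'n \<Rightarrow> (complex ^ 'n \<Rightarrow> 'a) \<Rightarrow> complex ^ 'n \<Rightarrow> 'a"
    and S :: "'n \<Rightarrow> (complex ^ 'n \<Rightarrow> 'b) \<Rightarrow> complex ^ 'n \<Rightarrow> 'b"
  assumes m: "m \<ge> 1"
    and E1: "hilbert_space E1" and E2: "hilbert_space E2"
    and H1: "weighted_bergman m E1 H1" and H2: "weighted_bergman m E2 H2"
    and A1: "drury_arveson E1 A1" and A2: "drury_arveson E2 A2"
    and Q1: "coinvariant_subspace H1 Q1" and Q2: "coinvariant_subspace H2 Q2"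
    and K1: "K1 = hs_sub H1 Q1" and K2: "K2 = hs_sub H2 Q2"
    and T: "T = compression H1 Q1" and S: "S = compression H2 Q2"
    and X: "contraction_op K1 K2 X"
    and intertwining: "\<forall>i. \<forall>f\<in>Q1. X (T i f) = S i (X f)"
  shows "((\<exists>\<Phi>. schur_agler E1 E2 A1 A2 \<Phi> \<and>
              (\<forall>k\<in>Q2. hs_adj K1 K2 X k = hs_adj H1 H2 (mult_op \<Phi>) k))
          \<longleftrightarrow> positive_op K2
                (one_minus_sigma_pow K2 S (m - 1) (\<lambda>k. k - X (hs_adj K1 K2 X k)))) \<and>
         (positive_op K2
            (one_minus_sigma_pow K2 S (m - 1) (\<lambda>k. k - X (hs_adj K1 K2 X k))) \<longrightarrow>
          (\<exists>(L :: (nat \<Rightarrow> complex \<times> (complex ^ 'n \<Rightarrow> 'a) \<times> (complex ^ 'n \<Rightarrow> 'b)) hspace) U.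
             hilbert_space L \<and> infinite_dimensional L \<and>
             associated_unitary m K1 K2 T S X L U) \<and>
          (\<forall>(L :: 'l::complex_vector hspace) U.
             hilbert_space L \<and> associated_unitary m K1 K2 T S X L U \<longrightarrow>
             schur_agler E1 E2 A1 A2 (transfer_multiplier m E1 E2 K1 K2 T S X L U) \<and>
             (\<forall>k\<in>Q2. hs_adj K1 K2 X k =
                hs_adj H1 H2 (mult_op (transfer_multiplier m E1 E2 K1 K2 T S X L U)) k)))"
proof -
  interpret S1: coinvariant m E1 H1 Q1 by unfold_locales (rule m E1 H1 Q1)+
  interpret S2: coinvariant m E2 H2 Q2 by unfold_locales (rule m E2 H2 Q2)+
  have K1': "K1 = S1.K" and K2': "K2 = S2.K" and T': "T = S1.T" and S': "S = S2.T"
    by (simp_all add: K1 K2 T S S1.K_def S2.K_def S1.T_def S2.T_def)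
  interpret l: lifting m E1 H1 Q1 E2 H2 Q2 X
    by unfold_locales (use X intertwining in \<open>simp_all add: K1' K2' T' S'\<close>)
  \<comment> \<open>The same setting with exponent 1. Since \<open>mult_kernel\<close> depends on
    the coefficient spaces only, its positivity is shared by the Drury-Arveson spaces and the spaces
    with exponent m.\<close>
  interpret A: bergman_pair 1 E1 A1 E2 A2
    by unfold_locales (use E1 E2 A1 A2 in \<open>simp_all add: drury_arveson_def\<close>)
  have Xs: "hs_adj K1 K2 X = l.Xs" by (simp add: l.Xs_def K1' K2')
  have Z: "one_minus_sigma_pow K2 S (m - 1) (\<lambda>k. k - X (l.Xs k)) = l.Z"
    by (simp add: l.Z_def l.Xs_def K1' K2' S')
  \<comment> \<open>Polymorphic in the type of L: it serves the arbitrary auxiliary space of the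
    last claim, and, with the sequence space of \<open>ex\<close>, the existence of \<Phi>.\<close>
  have lift: "schur_agler E1 E2 A1 A2 (transfer_multiplier m E1 E2 K1 K2 T S X L U) \<and>
      (\<forall>k\<in>Q2. l.Xs k = hs_adj H1 H2 (mult_op (transfer_multiplier m E1 E2 K1 K2 T S X L U)) k)"
    if pos: "positive_op K2 l.Z" and LU: "hilbert_space L" "associated_unitary m K1 K2 T S X L U"
    for L :: "'x::complex_vector hspace" and U
  proof -
    interpret p: positive_lifting m E1 H1 Q1 E2 H2 Q2 X
      by unfold_locales (use pos in \<open>simp add: K2'\<close>)
    let ?\<Phi> = "transfer_multiplier m E1 E2 S1.K S2.K S1.T S2.T X L U"
    note t = p.transfer_multiplier_lifts[OF LU(1) LU(2)[unfolded K1' K2' T' S']]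
    have "contraction_op A1 A2 (mult_op ?\<Phi>)"
      by (rule A.contraction_if_mult_kernel_psd) (use t(1,2) in \<open>auto simp: holomorphic_op_def\<close>)
    with t show ?thesis by (simp add: schur_agler_def K1' K2' T' S')
  qed
  have ex: "\<exists>(L :: (nat \<Rightarrow> complex \<times> (complex ^ 'n \<Rightarrow> 'a) \<times> (complex ^ 'n \<Rightarrow> 'b)) hspace) U.
      hilbert_space L \<and> infinite_dimensional L \<and> associated_unitary m K1 K2 T S X L U"
    if pos: "positive_op K2 l.Z"
  proof -
    interpret p: positive_lifting m E1 H1 Q1 E2 H2 Q2 X
      by unfold_locales (use pos in \<open>simp add: K2'\<close>)
    show ?thesis using p.associated_unitary_exists by (simp add: K1' K2' T' S')
  qed
  have nec: "positive_op K2 l.Z" if \<Phi>: "schur_agler E1 E2 A1 A2 \<Phi>" "\<forall>k\<in>Q2. l.Xs k = hs_adj H1 H2 (mult_op \<Phi>) k" for \<Phi>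
  proof -
    have \<Phi>b: "\<Phi> z \<in> bounded_ops E1 E2" if "z \<in> unit_ball" for z
      using \<Phi>(1) that by (simp add: schur_agler_def holomorphic_op_def)
    have psd: "psd_kernel E2 (A.mult_kernel 1 \<Phi>)"
      by (rule A.mult_kernel_psd_if_contraction) (use \<Phi>(1) \<Phi>b in \<open>auto simp: schur_agler_def\<close>)
    show ?thesis unfolding K2' by (rule l.positive_if_lifting[OF \<Phi>b psd]) (use \<Phi>(2) in auto)
  qed
  have suff: "\<exists>\<Phi>. schur_agler E1 E2 A1 A2 \<Phi> \<and> (\<forall>k\<in>Q2. l.Xs k = hs_adj H1 H2 (mult_op \<Phi>) k)"
    if pos: "positive_op K2 l.Z"
    using ex[OF pos] lift[OF pos] by blast
  show ?thesis
    unfolding Xs Z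
  proof (intro conjI iffI impI allI)
    show "positive_op K2 l.Z"
      if "\<exists>\<Phi>. schur_agler E1 E2 A1 A2 \<Phi> \<and> (\<forall>k\<in>Q2. l.Xs k = hs_adj H1 H2 (mult_op \<Phi>) k)"
      using that nec by blast
  qed (use suff ex lift in blast)+
qed

end
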